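(* Let $\mathcal{A}$ be a central $\ell$-arrangement in $V$ over a field $\mathbb{K}$, $\ell\ge2$. (1) Assume that there is $H\in\mathcal{A}$ such that $\chi((\mathcal{A}_X)^H;t)$ divides $\chi(\mathcal{A}_X;t)$ for all $X\in L_2(\mathcal{A}^H)$, and $\mathcal{A}^H$ is free. Then $\mathcal{A}$ is free. (2) Assume that there is a flag $V=X_0\supset X_1\supset\cdots\supset X_{\ell-2}$ with $X_i\in L_i(\mathcal{A})$ ($i=0,\dots,\ell-2$) such that, for $\mathcal{A}_i:=\mathcal{A}^{X_i}$ ($i=0,\dots,\ell-2$), $\chi((\mathcal{A}_{i+1})_Y;t)$ divides $\chi((\mathcal{A}_i)_Y;t)$ for all $Y\in L_2(\mathcal{A}_{i+1})$ and for $i=0,\dots,\ell-3$. Then $\mathcal{A}$ is free.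
   Context: A (central) $\ell$-arrangement $\mathcal{A}$ is a finite set of linear hyperplanes in an $\ell$-dimensional vector space $V$ over a field $\mathbb{K}$; for $H\in\mathcal{A}$ fix $\alpha_H\in V^*$ with $\ker\alpha_H=H$. $L(\mathcal{A})$ is the set of all intersections of subsets of $\mathcal{A}$ (with $V$ the empty intersection), and $L_i(\mathcal{A})$ is the set of those of codimension $i$ in the ambient space of $\mathcal{A}$ (so elements of $L_2(\mathcal{A}^X)$ have codimension 2 in $X$). For $X\in L(\mathcal{A})$, the localization is $\mathcal{A}_X=\{H\in\mathcal{A}\mid H\supset X\}$ (an arrangement in $V$), and the restriction is $\mathcal{A}^X=\{H\cap X\mid H\in\mathcal{A}\setminus\mathcal{A}_X\}$ (an arrangement in $X$). The Möbius function is given by $\mu(V)=1$, $\mu(X)=-\sum_{Y\in L(\mathcal{A}),\,X\subsetneq Y}\mu(Y)$ for $X\ne V$; $\chi(\mathcal{A};t)=\sum_{X\in L(\mathcal{A})}\mu(X)t^{\dim X}$. Let $S=\mathrm{Sym}(V^* )$ and $D(\mathcal{A})=\{\theta\in\mathrm{Der}\,S\mid\theta(\alpha_H)\in S\alpha_H\ \forall H\in\mathcal{A}\}$. $\mathcal{A}$ is free if $D(\mathcal{A})$ has an $S$-basis of homogeneous derivations. *)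

theory Defs
  imports
    "HOL-Library.Poly_Mapping"
    "HOL-Library.FuncSet"
    "HOL-Computational_Algebra.Polynomial"
begin

section \<open>Intersection lattice, localization and restriction\<close>

text \<open>
  An arrangement is carried together with its ambient space \<open>W\<close>, a subspace of the type
  \<open>'v\<close>, because the restriction to \<open>X\<close> is an arrangement in \<open>X\<close>.
\<close>

text \<open>For \<open>B = {}\<close> the intersection is the ambient space \<open>W\<close>.\<close>

definition inter_lattice :: "'v set \<Rightarrow> 'v set set \<Rightarrow> 'v set set" where
  "inter_lattice W A = {W \<inter> \<Inter>B | B. B \<subseteq> A}"

definition localization :: "'v set set \<Rightarrow> 'v set \<Rightarrow> 'v set set" where
  "localization A X = {H \<in> A. X \<subseteq> H}"

definition restriction :: "'v set set \<Rightarrow> 'v set \<Rightarrow> 'v set set" where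
  "restriction A X = {H \<inter> X | H. H \<in> A - localization A X}"

lemma finite_inter_lattice: "finite A \<Longrightarrow> finite (inter_lattice W A)"
proof -
  assume "finite A"
  moreover have "inter_lattice W A = (\<lambda>B. W \<inter> \<Inter>B) ` Pow A"
    by (auto simp: inter_lattice_def)
  ultimately show ?thesis by simp
qed

text \<open>The guard \<open>finite A\<close> only serves termination.\<close>

function mobius :: "'v set \<Rightarrow> 'v set set \<Rightarrow> 'v set \<Rightarrow> int" where
  "mobius W A X =
     (if finite A \<and> X \<noteq> W then - (\<Sum>Y \<in> {Y \<in> inter_lattice W A. X \<subset> Y}. mobius W A Y) else 1)"
  by pat_completeness auto
termination
proof (relation "measure (\<lambda>(W, A, X). card {Y \<in> inter_lattice W A. X \<subset> Y})")
  fix W X Y :: "'v set" and A :: "'v set set"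
  assume "finite A \<and> X \<noteq> W" and Y: "Y \<in> {Y \<in> inter_lattice W A. X \<subset> Y}"
  then have "finite {Y \<in> inter_lattice W A. X \<subset> Y}"
    by (simp add: finite_inter_lattice)
  moreover have "{Z \<in> inter_lattice W A. Y \<subset> Z} \<subset> {Z \<in> inter_lattice W A. X \<subset> Z}"
    using Y by blast
  ultimately have "card {Z \<in> inter_lattice W A. Y \<subset> Z} < card {Z \<in> inter_lattice W A. X \<subset> Z}"
    by (rule psubset_card_mono)
  then show "((W, A, Y), (W, A, X))
      \<in> measure (\<lambda>(W, A, X). card {Y \<in> inter_lattice W A. X \<subset> Y})"
    by simp
qed simp

declare mobius.simps [simp del]


section \<open>Polynomial rings and their derivations\<close>

text \<open>
  Polynomials are finitely supported functions from exponent vectors to coefficients;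
  \<open>poly_ring n\<close> consists of those in which only the variables \<open>0, \<dots>, n - 1\<close> occur.
\<close>

type_synonym 'k mpol = "(nat \<Rightarrow>\<^sub>0 nat) \<Rightarrow>\<^sub>0 'k"

definition poly_ring :: "nat \<Rightarrow> ('k::field) mpol set" where
  "poly_ring n = {p. \<forall>m \<in> Poly_Mapping.keys p. Poly_Mapping.keys m \<subseteq> {..<n}}"

definition mconst :: "'k::field \<Rightarrow> 'k mpol" where
  "mconst c = Poly_Mapping.single 0 c"

definition mvar :: "nat \<Rightarrow> ('k::field) mpol" where
  "mvar i = Poly_Mapping.single (Poly_Mapping.single i 1) 1"

definition homogeneous_poly :: "nat \<Rightarrow> ('k::field) mpol \<Rightarrow> bool" where
  "homogeneous_poly d p \<longleftrightarrow>
     (\<forall>m \<in> Poly_Mapping.keys p. (\<Sum>i \<in> Poly_Mapping.keys m. Poly_Mapping.lookup m i) = d)"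

text \<open>
  Derivations live on \<open>poly_ring n\<close>; extensionality outside this carrier makes equality of
  derivations the equality of HOL functions.
\<close>

definition Der :: "nat \<Rightarrow> (('k::field) mpol \<Rightarrow> 'k mpol) set" where
  "Der n = {\<theta> \<in> poly_ring n \<rightarrow>\<^sub>E poly_ring n.
     (\<forall>f \<in> poly_ring n. \<forall>g \<in> poly_ring n. \<theta> (f + g) = \<theta> f + \<theta> g) \<and>
     (\<forall>c. \<forall>f \<in> poly_ring n. \<theta> (mconst c * f) = mconst c * \<theta> f) \<and>
     (\<forall>f \<in> poly_ring n. \<forall>g \<in> poly_ring n. \<theta> (f * g) = f * \<theta> g + g * \<theta> f)}"

text \<open>
  Writing \<open>\<theta> = \<Sum>i. f\<^sub>i \<partial>\<^sub>i\<close> with \<open>f\<^sub>i = \<theta> x\<^sub>i\<close>, homogeneity means that all \<open>f\<^sub>i\<close> are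
  homogeneous of one and the same degree (zero being homogeneous of every degree).
\<close>

definition homogeneous_derivation :: "nat \<Rightarrow> (('k::field) mpol \<Rightarrow> 'k mpol) \<Rightarrow> bool" where
  "homogeneous_derivation n \<theta> \<longleftrightarrow> (\<exists>d. \<forall>i<n. homogeneous_poly d (\<theta> (mvar i)))"

definition der_basis ::
    "nat \<Rightarrow> (('k::field) mpol \<Rightarrow> 'k mpol) set \<Rightarrow> ('k mpol \<Rightarrow> 'k mpol) set \<Rightarrow> bool" where
  "der_basis n M \<Theta> \<longleftrightarrow> finite \<Theta> \<and> \<Theta> \<subseteq> M \<and>
     (\<forall>\<theta> \<in> M. \<exists>c \<in> \<Theta> \<rightarrow> poly_ring n. \<forall>f \<in> poly_ring n. \<theta> f = (\<Sum>\<eta>\<in>\<Theta>. c \<eta> * \<eta> f)) \<and>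
     (\<forall>c \<in> \<Theta> \<rightarrow> poly_ring n.
        (\<forall>f \<in> poly_ring n. (\<Sum>\<eta>\<in>\<Theta>. c \<eta> * \<eta> f) = 0) \<longrightarrow> (\<forall>\<eta>\<in>\<Theta>. c \<eta> = 0))"

text \<open>
  An ordered basis \<open>bs\<close> of \<open>W\<close> identifies \<open>Sym(W\<^sup>*)\<close> with \<open>poly_ring (length bs)\<close>, the
  variables being the dual basis. A linear form \<open>\<alpha>\<close> on \<open>W\<close> then becomes \<open>linear_form bs \<alpha>\<close>.
\<close>

definition linear_form :: "'v list \<Rightarrow> ('v \<Rightarrow> 'k::field) \<Rightarrow> 'k mpol" where
  "linear_form bs \<alpha> = (\<Sum>i<length bs. mconst (\<alpha> (bs ! i)) * mvar i)"


section \<open>Arrangements, characteristic polynomial, freeness\<close>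

text \<open>
  The scalar multiplication of the ambient vector space is an explicit parameter throughout.
\<close>

definition arrangement ::
    "('k::field \<Rightarrow> 'v::ab_group_add \<Rightarrow> 'v) \<Rightarrow> 'v set \<Rightarrow> 'v set set \<Rightarrow> bool" where
  "arrangement scale W A \<longleftrightarrow> module.subspace scale W \<and> finite A \<and>
     (\<forall>H\<in>A. module.subspace scale H \<and> H \<subseteq> W \<and>
        vector_space.dim scale H + 1 = vector_space.dim scale W)"

definition inter_lattice_codim ::
    "('k::field \<Rightarrow> 'v::ab_group_add \<Rightarrow> 'v) \<Rightarrow> nat \<Rightarrow> 'v set \<Rightarrow> 'v set set \<Rightarrow> 'v set set" where
  "inter_lattice_codim scale i W A =
     {X \<in> inter_lattice W A. vector_space.dim scale X + i = vector_space.dim scale W}"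

definition char_poly ::
    "('k::field \<Rightarrow> 'v::ab_group_add \<Rightarrow> 'v) \<Rightarrow> 'v set \<Rightarrow> 'v set set \<Rightarrow> int poly" where
  "char_poly scale W A =
     (\<Sum>X \<in> inter_lattice W A. monom (mobius W A X) (vector_space.dim scale X))"

definition ordered_basis ::
    "('k::field \<Rightarrow> 'v::ab_group_add \<Rightarrow> 'v) \<Rightarrow> 'v set \<Rightarrow> 'v list \<Rightarrow> bool" where
  "ordered_basis scale W bs \<longleftrightarrow>
     distinct bs \<and> \<not> module.dependent scale (set bs) \<and> module.span scale (set bs) = W"

text \<open>
  A linear form on \<open>W\<close> is represented by a linear form on the whole space, of which only the
  restriction to \<open>W\<close> matters.
\<close>

definition defining_form ::
    "('k::field \<Rightarrow> 'v::ab_group_add \<Rightarrow> 'v) \<Rightarrow> 'v set \<Rightarrow> 'v set \<Rightarrow> ('v \<Rightarrow> 'k) \<Rightarrow> bool" where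
  "defining_form scale W H \<alpha> \<longleftrightarrow>
     Vector_Spaces.linear scale (*) \<alpha> \<and> {x \<in> W. \<alpha> x = 0} = H"

text \<open>
  Defining forms of the same hyperplane of \<open>W\<close> agree on \<open>W\<close> up to a nonzero scalar, so
  quantifying over all of them is the same as fixing one for each hyperplane.
\<close>

definition log_derivations ::
    "('k::field \<Rightarrow> 'v::ab_group_add \<Rightarrow> 'v) \<Rightarrow> 'v list \<Rightarrow> 'v set set \<Rightarrow> ('k mpol \<Rightarrow> 'k mpol) set" where
  "log_derivations scale bs A = {\<theta> \<in> Der (length bs).
     \<forall>H\<in>A. \<forall>\<alpha>. defining_form scale (module.span scale (set bs)) H \<alpha> \<longrightarrow>
       (\<exists>g \<in> poly_ring (length bs). \<theta> (linear_form bs \<alpha>) = g * linear_form bs \<alpha>)}"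

text \<open>
  A change of the basis \<open>bs\<close> of \<open>W\<close> is a linear change of variables, hence the existence of a
  homogeneous basis does not depend on \<open>bs\<close>.
\<close>

definition free_arrangement ::
    "('k::field \<Rightarrow> 'v::ab_group_add \<Rightarrow> 'v) \<Rightarrow> 'v set \<Rightarrow> 'v set set \<Rightarrow> bool" where
  "free_arrangement scale W A \<longleftrightarrow> (\<exists>bs. ordered_basis scale W bs \<and>
     (\<exists>\<Theta>. der_basis (length bs) (log_derivations scale bs A) \<Theta> \<and>
          (\<forall>\<theta>\<in>\<Theta>. homogeneous_derivation (length bs) \<theta>)))"

end

theory Submission
  imports Defs "HOL-Library.Product_Plus"
begin

text \<open>
  Split off the coordinate t defining H, so that S = R[t] with R the polynomial ring of H.
  For X of codimension two in H, comparing dimensions of graded pieces by means of Terao's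
  polynomial B turns the divisibility of the characteristic polynomials, which is an equality
  of second Betti numbers, into local data: the derivations of the rank-three arrangement
  A_X restrict onto the Ziegler multirestriction of A_X to H, and together with the Euler
  derivation this gives all of D((A_X)^H). The Chinese remainder theorem for powers of linear
  forms glues these local statements (a Hartogs argument on the codimension-two strata): every
  element of D(A^H) lifts to a logarithmic derivation of A, the obstruction being divisible
  by t and hence vanishing for reasons of degree. The lifts of a homogeneous basis of D(A^H),
  together with one further derivation, form a basis of D(A). The second part is an induction
  along the flag.
\<close>


section \<open>Polynomials\<close>

text \<open>The obstacle is to pass from an equality of numbers to actual derivations. Up to a
  multiple of the Euler derivation a logarithmic derivation kills t, and for A_X such derivations
  are pairs of polynomials in three variables. In degree |A_X| - 1 their space is bounded from below
  by adding the hyperplanes one at a time: the loss caused by a hyperplane is controlled by the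
  number of points on it, and these numbers add up to b2. It is bounded from above by the filtration
  by powers of t, whose layers are governed by the degrees h - 1 and |A_X| - h, where h is the
  number of hyperplanes of the restriction of A_X to H. For the value of b2 that divisibility
  forces, the two bounds meet. Hence every intermediate estimate is sharp, and sharpness in these
  two degrees yields the two derivations of the local argument. Freeness of A^H enters the gluing
  through coordinates: they replace a congruence problem for vectors by congruences for single
  polynomials. Sheaves and localized rings are avoided; local statements are divisibilities by the
  forms through one flat.\<close>

lemma poly_mapping_sum_single: "p = (\<Sum>m\<in>Poly_Mapping.keys p. Poly_Mapping.single m (Poly_Mapping.lookup p m))"
  by (rule poly_mapping_eqI) (auto simp: lookup_sum lookup_single when_def in_keys_iff)

lemma mconst_add: "mconst (a + b) = mconst a + mconst b"
  and mconst_mult: "mconst (a * b) = mconst a * mconst b"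
  and mconst_0 [simp]: "mconst 0 = 0" and mconst_1 [simp]: "mconst 1 = 1"
  and mconst_uminus: "mconst (- a) = - mconst a"
  and mconst_diff: "mconst (a - b) = mconst a - mconst b"
  by (simp_all add: mconst_def single_add mult_single single_uminus single_diff)

lemma mconst_eq_0_iff [simp]: "mconst a = 0 \<longleftrightarrow> a = 0"
  by (metis lookup_single_eq lookup_zero mconst_0 mconst_def)

lemma mconst_inverse [simp]: "a \<noteq> 0 \<Longrightarrow> mconst a * mconst (inverse a) = 1"
  by (simp add: mconst_mult [symmetric])

lemma mconst_sum: "mconst (sum f A) = (\<Sum>x\<in>A. mconst (f x))"
  by (induction A rule: infinite_finite_induct) (auto simp: mconst_add)

lemma mconst_single: "mconst c * Poly_Mapping.single m d = Poly_Mapping.single m (c * d)"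
  by (simp add: mconst_def mult_single)

lemma lookup_mconst_mult: "Poly_Mapping.lookup (mconst c * p) m = c * Poly_Mapping.lookup p m"
proof -
  have "mconst c * p = (\<Sum>m\<in>Poly_Mapping.keys p. Poly_Mapping.single m (c * Poly_Mapping.lookup p m))"
    by (subst poly_mapping_sum_single [of p]) (simp add: sum_distrib_left mconst_single)
  then show ?thesis
    by (auto simp: lookup_sum lookup_single when_def in_keys_iff)
qed

definition monom_eval :: "(nat \<Rightarrow> 'a::comm_semiring_1) \<Rightarrow> (nat \<Rightarrow>\<^sub>0 nat) \<Rightarrow> 'a" where
  "monom_eval \<sigma> m = (\<Prod>i\<in>Poly_Mapping.keys m. \<sigma> i ^ Poly_Mapping.lookup m i)"

lemma monom_eval_superset:
  "finite T \<Longrightarrow> Poly_Mapping.keys m \<subseteq> T \<Longrightarrow> monom_eval \<sigma> m = (\<Prod>i\<in>T. \<sigma> i ^ Poly_Mapping.lookup m i)"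
  unfolding monom_eval_def by (rule prod.mono_neutral_left) (auto simp: in_keys_iff)

lemma monom_eval_add: "monom_eval \<sigma> (m + m') = monom_eval \<sigma> m * monom_eval \<sigma> m'"
proof -
  let ?T = "Poly_Mapping.keys m \<union> Poly_Mapping.keys m'"
  have "monom_eval \<sigma> (m + m') = (\<Prod>i\<in>?T. \<sigma> i ^ Poly_Mapping.lookup (m + m') i)"
    by (rule monom_eval_superset) (auto dest: subsetD [OF Poly_Mapping.keys_add])
  also have "\<dots> = monom_eval \<sigma> m * monom_eval \<sigma> m'"
    by (simp add: monom_eval_superset [of ?T] lookup_add power_add prod.distrib)
  finally show ?thesis .
qed

lemma monom_eval_0 [simp]: "monom_eval \<sigma> 0 = 1"
  by (simp add: monom_eval_def)

lemma monom_eval_single: "monom_eval \<sigma> (Poly_Mapping.single i k) = \<sigma> i ^ k"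
  by (simp add: monom_eval_def)

lemma mvar_power: "mvar i ^ k = Poly_Mapping.single (Poly_Mapping.single i k) 1"
  by (induction k) (auto simp: mvar_def mult_single single_add [symmetric])

lemma prod_single_1:
  "finite T \<Longrightarrow> (\<Prod>i\<in>T. Poly_Mapping.single (f i) 1) = Poly_Mapping.single (\<Sum>i\<in>T. f i) (1::'a::comm_semiring_1)"
  by (induction T rule: finite_induct) (auto simp: mult_single)

lemma monom_eval_mvar: "monom_eval mvar m = Poly_Mapping.single m 1"
  unfolding monom_eval_def mvar_power
  by (subst prod_single_1) (simp_all add: poly_mapping_sum_single [symmetric])

text \<open>All ring homomorphisms of the proof are substitutions: setting variables to zero
  (\<open>trunc\<close>), eliminating a variable along a linear form (\<open>elim\<close>), passing
  to the coordinates of a plane, and adjoining an infinitesimal in order to differentiate.\<close>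

definition psubst :: "(nat \<Rightarrow> 'k mpol) \<Rightarrow> ('k::field) mpol \<Rightarrow> 'k mpol" where
  "psubst \<sigma> p = (\<Sum>m\<in>Poly_Mapping.keys p. mconst (Poly_Mapping.lookup p m) * monom_eval \<sigma> m)"

lemma psubst_superset:
  "finite T \<Longrightarrow> Poly_Mapping.keys p \<subseteq> T \<Longrightarrow>
    psubst \<sigma> p = (\<Sum>m\<in>T. mconst (Poly_Mapping.lookup p m) * monom_eval \<sigma> m)"
  unfolding psubst_def by (rule sum.mono_neutral_left) (auto simp: in_keys_iff)

lemma psubst_add [simp]: "psubst \<sigma> (p + q) = psubst \<sigma> p + psubst \<sigma> q"
proof -
  let ?T = "Poly_Mapping.keys p \<union> Poly_Mapping.keys q"
  have "psubst \<sigma> (p + q) = (\<Sum>m\<in>?T. mconst (Poly_Mapping.lookup (p + q) m) * monom_eval \<sigma> m)"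
    by (rule psubst_superset) (auto dest: subsetD [OF Poly_Mapping.keys_add])
  also have "\<dots> = psubst \<sigma> p + psubst \<sigma> q"
    by (simp add: psubst_superset [of ?T] lookup_add mconst_add algebra_simps sum.distrib)
  finally show ?thesis .
qed

lemma psubst_0 [simp]: "psubst \<sigma> 0 = 0"
  by (simp add: psubst_def)

lemma psubst_sum [simp]: "psubst \<sigma> (sum f A) = (\<Sum>x\<in>A. psubst \<sigma> (f x))"
  by (induction A rule: infinite_finite_induct) auto

lemma psubst_single: "psubst \<sigma> (Poly_Mapping.single m c) = mconst c * monom_eval \<sigma> m"
  by (cases "c = 0") (auto simp: psubst_def)

lemma psubst_mconst [simp]: "psubst \<sigma> (mconst c) = mconst c"
  by (simp add: mconst_def psubst_single)

lemma psubst_1 [simp]: "psubst \<sigma> 1 = 1"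
  by (metis mconst_1 psubst_mconst)

lemma psubst_mvar [simp]: "psubst \<sigma> (mvar i) = \<sigma> i"
  by (simp add: mvar_def psubst_single monom_eval_single)

lemma psubst_mult [simp]: "psubst \<sigma> (p * q) = psubst \<sigma> p * psubst \<sigma> q"
proof -
  let ?s = "Poly_Mapping.single" and ?l = "Poly_Mapping.lookup"
  have "psubst \<sigma> (p * q) =
      psubst \<sigma> ((\<Sum>m\<in>Poly_Mapping.keys p. ?s m (?l p m)) * (\<Sum>m\<in>Poly_Mapping.keys q. ?s m (?l q m)))"
    by (simp only: poly_mapping_sum_single [symmetric])
  also have "\<dots> = (\<Sum>m\<in>Poly_Mapping.keys p. \<Sum>m'\<in>Poly_Mapping.keys q.
      (mconst (?l p m) * monom_eval \<sigma> m) * (mconst (?l q m') * monom_eval \<sigma> m'))"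
    unfolding sum_product mult_single psubst_sum psubst_single monom_eval_add mconst_mult
    by (simp add: mult_ac)
  also have "\<dots> = psubst \<sigma> p * psubst \<sigma> q"
    by (simp add: psubst_def sum_product)
  finally show ?thesis .
qed

lemma psubst_uminus [simp]: "psubst \<sigma> (- p) = - psubst \<sigma> p"
  by (metis add.right_inverse neg_eq_iff_add_eq_0 psubst_0 psubst_add)

lemma psubst_diff [simp]: "psubst \<sigma> (p - q) = psubst \<sigma> p - psubst \<sigma> q"
  by (metis diff_conv_add_uminus psubst_add psubst_uminus)

lemma psubst_power [simp]: "psubst \<sigma> (p ^ k) = psubst \<sigma> p ^ k"
  by (induction k) auto

lemma psubst_prod [simp]: "psubst \<sigma> (prod f A) = (\<Prod>x\<in>A. psubst \<sigma> (f x))"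
  by (induction A rule: infinite_finite_induct) auto

lemma psubst_dvd: "p dvd q \<Longrightarrow> psubst \<sigma> p dvd psubst \<sigma> q"
  by (auto elim!: dvdE)

lemma poly_ring_0 [simp]: "0 \<in> poly_ring n"
  by (simp add: poly_ring_def)

lemma poly_ring_mconst [simp]: "mconst c \<in> poly_ring n"
  by (auto simp: poly_ring_def mconst_def)

lemma poly_ring_1 [simp]: "1 \<in> poly_ring n"
  by (metis mconst_1 poly_ring_mconst)

lemma poly_ring_mvar [simp]: "i < n \<Longrightarrow> mvar i \<in> poly_ring n"
  by (auto simp: poly_ring_def mvar_def)

lemma poly_ring_add [simp]: "p \<in> poly_ring n \<Longrightarrow> q \<in> poly_ring n \<Longrightarrow> p + q \<in> poly_ring n"
  unfolding poly_ring_def using Poly_Mapping.keys_add [of p q] by blast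

lemma poly_ring_uminus [simp]: "p \<in> poly_ring n \<Longrightarrow> - p \<in> poly_ring n"
  by (simp add: poly_ring_def in_keys_iff)

lemma poly_ring_diff [simp]: "p \<in> poly_ring n \<Longrightarrow> q \<in> poly_ring n \<Longrightarrow> p - q \<in> poly_ring n"
  by (metis diff_conv_add_uminus poly_ring_add poly_ring_uminus)

lemma poly_ring_mult [simp]:
  assumes "p \<in> poly_ring n" "q \<in> poly_ring n" shows "p * q \<in> poly_ring n"
proof -
  { fix m assume "m \<in> Poly_Mapping.keys (p * q)"
    then obtain a b where "m = a + b" "a \<in> Poly_Mapping.keys p" "b \<in> Poly_Mapping.keys q"
      using Poly_Mapping.keys_mult [of p q] by blast
    then have "Poly_Mapping.keys m \<subseteq> {..<n}"
      using assms Poly_Mapping.keys_add [of a b] unfolding poly_ring_def by blast }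
  then show ?thesis by (simp add: poly_ring_def)
qed

lemma poly_ring_power [simp]: "p \<in> poly_ring n \<Longrightarrow> p ^ k \<in> poly_ring n"
  by (induction k) auto

lemma poly_ring_sum [simp]: "(\<And>x. x \<in> A \<Longrightarrow> f x \<in> poly_ring n) \<Longrightarrow> sum f A \<in> poly_ring n"
  by (induction A rule: infinite_finite_induct) auto

lemma poly_ring_prod [simp]: "(\<And>x. x \<in> A \<Longrightarrow> f x \<in> poly_ring n) \<Longrightarrow> prod f A \<in> poly_ring n"
  by (induction A rule: infinite_finite_induct) auto

lemma poly_ring_mono: "p \<in> poly_ring n \<Longrightarrow> n \<le> k \<Longrightarrow> p \<in> poly_ring k"
  by (fastforce simp: poly_ring_def)

lemma poly_ring_induct [consumes 1, case_names const var add mult]: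
  assumes "p \<in> poly_ring n"
    and const: "\<And>c. P (mconst c)" and var: "\<And>i. i < n \<Longrightarrow> P (mvar i)"
    and add: "\<And>p q. p \<in> poly_ring n \<Longrightarrow> q \<in> poly_ring n \<Longrightarrow> P p \<Longrightarrow> P q \<Longrightarrow> P (p + q)"
    and mult: "\<And>p q. p \<in> poly_ring n \<Longrightarrow> q \<in> poly_ring n \<Longrightarrow> P p \<Longrightarrow> P q \<Longrightarrow> P (p * q)"
  shows "P p"
proof -
  have pow: "P (mvar i ^ k)" if "i < n" for i k
    using that const [of 1] by (induction k) (auto intro!: mult var)
  have prod: "P (\<Prod>i\<in>T. mvar i ^ f i)" if "finite T" "T \<subseteq> {..<n}" for T f
    using that const [of 1] by (induction T rule: finite_induct) (auto intro!: mult pow poly_ring_prod poly_ring_power)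
  have mon: "P (Poly_Mapping.single m c) \<and> Poly_Mapping.single m c \<in> poly_ring n"
    if "Poly_Mapping.keys m \<subseteq> {..<n}" for m c
  proof -
    have "Poly_Mapping.single m c = mconst c * monom_eval mvar m"
      by (simp add: monom_eval_mvar mconst_single)
    moreover have "P (mconst c * monom_eval mvar m)"
      unfolding monom_eval_def using that by (auto intro!: mult const prod poly_ring_prod poly_ring_power)
    moreover have "Poly_Mapping.single m c \<in> poly_ring n"
      using that by (simp add: poly_ring_def)
    ultimately show ?thesis by simp
  qed
  have "P (\<Sum>m\<in>T. Poly_Mapping.single m (Poly_Mapping.lookup p m))"
    if "finite T" "T \<subseteq> Poly_Mapping.keys p" for T
    using that
  proof (induction T rule: finite_induct)
    case (insert m T)
    then have "Poly_Mapping.keys m \<subseteq> {..<n}" and "\<And>m'. m' \<in> T \<Longrightarrow> Poly_Mapping.keys m' \<subseteq> {..<n}"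
      using assms(1) by (auto simp: poly_ring_def)
    then show ?case using insert by (simp, intro add poly_ring_sum) (simp_all add: mon)
  qed (use const [of 0] in simp)
  from this [of "Poly_Mapping.keys p"] show ?thesis
    using poly_mapping_sum_single [of p] by simp
qed

lemma mpol_in_poly_ring: "\<exists>n. p \<in> poly_ring n"
proof -
  have "finite (\<Union>m\<in>Poly_Mapping.keys p. Poly_Mapping.keys m)" by auto
  then obtain n where "(\<Union>m\<in>Poly_Mapping.keys p. Poly_Mapping.keys m) \<subseteq> {..<n}"
    using finite_nat_iff_bounded by blast
  then show ?thesis by (auto simp: poly_ring_def)
qed

lemma mpol_induct [case_names const var add mult]:
  assumes "\<And>c. P (mconst c)" "\<And>i. P (mvar i)"
    and "\<And>p q. P p \<Longrightarrow> P q \<Longrightarrow> P (p + q)" "\<And>p q. P p \<Longrightarrow> P q \<Longrightarrow> P (p * q)"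
  shows "P p"
proof -
  obtain n where "p \<in> poly_ring n" using mpol_in_poly_ring by blast
  then show ?thesis by (induction rule: poly_ring_induct) (auto intro: assms)
qed

lemma psubst_in_poly_ring:
  "p \<in> poly_ring n \<Longrightarrow> (\<And>i. i < n \<Longrightarrow> \<sigma> i \<in> poly_ring k) \<Longrightarrow> psubst \<sigma> p \<in> poly_ring k"
  by (induction rule: poly_ring_induct) auto

lemma psubst_id [simp]: "psubst mvar p = p"
  by (induction p rule: mpol_induct) auto

lemma psubst_diff_dvd:
  assumes "\<And>i. q dvd mvar i - \<sigma> i" shows "q dvd p - psubst \<sigma> p"
proof (induction p rule: mpol_induct)
  case (add p r)
  have "p + r - psubst \<sigma> (p + r) = (p - psubst \<sigma> p) + (r - psubst \<sigma> r)" by simp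
  then show ?case using add by (metis dvd_add)
next
  case (mult p r)
  have "p * r - psubst \<sigma> (p * r) = p * (r - psubst \<sigma> r) + psubst \<sigma> r * (p - psubst \<sigma> p)"
    by (simp add: algebra_simps)
  then show ?case using mult by (metis dvd_add dvd_mult)
qed (use assms in auto)

text \<open>With t = x_n the last of n + 1 variables this is restriction to the hyperplane t = 0; on
  \<open>poly_ring (Suc n)\<close> its kernel is generated by t, see
  \<open>mvar_dvd_iff_trunc\<close>. It also serves as a retraction onto
  \<open>poly_ring n\<close>.\<close>

definition trunc :: "nat \<Rightarrow> ('k::field) mpol \<Rightarrow> 'k mpol" where
  "trunc n = psubst (\<lambda>i. if i < n then mvar i else 0)"

lemma trunc_simps [simp]:
  "trunc n (p + q) = trunc n p + trunc n q" "trunc n (p - q) = trunc n p - trunc n q"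
  "trunc n (p * q) = trunc n p * trunc n q" "trunc n (- p) = - trunc n p"
  "trunc n (p ^ k) = trunc n p ^ k" "trunc n 0 = 0" "trunc n 1 = 1" "trunc n (mconst c) = mconst c"
  "trunc n (sum f A) = (\<Sum>x\<in>A. trunc n (f x))" "trunc n (prod f A) = (\<Prod>x\<in>A. trunc n (f x))"
  by (simp_all add: trunc_def)

lemma trunc_mvar: "trunc n (mvar i) = (if i < n then mvar i else 0)"
  by (simp add: trunc_def)

lemma trunc_in_poly_ring [simp]: "trunc n p \<in> poly_ring n"
  by (induction p rule: mpol_induct) (auto simp: trunc_mvar)

lemma trunc_eq: "p \<in> poly_ring n \<Longrightarrow> trunc n p = p"
  by (induction rule: poly_ring_induct) (auto simp: trunc_mvar)

lemma trunc_dvd: "p dvd q \<Longrightarrow> trunc n p dvd trunc n q"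
  by (auto elim!: dvdE)

text \<open>Divisibility is taken in the ring with infinitely many variables. Setting the surplus
  variables of the quotient to zero does not disturb the equation, so quotients can be kept in
  \<open>poly_ring n\<close>.\<close>

lemma poly_ring_dvdE:
  assumes "p dvd q" "p \<in> poly_ring n" "q \<in> poly_ring n"
  obtains r where "r \<in> poly_ring n" "q = p * r"
proof -
  obtain s where "q = p * s" using assms(1) by (auto elim: dvdE)
  then have "q = p * trunc n s" using assms by (metis trunc_eq trunc_simps(3))
  then show ?thesis using that [OF trunc_in_poly_ring] by blast
qed

lemma trunc_Suc_diff_dvd: "p \<in> poly_ring (Suc n) \<Longrightarrow> mvar n dvd p - trunc n p"
proof (induction rule: poly_ring_induct)
  case (var i)
  then show ?case by (cases "i = n") (auto simp: trunc_mvar)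
next
  case (add p r)
  have "p + r - trunc n (p + r) = (p - trunc n p) + (r - trunc n r)" by simp
  then show ?case using add by (metis dvd_add)
next
  case (mult p r)
  have "p * r - trunc n (p * r) = p * (r - trunc n r) + trunc n r * (p - trunc n p)"
    by (simp add: algebra_simps)
  then show ?case using mult by (metis dvd_add dvd_mult)
qed auto

lemma mvar_dvd_iff_trunc: "p \<in> poly_ring (Suc n) \<Longrightarrow> mvar n dvd p \<longleftrightarrow> trunc n p = 0"
proof
  assume "mvar n dvd p"
  then have "trunc n (mvar n) dvd trunc n p" by (rule trunc_dvd)
  then show "trunc n p = 0" by (simp add: trunc_mvar)
next
  assume "p \<in> poly_ring (Suc n)" "trunc n p = 0"
  then show "mvar n dvd p" using trunc_Suc_diff_dvd by fastforce
qed

lemma mvar_neq_0 [simp]: "mvar i \<noteq> 0"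
  by (metis mvar_def lookup_single_eq lookup_zero one_neq_zero)

section \<open>Homogeneous components\<close>

definition mdeg :: "(nat \<Rightarrow>\<^sub>0 nat) \<Rightarrow> nat" where
  "mdeg m = (\<Sum>i\<in>Poly_Mapping.keys m. Poly_Mapping.lookup m i)"

lemma mdeg_add [simp]: "mdeg (m + m') = mdeg m + mdeg m'"
proof -
  have sup: "mdeg m = (\<Sum>i\<in>T. Poly_Mapping.lookup m i)"
    if "finite T" "Poly_Mapping.keys m \<subseteq> T" for m T
    unfolding mdeg_def using that by (intro sum.mono_neutral_left) (auto simp: in_keys_iff)
  let ?T = "Poly_Mapping.keys m \<union> Poly_Mapping.keys m'"
  have "mdeg (m + m') = (\<Sum>i\<in>?T. Poly_Mapping.lookup (m + m') i)"
    by (rule sup) (auto dest: subsetD [OF Poly_Mapping.keys_add])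
  also have "\<dots> = mdeg m + mdeg m'"
    by (simp add: lookup_add sum.distrib sup [of ?T])
  finally show ?thesis .
qed

lemma mdeg_0 [simp]: "mdeg 0 = 0" and mdeg_single [simp]: "mdeg (Poly_Mapping.single i k) = k"
  by (simp_all add: mdeg_def)

lemma homogeneous_poly_iff: "homogeneous_poly d p \<longleftrightarrow> (\<forall>m\<in>Poly_Mapping.keys p. mdeg m = d)"
  by (simp add: homogeneous_poly_def mdeg_def)

lemma homogeneous_0 [simp]: "homogeneous_poly d 0"
  by (simp add: homogeneous_poly_iff)

lemma homogeneous_mconst [simp]: "homogeneous_poly 0 (mconst c)"
  by (auto simp: homogeneous_poly_iff mconst_def)

lemma homogeneous_1 [simp]: "homogeneous_poly 0 1"
  by (auto simp: homogeneous_poly_iff)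

lemma homogeneous_mvar: "homogeneous_poly 1 (mvar i)"
  by (auto simp: homogeneous_poly_iff mvar_def)

lemma homogeneous_add [simp]: "homogeneous_poly d p \<Longrightarrow> homogeneous_poly d q \<Longrightarrow> homogeneous_poly d (p + q)"
  unfolding homogeneous_poly_iff using Poly_Mapping.keys_add [of p q] by blast

lemma homogeneous_uminus [simp]: "homogeneous_poly d p \<Longrightarrow> homogeneous_poly d (- p)"
  by (simp add: homogeneous_poly_iff in_keys_iff)

lemma homogeneous_diff [simp]: "homogeneous_poly d p \<Longrightarrow> homogeneous_poly d q \<Longrightarrow> homogeneous_poly d (p - q)"
  by (metis diff_conv_add_uminus homogeneous_add homogeneous_uminus)

lemma homogeneous_mult:
  "homogeneous_poly d p \<Longrightarrow> homogeneous_poly e q \<Longrightarrow> homogeneous_poly (d + e) (p * q)"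
  unfolding homogeneous_poly_iff using Poly_Mapping.keys_mult [of p q] by fastforce

lemma homogeneous_sum [simp]: "(\<And>x. x \<in> A \<Longrightarrow> homogeneous_poly d (f x)) \<Longrightarrow> homogeneous_poly d (sum f A)"
  by (induction A rule: infinite_finite_induct) auto

lemma homogeneous_power: "homogeneous_poly d p \<Longrightarrow> homogeneous_poly (d * k) (p ^ k)"
  by (induction k) (auto simp: homogeneous_mult)

lemma homogeneous_prod:
  "(\<And>x. x \<in> A \<Longrightarrow> homogeneous_poly (d x) (f x)) \<Longrightarrow> homogeneous_poly (\<Sum>x\<in>A. d x) (prod f A)"
  by (induction A rule: infinite_finite_induct) (auto simp: homogeneous_mult)

lemma homogeneous_prod_1:
  "(\<And>x. x \<in> A \<Longrightarrow> homogeneous_poly 1 (f x)) \<Longrightarrow> homogeneous_poly (card A) (prod f A)"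
  using homogeneous_prod [of A "\<lambda>_. 1" f] by simp

lemma homogeneous_mconst_mult [simp]: "homogeneous_poly d p \<Longrightarrow> homogeneous_poly d (mconst c * p)"
  using homogeneous_mult [of 0 "mconst c" d p] by simp

definition hcomp :: "nat \<Rightarrow> ('k::field) mpol \<Rightarrow> 'k mpol" where
  "hcomp d p = (\<Sum>m\<in>{m \<in> Poly_Mapping.keys p. mdeg m = d}. Poly_Mapping.single m (Poly_Mapping.lookup p m))"

lemma lookup_hcomp: "Poly_Mapping.lookup (hcomp d p) m = (if mdeg m = d then Poly_Mapping.lookup p m else 0)"
  by (auto simp: hcomp_def lookup_sum lookup_single when_def in_keys_iff)

lemma hcomp_add [simp]: "hcomp d (p + q) = hcomp d p + hcomp d q"
  and hcomp_diff [simp]: "hcomp d (p - q) = hcomp d p - hcomp d q"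
  and hcomp_0 [simp]: "hcomp d 0 = 0"
  and hcomp_mconst_mult: "hcomp d (mconst c * p) = mconst c * hcomp d p"
  by (rule poly_mapping_eqI; simp add: lookup_hcomp lookup_add lookup_minus lookup_mconst_mult)+

lemma hcomp_sum [simp]: "hcomp d (sum f A) = (\<Sum>x\<in>A. hcomp d (f x))"
  by (induction A rule: infinite_finite_induct) auto

lemma homogeneous_hcomp [simp]: "homogeneous_poly d (hcomp d p)"
  by (auto simp: homogeneous_poly_iff in_keys_iff lookup_hcomp split: if_splits)

lemma hcomp_homogeneous:
  assumes "homogeneous_poly e p" shows "hcomp d p = (if d = e then p else 0)"
proof -
  have "Poly_Mapping.lookup p m = 0" if "mdeg m \<noteq> e" for m
    using that assms by (auto simp: homogeneous_poly_iff in_keys_iff)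
  then show ?thesis by (auto intro!: poly_mapping_eqI simp: lookup_hcomp)
qed

lemma hcomp_eq: "homogeneous_poly d p \<Longrightarrow> hcomp d p = p"
  by (simp add: hcomp_homogeneous)

lemma sum_hcomp: "\<exists>k. p = (\<Sum>d<k. hcomp d p)"
proof -
  obtain k where k: "mdeg ` Poly_Mapping.keys p \<subseteq> {..<k}"
    using finite_nat_iff_bounded [of "mdeg ` Poly_Mapping.keys p"] by auto
  have "p = (\<Sum>d<k. hcomp d p)"
    using k by (intro poly_mapping_eqI) (auto simp: lookup_sum lookup_hcomp in_keys_iff image_subset_iff)
  then show ?thesis by blast
qed

lemma hcomp_mult:
  assumes q: "homogeneous_poly e q"
  shows "hcomp (e + d) (q * p) = q * hcomp d p"
    and "d' < e \<Longrightarrow> hcomp d' (q * p) = 0"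
proof -
  obtain k where k: "p = (\<Sum>d<k. hcomp d p)" using sum_hcomp by blast
  have h: "hcomp c (q * p) = (\<Sum>d<k. if c = e + d then q * hcomp d p else 0)" for c
    by (subst k) (simp add: sum_distrib_left hcomp_homogeneous [OF homogeneous_mult [OF q homogeneous_hcomp]])
  show "d' < e \<Longrightarrow> hcomp d' (q * p) = 0" by (simp add: h)
  have "hcomp d p = (\<Sum>d'<k. if d = d' then hcomp d' p else 0)"
    by (subst k) (simp add: hcomp_homogeneous [OF homogeneous_hcomp])
  then show "hcomp (e + d) (q * p) = q * hcomp d p"
    by (simp add: h sum_distrib_left if_distrib cong: if_cong)
qed

lemma hcomp_in_poly_ring [simp]: "p \<in> poly_ring n \<Longrightarrow> hcomp d p \<in> poly_ring n"
  by (auto simp: poly_ring_def in_keys_iff lookup_hcomp split: if_splits)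

text \<open>A homogeneous polynomial generates a graded ideal. Congruences modulo products of linear
  forms can therefore be restricted to one degree, which is how solutions are made
  homogeneous.\<close>

lemma hcomp_dvd: "homogeneous_poly e q \<Longrightarrow> q dvd p \<Longrightarrow> q dvd hcomp d p"
proof -
  assume q: "homogeneous_poly e q" and "q dvd p"
  then obtain r where p: "p = q * r" by (auto elim: dvdE)
  show ?thesis
  proof (cases "d < e")
    case False
    then show ?thesis using hcomp_mult(1) [OF q, of "d - e" r] by (simp add: p)
  qed (simp add: p hcomp_mult(2) [OF q])
qed

lemma homogeneous_monom_eval:
  assumes "\<And>i. homogeneous_poly 1 (\<sigma> i)" shows "homogeneous_poly (mdeg m) (monom_eval \<sigma> m)"
  unfolding monom_eval_def mdeg_def
proof (rule homogeneous_prod)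
  fix i
  show "homogeneous_poly (Poly_Mapping.lookup m i) (\<sigma> i ^ Poly_Mapping.lookup m i)"
    using homogeneous_power [OF assms [of i], of "Poly_Mapping.lookup m i"] by simp
qed

lemma homogeneous_psubst:
  assumes "\<And>i. homogeneous_poly 1 (\<sigma> i)" and p: "homogeneous_poly d p"
  shows "homogeneous_poly d (psubst \<sigma> p)"
  unfolding psubst_def
proof (intro homogeneous_sum homogeneous_mconst_mult)
  fix m assume "m \<in> Poly_Mapping.keys p"
  then have "mdeg m = d" using p by (simp add: homogeneous_poly_iff)
  then show "homogeneous_poly d (monom_eval \<sigma> m)"
    using homogeneous_monom_eval [OF assms(1), of m] by simp
qed

lemma hcomp_psubst:
  assumes "\<And>i. homogeneous_poly 1 (\<sigma> i)"
  shows "hcomp d (psubst \<sigma> p) = psubst \<sigma> (hcomp d p)"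
proof -
  have h: "hcomp d (psubst \<sigma> (hcomp e p)) = (if d = e then psubst \<sigma> (hcomp e p) else 0)" for e
    by (rule hcomp_homogeneous) (intro homogeneous_psubst assms homogeneous_hcomp)
  have h': "hcomp d (hcomp e p) = (if d = e then hcomp e p else 0)" for e
    by (rule hcomp_homogeneous) (rule homogeneous_hcomp)
  obtain k where k: "p = (\<Sum>d<k. hcomp d p)" using sum_hcomp by blast
  have "hcomp d (psubst \<sigma> p) = hcomp d (psubst \<sigma> (\<Sum>e<k. hcomp e p))"
    using k by simp
  also have "\<dots> = psubst \<sigma> (\<Sum>e<k. hcomp d (hcomp e p))"
    by (simp add: h h' if_distrib cong: if_cong)
  also have "\<dots> = psubst \<sigma> (hcomp d p)"
    using k by (simp only: hcomp_sum [symmetric])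
  finally show ?thesis .
qed

lemma hcomp_trunc: "hcomp d (trunc n p) = trunc n (hcomp d p)"
  unfolding trunc_def by (rule hcomp_psubst) (simp add: homogeneous_mvar [unfolded One_nat_def])

lemma homogeneous_trunc: "homogeneous_poly d p \<Longrightarrow> homogeneous_poly d (trunc n p)"
  unfolding trunc_def by (rule homogeneous_psubst) (simp_all add: homogeneous_mvar [unfolded One_nat_def])

lemma homogeneous_quotient:
  assumes "homogeneous_poly e q" "q \<noteq> 0" "homogeneous_poly (e + d) (q * p)"
  shows "homogeneous_poly d p"
proof -
  have "q * hcomp d p = q * p"
    by (rule trans [OF hcomp_mult(1) [OF assms(1), symmetric] hcomp_eq [OF assms(3)]])
  then have "p = hcomp d p" using assms(2) by auto
  then show ?thesis using homogeneous_hcomp [of d p] by simp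
qed

lemma homogeneous_quotient_less:
  assumes "homogeneous_poly e q" "q \<noteq> 0" "homogeneous_poly d (q * p)" "d < e"
  shows "p = 0"
  using hcomp_mult(2) [OF assms(1,4), of p] hcomp_eq [OF assms(3)] assms(2) by simp

section \<open>Linear forms\<close>

text \<open>If f lists the values of a derivation on the variables, this is its value on the linear
  form with coefficients b. For the Euler derivation, f = \<open>mvar\<close>, the value is the form
  itself, whence the abbreviation \<open>lin\<close>.\<close>

definition dot :: "nat \<Rightarrow> (nat \<Rightarrow> ('k::field) mpol) \<Rightarrow> (nat \<Rightarrow> 'k) \<Rightarrow> 'k mpol" where
  "dot n f b = (\<Sum>i<n. mconst (b i) * f i)"

abbreviation lin :: "nat \<Rightarrow> (nat \<Rightarrow> 'k) \<Rightarrow> ('k::field) mpol" where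
  "lin n b \<equiv> dot n mvar b"

lemma dot_add_right: "dot n f (\<lambda>i. a i + b i) = dot n f a + dot n f b"
  and dot_diff_right: "dot n f (\<lambda>i. a i - b i) = dot n f a - dot n f b"
  and dot_scale_right: "dot n f (\<lambda>i. s * a i) = mconst s * dot n f a"
  and dot_0_right [simp]: "dot n f (\<lambda>i. 0) = 0"
  and dot_add_left: "dot n (\<lambda>i. f i + g i) b = dot n f b + dot n g b"
  and dot_diff_left: "dot n (\<lambda>i. f i - g i) b = dot n f b - dot n g b"
  and dot_scale_left: "dot n (\<lambda>i. p * f i) b = p * dot n f b"
  by (simp_all add: dot_def mconst_add mconst_diff mconst_mult algebra_simps sum.distrib
      sum_subtractf sum_distrib_left)

lemma dot_sum_left: "dot n (\<lambda>i. \<Sum>k\<in>K. f k i) b = (\<Sum>k\<in>K. dot n (f k) b)"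
  by (simp add: dot_def sum_distrib_left) (rule sum.swap)

lemma dot_cong: "(\<And>i. i < n \<Longrightarrow> f i = g i) \<Longrightarrow> (\<And>i. i < n \<Longrightarrow> a i = b i) \<Longrightarrow> dot n f a = dot n g b"
  by (simp add: dot_def)

lemma psubst_dot: "psubst \<sigma> (dot n f b) = dot n (\<lambda>i. psubst \<sigma> (f i)) b"
  by (simp add: dot_def)

lemma trunc_dot: "trunc k (dot n f b) = dot n (\<lambda>i. trunc k (f i)) b"
  by (simp add: trunc_def psubst_dot)

lemma hcomp_dot: "hcomp d (dot n f b) = dot n (\<lambda>i. hcomp d (f i)) b"
  by (simp add: dot_def hcomp_mconst_mult)

lemma dot_in_poly_ring [simp]: "(\<And>i. i < n \<Longrightarrow> f i \<in> poly_ring k) \<Longrightarrow> dot n f b \<in> poly_ring k"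
  unfolding dot_def by (intro poly_ring_sum poly_ring_mult) simp_all

lemma homogeneous_dot [simp]: "(\<And>i. i < n \<Longrightarrow> homogeneous_poly d (f i)) \<Longrightarrow> homogeneous_poly d (dot n f b)"
  unfolding dot_def by (intro homogeneous_sum homogeneous_mconst_mult) simp_all

lemma homogeneous_lin: "homogeneous_poly 1 (lin n b)"
  by (rule homogeneous_dot) (rule homogeneous_mvar)

lemma lin_in_poly_ring [simp]: "n \<le> k \<Longrightarrow> lin n b \<in> poly_ring k"
  by (rule dot_in_poly_ring) auto

lemma lookup_lin: "i < n \<Longrightarrow> Poly_Mapping.lookup (lin n b) (Poly_Mapping.single i 1) = b i"
proof -
  assume "i < n"
  have eq: "Poly_Mapping.single j 1 = Poly_Mapping.single i (1::nat) \<longleftrightarrow> i = j" for j :: nat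
    by (metis lookup_single_eq lookup_single_not_eq one_neq_zero)
  have "Poly_Mapping.lookup (lin n b) (Poly_Mapping.single i 1) = (\<Sum>j<n. if i = j then b j else 0)"
    unfolding dot_def lookup_sum
    by (rule sum.cong) (auto simp: mvar_def mconst_single lookup_single when_def eq simp del: One_nat_def)
  then show ?thesis using \<open>i < n\<close> by simp
qed

lemma lin_eq_iff: "lin n a = lin n b \<longleftrightarrow> (\<forall>i<n. a i = b i)"
  by (metis dot_cong lookup_lin)

lemma lin_eq_0_iff: "lin n b = 0 \<longleftrightarrow> (\<forall>i<n. b i = 0)"
  using lin_eq_iff [of n b "\<lambda>_. 0"] by simp

text \<open>Solving a linear form for one of its variables identifies the quotient by
  \<open>lin n b\<close> with the polynomials free of this variable. \<open>elim\<close> picks these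
  representatives, so that no quotient rings are needed.\<close>

definition elim_index :: "nat \<Rightarrow> (nat \<Rightarrow> 'k::field) \<Rightarrow> nat" where
  "elim_index n b = (SOME j. j < n \<and> b j \<noteq> 0)"

definition elim :: "nat \<Rightarrow> (nat \<Rightarrow> 'k::field) \<Rightarrow> 'k mpol \<Rightarrow> 'k mpol" where
  "elim n b = psubst (\<lambda>i. mvar i -
     (if i = elim_index n b then mconst (inverse (b i)) * lin n b else 0))"

lemma elim_simps [simp]:
  "elim n b (p + q) = elim n b p + elim n b q" "elim n b (p - q) = elim n b p - elim n b q"
  "elim n b (p * q) = elim n b p * elim n b q" "elim n b (- p) = - elim n b p"
  "elim n b (p ^ k) = elim n b p ^ k" "elim n b 0 = 0" "elim n b 1 = 1" "elim n b (mconst c) = mconst c"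
  "elim n b (sum f A) = (\<Sum>x\<in>A. elim n b (f x))" "elim n b (prod f A) = (\<Prod>x\<in>A. elim n b (f x))"
  by (simp_all add: elim_def)

lemma elim_index:
  assumes "lin n b \<noteq> 0" shows "elim_index n b < n" "b (elim_index n b) \<noteq> 0"
proof -
  have "\<exists>j. j < n \<and> b j \<noteq> 0" using assms lin_eq_0_iff by blast
  then have "elim_index n b < n \<and> b (elim_index n b) \<noteq> 0"
    unfolding elim_index_def by (rule someI_ex)
  then show "elim_index n b < n" "b (elim_index n b) \<noteq> 0" by auto
qed

lemma elim_lin:
  assumes "lin n b \<noteq> 0"
  shows "elim n b (lin n a) = lin n (\<lambda>i. a i - a (elim_index n b) / b (elim_index n b) * b i)"
proof -
  let ?j = "elim_index n b"
  have "elim n b (lin n a) = (\<Sum>i<n. mconst (a i) * mvar i -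
      (if i = ?j then mconst (a ?j) * (mconst (inverse (b ?j)) * lin n b) else 0))"
    unfolding elim_def psubst_dot by (simp add: dot_def) (rule sum.cong, auto simp: algebra_simps)
  also have "\<dots> = lin n a - mconst (a ?j / b ?j) * lin n b"
    using elim_index [OF assms] by (simp add: sum_subtractf dot_def mconst_mult divide_inverse mult.assoc)
  also have "\<dots> = lin n (\<lambda>i. a i - a ?j / b ?j * b i)"
    by (simp only: dot_diff_right dot_scale_right)
  finally show ?thesis .
qed

lemma elim_self: "lin n b \<noteq> 0 \<Longrightarrow> elim n b (lin n b) = 0"
  using elim_index [of n b] by (subst elim_lin) auto

lemma lin_dvd_diff_elim: "lin n b dvd p - elim n b p"
  unfolding elim_def by (rule psubst_diff_dvd) auto

lemma lin_dvd_iff_elim: "lin n b \<noteq> 0 \<Longrightarrow> lin n b dvd p \<longleftrightarrow> elim n b p = 0"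
proof
  assume "lin n b \<noteq> 0" "lin n b dvd p"
  then show "elim n b p = 0" by (auto elim!: dvdE simp: elim_self)
next
  assume "elim n b p = 0" then show "lin n b dvd p" using lin_dvd_diff_elim [of n b p] by simp
qed

lemma elim_elim [simp]: "lin n b \<noteq> 0 \<Longrightarrow> elim n b (elim n b p) = elim n b p"
  using lin_dvd_iff_elim [of n b "p - elim n b p"] lin_dvd_diff_elim [of n b p] by simp

lemma prime_lin: "lin n b \<noteq> 0 \<Longrightarrow> prime_elem (lin n b)"
  by (auto simp: prime_elem_def lin_dvd_iff_elim)

lemma lin_dvd_lin:
  assumes "lin n b dvd lin n a" "lin n b \<noteq> 0"
  shows "\<exists>s. \<forall>i<n. a i = s * b i"
proof -
  have "lin n (\<lambda>i. a i - a (elim_index n b) / b (elim_index n b) * b i) = 0"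
    using assms by (simp add: lin_dvd_iff_elim elim_lin)
  then show ?thesis unfolding lin_eq_0_iff
    by (intro exI [of _ "a (elim_index n b) / b (elim_index n b)"]) simp
qed

lemma homogeneous_elim: "homogeneous_poly d p \<Longrightarrow> homogeneous_poly d (elim n b p)"
  unfolding elim_def
proof (rule homogeneous_psubst)
  fix i
  have "homogeneous_poly 1 (mconst (inverse (b i)) * lin n b)"
    by (intro homogeneous_mconst_mult homogeneous_lin)
  then show "homogeneous_poly 1 (mvar i - (if i = elim_index n b then mconst (inverse (b i)) * lin n b else 0))"
    using homogeneous_diff [OF homogeneous_mvar [of i], of "mconst (inverse (b i)) * lin n b"]
      homogeneous_mvar [of i] by (cases "i = elim_index n b") simp_all
qed

lemma elim_in_poly_ring: "p \<in> poly_ring n \<Longrightarrow> elim n b p \<in> poly_ring n"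
  unfolding elim_def by (erule psubst_in_poly_ring) auto


section \<open>Coprimality and a Chinese remainder theorem for linear forms\<close>

text \<open>Q is a non-zero-divisor modulo P. Over a domain this form of coprimality is
  multiplicative in both arguments, so that it has to be checked for linear forms only, and these
  are prime.\<close>

definition cancels :: "'a::comm_ring_1 \<Rightarrow> 'a \<Rightarrow> bool" where
  "cancels P Q \<longleftrightarrow> (\<forall>y. P dvd Q * y \<longrightarrow> P dvd y)"

lemma cancelsD: "cancels P Q \<Longrightarrow> P dvd Q * y \<Longrightarrow> P dvd y"
  unfolding cancels_def by blast

lemma cancels_prime: "prime_elem P \<Longrightarrow> \<not> P dvd Q \<Longrightarrow> cancels P Q"
  unfolding cancels_def by (auto dest: prime_elem_dvd_multD)

lemma cancels_1_left [simp]: "cancels 1 Q" and cancels_1_right [simp]: "cancels P 1"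
  by (simp_all add: cancels_def)

lemma cancels_mult_right: "cancels P Q \<Longrightarrow> cancels P Q' \<Longrightarrow> cancels P (Q * Q')"
  unfolding cancels_def [of P "Q * Q'"] mult.assoc by (blast dest: cancelsD)

lemma cancels_mult_left:
  fixes P :: "'a::idom"
  assumes "cancels P Q" "cancels P' Q" shows "cancels (P * P') Q"
  unfolding cancels_def [of "P * P'"]
proof (intro allI impI)
  fix y assume y: "P * P' dvd Q * y"
  then have "P dvd y" using cancelsD [OF assms(1)] dvd_mult_left by blast
  then obtain z where z: "y = P * z" by (auto elim: dvdE)
  show "P * P' dvd y"
  proof (cases "P = 0")
    case False
    have "P * P' dvd P * (Q * z)" using y by (simp add: z mult_ac)
    then have "P' dvd Q * z" using False by simp
    then have "P' dvd z" by (rule cancelsD [OF assms(2)])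
    then show ?thesis by (simp add: z mult_dvd_mono)
  qed (simp add: z)
qed

lemma cancels_power_right: "cancels P Q \<Longrightarrow> cancels P (Q ^ k)"
  by (induction k) (auto intro: cancels_mult_right)

lemma cancels_power_left: "cancels P Q \<Longrightarrow> cancels ((P::'a::idom) ^ k) Q"
  by (induction k) (auto intro: cancels_mult_left)

lemma cancels_prod_right: "(\<And>x. x \<in> A \<Longrightarrow> cancels P (f x)) \<Longrightarrow> cancels P (prod f A)"
  by (induction A rule: infinite_finite_induct) (auto intro: cancels_mult_right)

lemma cancels_prod_left: "(\<And>x. x \<in> A \<Longrightarrow> cancels (f x) Q) \<Longrightarrow> cancels (prod f A :: 'a::idom) Q"
  by (induction A rule: infinite_finite_induct) (auto intro: cancels_mult_left)

lemma cancels_mult_dvd: "cancels P Q \<Longrightarrow> P dvd x \<Longrightarrow> Q dvd x \<Longrightarrow> P * Q dvd x"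
proof -
  assume "cancels P Q" "P dvd x" "Q dvd x"
  then obtain y where y: "x = Q * y" by (auto elim: dvdE)
  then have "P dvd y" using cancelsD [OF \<open>cancels P Q\<close>] \<open>P dvd x\<close> by blast
  then show ?thesis unfolding y by (subst mult.commute) (rule mult_dvd_mono, simp_all)
qed

lemma prod_dvd_of_cancels:
  assumes "\<And>k. k \<in> K \<Longrightarrow> f k dvd x"
    and "\<And>k k'. k \<in> K \<Longrightarrow> k' \<in> K \<Longrightarrow> k \<noteq> k' \<Longrightarrow> cancels (f k) (f k')"
  shows "prod f K dvd x"
  using assms
proof (induction K rule: infinite_finite_induct)
  case (insert k K)
  have "cancels (f k) (prod f K)" using insert by (intro cancels_prod_right) blast
  then show ?case using insert by (simp add: cancels_mult_dvd)
qed auto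

lemma cancels_lin:
  assumes "lin n a \<noteq> 0" "\<And>s. \<not> (\<forall>i<n. b i = s * a i)"
  shows "cancels (lin n a) (lin n b)"
  using assms lin_dvd_lin [of n a b] by (intro cancels_prime prime_lin) auto

section \<open>Non-zero-divisors modulo two polynomials, and the remainder theorem\<close>

definition nzd_mod :: "'a::comm_ring_1 \<Rightarrow> 'a \<Rightarrow> 'a \<Rightarrow> bool" where
  "nzd_mod L M u \<longleftrightarrow> (\<forall>x. (\<exists>p q. u * x = L * p + M * q) \<longrightarrow> (\<exists>p q. x = L * p + M * q))"

lemma nzd_modD: "nzd_mod L M u \<Longrightarrow> u * x = L * p + M * q \<Longrightarrow> \<exists>p q. x = L * p + M * q"
  unfolding nzd_mod_def by blast

lemma nzd_mod_1: "nzd_mod L M 1"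
  by (simp add: nzd_mod_def)

lemma nzd_mod_mult: "nzd_mod L M u \<Longrightarrow> nzd_mod L M v \<Longrightarrow> nzd_mod L M (u * v)"
  unfolding nzd_mod_def [of L M "u * v"] mult.assoc by (blast dest: nzd_modD)

lemma nzd_mod_power: "nzd_mod L M u \<Longrightarrow> nzd_mod L M (u ^ k)"
  by (induction k) (auto intro: nzd_mod_mult nzd_mod_1)

lemma nzd_mod_prod: "(\<And>x. x \<in> A \<Longrightarrow> nzd_mod L M (f x)) \<Longrightarrow> nzd_mod L M (prod f A)"
  by (induction A rule: infinite_finite_induct) (auto intro: nzd_mod_mult nzd_mod_1)

text \<open>A syzygy argument. Modulo the form b the combination L p + M q vanishes, and coprimality
  of L and M modulo b makes (p, q) a multiple of the trivial syzygy (-M, L). Subtracting this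
  multiple does not change L p + M q and makes both coefficients divisible by b, which is then
  cancelled.\<close>

lemma nzd_mod_lin:
  assumes b: "lin n b \<noteq> 0" and L: "elim n b L \<noteq> 0" and can: "cancels (elim n b L) (elim n b M)"
  shows "nzd_mod L M (lin n b)"
  unfolding nzd_mod_def
proof (intro allI impI, elim exE)
  fix x p q assume x: "lin n b * x = L * p + M * q"
  let ?r = "elim n b"
  have "?r (lin n b * x) = ?r (L * p + M * q)" by (simp only: x)
  then have 0: "?r L * ?r p + ?r M * ?r q = 0" by (simp add: elim_self b)
  then have "?r L * (- ?r p) = ?r M * ?r q" by (simp add: add_eq_0_iff)
  then have "?r L dvd ?r M * ?r q" by (metis dvd_triv_left)
  then have "?r L dvd ?r q" by (rule cancelsD [OF can])
  then obtain s0 where "?r q = ?r L * s0" by (auto elim: dvdE)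
  then have "?r (?r q) = ?r (?r L * s0)" by simp
  then have q: "?r q = ?r L * ?r s0" by (simp add: b)
  have "?r L * (?r p + ?r M * ?r s0) = 0" using 0 by (simp add: q algebra_simps)
  then have p: "?r p = - (?r M * ?r s0)" using L by (simp add: add_eq_0_iff)
  have "lin n b dvd q - L * ?r s0" "lin n b dvd p + M * ?r s0"
    using b by (simp_all add: lin_dvd_iff_elim p q)
  then obtain q' p' where "q - L * ?r s0 = lin n b * q'" "p + M * ?r s0 = lin n b * p'"
    by (auto elim!: dvdE)
  then have qp: "q = lin n b * q' + L * ?r s0" "p = lin n b * p' - M * ?r s0"
    by (simp_all only: diff_eq_eq eq_diff_eq)
  have "lin n b * x = L * (lin n b * p' - M * ?r s0) + M * (lin n b * q' + L * ?r s0)"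
    unfolding x by (simp only: qp [symmetric])
  then have "lin n b * x = lin n b * (L * p' + M * q')" by (simp add: algebra_simps)
  then show "\<exists>p q. x = L * p + M * q" using b by auto
qed

definition span2 :: "(nat \<Rightarrow> 'k::field) \<Rightarrow> (nat \<Rightarrow> 'k) \<Rightarrow> (nat \<Rightarrow> 'k) \<Rightarrow> bool" where
  "span2 a b x \<longleftrightarrow> (\<exists>s t. x = (\<lambda>i. s * a i + t * b i))"

lemma span2_left: "span2 a b a" and span2_right: "span2 a b b"
proof -
  have "a = (\<lambda>i. 1 * a i + 0 * b i)" "b = (\<lambda>i. 0 * a i + 1 * b i)" by auto
  then show "span2 a b a" "span2 a b b" unfolding span2_def by blast+
qed

text \<open>Coefficient functions vanish beyond n, so that proportionality and \<open>span2\<close>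
  are equalities of functions. For independent a and b, \<open>span2 a b x\<close> means that the
  hyperplane of x contains the intersection of the hyperplanes of a and b.\<close>

locale linear_forms =
  fixes n :: nat and J :: "'j set" and \<beta> :: "'j \<Rightarrow> nat \<Rightarrow> 'k::field"
  assumes finite_J: "finite J"
    and supp: "Y \<in> J \<Longrightarrow> n \<le> i \<Longrightarrow> \<beta> Y i = 0"
    and lin_nonzero: "Y \<in> J \<Longrightarrow> lin n (\<beta> Y) \<noteq> 0"
    and non_prop: "Y \<in> J \<Longrightarrow> Z \<in> J \<Longrightarrow> Y \<noteq> Z \<Longrightarrow> \<beta> Y \<noteq> (\<lambda>i. s * \<beta> Z i)"
begin

lemma non_prop': "Y \<in> J \<Longrightarrow> Z \<in> J \<Longrightarrow> Y \<noteq> Z \<Longrightarrow> \<not> (\<forall>i<n. \<beta> Y i = s * \<beta> Z i)"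
  using non_prop [of Y Z s] supp [of Y] supp [of Z]
  by (metis (no_types, opaque_lifting) ext linorder_not_less mult_zero_right)

lemma cancels_forms: "Y \<in> J \<Longrightarrow> Z \<in> J \<Longrightarrow> Y \<noteq> Z \<Longrightarrow> cancels (lin n (\<beta> Y)) (lin n (\<beta> Z))"
  using non_prop' by (intro cancels_lin lin_nonzero) auto

lemma cancels_powers:
  "Y \<in> J \<Longrightarrow> Z \<in> J \<Longrightarrow> Y \<noteq> Z \<Longrightarrow> cancels (lin n (\<beta> Y) ^ d) (lin n (\<beta> Z) ^ e)"
  by (intro cancels_power_left cancels_power_right cancels_forms)

text \<open>Modulo Z' the forms Y and X stay non-proportional, since a proportionality would put the
  three forms into one plane. Hence a power of Y and the product over K stay coprime on the
  hyperplane of Z', as \<open>nzd_mod_lin\<close> requires.\<close>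

lemma nzd_mod_forms:
  assumes J: "Y \<in> J" "Z' \<in> J" "K \<subseteq> J" and Z': "\<And>X. X \<in> K \<Longrightarrow> \<not> span2 (\<beta> Y) (\<beta> X) (\<beta> Z')"
    and K: "Y \<notin> K" "Y \<noteq> Z'"
  shows "nzd_mod (lin n (\<beta> Y) ^ e) (\<Prod>X\<in>K. lin n (\<beta> X) ^ d X) (lin n (\<beta> Z'))"
proof (rule nzd_mod_lin)
  let ?r = "elim n (\<beta> Z')"
  define q where "q X = \<beta> X (elim_index n (\<beta> Z')) / \<beta> Z' (elim_index n (\<beta> Z'))" for X
  have r: "?r (lin n (\<beta> X)) = lin n (\<lambda>i. \<beta> X i - q X * \<beta> Z' i)" for X
    unfolding q_def by (rule elim_lin) (rule lin_nonzero, fact)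
  show Z'0: "lin n (\<beta> Z') \<noteq> 0" by (rule lin_nonzero) fact
  have Y0: "?r (lin n (\<beta> Y)) \<noteq> 0"
    using non_prop' [of Y Z' "q Y"] J K by (simp add: r lin_eq_0_iff)
  then show "?r (lin n (\<beta> Y) ^ e) \<noteq> 0" by simp
  have "cancels (?r (lin n (\<beta> Y))) (?r (lin n (\<beta> X)))" if X: "X \<in> K" for X
    unfolding r
  proof (rule cancels_lin)
    show "lin n (\<lambda>i. \<beta> Y i - q Y * \<beta> Z' i) \<noteq> 0" using Y0 by (simp add: r)
    fix s
    show "\<not> (\<forall>i<n. \<beta> X i - q X * \<beta> Z' i = s * (\<beta> Y i - q Y * \<beta> Z' i))"
    proof
      assume *: "\<forall>i<n. \<beta> X i - q X * \<beta> Z' i = s * (\<beta> Y i - q Y * \<beta> Z' i)"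
      define c where "c = q X - s * q Y"
      have "\<beta> X i = s * \<beta> Y i + c * \<beta> Z' i" for i
      proof (cases "i < n")
        case True
        then show ?thesis using * by (simp add: c_def algebra_simps)
      next
        case False
        then show ?thesis using J X supp [of X i] supp [of Y i] supp [of Z' i] by auto
      qed
      note X_eq = this
      show False
      proof (cases "c = 0")
        case True
        then have "\<beta> X = (\<lambda>i. s * \<beta> Y i)" using X_eq by auto
        then show False using non_prop [of X Y s] J K X by auto
      next
        case False
        then have "\<beta> Z' = (\<lambda>i. (- s / c) * \<beta> Y i + (1 / c) * \<beta> X i)"
          using X_eq by (auto simp: field_simps)
        then have "span2 (\<beta> Y) (\<beta> X) (\<beta> Z')" unfolding span2_def by blast
        then show False using Z' X by blast
      qed
    qed
  qed
  then show "cancels (?r (lin n (\<beta> Y) ^ e)) (?r (\<Prod>X\<in>K. lin n (\<beta> X) ^ d X))"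
    by (simp add: cancels_power_left cancels_power_right cancels_prod_right)
qed

text \<open>The obstruction is a membership in an ideal generated by a power of one form and a
  product of powers of the others. Its associated primes have codimension two and are generated by
  two of the linear forms; there the hypothesis provides a solution. The proof makes this explicit
  with non-zero-divisors.\<close>

lemma chinese_remainder:
  assumes "\<And>Y Z. Y \<in> J \<Longrightarrow> Z \<in> J \<Longrightarrow> \<exists>f. \<forall>X\<in>J. span2 (\<beta> Y) (\<beta> Z) (\<beta> X) \<longrightarrow> lin n (\<beta> X) ^ e X dvd f - v X"
  shows "\<exists>f. \<forall>X\<in>J. lin n (\<beta> X) ^ e X dvd f - v X"
proof -
  let ?l = "\<lambda>X. lin n (\<beta> X) ^ e X"
  have "\<exists>f. \<forall>X\<in>J0. ?l X dvd f - v X" if "finite J0" "J0 \<subseteq> J" for J0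
    using that
  proof (induction J0 rule: finite_induct)
    case (insert Y J0)
    then obtain f0 where f0: "\<forall>X\<in>J0. ?l X dvd f0 - v X" and YJ: "Y \<in> J" and J0: "J0 \<subseteq> J" "Y \<notin> J0" by auto
    \<comment> \<open>A solution f0 for J0 can be extended to Y exactly if v Y - f0 lies in the
      ideal generated by \<open>?l Y\<close> and the product over J0. The set K grows towards J0 one
      form at a time.\<close>
    have "\<exists>p q. v Y - f0 = ?l Y * p + (\<Prod>X\<in>K. ?l X) * q" if "finite K" "K \<subseteq> J0" for K
      using that
    proof (induction K rule: finite_induct)
      case empty
      have "v Y - f0 = ?l Y * 0 + (\<Prod>X\<in>{}. ?l X) * (v Y - f0)" by simp
      then show ?case by blast
    next
      case (insert Z K)
      \<comment> \<open>K1 collects the forms in the plane of Y and Z, where the hypothesis applies;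
        K2 consists of the others, for which the induction hypothesis is weakened to a divisor of
        the product. The two memberships are merged since the ideals (\<open>?l Y\<close>,
        \<open>?B1\<close>) and (\<open>?l Y\<close>, \<open>?B2\<close>) meet in
        (\<open>?l Y\<close>, \<open>?B1 * ?B2\<close>).\<close>
      define K1 where "K1 = {X \<in> insert Z K. span2 (\<beta> Y) (\<beta> Z) (\<beta> X)}"
      define K2 where "K2 = {X \<in> K. \<not> span2 (\<beta> Y) (\<beta> Z) (\<beta> X)}"
      let ?B1 = "\<Prod>X\<in>K1. ?l X" and ?B2 = "\<Prod>X\<in>K2. ?l X"
      have ZJ: "Z \<in> J" "Z \<in> J0" and KJ: "K \<subseteq> J0" using insert J0 by auto
      have split: "insert Z K = K1 \<union> K2" "K1 \<inter> K2 = {}" and fin: "finite K1" "finite K2"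
        using insert span2_right [of "\<beta> Y" "\<beta> Z"] by (auto simp: K1_def K2_def)
      have sub: "K1 \<subseteq> J" "K1 \<subseteq> J0" "K2 \<subseteq> J0" using KJ J0 ZJ by (auto simp: K1_def K2_def)
      have B: "(\<Prod>X\<in>insert Z K. ?l X) = ?B1 * ?B2"
        unfolding split(1) by (rule prod.union_disjoint) (use fin split in auto)
      obtain p2 q2' where pq2: "v Y - f0 = ?l Y * p2 + (\<Prod>X\<in>K. ?l X) * q2'"
        using insert by auto
      have "?B2 dvd (\<Prod>X\<in>K. ?l X)"
        using insert by (intro prod_dvd_prod_subset) (auto simp: K2_def)
      then obtain r where r: "(\<Prod>X\<in>K. ?l X) = ?B2 * r" by (rule dvdE)
      define q2 where "q2 = r * q2'"
      have 2: "v Y - f0 = ?l Y * p2 + ?B2 * q2"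
        using pq2 unfolding r q2_def by (simp only: mult.assoc)
      obtain f where f: "\<forall>X\<in>J. span2 (\<beta> Y) (\<beta> Z) (\<beta> X) \<longrightarrow> ?l X dvd f - v X"
        using assms [OF YJ ZJ(1)] by blast
      have "?l X dvd f - f0" if "X \<in> K1" for X
      proof -
        have "?l X dvd f - v X" "?l X dvd f0 - v X" using f f0 that sub by (auto simp: K1_def)
        then have "?l X dvd (f - v X) - (f0 - v X)" by (rule dvd_diff)
        then show ?thesis by simp
      qed
      then have "?B1 dvd f - f0"
        using cancels_powers sub by (intro prod_dvd_of_cancels) (auto simp: subset_iff)
      moreover have "?l Y dvd f - v Y"
        using f YJ span2_left [of "\<beta> Y" "\<beta> Z"] by blast
      then have "?l Y dvd v Y - f" using dvd_minus_iff [of "?l Y" "f - v Y"] by simp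
      ultimately obtain p1 q1 where 1: "f - f0 = ?B1 * q1" "v Y - f = ?l Y * p1" by (auto elim!: dvdE)
      have 1: "v Y - f0 = ?l Y * p1 + ?B1 * q1" by (simp only: 1 [symmetric]) simp
      \<comment> \<open>If Z' were in the span of Y and a form X of K1, it would be in the span of Y
        and Z, because X is.\<close>
      have "nzd_mod (?l Y) ?B1 ?B2"
      proof (intro nzd_mod_prod nzd_mod_power nzd_mod_forms)
        fix Z' X assume Z': "Z' \<in> K2" and X: "X \<in> K1"
        show "\<not> span2 (\<beta> Y) (\<beta> X) (\<beta> Z')"
        proof
          assume "span2 (\<beta> Y) (\<beta> X) (\<beta> Z')"
          then obtain s t where "\<beta> Z' = (\<lambda>i. s * \<beta> Y i + t * \<beta> X i)" by (auto simp: span2_def)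
          moreover obtain s' t' where "\<beta> X = (\<lambda>i. s' * \<beta> Y i + t' * \<beta> Z i)"
            using X by (auto simp: K1_def span2_def)
          ultimately have "\<beta> Z' = (\<lambda>i. (s + t * s') * \<beta> Y i + (t * t') * \<beta> Z i)"
            by (auto simp: algebra_simps)
          then have "span2 (\<beta> Y) (\<beta> Z) (\<beta> Z')" unfolding span2_def by blast
          then show False using Z' by (simp add: K2_def)
        qed
      qed (use YJ J0 sub in auto)
      moreover have "?B2 * q2 = (v Y - f0) - ?l Y * p2" by (simp only: 2) simp
      then have "?B2 * q2 = ?l Y * (p1 - p2) + ?B1 * q1" by (simp only: 1) (simp add: right_diff_distrib)
      ultimately obtain a b where q2: "q2 = ?l Y * a + ?B1 * b" by (blast dest: nzd_modD)
      have "v Y - f0 = ?l Y * (p2 + ?B2 * a) + (?B1 * ?B2) * b"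
        unfolding 2 q2 by (simp add: algebra_simps)
      then show ?case unfolding B by blast
    qed
    from this [of J0] insert obtain p q where pq: "v Y - f0 = ?l Y * p + (\<Prod>X\<in>J0. ?l X) * q" by auto
    let ?f = "f0 + (\<Prod>X\<in>J0. ?l X) * q"
    have "?l X dvd ?f - v X" if "X \<in> J0" for X
    proof -
      have "?l X dvd (\<Prod>X\<in>J0. ?l X)" using insert that by (intro dvd_prodI) auto
      then have "?l X dvd (f0 - v X) + (\<Prod>X\<in>J0. ?l X) * q"
        using f0 that by (intro dvd_add) auto
      then show ?thesis by (simp add: algebra_simps)
    qed
    moreover have "?f - v Y = (\<Prod>X\<in>J0. ?l X) * q - (v Y - f0)" by simp
    then have "?f - v Y = ?l Y * (- p)" by (simp only: pq) simp
    then have "?l Y dvd ?f - v Y" by (metis dvd_triv_left)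
    ultimately have "\<forall>X\<in>insert Y J0. ?l X dvd ?f - v X" by simp
    then show ?case by blast
  qed auto
  from this [of J] show ?thesis using finite_J by blast
qed

end

section \<open>An arrangement seen from one of its hyperplanes\<close>

abbreviation vecs :: "nat \<Rightarrow> nat \<Rightarrow> (nat \<Rightarrow> ('k::field) mpol) set" where
  "vecs n k \<equiv> {f. \<forall>i<n. f i \<in> poly_ring k}"

lemma vecs_diff: "f \<in> vecs n k \<Longrightarrow> g \<in> vecs n k \<Longrightarrow> (\<lambda>i. f i - g i) \<in> vecs n k"
  and vecs_add: "f \<in> vecs n k \<Longrightarrow> g \<in> vecs n k \<Longrightarrow> (\<lambda>i. f i + g i) \<in> vecs n k"
  and vecs_scale: "p \<in> poly_ring k \<Longrightarrow> f \<in> vecs n k \<Longrightarrow> (\<lambda>i. p * f i) \<in> vecs n k"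
  and vecs_mvar: "n \<le> k \<Longrightarrow> mvar \<in> vecs n k"
  and vecs_trunc: "(\<lambda>i. trunc k (f i)) \<in> vecs n k"
  and vecs_hcomp: "f \<in> vecs n k \<Longrightarrow> (\<lambda>i. hcomp d (f i)) \<in> vecs n k"
  and vecs_mono: "f \<in> vecs n k \<Longrightarrow> k \<le> k' \<Longrightarrow> f \<in> vecs n k'"
  by (auto intro: poly_ring_mono)

lemma vecs_dot: "f \<in> vecs n k \<Longrightarrow> dot n f b \<in> poly_ring k"
  by (auto intro: dot_in_poly_ring)

lemma trunc_in_Suc [simp]: "trunc n p \<in> poly_ring (Suc n)"
  by (rule poly_ring_mono [OF trunc_in_poly_ring]) simp

lemma mconst_inverse_mult: "s \<noteq> 0 \<Longrightarrow> mconst (inverse s) * (mconst s * p) = p"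
  by (subst mult.assoc [symmetric]) (simp add: mconst_mult [symmetric])

lemma bex_choice: "(\<And>x. x \<in> A \<Longrightarrow> \<exists>z\<in>C. P x z) \<Longrightarrow> \<exists>f. \<forall>x\<in>A. f x \<in> C \<and> P x (f x)"
  by (rule bchoice) blast

lemma bex_choice2:
  "(\<And>x y. x \<in> A \<Longrightarrow> y \<in> B \<Longrightarrow> \<exists>z\<in>C. P x y z) \<Longrightarrow>
    \<exists>f. \<forall>x\<in>A. \<forall>y\<in>B. f x y \<in> C \<and> P x y (f x y)"
  by (rule bchoice, rule ballI, rule bchoice) blast

lemma poly_ring_dvd_iff:
  assumes "p \<in> poly_ring n" "q \<in> poly_ring n"
  shows "p dvd q \<longleftrightarrow> (\<exists>r\<in>poly_ring n. q = p * r)"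
proof
  assume "p dvd q" then show "\<exists>r\<in>poly_ring n. q = p * r" by (rule poly_ring_dvdE [OF _ assms]) blast
qed auto

lemma dvd_trans_diff: "p dvd a - b \<Longrightarrow> p dvd b - c \<Longrightarrow> p dvd a - (c::'a::comm_ring_1)"
  using dvd_add [of p "a - b" "b - c"] by simp

lemma dvd_diff_swap: "p dvd a - b \<Longrightarrow> p dvd b - (a::'a::comm_ring_1)"
  using dvd_minus_iff [of p "a - b"] by simp

lemma dvd_diff_left: "p dvd a - b \<Longrightarrow> p dvd b \<Longrightarrow> p dvd (a::'a::comm_ring_1)"
  using dvd_add [of p "a - b" b] by simp


text \<open>
  Coordinates are chosen such that the distinguished hyperplane is the zero set of the variable
  \<open>t = x\<^sub>n\<close>. The other hyperplanes \<open>L \<in> I\<close> are the zero sets of \<open>form L = lb (z L) + c L \<cdot> t\<close>, where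
  \<open>z L\<close> stands for the trace of \<open>L\<close> on \<open>{t = 0}\<close> and \<open>lb (z L)\<close> for a form defining that trace.
\<close>

locale pencils = linear_forms n J \<beta>
  for n :: nat and J :: "'j set" and \<beta> :: "'j \<Rightarrow> nat \<Rightarrow> 'k::field" +
  fixes I :: "'i set" and z :: "'i \<Rightarrow> 'j" and c :: "'i \<Rightarrow> 'k"
  assumes finite_I: "finite I" and z_image: "z ` I = J"
    and c_inj: "L \<in> I \<Longrightarrow> L' \<in> I \<Longrightarrow> z L = z L' \<Longrightarrow> c L = c L' \<Longrightarrow> L = L'"
begin

abbreviation lb :: "'j \<Rightarrow> 'k mpol" where "lb Y \<equiv> lin n (\<beta> Y)"
abbreviation t :: "'k mpol" where "t \<equiv> mvar n"

definition vec :: "'i \<Rightarrow> nat \<Rightarrow> 'k" where "vec L = (\<beta> (z L))(n := c L)"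
definition form :: "'i \<Rightarrow> 'k mpol" where "form L = lb (z L) + mconst (c L) * t"
definition fibre :: "'j \<Rightarrow> 'i set" where "fibre Y = {L \<in> I. z L = Y}"
definition G :: "'j \<Rightarrow> 'k mpol" where "G Y = (\<Prod>L\<in>fibre Y. form L)"
text \<open>Ziegler's multiplicity: the number of hyperplanes other than t = 0 with trace Y. It
  appears as an exponent when \<open>G Y\<close> is restricted to t = 0, see
  \<open>trunc_G\<close>.\<close>

definition m :: "'j \<Rightarrow> nat" where "m Y = card (fibre Y)"
text \<open>The hyperplanes of the restricted arrangement through the codimension-two flat cut out
  by Y and Z. For Y = Z this is {Y} by \<open>plane_same\<close>, so statements about all pairs also
  cover single hyperplanes.\<close>

definition plane :: "'j \<Rightarrow> 'j \<Rightarrow> 'j set" where "plane Y Z = {X \<in> J. span2 (\<beta> Y) (\<beta> Z) (\<beta> X)}"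

lemma dot_vec: "dot (Suc n) f (vec L) = dot n f (\<beta> (z L)) + mconst (c L) * f n"
proof -
  have "dot n f (vec L) = dot n f (\<beta> (z L))" by (rule dot_cong) (auto simp: vec_def)
  then show ?thesis by (simp add: dot_def vec_def)
qed

lemma form_lin: "form L = lin (Suc n) (vec L)"
  by (simp add: form_def dot_vec)

lemma zJ: "L \<in> I \<Longrightarrow> z L \<in> J"
  using z_image by blast

lemma finite_fibre: "finite (fibre Y)"
  by (simp add: fibre_def finite_I)

lemma m_pos: "Y \<in> J \<Longrightarrow> 0 < m Y"
  unfolding m_def card_gt_0_iff using z_image finite_fibre by (auto simp: fibre_def)

lemma form_in [simp]: "form L \<in> poly_ring (Suc n)"
  unfolding form_lin by (rule lin_in_poly_ring) simp

lemma lb_in [simp]: "lb Y \<in> poly_ring n"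
  by (rule lin_in_poly_ring) simp

lemma trunc_form [simp]: "trunc n (form L) = lb (z L)"
  by (simp add: form_def trunc_mvar trunc_eq)

lemma form_nonzero: "L \<in> I \<Longrightarrow> form L \<noteq> 0"
  using trunc_form [of L] lin_nonzero [OF zJ, of L] by (metis trunc_simps(6))

lemma homogeneous_form: "homogeneous_poly 1 (form L)"
  unfolding form_lin by (rule homogeneous_lin)

lemma G_in [simp]: "G Y \<in> poly_ring (Suc n)"
  unfolding G_def by auto

lemma trunc_G [simp]: "trunc n (G Y) = lb Y ^ m Y"
  unfolding G_def m_def by (simp add: fibre_def)

lemma homogeneous_G: "homogeneous_poly (m Y) (G Y)"
  unfolding G_def m_def by (rule homogeneous_prod_1) (rule homogeneous_form)

lemma cancels_form_t: "L \<in> I \<Longrightarrow> cancels (form L) t"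
proof -
  assume L: "L \<in> I"
  have "t = lin (Suc n) (\<lambda>i. if i = n then 1 else 0)"
    by (simp add: dot_def)
  moreover have "cancels (form L) (lin (Suc n) (\<lambda>i. if i = n then 1 else 0))"
    unfolding form_lin
  proof (rule cancels_lin)
    show "lin (Suc n) (vec L) \<noteq> 0" using form_nonzero [OF L] by (simp add: form_lin)
    fix s
    obtain i where i: "i < n" "\<beta> (z L) i \<noteq> 0" using lin_nonzero [OF zJ [OF L]] lin_eq_0_iff by blast
    show "\<not> (\<forall>i<Suc n. (if i = n then 1 else 0) = s * vec L i)"
    proof
      assume *: "\<forall>i<Suc n. (if i = n then 1 else 0) = s * vec L i"
      from *[rule_format, of i] have "s = 0" using i by (simp add: vec_def)
      then show False using *[rule_format, of n] by simp
    qed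
  qed
  ultimately show ?thesis by simp
qed

lemma form_dvd_cancel_t: "L \<in> I \<Longrightarrow> form L dvd t * p \<Longrightarrow> form L dvd p"
  by (rule cancelsD [OF cancels_form_t])

lemma G_dvd_cancel_t: "G Y dvd t * p \<Longrightarrow> G Y dvd p"
proof (rule cancelsD)
  show "cancels (G Y) t" unfolding G_def
    by (rule cancels_prod_left) (auto simp: fibre_def intro: cancels_form_t)
qed

lemma cancels_fibre:
  assumes "L \<in> I" "L' \<in> I" "z L = z L'" "L \<noteq> L'" shows "cancels (form L) (form L')"
  unfolding form_lin
proof (rule cancels_lin)
  show "lin (Suc n) (vec L) \<noteq> 0" using form_nonzero [OF assms(1)] by (simp add: form_lin)
  fix s
  obtain i where i: "i < n" "\<beta> (z L) i \<noteq> 0" using lin_nonzero [OF zJ [OF assms(1)]] lin_eq_0_iff by blast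
  have "c L \<noteq> c L'" using c_inj assms by blast
  show "\<not> (\<forall>i<Suc n. vec L' i = s * vec L i)"
  proof
    assume *: "\<forall>i<Suc n. vec L' i = s * vec L i"
    from *[rule_format, of i] have "s = 1" using i assms(3) by (simp add: vec_def)
    then show False using *[rule_format, of n] \<open>c L \<noteq> c L'\<close> by (simp add: vec_def)
  qed
qed

lemma G_dvdI: "(\<And>L. L \<in> I \<Longrightarrow> z L = Y \<Longrightarrow> form L dvd p) \<Longrightarrow> G Y dvd p"
  unfolding G_def by (rule prod_dvd_of_cancels) (auto simp: fibre_def intro: cancels_fibre)

lemma form_dvd_G: "L \<in> I \<Longrightarrow> form L dvd G (z L)"
  unfolding G_def by (rule dvd_prodI [OF finite_fibre]) (simp add: fibre_def)

lemma lb_dvd_pow: "Y \<in> J \<Longrightarrow> lb Y dvd lb Y ^ m Y"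
  using m_pos by (intro dvd_power) auto

lemma lb_pow: "Y \<in> J \<Longrightarrow> lb Y ^ m Y = lb Y * lb Y ^ (m Y - 1)"
  using m_pos [of Y] by (metis power_Suc Suc_diff_1)

section \<open>Codimension-two flats of the restricted arrangement\<close>

lemma plane_self: "Y \<in> J \<Longrightarrow> Y \<in> plane Y Z" and plane_self2: "Z \<in> J \<Longrightarrow> Z \<in> plane Y Z"
  by (auto simp: plane_def span2_left span2_right)

lemma plane_J: "X \<in> plane Y Z \<Longrightarrow> X \<in> J"
  by (simp add: plane_def)

lemma finite_plane: "finite (plane Y Z)"
  by (simp add: plane_def finite_J)

lemma plane_same: "Y \<in> J \<Longrightarrow> plane Y Y = {Y}"
proof -
  assume Y: "Y \<in> J"
  { fix X assume X: "X \<in> plane Y Y"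
    then obtain s r where "\<beta> X = (\<lambda>i. s * \<beta> Y i + r * \<beta> Y i)" by (auto simp: plane_def span2_def)
    then have "\<beta> X = (\<lambda>i. (s + r) * \<beta> Y i)" by (simp add: algebra_simps)
    then have "X = Y" using non_prop [OF plane_J [OF X] Y] by blast }
  then show ?thesis using plane_self [OF Y] by blast
qed

text \<open>The local data at a codimension-two flat. Both vectors are derivations killing t, so
  \<open>dot n \<Psi> (\<beta> Y)\<close> is the value on every form of the fibre, and divisibility
  by \<open>G Y\<close> makes them logarithmic for the localization. Restricted to t = 0, \<Xi> acts
  on the plane as a multiple of the Euler derivation, the multiplier being Ziegler's multiplicities
  lowered by one. The last equation is Saito's criterion: the Euler derivation and the restriction
  of \<Psi> form a basis for the rank-two arrangement.\<close>

definition locally_free_lifting :: bool where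
  "locally_free_lifting \<longleftrightarrow> (\<forall>Y1\<in>J. \<forall>Y2\<in>J. Y1 \<noteq> Y2 \<longrightarrow>
     (\<exists>\<Psi>\<in>vecs n (Suc n). \<exists>\<Xi>\<in>vecs n (Suc n). \<exists>e. e \<noteq> 0 \<and>
        (\<forall>Y\<in>plane Y1 Y2. G Y dvd dot n \<Psi> (\<beta> Y) \<and> G Y dvd dot n \<Xi> (\<beta> Y) \<and>
           trunc n (dot n \<Xi> (\<beta> Y)) = (\<Prod>X\<in>plane Y1 Y2. lb X ^ (m X - 1)) * lb Y) \<and>
        lb Y1 * trunc n (dot n \<Psi> (\<beta> Y2)) - lb Y2 * trunc n (dot n \<Psi> (\<beta> Y1))
          = mconst e * (\<Prod>X\<in>plane Y1 Y2. lb X)))"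

lemma locally_free_liftingE:
  assumes locally_free_lifting "Y1 \<in> J" "Y2 \<in> J" "Y1 \<noteq> Y2"
  obtains \<Psi> \<Xi> e where "\<Psi> \<in> vecs n (Suc n)" "\<Xi> \<in> vecs n (Suc n)" "e \<noteq> 0"
    "\<forall>Y\<in>plane Y1 Y2. G Y dvd dot n \<Psi> (\<beta> Y)"
    "\<forall>Y\<in>plane Y1 Y2. G Y dvd dot n \<Xi> (\<beta> Y)"
    "\<forall>Y\<in>plane Y1 Y2. trunc n (dot n \<Xi> (\<beta> Y)) = (\<Prod>X\<in>plane Y1 Y2. lb X ^ (m X - 1)) * lb Y"
    "lb Y1 * trunc n (dot n \<Psi> (\<beta> Y2)) - lb Y2 * trunc n (dot n \<Psi> (\<beta> Y1))
      = mconst e * (\<Prod>X\<in>plane Y1 Y2. lb X)"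
proof -
  from assms(1) [unfolded locally_free_lifting_def, rule_format, OF assms(2-4)]
  show ?thesis unfolding ball_conj_distrib
    by (elim bexE exE conjE) (rule that, assumption+)
qed

text \<open>Cramer's rule in the plane spanned by \<open>lb Y1\<close> and \<open>lb Y2\<close>.\<close>

lemma plane_decomposition:
  assumes J: "Y1 \<in> J" "Y2 \<in> J" "Y1 \<noteq> Y2"
    and \<psi>: "\<psi> \<in> vecs n n" "e \<noteq> 0"
      "lb Y1 * dot n \<psi> (\<beta> Y2) - lb Y2 * dot n \<psi> (\<beta> Y1) = mconst e * (\<Prod>X\<in>plane Y1 Y2. lb X)"
    and \<eta>: "\<eta> \<in> vecs n n" "\<And>Y. Y \<in> plane Y1 Y2 \<Longrightarrow> lb Y dvd dot n \<eta> (\<beta> Y)"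
  obtains g f where "g \<in> poly_ring n" "f \<in> poly_ring n"
    "\<forall>Y\<in>plane Y1 Y2. dot n \<eta> (\<beta> Y) = g * dot n \<psi> (\<beta> Y) - f * lb Y"
proof -
  let ?e1 = "dot n \<eta> (\<beta> Y1)" and ?e2 = "dot n \<eta> (\<beta> Y2)"
  let ?p1 = "dot n \<psi> (\<beta> Y1)" and ?p2 = "dot n \<psi> (\<beta> Y2)"
  let ?D = "lb Y1 * ?e2 - lb Y2 * ?e1" and ?P = "\<Prod>X\<in>plane Y1 Y2. lb X"
  have "lb Y dvd ?D" if Y: "Y \<in> plane Y1 Y2" for Y
  proof -
    obtain a b where ab: "\<beta> Y = (\<lambda>i. a * \<beta> Y1 i + b * \<beta> Y2 i)"
      using Y by (auto simp: plane_def span2_def)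
    have lY: "lb Y = mconst a * lb Y1 + mconst b * lb Y2"
      and eY: "dot n \<eta> (\<beta> Y) = mconst a * ?e1 + mconst b * ?e2"
      by (simp_all only: ab dot_add_right dot_scale_right)
    have "mconst a * ?D = lb Y * ?e2 - lb Y2 * dot n \<eta> (\<beta> Y)"
      and "mconst b * ?D = lb Y1 * dot n \<eta> (\<beta> Y) - lb Y * ?e1"
      unfolding lY eY by (simp_all add: algebra_simps)
    then have d: "lb Y dvd mconst a * ?D" "lb Y dvd mconst b * ?D"
      using \<eta>(2) [OF Y] by (simp_all add: dvd_diff)
    have "a \<noteq> 0 \<or> b \<noteq> 0" using lY lin_nonzero [OF plane_J [OF Y]] by auto
    then obtain s where s: "s \<noteq> 0" "lb Y dvd mconst s * ?D" using d by blast
    from s(2) have "lb Y dvd mconst (inverse s) * (mconst s * ?D)" by (rule dvd_mult)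
    then show ?thesis by (simp only: mconst_inverse_mult [OF s(1)])
  qed
  then have "?P dvd ?D"
    by (rule prod_dvd_of_cancels) (auto intro: cancels_forms plane_J)
  moreover have "?P \<in> poly_ring n" "?D \<in> poly_ring n"
    using \<eta>(1) by (auto intro!: poly_ring_prod poly_ring_diff poly_ring_mult vecs_dot)
  ultimately obtain g0 where g0: "g0 \<in> poly_ring n" "?D = ?P * g0" by (rule poly_ring_dvdE)
  define g where "g = mconst (inverse e) * g0"
  have g: "g \<in> poly_ring n" using g0 by (auto simp: g_def)
  have "?D = (mconst e * ?P) * g"
    using \<psi>(2) by (simp add: g0(2) g_def mult_ac)
  then have "?D = (lb Y1 * ?p2 - lb Y2 * ?p1) * g" by (simp only: \<psi>(3))
  then have eq: "lb Y1 * (?e2 - g * ?p2) = lb Y2 * (?e1 - g * ?p1)" by (simp add: algebra_simps)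
  have "lb Y1 dvd ?e1 - g * ?p1"
    by (rule cancelsD [OF cancels_forms [OF J(1,2,3)]]) (simp only: eq [symmetric] dvd_triv_left)
  moreover have "?e1 - g * ?p1 \<in> poly_ring n"
    using \<eta>(1) \<psi>(1) g by (auto intro!: poly_ring_diff poly_ring_mult vecs_dot)
  ultimately obtain f0 where f0: "f0 \<in> poly_ring n" "?e1 - g * ?p1 = lb Y1 * f0"
    using poly_ring_dvdE [OF _ lb_in] by metis
  have "lb Y1 * (?e2 - g * ?p2) = lb Y1 * (lb Y2 * f0)" unfolding eq f0(2) by (simp add: mult_ac)
  then have f2: "?e2 - g * ?p2 = lb Y2 * f0" using lin_nonzero [OF J(1)] by simp
  have e12: "?e1 = g * ?p1 + lb Y1 * f0" "?e2 = g * ?p2 + lb Y2 * f0"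
    using f0(2) f2 by (simp_all only: diff_eq_eq add.commute)
  show ?thesis
  proof (rule that [of g "- f0"], safe)
    fix Y assume Y: "Y \<in> plane Y1 Y2"
    obtain a b where ab: "\<beta> Y = (\<lambda>i. a * \<beta> Y1 i + b * \<beta> Y2 i)"
      using Y by (auto simp: plane_def span2_def)
    have lY: "dot n f (\<beta> Y) = mconst a * dot n f (\<beta> Y1) + mconst b * dot n f (\<beta> Y2)" for f
      by (simp only: ab dot_add_right dot_scale_right)
    show "dot n \<eta> (\<beta> Y) = g * dot n \<psi> (\<beta> Y) - - f0 * lb Y"
      unfolding lY e12 by (simp add: algebra_simps)
  qed (use g f0 in auto)
qed

text \<open>Decompose \<eta> along the restriction of \<Psi> and the Euler derivation. The first
  part satisfies the conditions with multiplicities because \<Psi> is logarithmic before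
  restriction; the second part is what f removes.\<close>

lemma local_shift:
  assumes lfl: locally_free_lifting and J: "Y1 \<in> J" "Y2 \<in> J"
    and \<eta>: "\<eta> \<in> vecs n n" "\<And>Y. Y \<in> plane Y1 Y2 \<Longrightarrow> lb Y dvd dot n \<eta> (\<beta> Y)"
  shows "\<exists>f. \<forall>Y\<in>plane Y1 Y2. lb Y ^ m Y dvd dot n \<eta> (\<beta> Y) + f * lb Y"
proof (cases "Y1 = Y2")
  case True
  then have p: "plane Y1 Y2 = {Y1}" using plane_same J by simp
  obtain k where "dot n \<eta> (\<beta> Y1) = lb Y1 * k" using \<eta>(2) [of Y1] p by (auto elim: dvdE)
  then have "dot n \<eta> (\<beta> Y1) + (- k) * lb Y1 = 0" by simp
  then have "lb Y1 ^ m Y1 dvd dot n \<eta> (\<beta> Y1) + (- k) * lb Y1" by (simp only: dvd_0_right)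
  then have "\<forall>Y\<in>{Y1}. lb Y ^ m Y dvd dot n \<eta> (\<beta> Y) + (- k) * lb Y" by (simp only: ball_simps)
  then show ?thesis unfolding p by (rule exI)
next
  case False
  obtain \<Psi> \<Xi> e where \<Psi>: "\<Psi> \<in> vecs n (Suc n)" "\<Xi> \<in> vecs n (Suc n)" "e \<noteq> 0"
    "\<forall>Y\<in>plane Y1 Y2. G Y dvd dot n \<Psi> (\<beta> Y)"
    "\<forall>Y\<in>plane Y1 Y2. G Y dvd dot n \<Xi> (\<beta> Y)"
    "\<forall>Y\<in>plane Y1 Y2. trunc n (dot n \<Xi> (\<beta> Y)) = (\<Prod>X\<in>plane Y1 Y2. lb X ^ (m X - 1)) * lb Y"
    "lb Y1 * trunc n (dot n \<Psi> (\<beta> Y2)) - lb Y2 * trunc n (dot n \<Psi> (\<beta> Y1))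
      = mconst e * (\<Prod>X\<in>plane Y1 Y2. lb X)"
    by (rule locally_free_liftingE [OF lfl J False])
  let ?\<psi> = "\<lambda>i. trunc n (\<Psi> i)"
  obtain g f where g: "g \<in> poly_ring n" and f: "f \<in> poly_ring n"
    and gf: "\<forall>Y\<in>plane Y1 Y2. dot n \<eta> (\<beta> Y) = g * dot n ?\<psi> (\<beta> Y) - f * lb Y"
    by (rule plane_decomposition [OF J False vecs_trunc \<Psi>(3) \<Psi>(7) [unfolded trunc_dot] \<eta>])
  have "lb Y ^ m Y dvd dot n \<eta> (\<beta> Y) + f * lb Y" if Y: "Y \<in> plane Y1 Y2" for Y
  proof -
    have "lb Y ^ m Y dvd dot n ?\<psi> (\<beta> Y)"
      using trunc_dvd [OF \<Psi>(4) [rule_format, OF Y], of n] by (simp add: trunc_dot)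
    then show ?thesis by (simp add: gf [rule_format, OF Y])
  qed
  then show ?thesis by blast
qed

text \<open>Restriction is onto the Ziegler multiarrangement near the flat: the conditions with
  multiplicities force the Euler coefficient of \<phi> to be divisible by the product of the
  \<open>lb X ^ (m X - 1)\<close>, so that on the forms of the plane \<phi> is a combination of the
  restrictions of \<Psi> and \<Xi>.\<close>

lemma local_lift:
  assumes lfl: locally_free_lifting and J: "Y1 \<in> J" "Y2 \<in> J"
    and \<phi>: "\<phi> \<in> vecs n n" "\<And>Y. Y \<in> plane Y1 Y2 \<Longrightarrow> lb Y ^ m Y dvd dot n \<phi> (\<beta> Y)"
  shows "\<exists>\<nu>\<in>vecs n (Suc n). (\<forall>Y\<in>plane Y1 Y2. G Y dvd dot n \<nu> (\<beta> Y)) \<and> (\<forall>i<n. trunc n (\<nu> i) = \<phi> i)"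
proof (cases "Y1 = Y2")
  case True
  then have p: "plane Y1 Y2 = {Y1}" using plane_same J by simp
  have "lb Y1 ^ m Y1 dvd dot n \<phi> (\<beta> Y1)" using \<phi>(2) p by simp
  then obtain k where k: "k \<in> poly_ring n" "dot n \<phi> (\<beta> Y1) = lb Y1 ^ m Y1 * k"
    by (rule poly_ring_dvdE) (auto intro!: vecs_dot [OF \<phi>(1)])
  obtain i0 where i0: "i0 < n" "\<beta> Y1 i0 \<noteq> 0" using lin_nonzero [OF J(1)] lin_eq_0_iff by blast
  \<comment> \<open>With a single form only one value has to be corrected, from
    \<open>lb Y1 ^ m Y1 * k\<close> to \<open>G Y1 * k\<close>. The correction w vanishes on t = 0
    and is put into a coordinate in which the form has a non-zero coefficient.\<close>
  define w where "w = (G Y1 - lb Y1 ^ m Y1) * k"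
  have w: "w \<in> poly_ring (Suc n)"
    unfolding w_def using k
    by (intro poly_ring_mult poly_ring_diff poly_ring_power lin_in_poly_ring) (auto intro: poly_ring_mono)
  define \<nu> where "\<nu> i = \<phi> i + (if i = i0 then mconst (inverse (\<beta> Y1 i0)) * w else 0)" for i
  have "dot n (\<lambda>i. if i = i0 then mconst (inverse (\<beta> Y1 i0)) * w else 0) (\<beta> Y1)
      = (\<Sum>i<n. if i = i0 then mconst (\<beta> Y1 i0) * (mconst (inverse (\<beta> Y1 i0)) * w) else 0)"
    unfolding dot_def by (rule sum.cong) auto
  also have "\<dots> = w" using i0 by (simp add: mult.assoc [symmetric])
  finally have "dot n \<nu> (\<beta> Y1) = lb Y1 ^ m Y1 * k + w"
    unfolding \<nu>_def dot_add_left k(2) by simp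
  then have "dot n \<nu> (\<beta> Y1) = G Y1 * k" by (simp add: w_def algebra_simps)
  then have "G Y1 dvd dot n \<nu> (\<beta> Y1)" by simp
  moreover have "\<nu> \<in> vecs n (Suc n)"
    using vecs_mono [OF \<phi>(1), of "Suc n"] w by (auto simp: \<nu>_def)
  moreover have "\<forall>i<n. trunc n (\<nu> i) = \<phi> i"
    using \<phi>(1) k(1) by (auto simp: \<nu>_def w_def trunc_eq)
  ultimately show ?thesis by (intro bexI [of _ \<nu>]) (simp_all add: p)
next
  case False
  let ?P = "plane Y1 Y2"
  let ?B = "\<Prod>X\<in>?P. lb X ^ (m X - 1)"
  obtain \<Psi> \<Xi> e where \<Psi>: "\<Psi> \<in> vecs n (Suc n)" "\<Xi> \<in> vecs n (Suc n)" "e \<noteq> 0"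
    "\<forall>Y\<in>?P. G Y dvd dot n \<Psi> (\<beta> Y)" "\<forall>Y\<in>?P. G Y dvd dot n \<Xi> (\<beta> Y)"
    "\<forall>Y\<in>?P. trunc n (dot n \<Xi> (\<beta> Y)) = ?B * lb Y"
    "lb Y1 * trunc n (dot n \<Psi> (\<beta> Y2)) - lb Y2 * trunc n (dot n \<Psi> (\<beta> Y1))
      = mconst e * (\<Prod>X\<in>?P. lb X)"
    by (rule locally_free_liftingE [OF lfl J False])
  let ?\<psi> = "\<lambda>i. trunc n (\<Psi> i)" and ?\<xi> = "\<lambda>i. trunc n (\<Xi> i)"
  have lb\<phi>: "lb Y dvd dot n \<phi> (\<beta> Y)" if "Y \<in> ?P" for Y
    using dvd_trans [OF lb_dvd_pow [OF plane_J [OF that]] \<phi>(2) [OF that]] .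
  obtain g f where g: "g \<in> poly_ring n" and f: "f \<in> poly_ring n"
    and gf: "\<forall>Y\<in>?P. dot n \<phi> (\<beta> Y) = g * dot n ?\<psi> (\<beta> Y) - f * lb Y"
    by (rule plane_decomposition [OF J False vecs_trunc \<Psi>(3) \<Psi>(7) [unfolded trunc_dot] \<phi>(1) lb\<phi>])
  have "lb Y ^ (m Y - 1) dvd f" if Y: "Y \<in> ?P" for Y
  proof -
    have "lb Y ^ m Y dvd dot n ?\<psi> (\<beta> Y)"
      using trunc_dvd [OF \<Psi>(4) [rule_format, OF Y], of n] by (simp add: trunc_dot)
    then have "lb Y ^ m Y dvd g * dot n ?\<psi> (\<beta> Y) - dot n \<phi> (\<beta> Y)"
      using \<phi>(2) [OF Y] by (intro dvd_diff dvd_mult)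
    then have "lb Y * lb Y ^ (m Y - 1) dvd lb Y * f"
      by (simp add: gf [rule_format, OF Y] lb_pow [OF plane_J [OF Y]] mult.commute)
    then show ?thesis using lin_nonzero [OF plane_J [OF Y]] by simp
  qed
  then have "?B dvd f"
    by (rule prod_dvd_of_cancels) (auto intro: cancels_powers plane_J)
  then obtain f' where f': "f' \<in> poly_ring n" "f = ?B * f'"
    by (rule poly_ring_dvdE [OF _ _ f]) auto
  \<comment> \<open>The plane sees only two of the n directions. \<kappa> is the remainder of
    \<phi>, on which all forms of the plane vanish; it is carried over unchanged.\<close>
  define \<kappa> where "\<kappa> i = \<phi> i - g * ?\<psi> i + f' * ?\<xi> i" for i
  define \<nu> where "\<nu> i = g * \<Psi> i - f' * \<Xi> i + \<kappa> i" for i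
  have \<kappa>: "dot n \<kappa> (\<beta> Y) = 0" if Y: "Y \<in> ?P" for Y
  proof -
    have "dot n ?\<xi> (\<beta> Y) = ?B * lb Y" using \<Psi>(6) [rule_format, OF Y] by (simp add: trunc_dot)
    then show ?thesis
      unfolding \<kappa>_def dot_add_left dot_diff_left dot_scale_left gf [rule_format, OF Y] f'(2)
      by (simp add: algebra_simps)
  qed
  have "G Y dvd dot n \<nu> (\<beta> Y)" if Y: "Y \<in> ?P" for Y
    unfolding \<nu>_def dot_add_left dot_diff_left dot_scale_left \<kappa> [OF Y]
    using \<Psi>(4) [rule_format, OF Y] \<Psi>(5) [rule_format, OF Y] by simp
  moreover have "\<nu> \<in> vecs n (Suc n)"
    unfolding \<nu>_def \<kappa>_def
    using \<Psi>(1,2) \<phi>(1) g f'(1) by (auto intro!: poly_ring_add poly_ring_diff poly_ring_mult intro: poly_ring_mono)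
  moreover have "\<forall>i<n. trunc n (\<nu> i) = \<phi> i"
    using \<phi>(1) g f'(1) by (auto simp: \<nu>_def \<kappa>_def trunc_eq)
  ultimately show ?thesis by blast
qed

text \<open>Dividing by \<open>lb X\<close> turns the condition into a congruence for f modulo
  \<open>lb X ^ (m X - 1)\<close>. The exponent drops by one because f multiplies the Euler
  derivation, whose value on \<open>lb X\<close> is \<open>lb X\<close> itself.\<close>

lemma global_shift:
  assumes w: "\<And>Y. Y \<in> J \<Longrightarrow> lb Y dvd w Y"
    and loc: "\<And>Y Z. Y \<in> J \<Longrightarrow> Z \<in> J \<Longrightarrow> \<exists>f. \<forall>X\<in>plane Y Z. lb X ^ m X dvd w X + f * lb X"
    and w_in: "\<And>Y. Y \<in> J \<Longrightarrow> w Y \<in> poly_ring n"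
  shows "\<exists>f\<in>poly_ring n. \<forall>X\<in>J. lb X ^ m X dvd w X + f * lb X"
proof -
  obtain v where v: "\<And>Y. Y \<in> J \<Longrightarrow> w Y = lb Y * v Y"
    using w unfolding dvd_def by metis
  have eq: "w X + f * lb X = lb X * (f - - v X)" if "X \<in> J" for X f
    by (simp add: v [OF that] algebra_simps)
  have iff: "lb X ^ m X dvd w X + f * lb X \<longleftrightarrow> lb X ^ (m X - 1) dvd f - - v X" if X: "X \<in> J" for X f
    unfolding eq [OF X] lb_pow [OF X] using lin_nonzero [OF X] by simp
  have "\<exists>f. \<forall>X\<in>J. lb X ^ (m X - 1) dvd f - - v X"
  proof (rule chinese_remainder)
    fix Y Z assume "Y \<in> J" "Z \<in> J"
    from loc [OF this] show "\<exists>f. \<forall>X\<in>J. span2 (\<beta> Y) (\<beta> Z) (\<beta> X) \<longrightarrow> lb X ^ (m X - 1) dvd f - - v X"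
      using iff by (auto simp: plane_def)
  qed
  then obtain f where f: "\<And>X. X \<in> J \<Longrightarrow> lb X ^ m X dvd w X + f * lb X" using iff by blast
  have "lb X ^ m X dvd w X + trunc n f * lb X" if X: "X \<in> J" for X
    using trunc_dvd [OF f [OF X], of n] w_in [OF X] by (simp add: trunc_eq)
  then show ?thesis by (intro bexI [of _ "trunc n f"] ballI) simp_all
qed

end

text \<open>The cofactor in the degree-d part of a product with a factor of degree e. The case
  distinction guards against truncated subtraction, which would return the constant term if d <
  e.\<close>

definition hpart :: "nat \<Rightarrow> nat \<Rightarrow> ('k::field) mpol \<Rightarrow> 'k mpol" where
  "hpart d e p = (if e \<le> d then hcomp (d - e) p else 0)"

lemma hcomp_mult_hpart: "homogeneous_poly e q \<Longrightarrow> hcomp d (q * p) = q * hpart d e p"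
  using hcomp_mult(1) [of e q "d - e" p] hcomp_mult(2) [of e q d p]
  by (cases "e \<le> d") (auto simp: hpart_def)

lemma hpart_in_poly_ring [simp]: "p \<in> poly_ring n \<Longrightarrow> hpart d e p \<in> poly_ring n"
  by (auto simp: hpart_def)

section \<open>Gluing with the help of a basis of the restricted module\<close>

context pencils
begin

definition restricted_basis :: "'x set \<Rightarrow> ('x \<Rightarrow> nat \<Rightarrow> 'k mpol) \<Rightarrow> bool" where
  "restricted_basis K \<phi> \<longleftrightarrow> finite K \<and>
     (\<forall>k\<in>K. \<phi> k \<in> vecs n n \<and> (\<forall>Y\<in>J. lb Y dvd dot n (\<phi> k) (\<beta> Y))) \<and>
     (\<forall>\<eta>\<in>vecs n n. (\<forall>Y\<in>J. lb Y dvd dot n \<eta> (\<beta> Y)) \<longrightarrow>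
        (\<exists>a. (\<forall>k\<in>K. a k \<in> poly_ring n) \<and> (\<forall>i<n. \<eta> i = (\<Sum>k\<in>K. a k * \<phi> k i)))) \<and>
     (\<forall>a. (\<forall>k\<in>K. a k \<in> poly_ring n) \<and> (\<forall>i<n. (\<Sum>k\<in>K. a k * \<phi> k i) = 0) \<longrightarrow> (\<forall>k\<in>K. a k = 0))"

lemma restricted_basisD:
  assumes "restricted_basis K \<phi>"
  shows "finite K" "k \<in> K \<Longrightarrow> \<phi> k \<in> vecs n n" "k \<in> K \<Longrightarrow> Y \<in> J \<Longrightarrow> lb Y dvd dot n (\<phi> k) (\<beta> Y)"
    and "\<eta> \<in> vecs n n \<Longrightarrow> (\<And>Y. Y \<in> J \<Longrightarrow> lb Y dvd dot n \<eta> (\<beta> Y)) \<Longrightarrow>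
       \<exists>a. (\<forall>k\<in>K. a k \<in> poly_ring n) \<and> (\<forall>i<n. \<eta> i = (\<Sum>k\<in>K. a k * \<phi> k i))"
    and "(\<And>k. k \<in> K \<Longrightarrow> a k \<in> poly_ring n) \<Longrightarrow> (\<And>i. i < n \<Longrightarrow> (\<Sum>k\<in>K. a k * \<phi> k i) = 0) \<Longrightarrow>
       k \<in> K \<Longrightarrow> a k = 0"
  using assms unfolding restricted_basis_def by blast+

abbreviation Q :: "'k mpol" where "Q \<equiv> \<Prod>Y\<in>J. lb Y"

lemma Q_remove: "X \<in> J \<Longrightarrow> Q = lb X * (\<Prod>Y\<in>J - {X}. lb Y)"
  by (rule prod.remove [OF finite_J])

lemma Q_in [simp]: "Q \<in> poly_ring n" "(\<Prod>Y\<in>J - {X}. lb Y) \<in> poly_ring n"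
  by auto

lemma Q_nonzero: "Q \<noteq> 0"
  using lin_nonzero finite_J by simp

text \<open>Q times any vector is logarithmic for A^H and has coordinates in the basis. If \<eta> is
  logarithmic along X, the product of the forms other than \<open>lb X\<close> is already a
  sufficient multiplier; comparing both expansions shows that the coordinates of Q \<eta> are
  multiples of \<open>lb X\<close>.\<close>

lemma coefficient_divisible:
  assumes b: "restricted_basis K \<phi>" and X: "X \<in> J"
    and \<eta>: "\<eta> \<in> vecs n n" "lb X dvd dot n \<eta> (\<beta> X)"
    and a: "\<And>k. k \<in> K \<Longrightarrow> a k \<in> poly_ring n" "\<And>i. i < n \<Longrightarrow> Q * \<eta> i = (\<Sum>k\<in>K. a k * \<phi> k i)"
    and k: "k \<in> K"
  shows "lb X dvd a k"
proof -
  let ?Q' = "\<Prod>Y\<in>J - {X}. lb Y"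
  have "lb Y dvd dot n (\<lambda>i. ?Q' * \<eta> i) (\<beta> Y)" if Y: "Y \<in> J" for Y
  proof (cases "Y = X")
    case False
    then have "lb Y dvd ?Q'" using Y finite_J by (intro dvd_prodI) auto
    then show ?thesis unfolding dot_scale_left by (rule dvd_mult2)
  qed (use \<eta> in \<open>simp add: dot_scale_left\<close>)
  moreover have "(\<lambda>i. ?Q' * \<eta> i) \<in> vecs n n" by (rule vecs_scale [OF Q_in(2) \<eta>(1)])
  ultimately have "\<exists>a. (\<forall>k\<in>K. a k \<in> poly_ring n) \<and> (\<forall>i<n. ?Q' * \<eta> i = (\<Sum>k\<in>K. a k * \<phi> k i))"
    by (intro restricted_basisD(4) [OF b])
  then obtain b' where b': "\<And>k. k \<in> K \<Longrightarrow> b' k \<in> poly_ring n"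
    "\<And>i. i < n \<Longrightarrow> ?Q' * \<eta> i = (\<Sum>k\<in>K. b' k * \<phi> k i)"
    by blast
  have "a k - lb X * b' k = 0"
  proof (rule restricted_basisD(5) [OF b _ _ k])
    fix i assume i: "i < n"
    have "(\<Sum>k\<in>K. (a k - lb X * b' k) * \<phi> k i) = Q * \<eta> i - lb X * (?Q' * \<eta> i)"
      unfolding a(2) [OF i] b'(2) [OF i] by (simp add: left_diff_distrib sum_subtractf sum_distrib_left mult.assoc)
    also have "\<dots> = 0" unfolding Q_remove [OF X] by (simp add: mult.assoc)
    finally show "(\<Sum>k\<in>K. (a k - lb X * b' k) * \<phi> k i) = 0" .
  next
    fix k assume "k \<in> K" then show "a k - lb X * b' k \<in> poly_ring n" using a b' by auto
  qed
  then show ?thesis by simp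
qed

text \<open>Cancelling \<open>lb X\<close> from the expansion of Q \<eta> shows that \<eta> times
  the product of the other forms is logarithmic, and this product is prime to \<open>lb X\<close>.
  With \<open>coefficient_divisible\<close> this expresses being logarithmic along X by divisibility
  of coordinates.\<close>

lemma divisible_of_coefficients:
  assumes b: "restricted_basis K \<phi>" and X: "X \<in> J"
    and a: "\<And>k. k \<in> K \<Longrightarrow> lb X dvd a k" "\<And>i. i < n \<Longrightarrow> Q * \<eta> i = (\<Sum>k\<in>K. a k * \<phi> k i)"
  shows "lb X dvd dot n \<eta> (\<beta> X)"
proof -
  let ?Q' = "\<Prod>Y\<in>J - {X}. lb Y"
  have "\<exists>b'. \<forall>k\<in>K. a k = lb X * b' k" by (rule bchoice) (use a(1) in \<open>auto elim: dvdE\<close>)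
  then obtain b' where b': "\<And>k. k \<in> K \<Longrightarrow> a k = lb X * b' k" by blast
  have "?Q' * \<eta> i = (\<Sum>k\<in>K. b' k * \<phi> k i)" if i: "i < n" for i
  proof -
    have "lb X * (?Q' * \<eta> i) = lb X * (\<Sum>k\<in>K. b' k * \<phi> k i)"
      using a(2) [OF i] unfolding Q_remove [OF X] by (simp add: sum_distrib_left b' mult.assoc)
    then show ?thesis using lin_nonzero [OF X] by simp
  qed
  then have "dot n (\<lambda>i. ?Q' * \<eta> i) (\<beta> X) = dot n (\<lambda>i. \<Sum>k\<in>K. b' k * \<phi> k i) (\<beta> X)"
    by (intro dot_cong) auto
  then have "?Q' * dot n \<eta> (\<beta> X) = (\<Sum>k\<in>K. b' k * dot n (\<phi> k) (\<beta> X))"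
    by (simp only: dot_sum_left dot_scale_left)
  moreover have "lb X dvd (\<Sum>k\<in>K. b' k * dot n (\<phi> k) (\<beta> X))"
    using restricted_basisD(3) [OF b _ X] by (intro dvd_sum dvd_mult)
  ultimately have "lb X dvd ?Q' * dot n \<eta> (\<beta> X)" by simp
  moreover have "cancels (lb X) ?Q'"
    using X by (intro cancels_prod_right cancels_forms) auto
  ultimately show ?thesis by (rule cancelsD [rotated])
qed

text \<open>The coordinates of Q times the local solutions turn the problem for vectors into one
  congruence problem modulo linear forms for each basis element, and
  \<open>chinese_remainder\<close> solves these separately.\<close>

lemma reduced_extension:
  assumes b: "restricted_basis K \<phi>"
    and loc: "\<And>Y Z. Y \<in> J \<Longrightarrow> Z \<in> J \<Longrightarrow> \<exists>\<eta>\<in>vecs n n. \<forall>X\<in>plane Y Z. lb X dvd dot n \<eta> (\<beta> X) - u X"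
  shows "\<exists>\<eta>\<in>vecs n n. \<forall>X\<in>J. lb X dvd dot n \<eta> (\<beta> X) - u X"
proof -
  have "\<exists>\<eta>. \<forall>Y\<in>J. \<forall>Z\<in>J. \<eta> Y Z \<in> vecs n n \<and> (\<forall>X\<in>plane Y Z. lb X dvd dot n (\<eta> Y Z) (\<beta> X) - u X)"
    by (rule bex_choice2) (rule loc)
  then obtain \<eta> where "\<forall>Y\<in>J. \<forall>Z\<in>J. \<eta> Y Z \<in> vecs n n \<and> (\<forall>X\<in>plane Y Z. lb X dvd dot n (\<eta> Y Z) (\<beta> X) - u X)" by (elim exE)
  then have \<eta>: "\<And>Y Z. Y \<in> J \<Longrightarrow> Z \<in> J \<Longrightarrow> \<eta> Y Z \<in> vecs n n"
    "\<And>Y Z X. Y \<in> J \<Longrightarrow> Z \<in> J \<Longrightarrow> X \<in> plane Y Z \<Longrightarrow> lb X dvd dot n (\<eta> Y Z) (\<beta> X) - u X"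
    by blast+
  have expand: "\<exists>a\<in>{a. \<forall>k\<in>K. a k \<in> poly_ring n}. \<forall>i<n. Q * \<eta> Y Z i = (\<Sum>k\<in>K. a k * \<phi> k i)"
    if YZ: "Y \<in> J" "Z \<in> J" for Y Z
    unfolding Bex_def mem_Collect_eq
  proof (rule restricted_basisD(4) [OF b])
    show "(\<lambda>i. Q * \<eta> Y Z i) \<in> vecs n n" using \<eta>(1) [OF YZ] by (rule vecs_scale [OF Q_in(1)])
    show "lb X dvd dot n (\<lambda>i. Q * \<eta> Y Z i) (\<beta> X)" if "X \<in> J" for X
      unfolding dot_scale_left Q_remove [OF that] by (simp add: mult.assoc)
  qed
  have "\<exists>a. \<forall>Y\<in>J. \<forall>Z\<in>J. a Y Z \<in> {a. \<forall>k\<in>K. a k \<in> poly_ring n} \<and>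
      (\<forall>i<n. Q * \<eta> Y Z i = (\<Sum>k\<in>K. a Y Z k * \<phi> k i))"
    by (rule bex_choice2) (rule expand)
  then obtain a where "\<forall>Y\<in>J. \<forall>Z\<in>J. a Y Z \<in> {a. \<forall>k\<in>K. a k \<in> poly_ring n} \<and>
      (\<forall>i<n. Q * \<eta> Y Z i = (\<Sum>k\<in>K. a Y Z k * \<phi> k i))" by (elim exE)
  then have a: "\<And>Y Z k. Y \<in> J \<Longrightarrow> Z \<in> J \<Longrightarrow> k \<in> K \<Longrightarrow> a Y Z k \<in> poly_ring n"
    "\<And>Y Z i. Y \<in> J \<Longrightarrow> Z \<in> J \<Longrightarrow> i < n \<Longrightarrow> Q * \<eta> Y Z i = (\<Sum>k\<in>K. a Y Z k * \<phi> k i)"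
    by blast+
  \<comment> \<open>Two local solutions differ by a vector that is logarithmic along X, so their
    coordinates agree modulo \<open>lb X\<close>. Hence \<open>a X X k\<close> is a well-defined
    target residue, and \<open>a Y Z k\<close> attains it on the whole plane of Y and Z.\<close>
  have compat: "lb X dvd a Y Z k - a X X k" if YZ: "Y \<in> J" "Z \<in> J" and X: "X \<in> plane Y Z" and k: "k \<in> K" for X Y Z k
  proof -
    note XJ = plane_J [OF X]
    let ?\<delta> = "\<lambda>i. \<eta> Y Z i - \<eta> X X i"
    have dX: "lb X dvd dot n ?\<delta> (\<beta> X)"
      unfolding dot_diff_left
      by (rule dvd_trans_diff [OF \<eta>(2) [OF YZ X] dvd_diff_swap [OF \<eta>(2) [OF XJ XJ plane_self [OF XJ]]]])
    have "lb X dvd (\<lambda>k. a Y Z k - a X X k) k"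
    proof (rule coefficient_divisible [OF b XJ _ dX _ _ k])
      show "?\<delta> \<in> vecs n n" by (rule vecs_diff [OF \<eta>(1) [OF YZ] \<eta>(1) [OF XJ XJ]])
      show "a Y Z k - a X X k \<in> poly_ring n" if "k \<in> K" for k using a(1) YZ XJ that by auto
      show "Q * ?\<delta> i = (\<Sum>k\<in>K. (a Y Z k - a X X k) * \<phi> k i)" if "i < n" for i
        using a(2) [OF YZ that] a(2) [OF XJ XJ that]
        by (simp add: right_diff_distrib left_diff_distrib sum_subtractf)
    qed
    then show ?thesis by simp
  qed
  have sol: "\<exists>f\<in>poly_ring n. \<forall>X\<in>J. lb X dvd f - a X X k" if k: "k \<in> K" for k
  proof -
    have "\<exists>f. \<forall>X\<in>J. lb X ^ 1 dvd f - a X X k"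
    proof (rule chinese_remainder)
      fix Y Z assume YZ: "Y \<in> J" "Z \<in> J"
      have "lb X ^ 1 dvd a Y Z k - a X X k" if "X \<in> J" "span2 (\<beta> Y) (\<beta> Z) (\<beta> X)" for X
        using compat [OF YZ _ k, of X] that by (simp add: plane_def)
      then show "\<exists>f. \<forall>X\<in>J. span2 (\<beta> Y) (\<beta> Z) (\<beta> X) \<longrightarrow> lb X ^ 1 dvd f - a X X k" by blast
    qed
    then obtain f where f: "\<And>X. X \<in> J \<Longrightarrow> lb X dvd f - a X X k" by auto
    have "lb X dvd trunc n f - a X X k" if "X \<in> J" for X
      using trunc_dvd [OF f [OF that], of n] a(1) [OF that that k] by (simp add: trunc_eq)
    then show ?thesis by (intro bexI [of _ "trunc n f"] ballI) simp_all
  qed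
  have "\<exists>s. \<forall>k\<in>K. s k \<in> poly_ring n \<and> (\<forall>X\<in>J. lb X dvd s k - a X X k)"
    by (rule bex_choice) (rule sol)
  then obtain s where "\<forall>k\<in>K. s k \<in> poly_ring n \<and> (\<forall>X\<in>J. lb X dvd s k - a X X k)" by (elim exE)
  then have s: "\<And>k. k \<in> K \<Longrightarrow> s k \<in> poly_ring n" "\<And>k X. k \<in> K \<Longrightarrow> X \<in> J \<Longrightarrow> lb X dvd s k - a X X k"
    by blast+
  let ?\<sigma> = "\<lambda>i. \<Sum>k\<in>K. s k * \<phi> k i"
  \<comment> \<open>Modulo \<open>lb X\<close> the glued combination agrees with Q times a local
    solution, which \<open>lb X\<close> divides. Therefore Q can be divided out again.\<close>
  have quot: "\<exists>q\<in>poly_ring n. ?\<sigma> i = Q * q" if "i \<in> {..<n}" for i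
  proof -
    have i: "i < n" using that by simp
    have "lb X dvd ?\<sigma> i" if X: "X \<in> J" for X
    proof -
      have "?\<sigma> i = (\<Sum>k\<in>K. (s k - a X X k) * \<phi> k i) + Q * \<eta> X X i"
        by (simp add: a(2) [OF X X i] left_diff_distrib sum_subtractf)
      moreover have "lb X dvd (\<Sum>k\<in>K. (s k - a X X k) * \<phi> k i)"
        using s(2) X by (intro dvd_sum dvd_mult2) auto
      moreover have "lb X dvd Q * \<eta> X X i" unfolding Q_remove [OF X] by (simp add: mult.assoc)
      ultimately show ?thesis by simp
    qed
    then have "Q dvd ?\<sigma> i" by (rule prod_dvd_of_cancels) (auto intro: cancels_forms)
    moreover have "?\<sigma> i \<in> poly_ring n"
      using s(1) restricted_basisD(2) [OF b] i by (intro poly_ring_sum poly_ring_mult) auto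
    ultimately show ?thesis using poly_ring_dvd_iff [OF Q_in(1)] by blast
  qed
  have "\<exists>h. \<forall>i\<in>{..<n}. h i \<in> poly_ring n \<and> ?\<sigma> i = Q * h i"
    by (rule bex_choice) (rule quot)
  then obtain h where "\<forall>i\<in>{..<n}. h i \<in> poly_ring n \<and> ?\<sigma> i = Q * h i" by (elim exE)
  then have h: "\<And>i. i < n \<Longrightarrow> h i \<in> poly_ring n" "\<And>i. i < n \<Longrightarrow> ?\<sigma> i = Q * h i" by auto
  have "lb X dvd dot n h (\<beta> X) - u X" if X: "X \<in> J" for X
  proof -
    have "lb X dvd dot n (\<lambda>i. h i - \<eta> X X i) (\<beta> X)"
    proof (rule divisible_of_coefficients [OF b X])
      show "lb X dvd s k - a X X k" if "k \<in> K" for k using s(2) that X by blast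
      show "Q * (h i - \<eta> X X i) = (\<Sum>k\<in>K. (s k - a X X k) * \<phi> k i)" if "i < n" for i
        using h(2) [OF that] a(2) [OF X X that] by (simp add: right_diff_distrib left_diff_distrib sum_subtractf)
    qed
    then show ?thesis unfolding dot_diff_left using \<eta>(2) [OF X X plane_self [OF X]] by (rule dvd_trans_diff)
  qed
  moreover have "h \<in> vecs n n" using h(1) by simp
  ultimately show ?thesis by blast
qed

text \<open>The problem is solved modulo the forms themselves, and the remaining error is removed by
  a multiple of the Euler derivation. Such a multiple exists locally by \<open>local_shift\<close>,
  and its multiplier, a single polynomial, is glued by \<open>global_shift\<close>.\<close>

lemma multi_extension:
  assumes b: "restricted_basis K \<phi>" and lfl: locally_free_lifting
    and u: "\<And>Y. Y \<in> J \<Longrightarrow> u Y \<in> poly_ring n"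
    and loc: "\<And>Y Z. Y \<in> J \<Longrightarrow> Z \<in> J \<Longrightarrow> \<exists>\<eta>\<in>vecs n n. \<forall>X\<in>plane Y Z. lb X ^ m X dvd dot n \<eta> (\<beta> X) - u X"
  shows "\<exists>\<eta>\<in>vecs n n. \<forall>X\<in>J. lb X ^ m X dvd dot n \<eta> (\<beta> X) - u X"
proof -
  have "\<exists>\<eta>\<in>vecs n n. \<forall>X\<in>J. lb X dvd dot n \<eta> (\<beta> X) - u X"
  proof (rule reduced_extension [OF b])
    fix Y Z assume "Y \<in> J" "Z \<in> J"
    from loc [OF this] obtain \<eta> where "\<eta> \<in> vecs n n" "\<And>X. X \<in> plane Y Z \<Longrightarrow> lb X ^ m X dvd dot n \<eta> (\<beta> X) - u X"
      by blast
    then show "\<exists>\<eta>\<in>vecs n n. \<forall>X\<in>plane Y Z. lb X dvd dot n \<eta> (\<beta> X) - u X"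
      using dvd_trans [OF lb_dvd_pow [OF plane_J]] by blast
  qed
  then obtain \<eta>0 where \<eta>0: "\<eta>0 \<in> vecs n n" "\<And>X. X \<in> J \<Longrightarrow> lb X dvd dot n \<eta>0 (\<beta> X) - u X" by blast
  define w where "w X = u X - dot n \<eta>0 (\<beta> X)" for X
  have w: "lb X dvd w X" if "X \<in> J" for X unfolding w_def by (rule dvd_diff_swap [OF \<eta>0(2) [OF that]])
  have "\<exists>f\<in>poly_ring n. \<forall>X\<in>J. lb X ^ m X dvd w X + f * lb X"
  proof (rule global_shift [OF w])
    fix Y Z assume J: "Y \<in> J" "Z \<in> J"
    from loc [OF this] obtain \<eta> where \<eta>: "\<eta> \<in> vecs n n" "\<And>X. X \<in> plane Y Z \<Longrightarrow> lb X ^ m X dvd dot n \<eta> (\<beta> X) - u X"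
      by blast
    let ?\<delta> = "\<lambda>i. \<eta> i - \<eta>0 i"
    have dw: "lb X ^ m X dvd dot n ?\<delta> (\<beta> X) - w X" if "X \<in> plane Y Z" for X
      using \<eta>(2) [OF that] by (simp add: dot_diff_left w_def)
    have "lb X dvd dot n ?\<delta> (\<beta> X)" if X: "X \<in> plane Y Z" for X
      using dvd_trans [OF lb_dvd_pow [OF plane_J [OF X]] dw [OF X]] w [OF plane_J [OF X]]
      by (rule dvd_diff_left)
    then have "\<exists>f. \<forall>X\<in>plane Y Z. lb X ^ m X dvd dot n ?\<delta> (\<beta> X) + f * lb X"
      by (rule local_shift [OF lfl J vecs_diff [OF \<eta>(1) \<eta>0(1)]])
    then obtain f where f: "\<And>X. X \<in> plane Y Z \<Longrightarrow> lb X ^ m X dvd dot n ?\<delta> (\<beta> X) + f * lb X"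
      by blast
    have "lb X ^ m X dvd w X + f * lb X" if X: "X \<in> plane Y Z" for X
    proof -
      have "w X + f * lb X = (dot n ?\<delta> (\<beta> X) + f * lb X) - (dot n ?\<delta> (\<beta> X) - w X)" by simp
      then show ?thesis using dvd_diff [OF f [OF X] dw [OF X]] by (simp only:)
    qed
    then show "\<exists>f. \<forall>X\<in>plane Y Z. lb X ^ m X dvd w X + f * lb X" by blast
  next
    fix Y assume "Y \<in> J" then show "w Y \<in> poly_ring n"
      unfolding w_def using u vecs_dot [OF \<eta>0(1)] by auto
  qed
  then obtain f where f: "f \<in> poly_ring n" "\<And>X. X \<in> J \<Longrightarrow> lb X ^ m X dvd w X + f * lb X" by blast
  let ?\<eta> = "\<lambda>i. \<eta>0 i - f * mvar i"
  have "lb X ^ m X dvd dot n ?\<eta> (\<beta> X) - u X" if X: "X \<in> J" for X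
  proof -
    have "dot n ?\<eta> (\<beta> X) - u X = - (w X + f * lb X)"
      unfolding dot_diff_left dot_scale_left w_def by simp
    then show ?thesis using f(2) [OF X] by (simp only: dvd_minus_iff)
  qed
  moreover have "?\<eta> \<in> vecs n n" by (intro vecs_diff \<eta>0 vecs_scale f vecs_mvar) simp
  ultimately show ?thesis by blast
qed

text \<open>
  This is the vanishing of a local cohomology group in disguise: the obstruction classes \<open>h\<close>
  are divisible by \<open>t\<close>, hence vanish for degree reasons.
\<close>

lemma obstruction_vanishes:
  assumes b: "restricted_basis K \<phi>" and lfl: locally_free_lifting
    and h: "\<And>Y. Y \<in> J \<Longrightarrow> h Y \<in> poly_ring (Suc n)" "\<And>Y. Y \<in> J \<Longrightarrow> homogeneous_poly d (h Y)"
    and loc: "\<And>Y Z. Y \<in> J \<Longrightarrow> Z \<in> J \<Longrightarrow> \<exists>\<eta>\<in>vecs n (Suc n). \<forall>X\<in>plane Y Z. G X dvd dot n \<eta> (\<beta> X) - h X"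
  shows "\<exists>\<eta>\<in>vecs n (Suc n). \<forall>X\<in>J. G X dvd dot n \<eta> (\<beta> X) - h X"
  using h loc
proof (induction d arbitrary: h rule: less_induct)
  case (less d)
  note h = less.prems(1,2) and loc = less.prems(3)
  have trunc_sol: "lb X ^ m X dvd dot n (\<lambda>i. trunc n (\<eta> i)) (\<beta> X) - trunc n (h X)"
    if "G X dvd dot n \<eta> (\<beta> X) - h X" for \<eta> X
    using trunc_dvd [OF that, of n] by (simp add: trunc_dot)
  have "\<exists>\<eta>\<in>vecs n n. \<forall>X\<in>J. lb X ^ m X dvd dot n \<eta> (\<beta> X) - trunc n (h X)"
  proof (rule multi_extension [OF b lfl])
    fix Y Z assume "Y \<in> J" "Z \<in> J"
    from loc [OF this] obtain \<eta> where "\<And>X. X \<in> plane Y Z \<Longrightarrow> G X dvd dot n \<eta> (\<beta> X) - h X" by blast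
    then show "\<exists>\<eta>\<in>vecs n n. \<forall>X\<in>plane Y Z. lb X ^ m X dvd dot n \<eta> (\<beta> X) - trunc n (h X)"
      by (intro bexI [of _ "\<lambda>i. trunc n (\<eta> i)"] vecs_trunc ballI trunc_sol)
  qed simp
  then obtain \<eta>' where \<eta>': "\<eta>' \<in> vecs n n" "\<And>X. X \<in> J \<Longrightarrow> lb X ^ m X dvd dot n \<eta>' (\<beta> X) - trunc n (h X)"
    by blast
  \<comment> \<open>Restricted to t = 0, a local solution differs from \<eta>' by an element of the
    multiarrangement. Subtracting a lift \<nu> of this element makes the difference divisible by t,
    and the quotient \<kappa> poses the same kind of problem one degree lower.\<close>
  have \<kappa>_ex: "\<exists>\<kappa>\<in>vecs n (Suc n). \<forall>X\<in>plane Y Z. G X dvd t * dot n \<kappa> (\<beta> X) - (h X - dot n \<eta>' (\<beta> X))"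
    if J: "Y \<in> J" "Z \<in> J" for Y Z
  proof -
    from loc [OF J] obtain \<eta> where \<eta>: "\<eta> \<in> vecs n (Suc n)" "\<And>X. X \<in> plane Y Z \<Longrightarrow> G X dvd dot n \<eta> (\<beta> X) - h X"
      by blast
    let ?\<phi> = "\<lambda>i. trunc n (\<eta> i) - \<eta>' i"
    have "\<exists>\<nu>\<in>vecs n (Suc n). (\<forall>X\<in>plane Y Z. G X dvd dot n \<nu> (\<beta> X)) \<and> (\<forall>i<n. trunc n (\<nu> i) = ?\<phi> i)"
    proof (rule local_lift [OF lfl J])
      show "?\<phi> \<in> vecs n n" by (rule vecs_diff [OF vecs_trunc \<eta>'(1)])
      fix X assume X: "X \<in> plane Y Z"
      show "lb X ^ m X dvd dot n ?\<phi> (\<beta> X)"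
        unfolding dot_diff_left
        by (rule dvd_trans_diff [OF trunc_sol [OF \<eta>(2) [OF X]] dvd_diff_swap [OF \<eta>'(2) [OF plane_J [OF X]]]])
    qed
    then obtain \<nu> where \<nu>: "\<nu> \<in> vecs n (Suc n)" "\<And>X. X \<in> plane Y Z \<Longrightarrow> G X dvd dot n \<nu> (\<beta> X)"
      "\<And>i. i < n \<Longrightarrow> trunc n (\<nu> i) = ?\<phi> i" by blast
    have quot: "\<exists>k\<in>poly_ring (Suc n). \<eta> i - \<eta>' i - \<nu> i = t * k" if "i \<in> {..<n}" for i
    proof -
      have i: "i < n" using that by simp
      have in1: "\<eta> i - \<eta>' i - \<nu> i \<in> poly_ring (Suc n)"
        using \<eta>(1) \<eta>'(1) \<nu>(1) i by (auto intro!: poly_ring_diff intro: poly_ring_mono)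
      have "trunc n (\<eta> i - \<eta>' i - \<nu> i) = 0" using \<nu>(3) [OF i] \<eta>'(1) i by (simp add: trunc_eq)
      then have "t dvd \<eta> i - \<eta>' i - \<nu> i" using mvar_dvd_iff_trunc [OF in1] by simp
      then show ?thesis using in1 by (simp add: poly_ring_dvd_iff [where n = "Suc n"])
    qed
    have "\<exists>\<kappa>. \<forall>i\<in>{..<n}. \<kappa> i \<in> poly_ring (Suc n) \<and> \<eta> i - \<eta>' i - \<nu> i = t * \<kappa> i"
      by (rule bex_choice) (rule quot)
    then obtain \<kappa> where "\<forall>i\<in>{..<n}. \<kappa> i \<in> poly_ring (Suc n) \<and> \<eta> i - \<eta>' i - \<nu> i = t * \<kappa> i" by (elim exE)
    then have \<kappa>: "\<And>i. i < n \<Longrightarrow> \<kappa> i \<in> poly_ring (Suc n)" "\<And>i. i < n \<Longrightarrow> \<eta> i - \<eta>' i - \<nu> i = t * \<kappa> i"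
      by auto
    have "G X dvd t * dot n \<kappa> (\<beta> X) - (h X - dot n \<eta>' (\<beta> X))" if X: "X \<in> plane Y Z" for X
    proof -
      have "t * dot n \<kappa> (\<beta> X) = dot n (\<lambda>i. t * \<kappa> i) (\<beta> X)" by (simp only: dot_scale_left)
      also have "\<dots> = dot n (\<lambda>i. \<eta> i - \<eta>' i - \<nu> i) (\<beta> X)" by (rule dot_cong) (auto simp: \<kappa>(2))
      finally have "t * dot n \<kappa> (\<beta> X) - (h X - dot n \<eta>' (\<beta> X)) = (dot n \<eta> (\<beta> X) - h X) - dot n \<nu> (\<beta> X)"
        by (simp add: dot_diff_left)
      then show ?thesis using dvd_diff [OF \<eta>(2) [OF X] \<nu>(2) [OF X]] by (simp only:)
    qed
    moreover have "\<kappa> \<in> vecs n (Suc n)" using \<kappa>(1) by simp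
    ultimately show ?thesis by blast
  qed
  have "\<exists>\<kappa>. \<forall>Y\<in>J. \<forall>Z\<in>J. \<kappa> Y Z \<in> vecs n (Suc n) \<and>
      (\<forall>X\<in>plane Y Z. G X dvd t * dot n (\<kappa> Y Z) (\<beta> X) - (h X - dot n \<eta>' (\<beta> X)))"
    by (rule bex_choice2) (rule \<kappa>_ex)
  then obtain \<kappa> where "\<forall>Y\<in>J. \<forall>Z\<in>J. \<kappa> Y Z \<in> vecs n (Suc n) \<and>
      (\<forall>X\<in>plane Y Z. G X dvd t * dot n (\<kappa> Y Z) (\<beta> X) - (h X - dot n \<eta>' (\<beta> X)))" by (elim exE)
  then have \<kappa>: "\<And>Y Z. Y \<in> J \<Longrightarrow> Z \<in> J \<Longrightarrow> \<kappa> Y Z \<in> vecs n (Suc n)"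
    "\<And>Y Z X. Y \<in> J \<Longrightarrow> Z \<in> J \<Longrightarrow> X \<in> plane Y Z \<Longrightarrow>
      G X dvd t * dot n (\<kappa> Y Z) (\<beta> X) - (h X - dot n \<eta>' (\<beta> X))"
    by blast+
  \<comment> \<open>The new right-hand side is read off at the single hyperplanes. On a plane the
    other local solutions agree with it modulo \<open>G X\<close>, since t can be cancelled.\<close>
  define h' where "h' X = dot n (\<kappa> X X) (\<beta> X)" for X
  have h'_in: "h' X \<in> poly_ring (Suc n)" if "X \<in> J" for X
    unfolding h'_def by (rule vecs_dot [OF \<kappa>(1) [OF that that]])
  have th': "G X dvd t * h' X - (h X - dot n \<eta>' (\<beta> X))" if "X \<in> J" for X
    unfolding h'_def by (rule \<kappa>(2)) (auto intro: that plane_self)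
  have h'_loc: "G X dvd dot n (\<kappa> Y Z) (\<beta> X) - h' X" if J: "Y \<in> J" "Z \<in> J" and X: "X \<in> plane Y Z" for X Y Z
  proof (rule G_dvd_cancel_t)
    show "G X dvd t * (dot n (\<kappa> Y Z) (\<beta> X) - h' X)"
      unfolding right_diff_distrib
      by (rule dvd_trans_diff [OF \<kappa>(2) [OF J X] dvd_diff_swap [OF th' [OF plane_J [OF X]]]])
  qed
  have hc: "G X dvd t * hpart d 1 (h' X) - (h X - dot n (\<lambda>i. hcomp d (\<eta>' i)) (\<beta> X))" if X: "X \<in> J" for X
    using hcomp_dvd [OF homogeneous_G th' [OF X], of d] h(2) [OF X]
    by (simp add: hcomp_eq hcomp_dot hcomp_mult_hpart [OF homogeneous_mvar, simplified])
  have \<eta>'h: "(\<lambda>i. hcomp d (\<eta>' i)) \<in> vecs n (Suc n)" by (intro vecs_hcomp vecs_mono [OF \<eta>'(1)]) simp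
  \<comment> \<open>A multiple of t has no component of degree 0, so in degree 0 the vector \<eta>'
    alone is a solution; otherwise the component of h' of degree d - 1 is handled by
    induction.\<close>
  show ?case
  proof (cases d)
    case 0
    have "G X dvd dot n (\<lambda>i. hcomp d (\<eta>' i)) (\<beta> X) - h X" if "X \<in> J" for X
      using hc [OF that] by (simp add: 0 hpart_def)
    then show ?thesis using \<eta>'h by blast
  next
    case (Suc d')
    have "\<exists>\<eta>\<in>vecs n (Suc n). \<forall>X\<in>J. G X dvd dot n \<eta> (\<beta> X) - hcomp d' (h' X)"
    proof (rule less.IH)
      show "d' < d" by (simp add: Suc)
      fix Y assume Y: "Y \<in> J"
      show "hcomp d' (h' Y) \<in> poly_ring (Suc n)" using h'_in [OF Y] by auto
      show "homogeneous_poly d' (hcomp d' (h' Y))" by simp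
      fix Z assume Z: "Z \<in> J"
      have "G X dvd dot n (\<lambda>i. hcomp d' (\<kappa> Y Z i)) (\<beta> X) - hcomp d' (h' X)" if X: "X \<in> plane Y Z" for X
        using hcomp_dvd [OF homogeneous_G h'_loc [OF Y Z X], of d'] by (simp add: hcomp_dot)
      then show "\<exists>\<eta>\<in>vecs n (Suc n). \<forall>X\<in>plane Y Z. G X dvd dot n \<eta> (\<beta> X) - hcomp d' (h' X)"
        using vecs_hcomp [OF \<kappa>(1) [OF Y Z]] by blast
    qed
    then obtain \<eta>'' where \<eta>'': "\<eta>'' \<in> vecs n (Suc n)" "\<And>X. X \<in> J \<Longrightarrow> G X dvd dot n \<eta>'' (\<beta> X) - hcomp d' (h' X)"
      by blast
    let ?\<eta> = "\<lambda>i. hcomp d (\<eta>' i) + t * \<eta>'' i"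
    have "G X dvd dot n ?\<eta> (\<beta> X) - h X" if X: "X \<in> J" for X
    proof -
      have "G X dvd (t * hcomp d' (h' X) - (h X - dot n (\<lambda>i. hcomp d (\<eta>' i)) (\<beta> X)))
          + t * (dot n \<eta>'' (\<beta> X) - hcomp d' (h' X))"
        using hc [OF X] \<eta>''(2) [OF X] by (intro dvd_add dvd_mult) (simp_all add: Suc hpart_def)
      then show ?thesis by (simp add: dot_add_left dot_scale_left algebra_simps)
    qed
    moreover have "?\<eta> \<in> vecs n (Suc n)" by (intro vecs_add \<eta>'h vecs_scale \<eta>'') auto
    ultimately show ?thesis by blast
  qed
qed

text \<open>Read as a vector over n + 1 variables, \<theta> fails to be logarithmic only by
  multiples t * h Y. Local lifts show that the h Y are locally the values of one vector,
  \<open>obstruction_vanishes\<close> provides a global one \<eta>, and \<theta> - t \<eta> is the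
  lift up to its homogeneous part.\<close>

lemma global_lift:
  assumes b: "restricted_basis K \<phi>" and lfl: locally_free_lifting
    and \<theta>: "\<theta> \<in> vecs n n" "\<And>i. i < n \<Longrightarrow> homogeneous_poly d (\<theta> i)"
      "\<And>Y. Y \<in> J \<Longrightarrow> lb Y ^ m Y dvd dot n \<theta> (\<beta> Y)"
  shows "\<exists>\<nu>\<in>vecs n (Suc n). (\<forall>Y\<in>J. G Y dvd dot n \<nu> (\<beta> Y)) \<and>
    (\<forall>i<n. homogeneous_poly d (\<nu> i) \<and> trunc n (\<nu> i) = \<theta> i)"
proof -
  have dot_in: "dot n \<theta> (\<beta> Y) \<in> poly_ring n" for Y by (rule vecs_dot [OF \<theta>(1)])
  have hom_dot: "homogeneous_poly d (dot n \<theta> (\<beta> Y))" for Y by (rule homogeneous_dot) (rule \<theta>(2))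
  \<comment> \<open>\<open>G Y * k\<close> is the obvious lift of the restricted value
    \<open>lb Y ^ m Y * k\<close>, and both differ by a multiple of t. For d = 0 this multiple is
    zero, so the truncated degree d - 1 is harmless.\<close>
  have h_ex: "\<exists>h\<in>poly_ring (Suc n). homogeneous_poly (d - 1) h \<and> G Y dvd dot n \<theta> (\<beta> Y) - t * h" if Y: "Y \<in> J" for Y
  proof -
    obtain k where k: "k \<in> poly_ring n" "dot n \<theta> (\<beta> Y) = lb Y ^ m Y * k"
      by (rule poly_ring_dvdE [OF \<theta>(3) [OF Y] _ dot_in]) simp
    have k': "k = hpart d (m Y) k"
    proof -
      have hp: "homogeneous_poly (m Y) (lb Y ^ m Y)" using homogeneous_power [OF homogeneous_lin [of n "\<beta> Y"], of "m Y"] by simp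
      have "lb Y ^ m Y * hpart d (m Y) k = lb Y ^ m Y * k"
        using hcomp_mult_hpart [OF hp, of d k] hcomp_eq [OF hom_dot, of Y] by (simp only: k(2))
      then show ?thesis using lin_nonzero [OF Y] by simp
    qed
    let ?D = "dot n \<theta> (\<beta> Y) - G Y * k"
    have D_in: "?D \<in> poly_ring (Suc n)"
      using poly_ring_mono [OF dot_in, of "Suc n"] poly_ring_mono [OF k(1), of "Suc n"] by simp
    have "trunc n ?D = 0" using k dot_in by (simp add: trunc_eq)
    then have "t dvd ?D" using mvar_dvd_iff_trunc [OF D_in] by simp
    then obtain h where h: "h \<in> poly_ring (Suc n)" "?D = t * h"
      by (rule poly_ring_dvdE [OF _ _ D_in]) simp
    have "homogeneous_poly d (G Y * k)"
      using hcomp_mult_hpart [OF homogeneous_G, of d Y k] k' homogeneous_hcomp [of d "G Y * k"] by simp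
    then have hD: "homogeneous_poly d (t * h)" unfolding h(2) [symmetric] by (intro homogeneous_diff hom_dot)
    have "homogeneous_poly (d - 1) h"
    proof (cases "d = 0")
      case True
      have "h = 0" using homogeneous_quotient_less [OF homogeneous_mvar mvar_neq_0 hD] True by simp
      then show ?thesis by simp
    next
      case False
      show ?thesis by (rule homogeneous_quotient [OF homogeneous_mvar mvar_neq_0]) (use hD False in simp)
    qed
    moreover have "dot n \<theta> (\<beta> Y) - t * h = G Y * k" unfolding h(2) [symmetric] by simp
    then have "G Y dvd dot n \<theta> (\<beta> Y) - t * h" by simp
    ultimately show ?thesis using h(1) by blast
  qed
  have "\<exists>h. \<forall>Y\<in>J. h Y \<in> poly_ring (Suc n) \<and> homogeneous_poly (d - 1) (h Y) \<and>
      G Y dvd dot n \<theta> (\<beta> Y) - t * h Y"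
    by (rule bex_choice) (rule h_ex)
  then obtain h where "\<forall>Y\<in>J. h Y \<in> poly_ring (Suc n) \<and> homogeneous_poly (d - 1) (h Y) \<and>
      G Y dvd dot n \<theta> (\<beta> Y) - t * h Y" by (elim exE)
  then have h: "\<And>Y. Y \<in> J \<Longrightarrow> h Y \<in> poly_ring (Suc n)" "\<And>Y. Y \<in> J \<Longrightarrow> homogeneous_poly (d - 1) (h Y)"
    "\<And>Y. Y \<in> J \<Longrightarrow> G Y dvd dot n \<theta> (\<beta> Y) - t * h Y" by blast+
  have "\<exists>\<eta>\<in>vecs n (Suc n). \<forall>X\<in>J. G X dvd dot n \<eta> (\<beta> X) - h X"
  proof (rule obstruction_vanishes [OF b lfl h(1,2)])
    fix Y Z assume J: "Y \<in> J" "Z \<in> J"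
    have "\<exists>\<nu>\<in>vecs n (Suc n). (\<forall>Y\<in>plane Y Z. G Y dvd dot n \<nu> (\<beta> Y)) \<and> (\<forall>i<n. trunc n (\<nu> i) = \<theta> i)"
      by (rule local_lift [OF lfl J \<theta>(1) \<theta>(3) [OF plane_J]])
    then obtain \<nu> where \<nu>: "\<nu> \<in> vecs n (Suc n)" "\<And>X. X \<in> plane Y Z \<Longrightarrow> G X dvd dot n \<nu> (\<beta> X)"
      "\<And>i. i < n \<Longrightarrow> trunc n (\<nu> i) = \<theta> i" by blast
    have quot: "\<exists>k\<in>poly_ring (Suc n). \<theta> i - \<nu> i = t * k" if "i \<in> {..<n}" for i
    proof -
      have i: "i < n" using that by simp
      have in1: "\<theta> i - \<nu> i \<in> poly_ring (Suc n)"
        using \<theta>(1) \<nu>(1) i by (auto intro!: poly_ring_diff intro: poly_ring_mono)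
      have "trunc n (\<theta> i - \<nu> i) = 0" using \<nu>(3) [OF i] \<theta>(1) i by (simp add: trunc_eq)
      then have "t dvd \<theta> i - \<nu> i" using mvar_dvd_iff_trunc [OF in1] by simp
      then show ?thesis using in1 by (simp add: poly_ring_dvd_iff [where n = "Suc n"])
    qed
    have "\<exists>\<eta>. \<forall>i\<in>{..<n}. \<eta> i \<in> poly_ring (Suc n) \<and> \<theta> i - \<nu> i = t * \<eta> i"
      by (rule bex_choice) (rule quot)
    then obtain \<eta> where "\<forall>i\<in>{..<n}. \<eta> i \<in> poly_ring (Suc n) \<and> \<theta> i - \<nu> i = t * \<eta> i" by (elim exE)
    then have \<eta>: "\<And>i. i < n \<Longrightarrow> \<eta> i \<in> poly_ring (Suc n)" "\<And>i. i < n \<Longrightarrow> \<theta> i - \<nu> i = t * \<eta> i"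
      by auto
    have "G X dvd dot n \<eta> (\<beta> X) - h X" if X: "X \<in> plane Y Z" for X
    proof (rule G_dvd_cancel_t)
      have "t * dot n \<eta> (\<beta> X) = dot n (\<lambda>i. t * \<eta> i) (\<beta> X)" by (simp only: dot_scale_left)
      also have "\<dots> = dot n (\<lambda>i. \<theta> i - \<nu> i) (\<beta> X)" by (rule dot_cong) (auto simp: \<eta>(2))
      finally have "t * (dot n \<eta> (\<beta> X) - h X) = (dot n \<theta> (\<beta> X) - t * h X) - dot n \<nu> (\<beta> X)"
        by (simp add: dot_diff_left right_diff_distrib)
      then show "G X dvd t * (dot n \<eta> (\<beta> X) - h X)"
        using dvd_diff [OF h(3) [OF plane_J [OF X]] \<nu>(2) [OF X]] by (simp only:)
    qed
    moreover have "\<eta> \<in> vecs n (Suc n)" using \<eta>(1) by simp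
    ultimately show "\<exists>\<eta>\<in>vecs n (Suc n). \<forall>X\<in>plane Y Z. G X dvd dot n \<eta> (\<beta> X) - h X" by blast
  qed
  then obtain \<eta> where \<eta>: "\<eta> \<in> vecs n (Suc n)" "\<And>X. X \<in> J \<Longrightarrow> G X dvd dot n \<eta> (\<beta> X) - h X" by blast
  let ?\<nu> = "\<lambda>i. \<theta> i - t * \<eta> i"
  have \<nu>: "G X dvd dot n ?\<nu> (\<beta> X)" if X: "X \<in> J" for X
  proof -
    have "dot n ?\<nu> (\<beta> X) = (dot n \<theta> (\<beta> X) - t * h X) - t * (dot n \<eta> (\<beta> X) - h X)"
      by (simp add: dot_diff_left dot_scale_left right_diff_distrib)
    then show ?thesis using dvd_diff [OF h(3) [OF X] dvd_mult [OF \<eta>(2) [OF X]]] by (simp only:)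
  qed
  have "G X dvd dot n (\<lambda>i. hcomp d (?\<nu> i)) (\<beta> X)" if "X \<in> J" for X
    using hcomp_dvd [OF homogeneous_G \<nu> [OF that], of d] by (simp only: hcomp_dot)
  moreover have "trunc n (hcomp d (?\<nu> i)) = \<theta> i" if "i < n" for i
  proof -
    have "trunc n (?\<nu> i) = \<theta> i" using \<theta>(1) that by (simp add: trunc_eq trunc_mvar)
    then have "trunc n (hcomp d (?\<nu> i)) = hcomp d (\<theta> i)" by (simp only: hcomp_trunc [symmetric])
    then show ?thesis using hcomp_eq [OF \<theta>(2) [OF that]] by simp
  qed
  moreover have "(\<lambda>i. hcomp d (?\<nu> i)) \<in> vecs n (Suc n)"
    by (intro vecs_hcomp vecs_diff vecs_scale \<eta>(1) vecs_mono [OF \<theta>(1)]) auto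
  ultimately show ?thesis by (intro bexI [of _ "\<lambda>i. hcomp d (?\<nu> i)"]) (auto simp del: hcomp_diff)
qed

end

lemma sum_hcomp_ge: "\<exists>k. \<forall>k'\<ge>k. p = (\<Sum>d<k'. hcomp d p)"
proof -
  obtain k where k: "p = (\<Sum>d<k. hcomp d p)" using sum_hcomp by blast
  have "hcomp d p = 0" if "d \<ge> k" for d
  proof -
    have "hcomp d p = (\<Sum>e<k. hcomp d (hcomp e p))" by (subst k) simp
    also have "\<dots> = 0" using that by (intro sum.neutral) (auto simp: hcomp_homogeneous [OF homogeneous_hcomp])
    finally show ?thesis .
  qed
  then have "(\<Sum>d<k'. hcomp d p) = (\<Sum>d<k. hcomp d p)" if "k' \<ge> k" for k'
    using that by (intro sum.mono_neutral_right) auto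
  then show ?thesis using k by metis
qed

lemma vec_sum_hcomp: "\<exists>k. \<forall>i<n::nat. f i = (\<Sum>d<k. hcomp d (f i))"
proof -
  have "\<exists>k. \<forall>i<n. \<forall>k'\<ge>k. f i = (\<Sum>d<k'. hcomp d (f i))"
  proof (induction n)
    case (Suc n)
    then obtain k where k: "\<forall>i<n. \<forall>k'\<ge>k. f i = (\<Sum>d<k'. hcomp d (f i))" by blast
    obtain j where j: "\<forall>k'\<ge>j. f n = (\<Sum>d<k'. hcomp d (f n))" using sum_hcomp_ge by blast
    have "\<forall>i<Suc n. \<forall>k'\<ge>max k j. f i = (\<Sum>d<k'. hcomp d (f i))"
      using k j by (auto simp: less_Suc_eq)
    then show ?case by blast
  qed simp
  then show ?thesis by blast
qed

text \<open>Krull's intersection theorem for powers of a variable: divisibility by the power d + 1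
  excludes a component of degree d. Linear independence can thus be tested modulo growing powers of
  t without a degree bound.\<close>

lemma mvar_power_dvd_imp_0:
  assumes "\<And>j. mvar n ^ j dvd p" shows "p = 0"
proof -
  have "hcomp d p = 0" for d
  proof -
    obtain q where q: "p = mvar n ^ Suc d * q" using assms [of "Suc d"] by (auto elim: dvdE)
    have "homogeneous_poly (Suc d) (mvar n ^ Suc d)"
      using homogeneous_power [OF homogeneous_mvar [of n], of "Suc d"] by simp
    then show ?thesis unfolding q by (rule hcomp_mult(2)) simp
  qed
  then show ?thesis using sum_hcomp [of p] by simp
qed

section \<open>Assembling a homogeneous basis of D(A)\<close>

context pencils
begin

text \<open>D(A) in coordinates. The last entry is the value on t, so \<open>t dvd f n\<close> is
  the condition for the distinguished hyperplane.\<close>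

definition log_vecs :: "(nat \<Rightarrow> 'k mpol) set" where
  "log_vecs = {f \<in> vecs (Suc n) (Suc n). t dvd f n \<and> (\<forall>L\<in>I. form L dvd dot (Suc n) f (vec L))}"

lemma log_vecsD:
  assumes "f \<in> log_vecs"
  shows "f \<in> vecs (Suc n) (Suc n)" "t dvd f n" "L \<in> I \<Longrightarrow> form L dvd dot (Suc n) f (vec L)"
  using assms by (auto simp: log_vecs_def)

lemma log_vecs_hcomp: "f \<in> log_vecs \<Longrightarrow> (\<lambda>i. hcomp d (f i)) \<in> log_vecs"
  unfolding log_vecs_def
  by (simp add: hcomp_dot [symmetric] hcomp_dvd [OF homogeneous_form] hcomp_dvd [OF homogeneous_mvar] vecs_hcomp)

lemma log_vecs_diff: "f \<in> log_vecs \<Longrightarrow> g \<in> log_vecs \<Longrightarrow> (\<lambda>i. f i - g i) \<in> log_vecs"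
  unfolding log_vecs_def by (simp add: dot_diff_left dvd_diff)

lemma log_vecs_scale: "p \<in> poly_ring (Suc n) \<Longrightarrow> f \<in> log_vecs \<Longrightarrow> (\<lambda>i. p * f i) \<in> log_vecs"
  unfolding log_vecs_def by (simp add: dot_scale_left)

lemma log_vecs_sum:
  assumes "\<And>k. k \<in> A \<Longrightarrow> f k \<in> log_vecs" shows "(\<lambda>i. \<Sum>k\<in>A. f k i) \<in> log_vecs"
  using assms unfolding log_vecs_def by (simp add: dot_sum_left dvd_sum)

text \<open>B times the Euler derivation is the least multiple of it satisfying the conditions with
  multiplicities, see \<open>lb_pow_dvd_B\<close> and \<open>B_dvdI\<close>. The degree of B is |A|
  - 1 - |A^H|.\<close>

definition B :: "'k mpol" where "B = (\<Prod>Y\<in>J. lb Y ^ (m Y - 1))"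
definition degB :: nat where "degB = (\<Sum>Y\<in>J. m Y - 1)"

lemma B_in [simp]: "B \<in> poly_ring n" by (simp add: B_def)

lemma B_nonzero: "B \<noteq> 0" using lin_nonzero finite_J by (simp add: B_def)

lemma homogeneous_lb_pow: "homogeneous_poly k (lb Y ^ k)"
  using homogeneous_power [OF homogeneous_lin [of n "\<beta> Y"], of k] by simp

lemma homogeneous_B: "homogeneous_poly degB B"
  unfolding B_def degB_def by (rule homogeneous_prod) (rule homogeneous_lb_pow)

lemma lb_pow_dvd_B: "Y \<in> J \<Longrightarrow> lb Y ^ m Y dvd B * lb Y"
  unfolding lb_pow B_def by (subst mult.commute) (intro mult_dvd_mono dvd_prodI finite_J, simp_all)

lemma B_dvdI:
  assumes "\<And>Y. Y \<in> J \<Longrightarrow> lb Y ^ m Y dvd p * lb Y" shows "B dvd p"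
  unfolding B_def
proof (rule prod_dvd_of_cancels)
  fix Y assume Y: "Y \<in> J"
  have "lb Y * lb Y ^ (m Y - 1) dvd lb Y * p"
    using assms [OF Y] unfolding lb_pow [OF Y] by (simp add: mult.commute)
  then show "lb Y ^ (m Y - 1) dvd p" using lin_nonzero [OF Y] by simp
qed (auto intro: cancels_powers)

text \<open>An element of D(A^H) satisfies the reduced conditions only. A multiple g of the Euler
  derivation of H is added to reach the conditions with multiplicities, \<open>global_lift\<close>
  is applied, and g times the Euler derivation of the whole space, which is always logarithmic, is
  subtracted again.\<close>

lemma lift_restricted:
  assumes b: "restricted_basis K \<phi>" and lfl: locally_free_lifting
    and \<theta>: "\<theta> \<in> vecs n n" "\<And>Y. Y \<in> J \<Longrightarrow> lb Y dvd dot n \<theta> (\<beta> Y)" "\<And>i. i < n \<Longrightarrow> homogeneous_poly d (\<theta> i)"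
  shows "\<exists>\<Phi>\<in>log_vecs. (\<forall>i<Suc n. homogeneous_poly d (\<Phi> i)) \<and> (\<forall>i<n. trunc n (\<Phi> i) = \<theta> i)"
proof -
  have "\<exists>f\<in>poly_ring n. \<forall>Y\<in>J. lb Y ^ m Y dvd dot n \<theta> (\<beta> Y) + f * lb Y"
  proof (rule global_shift)
    fix Y Z assume "Y \<in> J" "Z \<in> J"
    then show "\<exists>f. \<forall>X\<in>plane Y Z. lb X ^ m X dvd dot n \<theta> (\<beta> X) + f * lb X"
      using \<theta>(1,2) plane_J by (intro local_shift [OF lfl]) auto
  qed (use \<theta> vecs_dot in auto)
  then obtain f where f: "f \<in> poly_ring n" "\<And>Y. Y \<in> J \<Longrightarrow> lb Y ^ m Y dvd dot n \<theta> (\<beta> Y) + f * lb Y" by blast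
  define g where "g = hpart d 1 f"
  have g_in: "g \<in> poly_ring n" using f(1) by (simp add: g_def)
  have g_mvar: "g * mvar i = hcomp d (mvar i * f)" for i
    using hcomp_mult_hpart [OF homogeneous_mvar, of d i f] by (simp add: g_def mult.commute)
  have g_hom: "homogeneous_poly d (g * mvar i)" for i unfolding g_mvar by simp
  let ?\<theta>' = "\<lambda>i. \<theta> i + g * mvar i"
  have "\<exists>\<nu>\<in>vecs n (Suc n). (\<forall>Y\<in>J. G Y dvd dot n \<nu> (\<beta> Y)) \<and>
    (\<forall>i<n. homogeneous_poly d (\<nu> i) \<and> trunc n (\<nu> i) = ?\<theta>' i)"
  proof (rule global_lift [OF b lfl])
    show "?\<theta>' \<in> vecs n n" by (intro vecs_add vecs_scale vecs_mvar \<theta>(1) g_in) simp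
    show "homogeneous_poly d (?\<theta>' i)" if "i < n" for i
      by (intro homogeneous_add g_hom \<theta>(3) that)
    fix Y assume Y: "Y \<in> J"
    have "hcomp d (dot n \<theta> (\<beta> Y)) = dot n \<theta> (\<beta> Y)"
      by (intro hcomp_eq homogeneous_dot \<theta>(3))
    moreover have "hcomp d (f * lb Y) = g * lb Y"
      using hcomp_mult_hpart [OF homogeneous_lin, of d n "\<beta> Y" f] by (simp add: g_def mult.commute)
    ultimately have "hcomp d (dot n \<theta> (\<beta> Y) + f * lb Y) = dot n ?\<theta>' (\<beta> Y)"
      by (simp add: dot_add_left dot_scale_left)
    then show "lb Y ^ m Y dvd dot n ?\<theta>' (\<beta> Y)"
      using hcomp_dvd [OF homogeneous_lb_pow f(2) [OF Y], of d] by simp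
  qed
  then obtain \<nu> where \<nu>: "\<nu> \<in> vecs n (Suc n)" "\<And>Y. Y \<in> J \<Longrightarrow> G Y dvd dot n \<nu> (\<beta> Y)"
    "\<And>i. i < n \<Longrightarrow> homogeneous_poly d (\<nu> i)" "\<And>i. i < n \<Longrightarrow> trunc n (\<nu> i) = ?\<theta>' i" by blast
  \<comment> \<open>The lift \<nu> kills t and gets last entry 0; the Euler term contributes - g t
    there, which is divisible by t as required.\<close>
  define \<Phi> where "\<Phi> i = (if i < n then \<nu> i else 0) - g * mvar i" for i
  have g_in': "g \<in> poly_ring (Suc n)" by (rule poly_ring_mono [OF g_in]) simp
  have "form L dvd dot (Suc n) \<Phi> (vec L)" if L: "L \<in> I" for L
  proof -
    have "dot n \<Phi> (\<beta> (z L)) = dot n (\<lambda>i. \<nu> i - g * mvar i) (\<beta> (z L))"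
      by (rule dot_cong) (auto simp: \<Phi>_def)
    then have "dot (Suc n) \<Phi> (vec L) = dot n \<nu> (\<beta> (z L)) - g * form L"
      by (simp add: dot_vec dot_diff_left dot_scale_left \<Phi>_def form_def algebra_simps)
    moreover have "form L dvd dot n \<nu> (\<beta> (z L))"
      by (rule dvd_trans [OF form_dvd_G [OF L] \<nu>(2) [OF zJ [OF L]]])
    ultimately show ?thesis by simp
  qed
  moreover have "\<Phi> \<in> vecs (Suc n) (Suc n)" using \<nu>(1) g_in' by (auto simp: \<Phi>_def)
  moreover have "t dvd \<Phi> n" by (simp add: \<Phi>_def)
  ultimately have "\<Phi> \<in> log_vecs" by (simp add: log_vecs_def)
  moreover have "homogeneous_poly d (\<Phi> i)" for i using \<nu>(3) g_hom by (auto simp: \<Phi>_def)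
  moreover have "trunc n (\<Phi> i) = \<theta> i" if "i < n" for i
    using \<nu>(4) [OF that] that g_in by (simp add: \<Phi>_def trunc_eq trunc_mvar)
  ultimately show ?thesis by blast
qed

text \<open>B times the Euler derivation of H lifts to some \<nu> that kills t. The difference of B
  times the full Euler derivation and \<nu> is divisible by t, with last entry B t. The quotient is
  logarithmic along all hyperplanes except t = 0 and has value B on t, so it attains the bound of
  \<open>B_dvd_trunc\<close>.\<close>

lemma extra_derivation:
  assumes b: "restricted_basis K \<phi>" and lfl: locally_free_lifting
  shows "\<exists>\<eta>\<in>vecs (Suc n) (Suc n). (\<forall>L\<in>I. form L dvd dot (Suc n) \<eta> (vec L)) \<and> \<eta> n = B \<and>
    (\<forall>i<Suc n. homogeneous_poly degB (\<eta> i))"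
proof -
  let ?\<theta> = "\<lambda>i. B * mvar i"
  have hom: "homogeneous_poly (degB + 1) (?\<theta> i)" for i
    by (rule homogeneous_mult [OF homogeneous_B homogeneous_mvar])
  have "\<exists>\<nu>\<in>vecs n (Suc n). (\<forall>Y\<in>J. G Y dvd dot n \<nu> (\<beta> Y)) \<and>
    (\<forall>i<n. homogeneous_poly (degB + 1) (\<nu> i) \<and> trunc n (\<nu> i) = ?\<theta> i)"
  proof (rule global_lift [OF b lfl _ hom])
    show "?\<theta> \<in> vecs n n" by simp
    show "lb Y ^ m Y dvd dot n ?\<theta> (\<beta> Y)" if "Y \<in> J" for Y
      unfolding dot_scale_left by (rule lb_pow_dvd_B [OF that])
  qed
  then obtain \<nu> where \<nu>: "\<nu> \<in> vecs n (Suc n)" "\<And>Y. Y \<in> J \<Longrightarrow> G Y dvd dot n \<nu> (\<beta> Y)"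
    "\<And>i. i < n \<Longrightarrow> homogeneous_poly (degB + 1) (\<nu> i)" "\<And>i. i < n \<Longrightarrow> trunc n (\<nu> i) = ?\<theta> i" by blast
  have B_in': "B \<in> poly_ring (Suc n)" by (rule poly_ring_mono [OF B_in]) simp
  have quot: "\<exists>k\<in>poly_ring (Suc n). ?\<theta> i - \<nu> i = t * k" if "i \<in> {..<n}" for i
  proof -
    have i: "i < n" using that by simp
    have in1: "?\<theta> i - \<nu> i \<in> poly_ring (Suc n)" using \<nu>(1) i B_in' by simp
    have "trunc n (?\<theta> i - \<nu> i) = 0" using \<nu>(4) [OF i] i by (simp add: trunc_eq trunc_mvar)
    then have "t dvd ?\<theta> i - \<nu> i" using mvar_dvd_iff_trunc [OF in1] by simp
    then show ?thesis using in1 by (simp add: poly_ring_dvd_iff [where n = "Suc n"])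
  qed
  have "\<exists>\<kappa>. \<forall>i\<in>{..<n}. \<kappa> i \<in> poly_ring (Suc n) \<and> ?\<theta> i - \<nu> i = t * \<kappa> i"
    by (rule bex_choice) (rule quot)
  then obtain \<kappa> where "\<forall>i\<in>{..<n}. \<kappa> i \<in> poly_ring (Suc n) \<and> ?\<theta> i - \<nu> i = t * \<kappa> i" by (elim exE)
  then have \<kappa>: "\<And>i. i < n \<Longrightarrow> \<kappa> i \<in> poly_ring (Suc n)" "\<And>i. i < n \<Longrightarrow> ?\<theta> i - \<nu> i = t * \<kappa> i" by auto
  define \<eta> where "\<eta> = \<kappa>(n := B)"
  have "homogeneous_poly degB (\<kappa> i)" if i: "i < n" for i
  proof (rule homogeneous_quotient [OF homogeneous_mvar [of n] mvar_neq_0])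
    show "homogeneous_poly (1 + degB) (t * \<kappa> i)"
      unfolding \<kappa>(2) [OF i, symmetric] using hom [of i] \<nu>(3) [OF i] by simp
  qed
  then have "homogeneous_poly degB (\<eta> i)" if "i < Suc n" for i
    using that homogeneous_B by (auto simp: \<eta>_def less_Suc_eq)
  moreover have "\<eta> \<in> vecs (Suc n) (Suc n)" using \<kappa>(1) B_in' by (auto simp: \<eta>_def less_Suc_eq)
  moreover have "form L dvd dot (Suc n) \<eta> (vec L)" if L: "L \<in> I" for L
  proof (rule form_dvd_cancel_t [OF L])
    have "t * dot n \<eta> (\<beta> (z L)) = dot n (\<lambda>i. t * \<eta> i) (\<beta> (z L))" by (simp only: dot_scale_left)
    also have "\<dots> = dot n (\<lambda>i. ?\<theta> i - \<nu> i) (\<beta> (z L))" by (rule dot_cong) (auto simp: \<eta>_def \<kappa>(2))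
    also have "\<dots> = B * lb (z L) - dot n \<nu> (\<beta> (z L))" by (simp only: dot_diff_left dot_scale_left)
    finally have "t * dot n \<eta> (\<beta> (z L)) = B * lb (z L) - dot n \<nu> (\<beta> (z L))" .
    moreover have "\<eta> n = B" by (simp add: \<eta>_def)
    ultimately have "t * dot (Suc n) \<eta> (vec L) = B * form L - dot n \<nu> (\<beta> (z L))"
      by (simp add: dot_vec form_def distrib_left mult_ac)
    moreover have "form L dvd dot n \<nu> (\<beta> (z L))"
      by (rule dvd_trans [OF form_dvd_G [OF L] \<nu>(2) [OF zJ [OF L]]])
    ultimately show "form L dvd t * dot (Suc n) \<eta> (vec L)" by simp
  qed
  ultimately show ?thesis by (intro bexI [of _ \<eta>]) (auto simp: \<eta>_def)
qed

text \<open>Terao's polynomial \<open>B\<close>: eliminating the other coordinate by a determinant gives the full multiplicity.\<close>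

lemma B_dvd_trunc:
  assumes "\<And>L. L \<in> I \<Longrightarrow> form L dvd dot (Suc n) \<eta> (vec L)"
  shows "B dvd trunc n (\<eta> n)"
proof (rule B_dvdI)
  fix Y assume Y: "Y \<in> J"
  have "G Y dvd t * dot n \<eta> (\<beta> Y) - \<eta> n * lb Y"
  proof (rule G_dvdI)
    fix L assume L: "L \<in> I" "z L = Y"
    have "t * dot n \<eta> (\<beta> Y) - \<eta> n * lb Y = t * dot (Suc n) \<eta> (vec L) - \<eta> n * form L"
      by (simp add: dot_vec form_def L algebra_simps)
    then show "form L dvd t * dot n \<eta> (\<beta> Y) - \<eta> n * lb Y" using assms [OF L(1)] by simp
  qed
  from trunc_dvd [OF this, of n] show "lb Y ^ m Y dvd trunc n (\<eta> n) * lb Y"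
    by (simp add: trunc_mvar trunc_eq)
qed

definition vec_basis :: "'y set \<Rightarrow> ('y \<Rightarrow> nat \<Rightarrow> 'k mpol) \<Rightarrow> bool" where
  "vec_basis K \<Phi> \<longleftrightarrow> finite K \<and> (\<forall>k\<in>K. \<Phi> k \<in> log_vecs \<and> (\<exists>d. \<forall>i<Suc n. homogeneous_poly d (\<Phi> k i))) \<and>
    (\<forall>\<theta>\<in>log_vecs. \<exists>a. (\<forall>k\<in>K. a k \<in> poly_ring (Suc n)) \<and> (\<forall>i<Suc n. \<theta> i = (\<Sum>k\<in>K. a k * \<Phi> k i))) \<and>
    (\<forall>a. (\<forall>k\<in>K. a k \<in> poly_ring (Suc n)) \<and> (\<forall>i<Suc n. (\<Sum>k\<in>K. a k * \<Phi> k i) = 0) \<longrightarrow> (\<forall>k\<in>K. a k = 0))"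

text \<open>The added basis element is t \<eta> with \<eta> from \<open>extra_derivation\<close>.
  For generation, subtract lifts until the vector vanishes on t = 0 and divide by t. The quotient
  may fail to be logarithmic along t = 0, but only by a multiple of B, which \<eta> corrects; the
  degree has then dropped by one.\<close>

theorem vec_basis_exists:
  fixes \<phi> :: "'x \<Rightarrow> nat \<Rightarrow> 'k mpol"
  assumes b: "restricted_basis K \<phi>" and hom: "\<And>k. k \<in> K \<Longrightarrow> \<exists>d. \<forall>i<n. homogeneous_poly d (\<phi> k i)"
    and lfl: locally_free_lifting
  shows "\<exists>(K' :: 'x option set) \<Phi>. vec_basis K' \<Phi>"
proof -
  have "\<exists>dg. \<forall>k\<in>K. \<forall>i<n. homogeneous_poly (dg k) (\<phi> k i)" by (rule bchoice) (use hom in blast)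
  then obtain dg where dg: "\<And>k i. k \<in> K \<Longrightarrow> i < n \<Longrightarrow> homogeneous_poly (dg k) (\<phi> k i)" by blast
  have "\<exists>\<Phi>. \<forall>k\<in>K. \<Phi> k \<in> log_vecs \<and> ((\<forall>i<Suc n. homogeneous_poly (dg k) (\<Phi> k i)) \<and> (\<forall>i<n. trunc n (\<Phi> k i) = \<phi> k i))"
    by (rule bex_choice, rule lift_restricted [OF b lfl])
      (use restricted_basisD(2,3) [OF b] dg in auto)
  then obtain \<Phi> where \<Phi>: "\<And>k. k \<in> K \<Longrightarrow> \<Phi> k \<in> log_vecs" "\<And>k i. k \<in> K \<Longrightarrow> i < Suc n \<Longrightarrow> homogeneous_poly (dg k) (\<Phi> k i)"
    "\<And>k i. k \<in> K \<Longrightarrow> i < n \<Longrightarrow> trunc n (\<Phi> k i) = \<phi> k i" by blast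
  obtain \<eta> where \<eta>: "\<eta> \<in> vecs (Suc n) (Suc n)" "\<And>L. L \<in> I \<Longrightarrow> form L dvd dot (Suc n) \<eta> (vec L)" "\<eta> n = B"
    "\<And>i. i < Suc n \<Longrightarrow> homogeneous_poly degB (\<eta> i)"
    using extra_derivation [OF b lfl] by blast
  have finK: "finite K" by (rule restricted_basisD(1) [OF b])
  define gen where "gen \<theta> \<longleftrightarrow> (\<exists>a e. (\<forall>k\<in>K. a k \<in> poly_ring (Suc n)) \<and> e \<in> poly_ring (Suc n) \<and>
      (\<forall>i<Suc n. \<theta> i = (\<Sum>k\<in>K. a k * \<Phi> k i) + e * (t * \<eta> i)))" for \<theta>
  have gen_hom: "gen \<theta>" if "\<theta> \<in> log_vecs" "\<And>i. i < Suc n \<Longrightarrow> homogeneous_poly d (\<theta> i)" for \<theta> d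
    using that
  proof (induction d arbitrary: \<theta> rule: less_induct)
    case (less d)
    note \<theta> = log_vecsD [OF less.prems(1)] and \<theta>hom = less.prems(2)
    have tn: "trunc n (\<theta> n) = 0"
      using \<theta>(1,2) mvar_dvd_iff_trunc [of "\<theta> n" n] by simp
    have "\<exists>a. (\<forall>k\<in>K. a k \<in> poly_ring n) \<and> (\<forall>i<n. trunc n (\<theta> i) = (\<Sum>k\<in>K. a k * \<phi> k i))"
    proof (rule restricted_basisD(4) [OF b])
      show "(\<lambda>i. trunc n (\<theta> i)) \<in> vecs n n" by simp
      fix Y assume "Y \<in> J"
      then obtain L where L: "L \<in> I" "z L = Y" using z_image by blast
      from trunc_dvd [OF \<theta>(3) [OF L(1)], of n] show "lb Y dvd dot n (\<lambda>i. trunc n (\<theta> i)) (\<beta> Y)"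
        by (simp add: dot_vec L(2) tn trunc_dot)
    qed
    then obtain a0 where a0: "\<And>k. k \<in> K \<Longrightarrow> a0 k \<in> poly_ring n"
      "\<And>i. i < n \<Longrightarrow> trunc n (\<theta> i) = (\<Sum>k\<in>K. a0 k * \<phi> k i)" by blast
    define a where "a k = hpart d (dg k) (a0 k)" for k
    have a_in: "a k \<in> poly_ring n" if "k \<in> K" for k using a0(1) [OF that] by (simp add: a_def)
    have a_in': "a k \<in> poly_ring (Suc n)" if "k \<in> K" for k by (rule poly_ring_mono [OF a_in [OF that]]) simp
    have a: "trunc n (\<theta> i) = (\<Sum>k\<in>K. a k * \<phi> k i)" if i: "i < n" for i
    proof -
      have "trunc n (\<theta> i) = hcomp d (trunc n (\<theta> i))"
        using \<theta>hom [of i] i by (simp add: hcomp_eq homogeneous_trunc)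
      also have "\<dots> = (\<Sum>k\<in>K. hcomp d (\<phi> k i * a0 k))" by (simp add: a0(2) [OF i] mult.commute)
      also have "\<dots> = (\<Sum>k\<in>K. a k * \<phi> k i)"
      proof (rule sum.cong)
        fix k assume "k \<in> K"
        show "hcomp d (\<phi> k i * a0 k) = a k * \<phi> k i"
          unfolding a_def hcomp_mult_hpart [OF dg [OF \<open>k \<in> K\<close> i]] by (rule mult.commute)
      qed simp
      finally show ?thesis .
    qed
    let ?\<theta>1 = "\<lambda>i. \<theta> i - (\<Sum>k\<in>K. a k * \<Phi> k i)"
    have \<theta>1: "?\<theta>1 \<in> log_vecs"
      by (intro log_vecs_diff less.prems(1) log_vecs_sum log_vecs_scale a_in' \<Phi>(1))
    have \<theta>1hom: "homogeneous_poly d (?\<theta>1 i)" if i: "i < Suc n" for i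
    proof (intro homogeneous_diff \<theta>hom i homogeneous_sum)
      fix k assume k: "k \<in> K"
      show "homogeneous_poly d (a k * \<Phi> k i)"
        using hcomp_mult_hpart [OF \<Phi>(2) [OF k i], of d "a0 k"] homogeneous_hcomp [of d "\<Phi> k i * a0 k"]
        by (simp add: a_def mult.commute)
    qed
    have quot: "\<exists>k\<in>poly_ring (Suc n). ?\<theta>1 i = t * k" if "i \<in> {..<Suc n}" for i
    proof -
      have i: "i < Suc n" using that by simp
      have in1: "?\<theta>1 i \<in> poly_ring (Suc n)" using log_vecsD(1) [OF \<theta>1] i by blast
      have "t dvd ?\<theta>1 i"
      proof (cases "i = n")
        case True
        then show ?thesis using log_vecsD(2) [OF \<theta>1] by simp
      next
        case False
        then have i: "i < n" using i by simp
        have "trunc n (?\<theta>1 i) = 0" using i a_in by (simp add: a \<Phi>(3) trunc_eq)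
        then show ?thesis using mvar_dvd_iff_trunc [OF in1] by simp
      qed
      then show ?thesis using in1 by (simp add: poly_ring_dvd_iff [where n = "Suc n"] del: sum_subtractf)
    qed
    have "\<exists>\<kappa>. \<forall>i\<in>{..<Suc n}. \<kappa> i \<in> poly_ring (Suc n) \<and> ?\<theta>1 i = t * \<kappa> i"
      by (rule bex_choice) (rule quot)
    then obtain \<kappa> where "\<forall>i\<in>{..<Suc n}. \<kappa> i \<in> poly_ring (Suc n) \<and> ?\<theta>1 i = t * \<kappa> i" by (elim exE)
    then have \<kappa>: "\<And>i. i < Suc n \<Longrightarrow> \<kappa> i \<in> poly_ring (Suc n)" "\<And>i. i < Suc n \<Longrightarrow> ?\<theta>1 i = t * \<kappa> i" by auto
    show ?case
    proof (cases d)
      case 0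
      have "\<kappa> i = 0" if i: "i < Suc n" for i
      proof (rule homogeneous_quotient_less [OF homogeneous_mvar [of n] mvar_neq_0])
        show "homogeneous_poly 0 (t * \<kappa> i)" using \<theta>1hom [OF i] unfolding \<kappa>(2) [OF i] 0 .
      qed simp
      then have "\<theta> i = (\<Sum>k\<in>K. a k * \<Phi> k i) + 0 * (t * \<eta> i)" if "i < Suc n" for i
        using \<kappa>(2) [OF that] that by simp
      then show ?thesis unfolding gen_def using a_in' by (intro exI [of _ a] exI [of _ 0]) simp
    next
      case (Suc d')
      have \<kappa>hom: "homogeneous_poly d' (\<kappa> i)" if i: "i < Suc n" for i
      proof (rule homogeneous_quotient [OF homogeneous_mvar [of n] mvar_neq_0])
        show "homogeneous_poly (1 + d') (t * \<kappa> i)" using \<theta>1hom [OF i] unfolding \<kappa>(2) [OF i] Suc by simp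
      qed
      have \<kappa>L: "form L dvd dot (Suc n) \<kappa> (vec L)" if L: "L \<in> I" for L
      proof (rule form_dvd_cancel_t [OF L])
        have "t * dot (Suc n) \<kappa> (vec L) = dot (Suc n) (\<lambda>i. t * \<kappa> i) (vec L)" by (simp only: dot_scale_left)
        also have "\<dots> = dot (Suc n) ?\<theta>1 (vec L)" by (rule dot_cong) (simp_all only: \<kappa>(2))
        finally show "form L dvd t * dot (Suc n) \<kappa> (vec L)" using log_vecsD(3) [OF \<theta>1 L] by (simp only:)
      qed
      \<comment> \<open>\<kappa> is logarithmic along all hyperplanes except possibly t = 0, so its
        value on t restricts to a multiple of B. Subtracting the same multiple of \<eta> brings the
        vector back into D(A).\<close>
      have "B dvd trunc n (\<kappa> n)" by (rule B_dvd_trunc) (rule \<kappa>L)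
      then obtain g0 where g0: "g0 \<in> poly_ring n" "trunc n (\<kappa> n) = B * g0"
        by (rule poly_ring_dvdE [OF _ B_in trunc_in_poly_ring])
      define g where "g = hpart d' degB g0"
      have g_in: "g \<in> poly_ring n" using g0 by (simp add: g_def)
      have g_in': "g \<in> poly_ring (Suc n)" by (rule poly_ring_mono [OF g_in]) simp
      have g: "trunc n (\<kappa> n) = B * g"
        using hcomp_mult_hpart [OF homogeneous_B, of d' g0] hcomp_eq [OF homogeneous_trunc [OF \<kappa>hom [OF lessI], of n]]
        unfolding g0(2) g_def by (metis (no_types))
      let ?\<kappa>' = "\<lambda>i. \<kappa> i - g * \<eta> i"
      have \<kappa>'in: "?\<kappa>' \<in> vecs (Suc n) (Suc n)" using \<kappa>(1) g_in' \<eta>(1) by simp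
      have "trunc n (?\<kappa>' n) = 0" using g_in by (simp add: g \<eta>(3) trunc_eq mult.commute)
      then have "t dvd ?\<kappa>' n" using mvar_dvd_iff_trunc [of "?\<kappa>' n" n] \<kappa>'in by simp
      then have "?\<kappa>' \<in> log_vecs"
        unfolding log_vecs_def using \<kappa>'in \<kappa>L \<eta>(2) by (simp add: dot_diff_left dot_scale_left dvd_diff)
      moreover have "homogeneous_poly d' (?\<kappa>' i)" if i: "i < Suc n" for i
        using \<kappa>hom [OF i] hcomp_mult_hpart [OF \<eta>(4) [OF i], of d' g0] homogeneous_hcomp [of d' "\<eta> i * g0"]
        by (simp add: g_def mult.commute)
      ultimately have "gen ?\<kappa>'" using less.IH [of d' ?\<kappa>'] Suc by simp
      then obtain a1 e where a1: "\<And>k. k \<in> K \<Longrightarrow> a1 k \<in> poly_ring (Suc n)" "e \<in> poly_ring (Suc n)"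
        "\<And>i. i < Suc n \<Longrightarrow> ?\<kappa>' i = (\<Sum>k\<in>K. a1 k * \<Phi> k i) + e * (t * \<eta> i)"
        unfolding gen_def by blast
      have "\<theta> i = (\<Sum>k\<in>K. (a k + t * a1 k) * \<Phi> k i) + (g + t * e) * (t * \<eta> i)" if i: "i < Suc n" for i
      proof -
        have "\<theta> i = (\<Sum>k\<in>K. a k * \<Phi> k i) + t * (g * \<eta> i + ((\<Sum>k\<in>K. a1 k * \<Phi> k i) + e * (t * \<eta> i)))"
          using \<kappa>(2) [OF i] unfolding a1(3) [OF i, symmetric] by (simp add: algebra_simps)
        then show ?thesis by (simp add: algebra_simps sum.distrib sum_distrib_left)
      qed
      moreover have "\<forall>k\<in>K. a k + t * a1 k \<in> poly_ring (Suc n)" using a_in' a1(1) by simp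
      moreover have "g + t * e \<in> poly_ring (Suc n)" using g_in' a1(2) by simp
      ultimately show ?thesis unfolding gen_def by (intro exI [of _ "\<lambda>k. a k + t * a1 k"] exI [of _ "g + t * e"]) blast
    qed
  qed
  have gen: "gen \<theta>" if \<theta>: "\<theta> \<in> log_vecs" for \<theta>
  proof -
    obtain N where N: "\<And>i. i < Suc n \<Longrightarrow> \<theta> i = (\<Sum>d<N. hcomp d (\<theta> i))" using vec_sum_hcomp by blast
    have "gen (\<lambda>i. hcomp d (\<theta> i))" for d
      by (rule gen_hom [OF log_vecs_hcomp [OF \<theta>]]) (rule homogeneous_hcomp)
    then have "\<forall>d. \<exists>a e. (\<forall>k\<in>K. a k \<in> poly_ring (Suc n)) \<and> e \<in> poly_ring (Suc n) \<and>
      (\<forall>i<Suc n. hcomp d (\<theta> i) = (\<Sum>k\<in>K. a k * \<Phi> k i) + e * (t * \<eta> i))" unfolding gen_def by blast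
    then obtain a e where "\<forall>d. (\<forall>k\<in>K. a d k \<in> poly_ring (Suc n)) \<and> e d \<in> poly_ring (Suc n) \<and>
      (\<forall>i<Suc n. hcomp d (\<theta> i) = (\<Sum>k\<in>K. a d k * \<Phi> k i) + e d * (t * \<eta> i))"
      unfolding choice_iff by (elim exE)
    then have ae: "\<And>d k. k \<in> K \<Longrightarrow> a d k \<in> poly_ring (Suc n)" "\<And>d. e d \<in> poly_ring (Suc n)"
      "\<And>d i. i < Suc n \<Longrightarrow> hcomp d (\<theta> i) = (\<Sum>k\<in>K. a d k * \<Phi> k i) + e d * (t * \<eta> i)" by blast+
    have "\<theta> i = (\<Sum>k\<in>K. (\<Sum>d<N. a d k) * \<Phi> k i) + (\<Sum>d<N. e d) * (t * \<eta> i)" if i: "i < Suc n" for i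
    proof -
      have "\<theta> i = (\<Sum>d<N. (\<Sum>k\<in>K. a d k * \<Phi> k i) + e d * (t * \<eta> i))"
        by (subst N [OF i]) (simp add: ae(3) [OF i])
      also have "\<dots> = (\<Sum>k\<in>K. (\<Sum>d<N. a d k) * \<Phi> k i) + (\<Sum>d<N. e d) * (t * \<eta> i)"
        unfolding sum.distrib sum_distrib_right by (subst sum.swap) (rule refl)
      finally show ?thesis .
    qed
    then show ?thesis unfolding gen_def
      by (intro exI [of _ "\<lambda>k. \<Sum>d<N. a d k"] exI [of _ "\<Sum>d<N. e d"]) (simp add: ae)
  qed
  have indep: "(\<forall>k\<in>K. a k = 0) \<and> e = 0"
    if "\<And>k. k \<in> K \<Longrightarrow> a k \<in> poly_ring (Suc n)" "e \<in> poly_ring (Suc n)"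
      "\<And>i. i < Suc n \<Longrightarrow> (\<Sum>k\<in>K. a k * \<Phi> k i) + e * (t * \<eta> i) = 0" for a e
  proof -
    \<comment> \<open>Restriction to t = 0 shows that t divides every a k. After division by t, the
      last entries show that t divides e, because those of the \<Phi> k are divisible by t and that
      of \<eta> is B. The quotients satisfy the same relation.\<close>
    have "(\<forall>k\<in>K. t ^ j dvd a k) \<and> t ^ j dvd e" for j
      using that
    proof (induction j arbitrary: a e)
      case (Suc j)
      note a_in = Suc.prems(1) and e_in = Suc.prems(2) and rel = Suc.prems(3)
      have "trunc n (a k) = 0" if k: "k \<in> K" for k
      proof (rule restricted_basisD(5) [OF b _ _ k])
        fix i assume i: "i < n"
        from arg_cong [OF rel [of i], of "trunc n"] i
        show "(\<Sum>k\<in>K. trunc n (a k) * \<phi> k i) = 0" by (simp add: \<Phi>(3) trunc_mvar)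
      qed simp
      then have quot: "\<exists>q\<in>poly_ring (Suc n). a k = t * q" if "k \<in> K" for k
        using that a_in [OF that] mvar_dvd_iff_trunc [of "a k" n]
        by (simp add: poly_ring_dvd_iff [where n = "Suc n", symmetric])
      have "\<exists>a'. \<forall>k\<in>K. a' k \<in> poly_ring (Suc n) \<and> a k = t * a' k" by (rule bex_choice) (rule quot)
      then obtain a' where a': "\<And>k. k \<in> K \<Longrightarrow> a' k \<in> poly_ring (Suc n)" "\<And>k. k \<in> K \<Longrightarrow> a k = t * a' k" by blast
      have rel': "(\<Sum>k\<in>K. a' k * \<Phi> k i) + e * \<eta> i = 0" if i: "i < Suc n" for i
      proof -
        have "t * ((\<Sum>k\<in>K. a' k * \<Phi> k i) + e * \<eta> i) = (\<Sum>k\<in>K. a k * \<Phi> k i) + e * (t * \<eta> i)"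
          by (simp add: a'(2) algebra_simps sum_distrib_left)
        then show ?thesis using rel [OF i] by simp
      qed
      have "t dvd (\<Sum>k\<in>K. a' k * \<Phi> k n)"
        using log_vecsD(2) [OF \<Phi>(1)] by (intro dvd_sum dvd_mult)
      then have "trunc n (\<Sum>k\<in>K. a' k * \<Phi> k n) = 0"
        using trunc_dvd [of t _ n] by (fastforce simp: trunc_mvar simp del: trunc_simps(9))
      with arg_cong [OF rel' [of n], of "trunc n"] have "trunc n e * B = 0"
        by (simp add: \<eta>(3) trunc_eq)
      then have "trunc n e = 0" using B_nonzero by simp
      then have "\<exists>q\<in>poly_ring (Suc n). e = t * q"
        using e_in mvar_dvd_iff_trunc [of e n] by (simp add: poly_ring_dvd_iff [where n = "Suc n", symmetric])
      then obtain e' where e': "e' \<in> poly_ring (Suc n)" "e = t * e'" by blast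
      have "(\<forall>k\<in>K. t ^ j dvd a' k) \<and> t ^ j dvd e'"
      proof (rule Suc.IH)
        fix i assume "i < Suc n"
        from rel' [OF this] show "(\<Sum>k\<in>K. a' k * \<Phi> k i) + e' * (t * \<eta> i) = 0" by (simp add: e'(2) mult_ac)
      qed (use a' e' in auto)
      then show ?case by (auto simp: a'(2) e'(2) intro: mult_dvd_mono)
    qed simp
    then show ?thesis using mvar_power_dvd_imp_0 by blast
  qed
  let ?K = "insert None (Some ` K)"
  let ?\<Phi> = "\<lambda>k. case k of None \<Rightarrow> (\<lambda>i. t * \<eta> i) | Some k \<Rightarrow> \<Phi> k"
  have sumK: "(\<Sum>k\<in>?K. a k * ?\<Phi> k i) = (\<Sum>k\<in>K. a (Some k) * \<Phi> k i) + a None * (t * \<eta> i)" for a i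
    using finK by (simp add: sum.reindex add.commute)
  have "vec_basis ?K ?\<Phi>"
    unfolding vec_basis_def
  proof (intro conjI ballI allI impI)
    fix k assume "k \<in> ?K"
    then show "?\<Phi> k \<in> log_vecs"
    proof (elim insertE imageE)
      assume "k = None"
      then show ?thesis using \<eta>(1,2) by (simp add: log_vecs_def dot_scale_left)
    qed (use \<Phi>(1) in auto)
    from \<open>k \<in> ?K\<close> show "\<exists>d. \<forall>i<Suc n. homogeneous_poly d (?\<Phi> k i)"
    proof (elim insertE imageE)
      assume "k = None"
      then show ?thesis using homogeneous_mult [OF homogeneous_mvar [of n] \<eta>(4)] by auto
    qed (use \<Phi>(2) in auto)
  next
    fix \<theta> assume "\<theta> \<in> log_vecs"
    from gen [OF this] obtain a e where ae: "\<forall>k\<in>K. a k \<in> poly_ring (Suc n)" "e \<in> poly_ring (Suc n)"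
      "\<forall>i<Suc n. \<theta> i = (\<Sum>k\<in>K. a k * \<Phi> k i) + e * (t * \<eta> i)"
      unfolding gen_def by blast
    let ?a = "\<lambda>k. case k of None \<Rightarrow> e | Some k \<Rightarrow> a k"
    have "\<forall>k\<in>?K. ?a k \<in> poly_ring (Suc n)" using ae by auto
    moreover have "\<forall>i<Suc n. \<theta> i = (\<Sum>k\<in>?K. ?a k * ?\<Phi> k i)" unfolding sumK using ae by simp
    ultimately show "\<exists>a. (\<forall>k\<in>?K. a k \<in> poly_ring (Suc n)) \<and> (\<forall>i<Suc n. \<theta> i = (\<Sum>k\<in>?K. a k * ?\<Phi> k i))"
      by (intro exI [of _ ?a] conjI)
  next
    fix a k assume a: "(\<forall>k\<in>?K. a k \<in> poly_ring (Suc n)) \<and> (\<forall>i<Suc n. (\<Sum>k\<in>?K. a k * ?\<Phi> k i) = 0)" and k: "k \<in> ?K"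
    have "(\<forall>k\<in>K. a (Some k) = 0) \<and> a None = 0"
      by (rule indep) (use a in \<open>simp_all only: sumK\<close>, simp_all)
    then show "a k = 0" using k by auto
  qed (use finK in simp)
  then show ?thesis by blast
qed

end

section \<open>Dimensions of spaces of homogeneous polynomials\<close>

text \<open>The polynomial ring has infinite dimension, and \<open>dim\<close> returns 0 for
  subspaces without a finite basis. Monotonicity of \<open>dim\<close> therefore needs this
  condition on the larger space.\<close>

definition bounded_dim :: "('k::field \<Rightarrow> 'v::ab_group_add \<Rightarrow> 'v) \<Rightarrow> 'v set \<Rightarrow> bool" where
  "bounded_dim scale U \<longleftrightarrow> (\<exists>S. finite S \<and> U \<subseteq> module.span scale S)"

context vector_space
begin

lemma bounded_dim_mono: "U \<subseteq> V \<Longrightarrow> bounded_dim scale V \<Longrightarrow> bounded_dim scale U"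
  by (auto simp: bounded_dim_def)

lemma bounded_dim_basis:
  assumes "bounded_dim scale U"
  obtains S where "finite S" "S \<subseteq> U" "independent S" "U \<subseteq> span S" "card S = dim U"
proof -
  obtain T where T: "finite T" "U \<subseteq> span T" using assms by (auto simp: bounded_dim_def)
  obtain S where S: "S \<subseteq> U" "independent S" "U \<subseteq> span S" "card S = dim U" by (rule basis_exists [of U])
  have "finite S" using independent_span_bound [OF T(1) S(2)] S(1) T(2) by auto
  then show ?thesis using that S by blast
qed

lemma independent_card_le: "bounded_dim scale U \<Longrightarrow> independent S \<Longrightarrow> S \<subseteq> U \<Longrightarrow> card S \<le> dim U"
  by (metis bounded_dim_basis independent_span_bound order_trans)

lemma dim_mono_bounded: "U \<subseteq> V \<Longrightarrow> bounded_dim scale V \<Longrightarrow> dim U \<le> dim V"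
  by (metis bounded_dim_basis bounded_dim_mono independent_card_le order_trans)

lemma dim_pos_nonzero: "0 < dim U \<Longrightarrow> \<exists>x\<in>U. x \<noteq> 0"
proof (rule ccontr)
  assume "0 < dim U" "\<not> (\<exists>x\<in>U. x \<noteq> 0)"
  then have "U \<subseteq> span {}" by auto
  from dim_le_card [OF this] show False using \<open>0 < dim U\<close> by simp
qed

end

context vector_space_pair
begin

lemma bounded_dim_image:
  assumes f: "Vector_Spaces.linear s1 s2 f" and "bounded_dim s1 U" shows "bounded_dim s2 (f ` U)"
proof -
  obtain T where T: "finite T" "U \<subseteq> vs1.span T" using assms(2) by (auto simp: bounded_dim_def)
  then have "f ` U \<subseteq> vs2.span (f ` T)" using linear_span_image [OF f, of T] by blast
  then show ?thesis using T(1) by (auto simp: bounded_dim_def)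
qed

lemma dim_image_le_bounded:
  assumes f: "Vector_Spaces.linear s1 s2 f" and U: "bounded_dim s1 U" shows "vs2.dim (f ` U) \<le> vs1.dim U"
proof -
  obtain S where S: "finite S" "U \<subseteq> vs1.span S" "card S = vs1.dim U"
    by (rule vs1.bounded_dim_basis [OF U])
  have "f ` U \<subseteq> vs2.span (f ` S)" using linear_span_image [OF f, of S] S by blast
  then have "vs2.dim (f ` U) \<le> card (f ` S)" using S(1) by (intro vs2.dim_le_card) auto
  also have "\<dots> \<le> card S" by (rule card_image_le [OF S(1)])
  finally show ?thesis using S by simp
qed

text \<open>Preimages of a basis of the image, together with a basis of the kernel, span U. This
  half of the rank-nullity theorem is the one that the estimates use.\<close>

lemma dim_le_ker_plus_image:
  assumes f: "Vector_Spaces.linear s1 s2 f" and sub: "vs1.subspace U" and U: "bounded_dim s1 U"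
  shows "vs1.dim U \<le> vs1.dim {x \<in> U. f x = 0} + vs2.dim (f ` U)"
proof -
  have "bounded_dim s1 {x \<in> U. f x = 0}" by (rule vs1.bounded_dim_mono [OF _ U]) auto
  then obtain S where S: "finite S" "S \<subseteq> {x \<in> U. f x = 0}" "{x \<in> U. f x = 0} \<subseteq> vs1.span S"
    "card S = vs1.dim {x \<in> U. f x = 0}" by (rule vs1.bounded_dim_basis)
  obtain C where C: "finite C" "C \<subseteq> f ` U" "f ` U \<subseteq> vs2.span C" "card C = vs2.dim (f ` U)"
    by (rule vs2.bounded_dim_basis [OF bounded_dim_image [OF f U]])
  have "\<forall>c\<in>C. \<exists>u. u \<in> U \<and> f u = c" using C(2) by auto
  then obtain g where g: "\<And>c. c \<in> C \<Longrightarrow> g c \<in> U" "\<And>c. c \<in> C \<Longrightarrow> f (g c) = c" by metis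
  have "U \<subseteq> vs1.span (S \<union> g ` C)"
  proof
    fix x assume x: "x \<in> U"
    then have "f x \<in> vs2.span C" using C(3) by blast
    then obtain r where r: "f x = (\<Sum>c\<in>C. s2 (r c) c)"
      unfolding vs2.span_finite [OF C(1)] by auto
    define y where "y = (\<Sum>c\<in>C. s1 (r c) (g c))"
    have "y \<in> U" unfolding y_def by (intro vs1.subspace_sum sub vs1.subspace_scale g)
    have "f y = f x" unfolding y_def r linear_sum [OF f] by (rule sum.cong) (auto simp: linear_scale [OF f] g)
    then have "x - y \<in> {x \<in> U. f x = 0}"
      using x \<open>y \<in> U\<close> by (simp add: vs1.subspace_diff [OF sub] linear_diff [OF f])
    then have "x - y \<in> vs1.span S" using S(3) by blast
    then have 1: "x - y \<in> vs1.span (S \<union> g ` C)" by (rule subsetD [OF vs1.span_mono, rotated]) simp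
    have "y \<in> vs1.span (S \<union> g ` C)" unfolding y_def
      by (intro vs1.span_sum vs1.span_scale vs1.span_base) auto
    from vs1.span_add [OF 1 this] show "x \<in> vs1.span (S \<union> g ` C)" by simp
  qed
  then have "vs1.dim U \<le> card (S \<union> g ` C)" using S C by (intro vs1.dim_le_card) auto
  also have "\<dots> \<le> card S + card (g ` C)" by (rule card_Un_le)
  also have "\<dots> \<le> card S + card C" using card_image_le [OF C(1)] by simp
  finally show ?thesis using S C by simp
qed

end

section \<open>Graded pieces of polynomial rings in two and three variables\<close>

definition pscale :: "'k::field \<Rightarrow> 'k mpol \<Rightarrow> 'k mpol" where
  "pscale c p = mconst c * p"

definition pscale2 :: "'k::field \<Rightarrow> 'k mpol \<times> 'k mpol \<Rightarrow> 'k mpol \<times> 'k mpol" where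
  "pscale2 c x = (mconst c * fst x, mconst c * snd x)"

interpretation mp: vector_space pscale
  by unfold_locales (simp_all add: pscale_def mconst_add mconst_mult algebra_simps)

interpretation mp2: vector_space pscale2
  by unfold_locales (simp_all add: pscale2_def mconst_add mconst_mult algebra_simps prod_eq_iff)

interpretation mp_mp: vector_space_pair pscale pscale ..
interpretation mp2_mp: vector_space_pair pscale2 pscale ..
interpretation mp2_mp2: vector_space_pair pscale2 pscale2 ..

definition poly_vars :: "nat set \<Rightarrow> ('k::field) mpol set" where
  "poly_vars V = {p. \<forall>m\<in>Poly_Mapping.keys p. Poly_Mapping.keys m \<subseteq> V}"

lemma poly_vars_lessThan: "poly_vars {..<n} = poly_ring n"
  by (simp add: poly_vars_def poly_ring_def)

lemma poly_vars_mconst: "mconst c \<in> poly_vars V"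
  by (auto simp: poly_vars_def mconst_def)

lemma poly_vars_mvar: "i \<in> V \<Longrightarrow> mvar i \<in> poly_vars V"
  by (auto simp: poly_vars_def mvar_def)

lemma poly_vars_add: "p \<in> poly_vars V \<Longrightarrow> q \<in> poly_vars V \<Longrightarrow> p + q \<in> poly_vars V"
  unfolding poly_vars_def using Poly_Mapping.keys_add [of p q] by blast

lemma poly_vars_mult: "p \<in> poly_vars V \<Longrightarrow> q \<in> poly_vars V \<Longrightarrow> p * q \<in> poly_vars V"
proof -
  assume pq: "p \<in> poly_vars V" "q \<in> poly_vars V"
  { fix m assume "m \<in> Poly_Mapping.keys (p * q)"
    then obtain a b where "m = a + b" "a \<in> Poly_Mapping.keys p" "b \<in> Poly_Mapping.keys q"
      using Poly_Mapping.keys_mult [of p q] by blast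
    then have "Poly_Mapping.keys m \<subseteq> V"
      using pq Poly_Mapping.keys_add [of a b] unfolding poly_vars_def by blast }
  then show ?thesis by (simp add: poly_vars_def)
qed

lemma poly_vars_sum: "(\<And>x. x \<in> A \<Longrightarrow> f x \<in> poly_vars V) \<Longrightarrow> sum f A \<in> poly_vars V"
  by (induction A rule: infinite_finite_induct) (simp_all add: poly_vars_add, simp_all add: poly_vars_def)

lemma elim_in_poly_vars:
  assumes b: "lin n b \<noteq> 0" and p: "p \<in> poly_ring n"
  shows "elim n b p \<in> poly_vars ({..<n} - {elim_index n b})"
  using p
proof (induction rule: poly_ring_induct)
  case (var i)
  let ?j = "elim_index n b"
  show ?case
  proof (cases "i = ?j")
    case True
    have "mvar ?j - mconst (inverse (b ?j)) * lin n b
        = (\<Sum>i\<in>{..<n} - {?j}. mconst (- inverse (b ?j) * b i) * mvar i)"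
      using elim_index [OF b] unfolding dot_def
      by (subst sum.remove [of _ ?j])
        (simp_all add: distrib_left mult.assoc [symmetric] mconst_mult [symmetric] sum_distrib_left
          mconst_uminus sum_negf)
    then show ?thesis using True
      by (simp add: elim_def) (intro poly_vars_sum poly_vars_mult poly_vars_mconst poly_vars_mvar, simp)
  qed (use var in \<open>simp add: elim_def poly_vars_mvar\<close>)
qed (simp_all add: poly_vars_mconst poly_vars_add poly_vars_mult)

definition hpoly :: "nat set \<Rightarrow> nat \<Rightarrow> ('k::field) mpol set" where
  "hpoly V d = {p \<in> poly_vars V. homogeneous_poly d p}"

definition monomials :: "nat set \<Rightarrow> nat \<Rightarrow> (nat \<Rightarrow>\<^sub>0 nat) set" where
  "monomials V d = {m. Poly_Mapping.keys m \<subseteq> V \<and> mdeg m = d}"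

lemma hpoly_span: "hpoly V d \<subseteq> mp.span ((\<lambda>m. Poly_Mapping.single m 1) ` monomials V d)"
proof
  fix p :: "'a mpol" assume "p \<in> hpoly V d"
  then have *: "m \<in> monomials V d" if "m \<in> Poly_Mapping.keys p" for m
    using that by (auto simp: hpoly_def poly_vars_def monomials_def homogeneous_poly_iff)
  have "p = (\<Sum>m\<in>Poly_Mapping.keys p. pscale (Poly_Mapping.lookup p m) (Poly_Mapping.single m 1))"
    by (subst poly_mapping_sum_single [of p]) (simp add: pscale_def mconst_single)
  also have "\<dots> \<in> mp.span ((\<lambda>m. Poly_Mapping.single m 1) ` monomials V d)"
    by (intro mp.span_sum mp.span_scale mp.span_base imageI *)
  finally show "p \<in> mp.span ((\<lambda>m. Poly_Mapping.single m 1) ` monomials V d)" .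
qed

lemma monomials_lookup_0:
  assumes "m \<in> monomials V d" "k \<notin> V" shows "Poly_Mapping.lookup m k = 0"
proof -
  have "k \<notin> Poly_Mapping.keys m" using assms by (auto simp: monomials_def)
  then show ?thesis by (simp add: in_keys_iff)
qed

lemma mdeg_two:
  assumes "i \<noteq> j" "Poly_Mapping.keys m \<subseteq> {i, j}"
  shows "mdeg m = Poly_Mapping.lookup m i + Poly_Mapping.lookup m j"
proof -
  have "mdeg m = (\<Sum>k\<in>{i, j}. Poly_Mapping.lookup m k)"
    unfolding mdeg_def using assms(2) by (intro sum.mono_neutral_left) (auto simp: in_keys_iff)
  then show ?thesis using assms(1) by simp
qed

lemma monomials_two:
  assumes "i \<noteq> j" shows "finite (monomials {i, j} d)" "card (monomials {i, j} d) \<le> d + 1"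
proof -
  have inj: "inj_on (\<lambda>m. Poly_Mapping.lookup m i) (monomials {i, j} d)"
  proof (rule inj_onI, rule poly_mapping_eqI)
    fix m m' k
    assume m: "m \<in> monomials {i, j} d" "m' \<in> monomials {i, j} d"
      and eq: "Poly_Mapping.lookup m i = Poly_Mapping.lookup m' i"
    then have "Poly_Mapping.lookup m j = Poly_Mapping.lookup m' j"
      using mdeg_two [OF assms, of m] mdeg_two [OF assms, of m'] by (simp add: monomials_def)
    moreover have "Poly_Mapping.lookup m k = 0 \<and> Poly_Mapping.lookup m' k = 0" if "k \<noteq> i" "k \<noteq> j"
      using m that monomials_lookup_0 [of _ "{i, j}" d k] by simp
    ultimately show "Poly_Mapping.lookup m k = Poly_Mapping.lookup m' k"
      using eq by (cases "k = i \<or> k = j") auto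
  qed
  have sub: "(\<lambda>m. Poly_Mapping.lookup m i) ` monomials {i, j} d \<subseteq> {..d}"
    using mdeg_two [OF assms] by (auto simp: monomials_def)
  show "finite (monomials {i, j} d)" using finite_imageD [OF finite_subset [OF sub] inj] by simp
  have "card (monomials {i, j} d) \<le> card {..d}" by (rule card_inj_on_le [OF inj sub]) simp
  then show "card (monomials {i, j} d) \<le> d + 1" by simp
qed

text \<open>The exponents (a, b, d - a - b) are counted; doubling avoids a division. Pieces in three
  variables are estimated from below, whereas those in two variables are estimated from above in
  \<open>monomials_two\<close>.\<close>

lemma monomials_three:
  shows "finite (monomials {..<3} d)" "(d + 1) * (d + 2) \<le> 2 * card (monomials {..<3} d)"
proof -
  have V: "{..<3} = {0, 1, 2::nat}" by auto
  have deg: "mdeg m = Poly_Mapping.lookup m 0 + Poly_Mapping.lookup m 1 + Poly_Mapping.lookup m 2"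
    if "Poly_Mapping.keys m \<subseteq> {..<3}" for m
  proof -
    have "mdeg m = (\<Sum>k\<in>{0, 1, 2}. Poly_Mapping.lookup m k)"
      unfolding mdeg_def using that V by (intro sum.mono_neutral_left) (auto simp: in_keys_iff)
    then show ?thesis by simp
  qed
  have inj: "inj_on (\<lambda>m. (Poly_Mapping.lookup m 0, Poly_Mapping.lookup m 1, Poly_Mapping.lookup m 2)) (monomials {..<3} d)"
  proof (rule inj_onI, rule poly_mapping_eqI)
    fix m m' k
    assume m: "m \<in> monomials {..<3} d" "m' \<in> monomials {..<3} d"
      and eq: "(Poly_Mapping.lookup m 0, Poly_Mapping.lookup m 1, Poly_Mapping.lookup m 2) =
       (Poly_Mapping.lookup m' 0, Poly_Mapping.lookup m' 1, Poly_Mapping.lookup m' 2)"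
    have "Poly_Mapping.lookup m k = 0 \<and> Poly_Mapping.lookup m' k = 0" if "\<not> k < 3"
      using m that monomials_lookup_0 [of _ "{..<3}" d k] by simp
    moreover have "k < 3 \<longleftrightarrow> k = 0 \<or> k = 1 \<or> k = 2" by auto
    ultimately show "Poly_Mapping.lookup m k = Poly_Mapping.lookup m' k"
      using eq by auto
  qed
  have sub: "(\<lambda>m. (Poly_Mapping.lookup m 0, Poly_Mapping.lookup m 1, Poly_Mapping.lookup m 2)) ` monomials {..<3} d
      \<subseteq> {..d} \<times> {..d} \<times> {..d}"
    using deg by (auto simp: monomials_def)
  show fin: "finite (monomials {..<3} d)"
    using finite_imageD [OF finite_subset [OF sub] inj] by simp
  define T where "T = (SIGMA a:{..d}. {..d - a})"
  define f :: "nat \<times> nat \<Rightarrow> nat \<Rightarrow>\<^sub>0 nat" where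
    "f x = Poly_Mapping.single 0 (fst x) + Poly_Mapping.single 1 (snd x) + Poly_Mapping.single 2 (d - fst x - snd x)" for x
  have f0: "Poly_Mapping.lookup (f x) 0 = fst x" and f1: "Poly_Mapping.lookup (f x) 1 = snd x" for x
    by (simp_all add: f_def lookup_add lookup_single when_def)
  have "inj_on f T"
    by (rule inj_onI) (metis f0 f1 prod_eq_iff)
  moreover have "f x \<in> monomials {..<3} d" if "x \<in> T" for x
  proof -
    have x: "fst x \<le> d" "snd x \<le> d - fst x" using that by (auto simp: T_def)
    have "Poly_Mapping.keys (f x) \<subseteq> {..<3}"
      by (auto simp: f_def in_keys_iff lookup_add lookup_single when_def split: if_splits)
    then show ?thesis using x by (simp add: monomials_def f_def)
  qed
  then have "f ` T \<subseteq> monomials {..<3} d" by blast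
  ultimately have "card T \<le> card (monomials {..<3} d)" by (rule card_inj_on_le [OF _ _ fin])
  moreover have "card T = (\<Sum>a\<le>d. d - a + 1)" by (simp add: T_def)
  moreover have "(\<Sum>a\<le>d. d - a + 1) = (\<Sum>a\<le>d. a + 1)"
    by (rule sum.reindex_bij_witness [of _ "\<lambda>a. d - a" "\<lambda>a. d - a"]) auto
  moreover have "2 * (\<Sum>a\<le>d. a + 1) = (d + 1) * (d + 2)" by (induction d) auto
  ultimately show "(d + 1) * (d + 2) \<le> 2 * card (monomials {..<3} d)" by simp
qed

lemma hpoly_subspace: "mp.subspace (hpoly V d)"
  unfolding mp.subspace_def hpoly_def
  by (auto simp: poly_vars_add pscale_def poly_vars_mult poly_vars_mconst) (auto simp: poly_vars_def)

lemma hpoly_bounded: "finite (monomials V d) \<Longrightarrow> bounded_dim pscale (hpoly V d)"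
  unfolding bounded_dim_def using hpoly_span by blast

lemma dim_hpoly_two:
  assumes "i \<noteq> j"
  shows "bounded_dim pscale (hpoly {i, j} d :: ('k::field) mpol set)" "mp.dim (hpoly {i, j} d :: 'k mpol set) \<le> d + 1"
proof -
  note mon = monomials_two [OF assms, of d]
  show "bounded_dim pscale (hpoly {i, j} d :: 'k mpol set)" by (rule hpoly_bounded [OF mon(1)])
  have "mp.dim (hpoly {i, j} d :: 'k mpol set) \<le> card ((\<lambda>m. Poly_Mapping.single m (1::'k)) ` monomials {i, j} d)"
    using mon(1) by (intro mp.dim_le_card hpoly_span) simp
  also have "\<dots> \<le> card (monomials {i, j} d)" by (rule card_image_le [OF mon(1)])
  finally show "mp.dim (hpoly {i, j} d :: 'k mpol set) \<le> d + 1" using mon(2) by simp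
qed

lemma hpoly_pairs_bounded: "bounded_dim pscale2 (hpoly {..<3} d \<times> hpoly {..<3} d)"
proof -
  let ?M = "(\<lambda>m. Poly_Mapping.single m 1) ` monomials {..<3} d"
  have lin: "Vector_Spaces.linear pscale pscale2 (\<lambda>p. (p, 0))" "Vector_Spaces.linear pscale pscale2 (\<lambda>p. (0, p))"
    by (unfold_locales; simp add: pscale_def pscale2_def)+
  interpret vector_space_pair pscale pscale2 ..
  let ?S = "(\<lambda>p. (p, 0)) ` ?M \<union> (\<lambda>p. (0, p)) ` ?M"
  have "(p, q) \<in> mp2.span ?S" if "p \<in> hpoly {..<3} d" "q \<in> hpoly {..<3} d" for p q
  proof -
    have "(p, 0) \<in> mp2.span ((\<lambda>p. (p, 0)) ` ?M)" "(0, q) \<in> mp2.span ((\<lambda>p. (0, p)) ` ?M)"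
      using hpoly_span that linear_span_image [OF lin(1), of ?M] linear_span_image [OF lin(2), of ?M] by blast+
    then have "(p, 0) \<in> mp2.span ?S" "(0, q) \<in> mp2.span ?S"
      by (auto intro: subsetD [OF mp2.span_mono, rotated])
    from mp2.span_add [OF this] show ?thesis by simp
  qed
  then show ?thesis unfolding bounded_dim_def using monomials_three(1) [of d] by (intro exI [of _ ?S]) auto
qed

lemma dim_hpoly_pairs: "(d + 1) * (d + 2) \<le> mp2.dim (hpoly {..<3} d \<times> (hpoly {..<3} d :: ('k::field) mpol set))"
proof -
  let ?M = "monomials {..<3} d"
  let ?e = "\<lambda>(b, m). if b then (Poly_Mapping.single m (1::'k), 0 :: 'k mpol) else (0, Poly_Mapping.single m 1)"
  have M: "Poly_Mapping.single m c \<in> hpoly {..<3} d" if "m \<in> ?M" for m and c :: 'k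
    using that by (auto simp: monomials_def hpoly_def poly_vars_def homogeneous_poly_iff)
  have 0: "(0 :: 'k mpol) \<in> hpoly {..<3} d" by (auto simp: hpoly_def poly_vars_def)
  have sub: "?e ` (UNIV \<times> ?M) \<subseteq> hpoly {..<3} d \<times> hpoly {..<3} d"
    using M 0 by (auto split: if_splits)
  have eq: "Poly_Mapping.single m (1::'k) = Poly_Mapping.single m' 1 \<longleftrightarrow> m = m'" for m m' :: "nat \<Rightarrow>\<^sub>0 nat"
    by (metis lookup_single_eq lookup_single_not_eq one_neq_zero)
  have nz: "Poly_Mapping.single m (1::'k) \<noteq> 0" for m :: "nat \<Rightarrow>\<^sub>0 nat"
    by (metis lookup_single_eq lookup_zero one_neq_zero)
  have inj: "inj_on ?e (UNIV \<times> ?M)"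
    by (rule inj_onI) (auto split: if_splits simp: eq nz nz [symmetric])
  have "mp2.independent (?e ` (UNIV \<times> ?M))"
    unfolding mp2.independent_explicit_finite_subsets
  proof (intro allI impI ballI)
    fix A u v
    assume A: "A \<subseteq> ?e ` (UNIV \<times> ?M)" "finite A" and 0: "(\<Sum>v\<in>A. pscale2 (u v) v) = 0" and v: "v \<in> A"
    obtain b m where v_eq: "v = ?e (b, m)" using A v by blast
    \<comment> \<open>c reads off a coefficient to which v alone contributes: that of the monomial m
      in the component selected by b.\<close>
    define c where "c x = (Poly_Mapping.lookup (if b then fst x else snd x) m :: 'k)" for x
    have c_0: "c 0 = 0" and c_add: "c (x + y) = c x + c y" for x y by (simp_all add: c_def lookup_add)
    have c_sum: "c (\<Sum>x\<in>A. g x) = (\<Sum>x\<in>A. c (g x))" for g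
      using A(2) by (induction A rule: finite_induct) (simp_all add: c_0 c_add)
    have "c (pscale2 (u x) x) = (if x = v then u v else 0)" if x: "x \<in> A" for x
    proof -
      obtain b' m' where "x = ?e (b', m')" using A x by blast
      then show ?thesis unfolding v_eq c_def
        by (cases b; cases b') (auto simp: pscale2_def lookup_mconst_mult lookup_single when_def eq nz nz [symmetric])
    qed
    then have "c (\<Sum>x\<in>A. pscale2 (u x) x) = (\<Sum>x\<in>A. if x = v then u v else 0)"
      unfolding c_sum by (intro sum.cong) auto
    then show "u v = 0" using 0 A(2) v c_0 by simp
  qed
  then have "card (?e ` (UNIV \<times> ?M)) \<le> mp2.dim (hpoly {..<3} d \<times> (hpoly {..<3} d :: 'k mpol set))"
    by (rule mp2.independent_card_le [OF hpoly_pairs_bounded _ sub])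
  moreover have "card (?e ` (UNIV \<times> ?M)) = 2 * card ?M"
    by (subst card_image [OF inj]) (simp add: card_cartesian_product)
  ultimately show ?thesis using monomials_three(2) [of d] by simp
qed

section \<open>Terao's divisibility for restrictions\<close>

context linear_forms
begin

lemma cancels_elim:
  assumes "L \<in> J" "e \<in> J" "e \<noteq> L" "\<not> span2 (\<beta> L) (\<beta> e) (\<beta> e')" "e' \<in> J"
  shows "cancels (elim n (\<beta> L) (lin n (\<beta> e))) (elim n (\<beta> L) (lin n (\<beta> e')))"
    and "elim n (\<beta> L) (lin n (\<beta> e)) \<noteq> 0"
proof -
  have L0: "lin n (\<beta> L) \<noteq> 0" by (rule lin_nonzero) fact
  define q where "q x = \<beta> x (elim_index n (\<beta> L)) / \<beta> L (elim_index n (\<beta> L))" for x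
  have r: "elim n (\<beta> L) (lin n (\<beta> x)) = lin n (\<lambda>i. \<beta> x i - q x * \<beta> L i)" for x
    unfolding q_def by (rule elim_lin [OF L0])
  show nz: "elim n (\<beta> L) (lin n (\<beta> e)) \<noteq> 0"
    using non_prop' [of e L "q e"] assms by (simp add: r lin_eq_0_iff)
  show "cancels (elim n (\<beta> L) (lin n (\<beta> e))) (elim n (\<beta> L) (lin n (\<beta> e')))"
    unfolding r
  proof (rule cancels_lin)
    show "lin n (\<lambda>i. \<beta> e i - q e * \<beta> L i) \<noteq> 0" using nz by (simp add: r)
    fix s
    show "\<not> (\<forall>i<n. \<beta> e' i - q e' * \<beta> L i = s * (\<beta> e i - q e * \<beta> L i))"
    proof
      assume *: "\<forall>i<n. \<beta> e' i - q e' * \<beta> L i = s * (\<beta> e i - q e * \<beta> L i)"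
      have "\<beta> e' i = (q e' - s * q e) * \<beta> L i + s * \<beta> e i" for i
      proof (cases "i < n")
        case True
        then show ?thesis using * by (simp add: algebra_simps)
      next
        case False
        then show ?thesis using assms supp [of e i] supp [of e' i] supp [of L i] by simp
      qed
      then show False using assms(4) unfolding span2_def by blast
    qed
  qed
qed

text \<open>Terao's polynomial for the restriction to L: among the forms with the same trace on L,
  all but one divide the value. If r represents the trace of e, a non-zero scalar multiple of l_r
  f(L) - l_L f(r) equals l_e f(L) - l_L f(e), so l_e divides it. On L the second term vanishes and
  l_r cancels.\<close>

lemma elim_prod_dvd:
  assumes E: "E \<subseteq> J" and L: "L \<in> J" "L \<notin> E"
    and f: "\<And>e. e \<in> E \<Longrightarrow> lin n (\<beta> e) dvd dot n f (\<beta> e)"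
    and pt: "\<And>e e'. e \<in> E \<Longrightarrow> e' \<in> E \<Longrightarrow> pt e = pt e' \<longleftrightarrow> span2 (\<beta> L) (\<beta> e) (\<beta> e')"
    and R: "\<And>X. X \<in> pt ` E \<Longrightarrow> r X \<in> E \<and> pt (r X) = X"
  shows "(\<Prod>e\<in>E - r ` pt ` E. elim n (\<beta> L) (lin n (\<beta> e))) dvd elim n (\<beta> L) (dot n f (\<beta> L))"
proof -
  let ?l = "\<lambda>e. lin n (\<beta> e)" and ?el = "\<lambda>e. elim n (\<beta> L) (lin n (\<beta> e))" and ?g = "elim n (\<beta> L) (dot n f (\<beta> L))"
  let ?T = "E - r ` pt ` E"
  have fE: "finite E" by (rule finite_subset [OF E finite_J])
  have L0: "?l L \<noteq> 0" by (rule lin_nonzero) fact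
  have cls: "(\<Prod>e\<in>{e \<in> ?T. pt e = X}. ?el e) dvd ?g" if X: "X \<in> pt ` E" for X
  proof -
    let ?C = "{e \<in> E. pt e = X}"
    have rX: "r X \<in> E" "pt (r X) = X" using R [OF X] by auto
    let ?D = "?l (r X) * dot n f (\<beta> L) - ?l L * dot n f (\<beta> (r X))"
    have "?l e dvd ?D" if e: "e \<in> ?C" for e
    proof -
      have eE: "e \<in> E" "pt (r X) = pt e" using e rX by auto
      then have "span2 (\<beta> L) (\<beta> (r X)) (\<beta> e)" using pt rX by blast
      then obtain a b where ab: "\<beta> e = (\<lambda>i. a * \<beta> L i + b * \<beta> (r X) i)" by (auto simp: span2_def)
      have le: "dot n h (\<beta> e) = mconst a * dot n h (\<beta> L) + mconst b * dot n h (\<beta> (r X))" for h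
        by (simp only: ab dot_add_right dot_scale_right)
      have "b \<noteq> 0"
      proof
        assume "b = 0"
        then have "\<beta> e = (\<lambda>i. a * \<beta> L i)" using ab by simp
        then show False using non_prop [of e L a] eE E L by blast
      qed
      have "mconst b * ?D = ?l e * dot n f (\<beta> L) - ?l L * dot n f (\<beta> e)"
        unfolding le by (simp add: algebra_simps)
      then have "?l e dvd mconst b * ?D" using f [OF eE(1)] by (simp add: dvd_diff)
      then have "?l e dvd mconst (inverse b) * (mconst b * ?D)" by (rule dvd_mult)
      then show ?thesis by (simp only: mconst_inverse_mult [OF \<open>b \<noteq> 0\<close>])
    qed
    then have "(\<Prod>e\<in>?C. ?l e) dvd ?D"
      by (rule prod_dvd_of_cancels) (use E in \<open>auto intro: cancels_forms\<close>)
    then obtain k where k: "?D = (\<Prod>e\<in>?C. ?l e) * k" by (rule dvdE)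
    have "elim n (\<beta> L) ?D = (\<Prod>e\<in>?C. ?el e) * elim n (\<beta> L) k" unfolding k by simp
    then have "?el (r X) * ?g = (\<Prod>e\<in>?C. ?el e) * elim n (\<beta> L) k" by (simp add: elim_self [OF L0])
    moreover have "?C = insert (r X) (?C - {r X})" using rX by auto
    then have "(\<Prod>e\<in>?C. ?el e) = ?el (r X) * (\<Prod>e\<in>?C - {r X}. ?el e)"
      using fE rX by (subst prod.remove [of _ "r X"]) auto
    moreover have "?el (r X) \<noteq> 0"
      using non_prop' [of "r X" L] rX E L L0 lin_dvd_iff_elim [OF L0, of "?l (r X)"] lin_dvd_lin [of n "\<beta> L" "\<beta> (r X)"] by blast
    ultimately have "?g = (\<Prod>e\<in>?C - {r X}. ?el e) * elim n (\<beta> L) k" by (simp add: mult.assoc)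
    moreover have "{e \<in> ?T. pt e = X} = ?C - {r X}" using R by auto
    ultimately show ?thesis by simp
  qed
  have "(\<Prod>X\<in>pt ` E. \<Prod>e\<in>{e \<in> ?T. pt e = X}. ?el e) dvd ?g"
  proof (rule prod_dvd_of_cancels [OF cls])
    fix X X' assume "X \<in> pt ` E" "X' \<in> pt ` E" "X \<noteq> X'"
    then show "cancels (\<Prod>e\<in>{e \<in> ?T. pt e = X}. ?el e) (\<Prod>e\<in>{e \<in> ?T. pt e = X'}. ?el e)"
    proof (intro cancels_prod_left cancels_prod_right cancels_elim(1))
      fix e e' assume "e \<in> {e \<in> ?T. pt e = X}" "e' \<in> {e \<in> ?T. pt e = X'}"
      then show "\<not> span2 (\<beta> L) (\<beta> e) (\<beta> e')" using pt [of e e'] \<open>X \<noteq> X'\<close> by auto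
    qed (use E L in auto)
  qed
  moreover have "(\<Prod>X\<in>pt ` E. \<Prod>e\<in>{e \<in> ?T. pt e = X}. ?el e) = (\<Prod>e\<in>?T. ?el e)"
    by (rule prod.group) (use fE in auto)
  ultimately show ?thesis by simp
qed

end

section \<open>Counting in three variables\<close>

context pencils
begin

text \<open>\<open>None\<close> stands for the distinguished hyperplane t = 0, so that
  \<open>lines I\<close> indexes the whole arrangement.\<close>

definition covec :: "'i option \<Rightarrow> nat \<Rightarrow> 'k" where
  "covec e = (case e of None \<Rightarrow> (\<lambda>i. if i = n then 1 else 0) | Some L \<Rightarrow> vec L)"

lemma covec_simps [simp]: "covec None = (\<lambda>i. if i = n then 1 else 0)" "covec (Some L) = vec L"
  by (simp_all add: covec_def)

definition lines :: "'i set \<Rightarrow> 'i option set" where "lines I' = insert None (Some ` I')"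

lemma linear_forms_lines: "linear_forms (Suc n) (lines I) covec"
proof
  show "finite (lines I)" by (simp add: lines_def finite_I)
  fix Y assume Y: "Y \<in> lines I"
  show "covec Y i = 0" if "Suc n \<le> i" for i
    using Y that supp [OF zJ, of _ i] by (auto simp: lines_def vec_def)
  show "lin (Suc n) (covec Y) \<noteq> 0"
    using Y form_nonzero by (auto simp: lines_def form_lin [symmetric]) (simp add: dot_def)
  fix Z s assume Z: "Z \<in> lines I" "Y \<noteq> Z"
  have nz: "\<exists>i. i \<noteq> n \<and> vec L i \<noteq> 0" if "L \<in> I" for L
    using lin_nonzero [OF zJ [OF that]] lin_eq_0_iff [of n "\<beta> (z L)"] by (auto simp: vec_def)
  have vec_ne: "vec L i = \<beta> (z L) i" if "i \<noteq> n" for L i using that by (simp add: vec_def)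
  show "covec Y \<noteq> (\<lambda>i. s * covec Z i)"
  proof
    assume eq: "covec Y = (\<lambda>i. s * covec Z i)"
    show False
    proof (cases Y)
      case None
      then obtain L where L: "Z = Some L" "L \<in> I" using Z by (auto simp: lines_def)
      obtain i where i: "i \<noteq> n" "vec L i \<noteq> 0" using nz [OF L(2)] by blast
      have "s = 0" using fun_cong [OF eq, of i] i by (simp add: None L)
      then show False using fun_cong [OF eq, of n] by (simp add: None)
    next
      case (Some L)
      then have L: "L \<in> I" using Y by (auto simp: lines_def)
      obtain i where i: "i \<noteq> n" "vec L i \<noteq> 0" using nz [OF L] by blast
      show False
      proof (cases Z)
        case None
        then show False using fun_cong [OF eq, of i] i by (simp add: Some)
      next
        case (Some L')
        then have L': "L' \<in> I" "L \<noteq> L'" using Z \<open>Y = Some L\<close> by (auto simp: lines_def)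
        have eq': "vec L k = s * vec L' k" for k using fun_cong [OF eq, of k] by (simp add: Some \<open>Y = Some L\<close>)
        have "\<beta> (z L) k = s * \<beta> (z L') k" for k
          using eq' [of k] supp [OF zJ [OF L], of n] supp [OF zJ [OF L'(1)], of n] by (cases "k = n") (auto simp: vec_ne)
        then have zeq: "z L = z L'" using non_prop [OF zJ [OF L] zJ [OF L'(1)], of s] by blast
        have "\<beta> (z L) i = s * \<beta> (z L) i" using eq' [of i] i by (simp add: vec_ne zeq)
        then have "s = 1" using i by (simp add: vec_ne)
        then have "c L = c L'" using eq' [of n] by (simp add: vec_def)
        then show False using c_inj [OF L L'(1) zeq] L'(2) by blast
      qed
    qed
  qed
qed

lemma sum_m: "(\<Sum>Y\<in>J. m Y) = card I"
proof -
  have "(\<Sum>Y\<in>J. \<Sum>L\<in>{L \<in> I. z L = Y}. 1) = (\<Sum>L\<in>I. (1::nat))"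
    by (rule sum.group) (use finite_I finite_J z_image in auto)
  then show ?thesis by (simp add: m_def fibre_def)
qed

lemma degB: "degB + card J = card I"
proof -
  have "degB + card J = (\<Sum>Y\<in>J. m Y - 1 + 1)" unfolding degB_def sum.distrib by simp
  also have "\<dots> = (\<Sum>Y\<in>J. m Y)" by (rule sum.cong) (use m_pos in force)+
  finally show ?thesis by (simp add: sum_m)
qed

end

text \<open>A rank-three localization in essential coordinates: x_0 and x_1 are the coordinates of
  the hyperplane, and t = x_2.\<close>

locale rank3 = pencils 2 J \<beta> I z c
  for J :: "'j set" and \<beta> :: "'j \<Rightarrow> nat \<Rightarrow> 'k::field" and I :: "'i set" and z c
begin

sublocale lines: linear_forms 3 "lines I" covec
  using linear_forms_lines by (simp add: numeral_eq_Suc)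

definition pair_vec :: "'k mpol \<times> 'k mpol \<Rightarrow> nat \<Rightarrow> 'k mpol" where
  "pair_vec x i = (if i = 0 then fst x else if i = 1 then snd x else 0)"

lemma dot_pair: "dot 2 (pair_vec x) b = mconst (b 0) * fst x + mconst (b 1) * snd x"
  and dot_pair3: "dot 3 (pair_vec x) b = mconst (b 0) * fst x + mconst (b 1) * snd x"
  by (simp_all add: dot_def pair_vec_def numeral_eq_Suc)

lemma lin2: "lin 2 b = mconst (b 0) * mvar 0 + mconst (b 1) * mvar 1"
  by (simp add: dot_def numeral_eq_Suc)

lemma dot_pair_vec: "dot 3 (pair_vec x) (vec L) = dot 2 (pair_vec x) (\<beta> (z L))"
  by (simp add: dot_pair dot_pair3 vec_def)

text \<open>Derivations of degree d that kill t and are logarithmic along I'. They are logarithmic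
  along t = 0 as well, and any derivation logarithmic along I' and t = 0 differs from such a one by
  a multiple of the Euler derivation; hence two components suffice.\<close>

definition NN :: "'i set \<Rightarrow> nat \<Rightarrow> ('k mpol \<times> 'k mpol) set" where
  "NN I' d = {x \<in> hpoly {..<3} d \<times> hpoly {..<3} d. \<forall>L\<in>I'. form L dvd dot 3 (pair_vec x) (vec L)}"

lemma hpolyD: "p \<in> hpoly {..<k} d \<Longrightarrow> p \<in> poly_ring k" "p \<in> hpoly V d \<Longrightarrow> homogeneous_poly d p"
  by (auto simp: hpoly_def poly_vars_lessThan)

lemma form3: "form L = lin 3 (vec L)"
  using form_lin [of L] by simp

lemma NN_bounded: "bounded_dim pscale2 (NN I' d)"
  by (rule mp2.bounded_dim_mono [OF _ hpoly_pairs_bounded [of d]]) (auto simp: NN_def)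

lemma NN_subspace: "mp2.subspace (NN I' d)"
proof -
  have sub: "mp.subspace (hpoly {..<3} d :: 'k mpol set)" by (rule hpoly_subspace)
  have add: "dot 3 (pair_vec (x + y)) b = dot 3 (pair_vec x) b + dot 3 (pair_vec y) b" for x y :: "'k mpol \<times> 'k mpol" and b
    by (simp add: dot_pair3 algebra_simps)
  have scale: "dot 3 (pair_vec (pscale2 a x)) b = mconst a * dot 3 (pair_vec x) b" for a x b
    by (simp add: dot_pair3 pscale2_def algebra_simps)
  show ?thesis
    unfolding mp2.subspace_def
  proof (intro conjI ballI allI)
    show "0 \<in> NN I' d"
      using mp.subspace_0 [OF sub] by (simp add: NN_def dot_pair3 mem_Times_iff)
    show "x + y \<in> NN I' d" if "x \<in> NN I' d" "y \<in> NN I' d" for x y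
      using that mp.subspace_add [OF sub] by (simp add: NN_def add mem_Times_iff)
    show "pscale2 a x \<in> NN I' d" if "x \<in> NN I' d" for a x
      using that mp.subspace_scale [OF sub] unfolding NN_def
      by (simp add: scale mem_Times_iff) (simp add: pscale2_def pscale_def)
  qed
qed

definition restr :: "'k mpol \<times> 'k mpol \<Rightarrow> 'k mpol \<times> 'k mpol" where
  "restr x = (trunc 2 (fst x), trunc 2 (snd x))"

text \<open>The determinant with the Euler derivation of the plane t = 0. Its kernel consists of the
  multiples of the Euler derivation, so kernel and image can both be estimated by spaces of single
  polynomials.\<close>

definition wedge :: "'k mpol \<times> 'k mpol \<Rightarrow> 'k mpol" where
  "wedge x = mvar 0 * snd x - mvar 1 * fst x"

lemma linear_restr: "Vector_Spaces.linear pscale2 pscale2 restr"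
  by unfold_locales (simp_all add: restr_def pscale2_def)

lemma linear_wedge: "Vector_Spaces.linear pscale2 pscale wedge"
  by unfold_locales (simp_all add: wedge_def pscale2_def pscale_def algebra_simps)

lemma linear_mult: "Vector_Spaces.linear pscale pscale (\<lambda>q. P * q)"
  by unfold_locales (simp_all add: pscale_def algebra_simps)

lemma linear_eval: "Vector_Spaces.linear pscale2 pscale (\<lambda>x. elim 3 b (dot 3 (pair_vec x) b'))"
  by unfold_locales (simp_all add: dot_pair3 pscale_def pscale2_def algebra_simps)

text \<open>By \<open>elim_prod_dvd\<close> the values on L, restricted to L, are multiples of a
  fixed polynomial of degree k = |I'| + 1 - (number of points on L). The cofactors are polynomials
  of degree D - k in two variables, which leaves at most D - k + 1 dimensions.\<close>

lemma eval_image_dim: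
  assumes I': "I' \<subseteq> I" and L: "L \<in> I" "L \<notin> I'"
    and pt: "\<And>e e'. e \<in> lines I' \<Longrightarrow> e' \<in> lines I' \<Longrightarrow> pt e = pt e' \<longleftrightarrow> span2 (vec L) (covec e) (covec e')"
    and D: "card I' \<le> D"
  shows "mp.dim ((\<lambda>x. elim 3 (vec L) (dot 3 (pair_vec x) (vec L))) ` NN I' D) + card I' \<le> D + card (pt ` lines I')"
proof -
  let ?E = "lines I'"
  have finI': "finite I'" by (rule finite_subset [OF I' finite_I])
  have finE: "finite ?E" by (simp add: lines_def finI')
  have cardE: "card ?E = card I' + 1"
    unfolding lines_def using finI' by (subst card_insert_disjoint) (auto simp: card_image)
  define r where "r X = (SOME e. e \<in> ?E \<and> pt e = X)" for X
  have r: "r X \<in> ?E \<and> pt (r X) = X" if "X \<in> pt ` ?E" for X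
    unfolding r_def by (rule someI_ex) (use that in auto)
  have inj_r: "inj_on r (pt ` ?E)" by (rule inj_onI) (metis r)
  let ?T = "?E - r ` pt ` ?E"
  let ?P = "\<Prod>e\<in>?T. elim 3 (vec L) (lin 3 (covec e))"
  define k where "k = card ?T"
  have "card (r ` pt ` ?E) = card (pt ` ?E)" by (rule card_image [OF inj_r])
  moreover have "r ` pt ` ?E \<subseteq> ?E" using r by auto
  ultimately have kE: "k + card (pt ` ?E) = card I' + 1"
    unfolding k_def using finE cardE card_mono [of ?E "r ` pt ` ?E"] by (subst card_Diff_subset) auto
  \<comment> \<open>The line \<open>None\<close> always contributes a point on L. Hence k is at most
    |I'|, and D - k is a genuine difference.\<close>
  have pt1: "1 \<le> card (pt ` ?E)" using finE by (simp add: Suc_le_eq card_gt_0_iff lines_def)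
  have kD: "k \<le> D" using kE pt1 D by linarith
  have vL: "covec (Some L) = vec L" "Some L \<in> lines I" using L by (auto simp: lines_def)
  have EI: "?E \<subseteq> lines I" using I' by (auto simp: lines_def)
  have L0: "lin 3 (vec L) \<noteq> 0" using lines.lin_nonzero [OF vL(2)] by simp
  have P_hom: "homogeneous_poly k ?P"
    unfolding k_def by (rule homogeneous_prod_1) (rule homogeneous_elim [OF homogeneous_lin])
  have LE: "Some L \<notin> ?E" using L by (auto simp: lines_def)
  have P_ne: "?P \<noteq> 0"
  proof -
    have "elim 3 (vec L) (lin 3 (covec e)) \<noteq> 0" if e: "e \<in> ?E" for e
    proof
      assume "elim 3 (vec L) (lin 3 (covec e)) = 0"
      then have "lin 3 (vec L) dvd lin 3 (covec e)" using lin_dvd_iff_elim [OF L0] by simp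
      then obtain s where "\<forall>i<3. covec e i = s * vec L i" using lin_dvd_lin [OF _ L0] by blast
      then show False using lines.non_prop' [of e "Some L" s] e EI vL LE by auto
    qed
    then show ?thesis using finE by simp
  qed
  have P_in: "?P \<in> poly_ring 3" by (intro poly_ring_prod elim_in_poly_ring lin_in_poly_ring) simp
  have P_elim: "elim 3 (vec L) ?P = ?P" using L0 by simp
  define j where "j = elim_index 3 (vec L)"
  have j: "j < 3" unfolding j_def by (rule elim_index [OF L0])
  have image: "(\<lambda>x. elim 3 (vec L) (dot 3 (pair_vec x) (vec L))) ` NN I' D \<subseteq> (\<lambda>q. ?P * q) ` hpoly ({..<3} - {j}) (D - k)"
  proof (rule image_subsetI)
    fix x assume x: "x \<in> NN I' D"
    let ?g = "elim 3 (vec L) (dot 3 (pair_vec x) (vec L))"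
    have xh: "fst x \<in> hpoly {..<3} D" "snd x \<in> hpoly {..<3} D" using x by (auto simp: NN_def)
    have g_in: "?g \<in> poly_ring 3"
      unfolding dot_pair3 using hpolyD(1) xh by (intro elim_in_poly_ring poly_ring_add poly_ring_mult poly_ring_mconst) auto
    have g_hom: "homogeneous_poly D ?g"
      unfolding dot_pair3 using hpolyD(2) xh by (intro homogeneous_elim homogeneous_add homogeneous_mconst_mult) auto
    have "?P dvd ?g"
      unfolding vL(1) [symmetric]
    proof (rule lines.elim_prod_dvd [OF EI vL(2) LE])
      fix e assume e: "e \<in> ?E"
      show "lin 3 (covec e) dvd dot 3 (pair_vec x) (covec e)"
      proof (cases e)
        case None then show ?thesis by (simp add: dot_pair3)
      next
        case (Some L')
        then show ?thesis using x e by (auto simp: lines_def NN_def form3)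
      qed
    next
      fix e e' assume "e \<in> ?E" "e' \<in> ?E"
      then show "(pt e = pt e') = span2 (covec (Some L)) (covec e) (covec e')" using pt by simp
    qed (use r in blast)
    then obtain q0 where q0: "q0 \<in> poly_ring 3" "?g = ?P * q0" by (rule poly_ring_dvdE [OF _ P_in g_in])
    have "?P * elim 3 (vec L) q0 = ?P * q0"
    proof -
      have "elim 3 (vec L) ?g = ?P * elim 3 (vec L) q0" unfolding q0(2) elim_simps(3) P_elim ..
      moreover have "elim 3 (vec L) ?g = ?g" using L0 by (rule elim_elim)
      ultimately show ?thesis by (simp only: q0(2))
    qed
    then have q_elim: "elim 3 (vec L) q0 = q0" using P_ne by simp
    have "homogeneous_poly (D - k) q0"
      by (rule homogeneous_quotient [OF P_hom P_ne]) (use g_hom kD in \<open>simp add: q0(2) [symmetric]\<close>)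
    moreover have "q0 \<in> poly_vars ({..<3} - {j})"
      using elim_in_poly_vars [OF L0 q0(1)] unfolding q_elim j_def .
    ultimately have "q0 \<in> hpoly ({..<3} - {j}) (D - k)" by (simp add: hpoly_def)
    then show "?g \<in> (\<lambda>q. ?P * q) ` hpoly ({..<3} - {j}) (D - k)" using q0(2) by blast
  qed
  obtain a b where ab: "{..<3} - {j} = {a, b}" "a \<noteq> b"
  proof -
    have "card ({..<3} - {j}) = 2" using j by simp
    then show ?thesis using that by (auto simp: card_2_iff)
  qed
  note hp = dim_hpoly_two [OF ab(2), where 'k = 'k, of "D - k"]
  have "mp.dim ((\<lambda>x. elim 3 (vec L) (dot 3 (pair_vec x) (vec L))) ` NN I' D) \<le> mp.dim ((\<lambda>q. ?P * q) ` hpoly {a, b} (D - k))"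
    using image unfolding ab(1)
    by (rule mp.dim_mono_bounded) (rule mp_mp.bounded_dim_image [OF linear_mult hp(1)])
  also have "\<dots> \<le> D - k + 1"
    using mp_mp.dim_image_le_bounded [OF linear_mult hp(1)] hp(2) by (rule order_trans)
  finally show ?thesis using kE kD by linarith
qed

text \<open>The kernel of evaluation on a new hyperplane L consists of the derivations that are
  logarithmic along L too. If i hyperplanes precede and p points lie on L, the dimension drops by at
  most D + p - i; these drops are added up, and b sums the numbers p. Both sides are doubled to
  avoid halves. Points and b stay abstract, so that only incidences matter.\<close>

lemma dim_NN_lower:
  assumes I': "I' \<subseteq> I"
    and pt: "\<And>e e' L. e \<in> lines I \<Longrightarrow> e' \<in> lines I \<Longrightarrow> L \<in> lines I \<Longrightarrow> e \<noteq> L \<Longrightarrow> e' \<noteq> L \<Longrightarrow>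
      pt L e = pt L e' \<longleftrightarrow> span2 (covec L) (covec e) (covec e')"
    and b: "b {None} = 0"
      "\<And>A L. A \<subseteq> lines I \<Longrightarrow> None \<in> A \<Longrightarrow> L \<in> lines I \<Longrightarrow> L \<notin> A \<Longrightarrow> b (insert L A) = b A + card (pt L ` A)"
    and D: "card I' \<le> D"
  shows "2 * ((D + 1) * (D + 2)) + card I' * (card I' + 1)
    \<le> 2 * mp2.dim (NN I' D) + 2 * (card I' * (D + 1)) + 2 * b (lines I')"
proof -
  have "finite I'" by (rule finite_subset [OF I' finite_I])
  then show ?thesis using I' D
  proof (induction I' rule: finite_induct)
    case empty
    have "NN {} D = hpoly {..<3} D \<times> hpoly {..<3} D" by (auto simp: NN_def)
    then show ?case using dim_hpoly_pairs [of D, where 'k = 'k] by simp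
  next
    case (insert L I')
    let ?F = "\<lambda>x. elim 3 (vec L) (dot 3 (pair_vec x) (vec L))"
    have L0: "lin 3 (vec L) \<noteq> 0" using insert form_nonzero [of L] by (simp add: form3)
    have ker: "{x \<in> NN I' D. ?F x = 0} = NN (insert L I') D"
      using lin_dvd_iff_elim [OF L0] by (auto simp: NN_def form3)
    have "mp.dim (?F ` NN I' D) + card I' \<le> D + card (pt (Some L) ` lines I')"
    proof (rule eval_image_dim)
      fix e e' assume "e \<in> lines I'" "e' \<in> lines I'"
      then show "(pt (Some L) e = pt (Some L) e') = span2 (vec L) (covec e) (covec e')"
        using pt [of e e' "Some L"] insert by (auto simp: lines_def)
    qed (use insert in auto)
    moreover have "mp2.dim (NN I' D) \<le> mp2.dim (NN (insert L I') D) + mp.dim (?F ` NN I' D)"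
      unfolding ker [symmetric] by (rule mp2_mp.dim_le_ker_plus_image [OF linear_eval NN_subspace NN_bounded])
    moreover have "lines (insert L I') = insert (Some L) (lines I')" by (auto simp: lines_def)
    then have "b (lines (insert L I')) = b (lines I') + card (pt (Some L) ` lines I')"
      using b(2) [of "lines I'" "Some L"] insert by (auto simp: lines_def)
    moreover have "2 * ((D + 1) * (D + 2)) + card I' * (card I' + 1)
      \<le> 2 * mp2.dim (NN I' D) + 2 * (card I' * (D + 1)) + 2 * b (lines I')"
      using insert by simp
    ultimately show ?case using insert by (simp add: algebra_simps)
  qed
qed

section \<open>Restriction of the rank-three derivations to the plane t = 0\<close>

definition TT :: "nat \<Rightarrow> ('k mpol \<times> 'k mpol) set" where "TT d = restr ` NN I d"

lemma TT_bounded: "bounded_dim pscale2 (TT d)"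
  unfolding TT_def by (rule mp2_mp2.bounded_dim_image [OF linear_restr NN_bounded])

lemma TT_subspace: "mp2.subspace (TT d)"
  unfolding TT_def by (rule mp2_mp2.linear_subspace_image [OF linear_restr NN_subspace])

lemma NN_G: "x \<in> NN I d \<Longrightarrow> G Y dvd dot 2 (pair_vec x) (\<beta> Y)"
  by (rule G_dvdI) (auto simp: NN_def dot_pair_vec)

lemma TT_props:
  assumes "x \<in> TT d"
  shows "fst x \<in> hpoly {..<2} d" "snd x \<in> hpoly {..<2} d"
    "lb Y ^ m Y dvd mconst (\<beta> Y 0) * fst x + mconst (\<beta> Y 1) * snd x"
proof -
  obtain y where y: "y \<in> NN I d" "x = restr y" using assms by (auto simp: TT_def)
  have "fst y \<in> hpoly {..<3} d" "snd y \<in> hpoly {..<3} d" using y by (auto simp: NN_def)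
  then show "fst x \<in> hpoly {..<2} d" "snd x \<in> hpoly {..<2} d"
    by (auto simp: y(2) restr_def hpoly_def poly_vars_lessThan intro: homogeneous_trunc)
  show "lb Y ^ m Y dvd mconst (\<beta> Y 0) * fst x + mconst (\<beta> Y 1) * snd x"
    using trunc_dvd [OF NN_G [OF y(1), of Y], of 2] by (simp add: dot_pair y(2) restr_def)
qed

text \<open>A pair vanishing on t = 0 is t times a pair of one degree less, which is again
  logarithmic because t is prime to the forms. In degree 0 only the zero pair vanishes on t = 0, and
  the filtration ends.\<close>

lemma dim_NN_step: "mp2.dim (NN I (Suc d)) \<le> mp2.dim (NN I d) + mp2.dim (TT (Suc d))"
  and dim_NN_0: "mp2.dim (NN I 0) \<le> mp2.dim (TT 0)"
proof -
  have S3: "Suc 2 = (3::nat)" by simp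
  have tq: "\<exists>y. x = pscale2 1 (mvar 2 * fst y, mvar 2 * snd y) \<and> fst y \<in> poly_ring 3 \<and> snd y \<in> poly_ring 3"
    if x: "x \<in> NN I d" "restr x = 0" for x d
  proof -
    have x3: "fst x \<in> poly_ring 3" "snd x \<in> poly_ring 3"
      using x hpolyD(1) [of _ 3 d] by (auto simp: NN_def)
    moreover have "trunc 2 (fst x) = 0" "trunc 2 (snd x) = 0" using x(2) by (auto simp: restr_def prod_eq_iff)
    ultimately have "t dvd fst x" "t dvd snd x" by (simp_all add: mvar_dvd_iff_trunc [where n = 2, unfolded S3])
    moreover have "t \<in> poly_ring 3" by simp
    ultimately have "\<exists>p\<in>poly_ring 3. fst x = t * p" "\<exists>q\<in>poly_ring 3. snd x = t * q"
      using x3 poly_ring_dvd_iff [of t 3] by blast+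
    then obtain p q where "p \<in> poly_ring 3" "q \<in> poly_ring 3" "fst x = t * p" "snd x = t * q"
      by blast
    then show ?thesis by (intro exI [of _ "(p, q)"]) (simp add: pscale2_def prod_eq_iff)
  qed
  have lin: "Vector_Spaces.linear pscale2 pscale2 (\<lambda>y. (mvar 2 * fst y, mvar 2 * snd y))"
    by unfold_locales (simp_all add: pscale2_def algebra_simps)
  have ker: "{x \<in> NN I (Suc d). restr x = 0} \<subseteq> (\<lambda>y. (mvar 2 * fst y, mvar 2 * snd y)) ` NN I d"
  proof safe
    fix p q assume x: "(p, q) \<in> NN I (Suc d)" "restr (p, q) = 0"
    then obtain y where y: "p = t * fst y" "q = t * snd y" "fst y \<in> poly_ring 3" "snd y \<in> poly_ring 3"
      using tq [OF x] by (auto simp: pscale2_def)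
    have "homogeneous_poly (1 + d) (t * fst y)" "homogeneous_poly (1 + d) (t * snd y)"
      using x y by (auto simp: NN_def hpoly_def)
    then have "homogeneous_poly d (fst y)" "homogeneous_poly d (snd y)"
      by (auto intro: homogeneous_quotient [OF homogeneous_mvar mvar_neq_0])
    moreover have "form L dvd dot 3 (pair_vec y) (vec L)" if L: "L \<in> I" for L
    proof (rule form_dvd_cancel_t [OF L])
      have "dot 3 (pair_vec (p, q)) (vec L) = t * dot 3 (pair_vec y) (vec L)"
        by (simp add: dot_pair3 y(1,2) algebra_simps)
      then show "form L dvd t * dot 3 (pair_vec y) (vec L)" using x L by (auto simp: NN_def)
    qed
    ultimately have "y \<in> NN I d" using y by (cases y) (auto simp: NN_def hpoly_def poly_vars_lessThan)
    then show "(p, q) \<in> (\<lambda>y. (mvar 2 * fst y, mvar 2 * snd y)) ` NN I d" using y by auto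
  qed
  have "mp2.dim {x \<in> NN I (Suc d). restr x = 0} \<le> mp2.dim ((\<lambda>y. (mvar 2 * fst y, mvar 2 * snd y)) ` NN I d)"
    by (rule mp2.dim_mono_bounded [OF ker mp2_mp2.bounded_dim_image [OF lin NN_bounded]])
  also have "\<dots> \<le> mp2.dim (NN I d)" by (rule mp2_mp2.dim_image_le_bounded [OF lin NN_bounded])
  finally show "mp2.dim (NN I (Suc d)) \<le> mp2.dim (NN I d) + mp2.dim (TT (Suc d))"
    using mp2_mp2.dim_le_ker_plus_image [OF linear_restr NN_subspace NN_bounded, of I "Suc d"] by (simp add: TT_def)
  have "{x \<in> NN I 0. restr x = 0} \<subseteq> mp2.span {}"
  proof safe
    fix p q assume x: "(p, q) \<in> NN I 0" "restr (p, q) = 0"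
    then obtain y where y: "p = t * fst y" "q = t * snd y" using tq [OF x] by (auto simp: pscale2_def)
    have "homogeneous_poly 0 (t * fst y)" "homogeneous_poly 0 (t * snd y)"
      using x y by (auto simp: NN_def hpoly_def)
    then have "fst y = 0" "snd y = 0"
      by (auto intro: homogeneous_quotient_less [OF homogeneous_mvar mvar_neq_0])
    then show "(p, q) \<in> mp2.span {}" using y by (simp add: zero_prod_def)
  qed
  from mp2.dim_le_card [OF this] have "mp2.dim {x \<in> NN I 0. restr x = 0} = 0" by simp
  then show "mp2.dim (NN I 0) \<le> mp2.dim (TT 0)"
    using mp2_mp2.dim_le_ker_plus_image [OF linear_restr NN_subspace NN_bounded, of I 0] by (simp add: TT_def)
qed

lemma dim_NN_upper: "mp2.dim (NN I D) \<le> (\<Sum>d\<le>D. mp2.dim {x \<in> TT d. wedge x = 0} + mp.dim (wedge ` TT d))"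
proof (induction D)
  case 0
  show ?case using dim_NN_0 mp2_mp.dim_le_ker_plus_image [OF linear_wedge TT_subspace TT_bounded, of 0] by simp
next
  case (Suc D)
  then show ?case
    using dim_NN_step [of D] mp2_mp.dim_le_ker_plus_image [OF linear_wedge TT_subspace TT_bounded, of "Suc D"] by simp
qed

lemma homogeneous_lb_prod: "homogeneous_poly (card J) (\<Prod>Y\<in>J. lb Y)"
  by (rule homogeneous_prod_1) (rule homogeneous_lin)

lemma hpoly2: "hpoly {..<2} d = hpoly {0, 1::nat} d"
  by (rule arg_cong [of _ _ "\<lambda>V. hpoly V d"]) auto

text \<open>\<open>lb Y\<close> divides the values on \<open>lb Y\<close> of both x and the Euler
  derivation, hence their determinant. So the product of all forms, of degree |J|, divides a
  polynomial of degree d + 1.\<close>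

lemma wedge_TT:
  assumes x: "x \<in> TT d"
  shows "wedge x = 0 \<or> (card J \<le> d + 1 \<and> (\<exists>q\<in>hpoly {..<2} (d + 1 - card J). wedge x = (\<Prod>Y\<in>J. lb Y) * q))"
proof -
  note xp = TT_props [OF x]
  have "lb Y dvd wedge x" if Y: "Y \<in> J" for Y
  proof -
    let ?a = "\<beta> Y 0" and ?b = "\<beta> Y 1"
    have d: "lb Y dvd mconst ?a * fst x + mconst ?b * snd x" by (rule dvd_trans [OF lb_dvd_pow [OF Y] xp(3)])
    have "mconst ?a * wedge x = lb Y * snd x - mvar 1 * (mconst ?a * fst x + mconst ?b * snd x)"
      "mconst ?b * wedge x = mvar 0 * (mconst ?a * fst x + mconst ?b * snd x) - lb Y * fst x"
      unfolding wedge_def lin2 by (simp_all add: algebra_simps)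
    then have dd: "lb Y dvd mconst ?a * wedge x" "lb Y dvd mconst ?b * wedge x"
      using d by (simp_all add: dvd_diff)
    have "?a \<noteq> 0 \<or> ?b \<noteq> 0" using lin_nonzero [OF Y] by (auto simp: lin2)
    then obtain s where s: "s \<noteq> 0" "lb Y dvd mconst s * wedge x" using dd by blast
    from s(2) have "lb Y dvd mconst (inverse s) * (mconst s * wedge x)" by (rule dvd_mult)
    then show ?thesis by (simp only: mconst_inverse_mult [OF s(1)])
  qed
  then have "(\<Prod>Y\<in>J. lb Y) dvd wedge x" by (rule prod_dvd_of_cancels) (auto intro: cancels_forms)
  moreover have w_in: "wedge x \<in> poly_ring 2"
    using xp hpolyD(1) unfolding wedge_def by (intro poly_ring_diff poly_ring_mult) auto
  ultimately obtain q where q: "q \<in> poly_ring 2" "wedge x = (\<Prod>Y\<in>J. lb Y) * q"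
    by (rule poly_ring_dvdE [OF _ Q_in(1)])
  have w_hom: "homogeneous_poly (d + 1) (wedge x)"
    using homogeneous_diff [OF homogeneous_mult [OF homogeneous_mvar hpolyD(2) [OF xp(2)]] homogeneous_mult [OF homogeneous_mvar hpolyD(2) [OF xp(1)]], of 0 1]
    by (simp add: wedge_def)
  show ?thesis
  proof (cases "card J \<le> d + 1")
    case True
    have "homogeneous_poly (d + 1 - card J) q"
      by (rule homogeneous_quotient [OF homogeneous_lb_prod Q_nonzero]) (use w_hom True q in simp)
    then show ?thesis using q True by (auto simp: hpoly_def poly_vars_lessThan)
  next
    case False
    have "q = 0"
      by (rule homogeneous_quotient_less [OF homogeneous_lb_prod Q_nonzero, of "d + 1"]) (use w_hom False q in simp_all)
    then show ?thesis using q by simp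
  qed
qed

text \<open>A vanishing determinant makes x a multiple k of the Euler derivation, since x_0 and x_1
  are coprime. The conditions with multiplicities then say that B divides k.\<close>

lemma ker_TT:
  assumes x: "x \<in> TT d" "wedge x = 0"
  shows "x = 0 \<or> (degB < d \<and> (\<exists>q\<in>hpoly {..<2} (d - 1 - degB). x = (B * mvar 0 * q, B * mvar 1 * q)))"
proof -
  note xp = TT_props [OF x(1)]
  have eq: "mvar 0 * snd x = mvar 1 * fst x" using x(2) by (simp add: wedge_def)
  have "cancels (mvar 0) (mvar 1 :: 'k mpol)"
  proof -
    have "cancels (lin 2 (\<lambda>i. if i = 0 then 1 else 0)) (lin 2 (\<lambda>i. if i = 1 then 1 else 0) :: 'k mpol)"
      by (rule cancels_lin) (auto simp: lin2)
    then show ?thesis by (simp add: lin2)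
  qed
  moreover have "mvar 0 dvd mvar 1 * fst x" unfolding eq [symmetric] by simp
  ultimately have "mvar 0 dvd fst x" by (rule cancelsD)
  then obtain k where k: "k \<in> poly_ring 2" "fst x = mvar 0 * k"
    by (rule poly_ring_dvdE) (use xp hpolyD(1) in auto)
  have "mvar 0 * snd x = mvar 0 * (mvar 1 * k)" unfolding eq k(2) by (simp add: mult_ac)
  then have k2: "snd x = mvar 1 * k" by simp
  have k_hom: "homogeneous_poly (d - 1) k \<and> (d = 0 \<longrightarrow> k = 0)"
  proof (cases "d = 0")
    case True
    have "k = 0"
      by (rule homogeneous_quotient_less [OF homogeneous_mvar [of 0] mvar_neq_0, of d])
        (use hpolyD(2) [OF xp(1)] True k in auto)
    then show ?thesis by simp
  next
    case False
    have "homogeneous_poly (d - 1) k"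
      by (rule homogeneous_quotient [OF homogeneous_mvar [of 0] mvar_neq_0])
        (use hpolyD(2) [OF xp(1)] False k in auto)
    then show ?thesis using False by simp
  qed
  have "B dvd k"
  proof (rule B_dvdI)
    fix Y
    have "mconst (\<beta> Y 0) * fst x + mconst (\<beta> Y 1) * snd x = k * lb Y"
      by (simp add: k(2) k2 lin2 algebra_simps)
    then show "lb Y ^ m Y dvd k * lb Y" using xp(3) [of Y] by (simp only:)
  qed
  then obtain q where q: "q \<in> poly_ring 2" "k = B * q" by (rule poly_ring_dvdE [OF _ B_in k(1)])
  have x_eq: "x = (B * mvar 0 * q, B * mvar 1 * q)" by (simp add: prod_eq_iff k(2) k2 q(2) mult_ac)
  show ?thesis
  proof (cases "degB < d")
    case True
    have "homogeneous_poly (d - 1 - degB) q"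
      by (rule homogeneous_quotient [OF homogeneous_B B_nonzero]) (use k_hom True q in simp)
    then show ?thesis using x_eq True q by (auto simp: hpoly_def poly_vars_lessThan)
  next
    case False
    have "k = 0"
    proof (cases "d = 0")
      case d: False
      have "q = 0"
        by (rule homogeneous_quotient_less [OF homogeneous_B B_nonzero, of "d - 1"]) (use k_hom False d q in auto)
      then show ?thesis using q by simp
    qed (use k_hom in simp)
    then show ?thesis by (simp add: prod_eq_iff k(2) k2)
  qed
qed

lemma dim_wedge_TT: "mp.dim (wedge ` TT d) \<le> d + 2 - card J"
proof (cases "card J \<le> d + 1")
  case True
  note hp = dim_hpoly_two [of 0 "1::nat", where 'k = 'k, of "d + 1 - card J"]
  have "wedge ` TT d \<subseteq> (\<lambda>q. (\<Prod>Y\<in>J. lb Y) * q) ` hpoly {0, 1} (d + 1 - card J)"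
  proof (rule image_subsetI)
    fix x assume "x \<in> TT d"
    moreover have "0 \<in> (\<lambda>q. (\<Prod>Y\<in>J. lb Y) * q) ` hpoly {0, 1} (d + 1 - card J)"
      using mp.subspace_0 [OF hpoly_subspace] by force
    ultimately show "wedge x \<in> (\<lambda>q. (\<Prod>Y\<in>J. lb Y) * q) ` hpoly {0, 1} (d + 1 - card J)"
      using wedge_TT [of x d] by (auto simp: hpoly2)
  qed
  then have "mp.dim (wedge ` TT d) \<le> mp.dim ((\<lambda>q. (\<Prod>Y\<in>J. lb Y) * q) ` hpoly {0, 1} (d + 1 - card J))"
    by (rule mp.dim_mono_bounded) (rule mp_mp.bounded_dim_image [OF linear_mult], rule hp, simp)
  also have "\<dots> \<le> mp.dim (hpoly {0, 1} (d + 1 - card J) :: 'k mpol set)"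
    by (rule mp_mp.dim_image_le_bounded [OF linear_mult]) (rule hp, simp)
  also have "\<dots> \<le> d + 1 - card J + 1" by (rule hp) simp
  finally show ?thesis using True by linarith
next
  case False
  then have "wedge ` TT d \<subseteq> mp.span {}" using wedge_TT [of _ d] by auto
  from mp.dim_le_card [OF this] show ?thesis by simp
qed

lemma dim_ker_TT: "mp2.dim {x \<in> TT d. wedge x = 0} \<le> d - degB"
proof (cases "degB < d")
  case True
  note hp = dim_hpoly_two [of 0 "1::nat", where 'k = 'k, of "d - 1 - degB"]
  interpret mm: vector_space_pair pscale pscale2 ..
  let ?f = "\<lambda>q. (B * mvar 0 * q, B * mvar 1 * q)"
  have lin: "Vector_Spaces.linear pscale pscale2 ?f"
    by unfold_locales (simp_all add: pscale_def pscale2_def algebra_simps)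
  have "{x \<in> TT d. wedge x = 0} \<subseteq> ?f ` hpoly {0, 1} (d - 1 - degB)"
  proof
    fix x assume x: "x \<in> {x \<in> TT d. wedge x = 0}"
    have "0 \<in> ?f ` hpoly {0, 1} (d - 1 - degB)"
      using mp.subspace_0 [OF hpoly_subspace, of "{0, 1}" "d - 1 - degB"] by (intro image_eqI [of _ _ 0]) (simp_all add: zero_prod_def)
    then show "x \<in> ?f ` hpoly {0, 1} (d - 1 - degB)"
      using ker_TT [of x d] x by (auto simp: hpoly2)
  qed
  then have "mp2.dim {x \<in> TT d. wedge x = 0} \<le> mp2.dim (?f ` hpoly {0, 1} (d - 1 - degB))"
    by (rule mp2.dim_mono_bounded) (rule mm.bounded_dim_image [OF lin], rule hp, simp)
  also have "\<dots> \<le> mp.dim (hpoly {0, 1} (d - 1 - degB) :: 'k mpol set)"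
    by (rule mm.dim_image_le_bounded [OF lin]) (rule hp, simp)
  also have "\<dots> \<le> d - 1 - degB + 1" by (rule hp) simp
  finally show ?thesis using True by linarith
next
  case False
  then have "{x \<in> TT d. wedge x = 0} \<subseteq> mp2.span {}" using ker_TT [of _ d] by auto
  from mp2.dim_le_card [OF this] show ?thesis by simp
qed

text \<open>d + 1 - k is the dimension in degree d of a free module of rank one over two variables
  with generator in degree k; truncated subtraction gives 0 below that degree.\<close>

lemma double_sum_truncated: "k \<le> N + (1::nat) \<Longrightarrow> 2 * (\<Sum>d\<le>N. d + 1 - k) = (N + 1 - k) * (N + 2 - k)"
proof (induction N)
  case 0
  then show ?case by (cases k) auto
next
  case (Suc N)
  show ?case
  proof (cases "k \<le> N + 1")
    case True
    then obtain j where j: "N + 1 = k + j" using le_Suc_ex by blast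
    then have diffs: "N + 1 - k = j" "N + 2 - k = j + 1" "Suc N + 1 - k = j + 1" "Suc N + 2 - k = j + 2" by linarith+
    have "(\<Sum>d\<le>Suc N. d + 1 - k) = (\<Sum>d\<le>N. d + 1 - k) + (Suc N + 1 - k)" by (rule sum.atMost_Suc)
    then show ?thesis using Suc.IH [OF True] unfolding diffs by simp
  next
    case False
    then have "(\<Sum>d\<le>Suc N. d + 1 - k) = 0" using Suc.prems by (intro sum.neutral) auto
    then show ?thesis using False Suc.prems by simp
  qed
qed

lemma homogeneous_0_const: "homogeneous_poly 0 p \<Longrightarrow> \<exists>e. p = mconst e"
proof -
  assume p: "homogeneous_poly 0 p"
  have "Poly_Mapping.keys p \<subseteq> {0}"
  proof
    fix m assume "m \<in> Poly_Mapping.keys p"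
    then have "mdeg m = 0" using p by (simp add: homogeneous_poly_iff)
    then have "Poly_Mapping.lookup m a = 0" for a by (auto simp: mdeg_def in_keys_iff)
    then show "m \<in> {0}" by (auto intro: poly_mapping_eqI)
  qed
  then have "p = mconst (Poly_Mapping.lookup p 0)"
    by (intro poly_mapping_eqI) (auto simp: mconst_def lookup_single when_def in_keys_iff)
  then show ?thesis ..
qed

text \<open>Put N = |I|, h = |J|, g = h - 1 and M = N - g. Twice the sum of the upper bounds is (M +
  1)(M + 2) + (g + 1)(g + 2), and for b at most N + g M the doubled lower bound in degree N reaches
  this value. So all estimates are equalities, and in degrees g and M, where the two upper bounds
  first become positive, determinant and kernel provide \<Psi> and \<Xi>.\<close>

theorem rank3_lifting:
  assumes J: "1 \<le> card J"
    and pt: "\<And>e e' L. e \<in> lines I \<Longrightarrow> e' \<in> lines I \<Longrightarrow> L \<in> lines I \<Longrightarrow> e \<noteq> L \<Longrightarrow> e' \<noteq> L \<Longrightarrow>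
      pt L e = pt L e' \<longleftrightarrow> span2 (covec L) (covec e) (covec e')"
    and b: "b {None} = 0"
      "\<And>A L. A \<subseteq> lines I \<Longrightarrow> None \<in> A \<Longrightarrow> L \<in> lines I \<Longrightarrow> L \<notin> A \<Longrightarrow> b (insert L A) = b A + card (pt L ` A)"
    and b2: "b (lines I) \<le> card I + (card J - 1) * (card I + 1 - card J)"
  shows "\<exists>\<Psi>\<in>vecs 2 3. \<exists>\<Xi>\<in>vecs 2 3. \<exists>e. e \<noteq> 0 \<and>
    (\<forall>Y\<in>J. G Y dvd dot 2 \<Psi> (\<beta> Y) \<and> G Y dvd dot 2 \<Xi> (\<beta> Y) \<and> trunc 2 (dot 2 \<Xi> (\<beta> Y)) = B * lb Y) \<and>
    mvar 0 * trunc 2 (\<Psi> 1) - mvar 1 * trunc 2 (\<Psi> 0) = mconst e * (\<Prod>Y\<in>J. lb Y)"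
proof -
  let ?N = "card I" and ?h = "card J"
  let ?A = "\<lambda>d. mp.dim (wedge ` TT d)" and ?K = "\<lambda>d. mp2.dim {x \<in> TT d. wedge x = 0}"
  have hN: "?h \<le> ?N" using card_image_le [OF finite_I, of z] z_image by simp
  have dB: "degB = ?N - ?h" using degB by linarith
  have A: "?A d \<le> d + 1 - (?h - 1)" for d using dim_wedge_TT [of d] J by simp
  have K: "?K d \<le> d + 1 - (?N + 1 - ?h)" for d using dim_ker_TT [of d] hN by (simp add: dB)
  have low: "2 * ((?N + 1) * (?N + 2)) + ?N * (?N + 1) \<le> 2 * mp2.dim (NN I ?N) + 2 * (?N * (?N + 1)) + 2 * b (lines I)"
    by (rule dim_NN_lower [where b = b, OF subset_refl pt b order_refl])
  have SA: "2 * (\<Sum>d\<le>?N. d + 1 - (?h - 1)) = (?N + 1 - (?h - 1)) * (?N + 2 - (?h - 1))"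
    using hN by (intro double_sum_truncated) simp
  have SK: "2 * (\<Sum>d\<le>?N. d + 1 - (?N + 1 - ?h)) = (?N + 1 - (?N + 1 - ?h)) * (?N + 2 - (?N + 1 - ?h))"
    by (intro double_sum_truncated) simp
  obtain g M where g: "?h = g + 1" and M: "?N = M + g" using J hN
    by (metis add.commute le_Suc_ex add_diff_cancel_left' le_add_diff_inverse2 Suc_eq_plus1 Suc_le_lessD Suc_leD)
  have "2 * (\<Sum>d\<le>?N. d + 1 - (?h - 1)) + 2 * (\<Sum>d\<le>?N. d + 1 - (?N + 1 - ?h)) \<le> 2 * mp2.dim (NN I ?N)"
    unfolding SA SK using low b2 by (simp add: g M algebra_simps)
  also have "\<dots> \<le> 2 * (\<Sum>d\<le>?N. ?K d + ?A d)" using dim_NN_upper [of ?N] by simp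
  finally have le: "(\<Sum>d\<le>?N. (d + 1 - (?N + 1 - ?h)) + (d + 1 - (?h - 1))) \<le> (\<Sum>d\<le>?N. ?K d + ?A d)"
    by (simp add: sum.distrib)
  \<comment> \<open>A strict inequality in a single degree would push the sum of the dimensions
    below the lower bound.\<close>
  have eq: "?K d = d + 1 - (?N + 1 - ?h) \<and> ?A d = d + 1 - (?h - 1)" if "d \<le> ?N" for d
  proof (rule ccontr)
    assume "\<not> ?thesis"
    then have "?K d + ?A d < (d + 1 - (?N + 1 - ?h)) + (d + 1 - (?h - 1))" using A [of d] K [of d] by linarith
    then have "(\<Sum>d\<le>?N. ?K d + ?A d) < (\<Sum>d\<le>?N. (d + 1 - (?N + 1 - ?h)) + (d + 1 - (?h - 1)))"
      using that by (intro sum_strict_mono_ex1) (auto intro!: add_mono A K simp del: One_nat_def)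
    then show False using le by simp
  qed
  \<comment> \<open>In degree h - 1 the determinant has the degree of the product of all forms, so
    the cofactor q is a constant.\<close>
  have "0 < ?A (?h - 1)" using eq [of "?h - 1"] hN by simp
  then obtain y where y: "y \<in> wedge ` TT (?h - 1)" "y \<noteq> 0" using mp.dim_pos_nonzero by blast
  then obtain x where x: "x \<in> NN I (?h - 1)" "y = wedge (restr x)" by (auto simp: TT_def)
  have "restr x \<in> TT (?h - 1)" using x by (simp add: TT_def)
  from wedge_TT [OF this] obtain q where q: "q \<in> hpoly {..<2} 0" "wedge (restr x) = (\<Prod>Y\<in>J. lb Y) * q"
    using x(2) y(2) J by auto
  obtain e where e: "q = mconst e" using homogeneous_0_const hpolyD(2) [OF q(1)] by blast
  have e0: "e \<noteq> 0" using x(2) y(2) q(2) e by auto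
  \<comment> \<open>The degree N + 1 - h = \<open>degB\<close> + 1 is that of B times the Euler
    derivation, so the cofactor q' is again a constant; dividing by it normalizes \<Xi>.\<close>
  have "0 < ?K (?N + 1 - ?h)" using eq [of "?N + 1 - ?h"] J hN by simp
  then obtain w where w: "w \<in> TT (?N + 1 - ?h)" "wedge w = 0" "w \<noteq> 0" using mp2.dim_pos_nonzero by blast
  then obtain v where v: "v \<in> NN I (?N + 1 - ?h)" "w = restr v" by (auto simp: TT_def)
  from ker_TT [OF w(1,2)] w(3) obtain q' where q': "q' \<in> hpoly {..<2} (?N + 1 - ?h - 1 - degB)"
    "w = (B * mvar 0 * q', B * mvar 1 * q')" by blast
  have "?N + 1 - ?h - 1 - degB = 0" using dB by simp
  then obtain e' where e': "q' = mconst e'" using homogeneous_0_const hpolyD(2) [OF q'(1)] by metis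
  have e'0: "e' \<noteq> 0" using w(3) q'(2) e' by (auto simp: zero_prod_def)
  let ?v = "pscale2 (inverse e') v"
  have vN: "?v \<in> NN I (?N + 1 - ?h)" by (rule mp2.subspace_scale [OF NN_subspace v(1)])
  have in3: "pair_vec u \<in> vecs 2 3" if "u \<in> NN I d" for u d
    using that hpolyD(1) [of _ 3] by (auto simp: NN_def pair_vec_def)
  have rv: "trunc 2 (fst v) = B * mvar 0 * mconst e'" "trunc 2 (snd v) = B * mvar 1 * mconst e'"
    using v(2) q'(2) e' by (auto simp: restr_def)
  have inv: "mconst (inverse e') * (p * mconst e') = p" for p :: "'k mpol"
    using mconst_inverse_mult [OF e'0, of p] by (simp add: mult.commute)
  have "trunc 2 (dot 2 (pair_vec ?v) (\<beta> Y)) = B * lb Y" for Y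
    unfolding dot_pair pscale2_def fst_conv snd_conv trunc_simps rv inv lin2 by (simp add: algebra_simps)
  moreover have "mvar 0 * trunc 2 (pair_vec x 1) - mvar 1 * trunc 2 (pair_vec x 0) = mconst e * (\<Prod>Y\<in>J. lb Y)"
    using q(2) by (simp add: wedge_def restr_def pair_vec_def e mult.commute)
  ultimately show ?thesis
    using in3 [OF x(1)] in3 [OF vN] e0 NN_G [OF x(1)] NN_G [OF vN]
    by (intro bexI [of _ "pair_vec x"] bexI [of _ "pair_vec ?v"] exI [of _ e]) auto
qed

end

section \<open>From three variables to localizations of rank three\<close>

context pencils
begin

definition over :: "'j set \<Rightarrow> 'i set" where "over P = {L \<in> I. z L \<in> P}"

text \<open>Cramer's rule for a non-zero two-by-two minor, found in the columns i and j.\<close>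

lemma dual_vectors:
  assumes "Y1 \<in> J" "Y2 \<in> J" "Y1 \<noteq> Y2"
  obtains u1 u2 :: "nat \<Rightarrow> 'k" where
    "(\<Sum>i<n. \<beta> Y1 i * u1 i) = 1" "(\<Sum>i<n. \<beta> Y2 i * u1 i) = 0"
    "(\<Sum>i<n. \<beta> Y1 i * u2 i) = 0" "(\<Sum>i<n. \<beta> Y2 i * u2 i) = 1"
proof -
  obtain i where i: "i < n" "\<beta> Y1 i \<noteq> 0" using lin_nonzero [OF assms(1)] lin_eq_0_iff by blast
  obtain j where j: "j < n" "\<beta> Y2 j \<noteq> (\<beta> Y2 i / \<beta> Y1 i) * \<beta> Y1 j"
    using non_prop' [of Y2 Y1 "\<beta> Y2 i / \<beta> Y1 i"] assms by auto
  have ij: "i \<noteq> j" using j i by auto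
  define d where "d = \<beta> Y1 i * \<beta> Y2 j - \<beta> Y1 j * \<beta> Y2 i"
  have d: "d \<noteq> 0" using j i by (auto simp: d_def field_simps)
  have sum2: "(\<Sum>k<n. w k * (if k = i then a else if k = j then b else 0)) = w i * a + w j * b" for w :: "nat \<Rightarrow> 'k" and a b
  proof -
    have "(\<Sum>k<n. w k * (if k = i then a else if k = j then b else 0))
        = (\<Sum>k<n. (if k = i then w i * a else 0) + (if k = j then w j * b else 0))"
      by (rule sum.cong) (use ij in auto)
    then show ?thesis using i(1) j(1) by (simp add: sum.distrib)
  qed
  show ?thesis
  proof (rule that [of "\<lambda>k. if k = i then \<beta> Y2 j / d else if k = j then - \<beta> Y2 i / d else 0"
        "\<lambda>k. if k = i then - \<beta> Y1 j / d else if k = j then \<beta> Y1 i / d else 0"])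
  qed (unfold sum2, use d in \<open>simp_all add: divide_simps, simp_all add: d_def algebra_simps\<close>)
qed

text \<open>The incidence data for \<open>rank3_lifting\<close>: \<open>pt L e\<close> names the
  flat in which L and e meet, and b plays the role of a second Betti number computed by adding
  hyperplanes. The type argument fixes the type of points, over which the existential cannot
  quantify.\<close>

definition rank3_condition :: "'p itself \<Rightarrow> 'j \<Rightarrow> 'j \<Rightarrow> bool" where
  "rank3_condition _ Y1 Y2 \<longleftrightarrow> (\<exists>(pt :: 'i option \<Rightarrow> 'i option \<Rightarrow> 'p) b.
     (\<forall>e\<in>lines (over (plane Y1 Y2)). \<forall>e'\<in>lines (over (plane Y1 Y2)). \<forall>L\<in>lines (over (plane Y1 Y2)).
        e \<noteq> L \<longrightarrow> e' \<noteq> L \<longrightarrow> (pt L e = pt L e' \<longleftrightarrow> span2 (covec L) (covec e) (covec e'))) \<and>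
     b {None} = (0::nat) \<and>
     (\<forall>A L. A \<subseteq> lines (over (plane Y1 Y2)) \<longrightarrow> None \<in> A \<longrightarrow> L \<in> lines (over (plane Y1 Y2)) \<longrightarrow> L \<notin> A \<longrightarrow>
        b (insert L A) = b A + card (pt L ` A)) \<and>
     b (lines (over (plane Y1 Y2))) \<le> card (over (plane Y1 Y2)) +
       (card (plane Y1 Y2) - 1) * (card (over (plane Y1 Y2)) + 1 - card (plane Y1 Y2)))"

text \<open>The localization at the flat involves only t and the forms spanned by those of Y1 and
  Y2. In these three coordinates it is an arrangement of rank three, whose derivations are carried
  back by the substitution of \<open>lb Y1\<close>, \<open>lb Y2\<close>, t for x_0, x_1,
  x_2.\<close>

lemma locally_free_liftingI:
  assumes "\<And>Y1 Y2. Y1 \<in> J \<Longrightarrow> Y2 \<in> J \<Longrightarrow> Y1 \<noteq> Y2 \<Longrightarrow> rank3_condition TYPE('p) Y1 Y2"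
  shows locally_free_lifting
  unfolding locally_free_lifting_def
proof (intro ballI impI)
  fix Y1 Y2 assume J: "Y1 \<in> J" "Y2 \<in> J" "Y1 \<noteq> Y2"
  let ?P = "plane Y1 Y2"
  obtain u1 u2 where u: "(\<Sum>i<n. \<beta> Y1 i * u1 i) = 1" "(\<Sum>i<n. \<beta> Y2 i * u1 i) = 0"
    "(\<Sum>i<n. \<beta> Y1 i * u2 i) = 0" "(\<Sum>i<n. \<beta> Y2 i * u2 i) = 1"
    by (rule dual_vectors [OF J])
  \<comment> \<open>The coordinates of a form of the plane with respect to Y1 and Y2, obtained by
    pairing with the dual vectors.\<close>
  define \<beta>' where "\<beta>' Y i = (if i = 0 then \<Sum>k<n. \<beta> Y k * u1 k else if i = 1 then \<Sum>k<n. \<beta> Y k * u2 k else 0)"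
    for Y and i :: nat
  have \<beta>': "\<beta> Y = (\<lambda>i. \<beta>' Y 0 * \<beta> Y1 i + \<beta>' Y 1 * \<beta> Y2 i)" if Y: "Y \<in> ?P" for Y
  proof -
    obtain a b where ab: "\<beta> Y = (\<lambda>i. a * \<beta> Y1 i + b * \<beta> Y2 i)"
      using Y by (auto simp: plane_def span2_def)
    have "(\<Sum>k<n. \<beta> Y k * w k) = a * (\<Sum>k<n. \<beta> Y1 k * w k) + b * (\<Sum>k<n. \<beta> Y2 k * w k)" for w
      unfolding ab by (simp add: algebra_simps sum.distrib sum_distrib_left)
    then have "\<beta>' Y 0 = a" "\<beta>' Y 1 = b" by (simp_all add: \<beta>'_def u)
    then show ?thesis using ab by simp
  qed
  have dotP: "dot n f (\<beta> Y) = mconst (\<beta>' Y 0) * dot n f (\<beta> Y1) + mconst (\<beta>' Y 1) * dot n f (\<beta> Y2)"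
    if "Y \<in> ?P" for Y f
    by (subst \<beta>' [OF that]) (simp only: dot_add_right dot_scale_right)
  have lin2: "lin 2 b = mconst (b 0) * mvar 0 + mconst (b 1) * mvar 1" for b :: "nat \<Rightarrow> 'k"
    by (simp add: dot_def numeral_eq_Suc)
  have zP: "z ` over ?P = ?P" using z_image by (auto simp: over_def plane_def)
  have ne: "Y \<in> ?P \<Longrightarrow> \<beta>' Y 0 \<noteq> 0 \<or> \<beta>' Y 1 \<noteq> 0" for Y
    using dotP [of Y mvar] lin_nonzero [OF plane_J] by force
  interpret r: rank3 ?P \<beta>' "over ?P" z c
  proof
    show "finite ?P" by (rule finite_plane)
    show "finite (over ?P)" by (simp add: over_def finite_I)
    show "z ` over ?P = ?P" by (rule zP)
    show "\<beta>' Y i = 0" if "Y \<in> ?P" "2 \<le> i" for Y i using that by (simp add: \<beta>'_def)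
    show "lin 2 (\<beta>' Y) \<noteq> 0" if "Y \<in> ?P" for Y
      unfolding lin_eq_0_iff using ne [OF that] by (metis one_less_numeral_iff semiring_norm(76) zero_less_numeral)
    show "\<beta>' Y \<noteq> (\<lambda>i. s * \<beta>' Z i)" if "Y \<in> ?P" "Z \<in> ?P" "Y \<noteq> Z" for Y Z s
    proof
      assume eq: "\<beta>' Y = (\<lambda>i. s * \<beta>' Z i)"
      have "\<beta> Y = (\<lambda>i. s * \<beta> Z i)"
        by (subst \<beta>' [OF that(1)], subst \<beta>' [OF that(2)]) (simp add: eq algebra_simps)
      then show False using non_prop [of Y Z s] that plane_J by blast
    qed
    show "L = L'" if "L \<in> over ?P" "L' \<in> over ?P" "z L = z L'" "c L = c L'" for L L'
      using c_inj [of L L'] that by (simp add: over_def)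
  qed
  obtain pt :: "'i option \<Rightarrow> 'i option \<Rightarrow> 'p" and b where
    pt0: "\<forall>e\<in>lines (over ?P). \<forall>e'\<in>lines (over ?P). \<forall>L\<in>lines (over ?P).
        e \<noteq> L \<longrightarrow> e' \<noteq> L \<longrightarrow> (pt L e = pt L e' \<longleftrightarrow> span2 (covec L) (covec e) (covec e'))"
    and b0: "b {None} = (0::nat)"
      "\<forall>A L. A \<subseteq> lines (over ?P) \<longrightarrow> None \<in> A \<longrightarrow> L \<in> lines (over ?P) \<longrightarrow> L \<notin> A \<longrightarrow>
        b (insert L A) = b A + card (pt L ` A)"
      "b (lines (over ?P)) \<le> card (over ?P) + (card ?P - 1) * (card (over ?P) + 1 - card ?P)"
    using assms [OF J] unfolding rank3_condition_def by (elim exE conjE)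
  note pt = pt0 [rule_format] and b = b0(1) b0(2) [rule_format] b0(3)
  have covec: "covec e i = r.covec e 0 * \<beta> Y1 i + r.covec e 1 * \<beta> Y2 i + r.covec e 2 * (if i = n then 1 else 0)"
    if "e \<in> lines (over ?P)" for e i
  proof (cases e)
    case (Some L)
    then have L: "z L \<in> ?P" using that by (auto simp: lines_def over_def)
    show ?thesis
      using fun_cong [OF \<beta>' [OF L], of i] supp [OF J(1), of n] supp [OF J(2), of n]
      by (cases "i = n") (simp_all add: Some vec_def r.vec_def)
  qed simp
  have covec0: "r.covec e i = 0" if "e \<in> lines (over ?P)" "3 \<le> i" for e i
    using r.lines.supp [of e i] that by simp
  have recover: "(\<Sum>k<n. covec e k * u1 k) = r.covec e 0" "(\<Sum>k<n. covec e k * u2 k) = r.covec e 1"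
    "covec e n = r.covec e 2" if "e \<in> lines (over ?P)" for e
  proof -
    have "(\<Sum>k<n. covec e k * w k) = r.covec e 0 * (\<Sum>k<n. \<beta> Y1 k * w k) + r.covec e 1 * (\<Sum>k<n. \<beta> Y2 k * w k)" for w
    proof -
      have "(\<Sum>k<n. covec e k * w k) = (\<Sum>k<n. r.covec e 0 * (\<beta> Y1 k * w k) + r.covec e 1 * (\<beta> Y2 k * w k))"
        by (rule sum.cong) (simp_all add: covec [OF that] algebra_simps)
      then show ?thesis by (simp add: sum.distrib sum_distrib_left)
    qed
    then show "(\<Sum>k<n. covec e k * u1 k) = r.covec e 0" "(\<Sum>k<n. covec e k * u2 k) = r.covec e 1"
      by (simp_all add: u)
    show "covec e n = r.covec e 2" using covec [OF that, of n] supp [OF J(1), of n] supp [OF J(2), of n] by simp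
  qed
  \<comment> \<open>The three coordinates determine a covector of the plane linearly and are
    recovered by pairing with u1 and u2 and by the entry n; so linear relations transfer both
    ways.\<close>
  have span_iff: "span2 (r.covec x) (r.covec y) (r.covec w) \<longleftrightarrow> span2 (covec x) (covec y) (covec w)"
    if "x \<in> lines (over ?P)" "y \<in> lines (over ?P)" "w \<in> lines (over ?P)" for x y w
  proof
    assume "span2 (r.covec x) (r.covec y) (r.covec w)"
    then obtain s v where sv: "r.covec w = (\<lambda>i. s * r.covec x i + v * r.covec y i)" by (auto simp: span2_def)
    have "covec w = (\<lambda>i. s * covec x i + v * covec y i)"
      by (rule ext) (simp add: covec [OF that(1)] covec [OF that(2)] covec [OF that(3)] sv algebra_simps)
    then show "span2 (covec x) (covec y) (covec w)" unfolding span2_def by blast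
  next
    assume "span2 (covec x) (covec y) (covec w)"
    then obtain s v where sv: "covec w = (\<lambda>i. s * covec x i + v * covec y i)" by (auto simp: span2_def)
    have sum_sv: "(\<Sum>k<n. covec w k * q k) = s * (\<Sum>k<n. covec x k * q k) + v * (\<Sum>k<n. covec y k * q k)" for q
      unfolding sv by (simp add: algebra_simps sum.distrib sum_distrib_left)
    have "r.covec w i = s * r.covec x i + v * r.covec y i" for i
    proof -
      have "i = 0 \<or> i = 1 \<or> i = 2 \<or> 3 \<le> i" by arith
      then show ?thesis
        using sum_sv [of u1] sum_sv [of u2] fun_cong [OF sv, of n] covec0 that
        by (elim disjE) (simp_all only: recover, simp_all)
    qed
    then show "span2 (r.covec x) (r.covec y) (r.covec w)" unfolding span2_def by blast
  qed
  have pt': "pt L e = pt L e' \<longleftrightarrow> span2 (r.covec L) (r.covec e) (r.covec e')"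
    if "e \<in> lines (over ?P)" "e' \<in> lines (over ?P)" "L \<in> lines (over ?P)" "e \<noteq> L" "e' \<noteq> L" for e e' L
    unfolding span_iff [OF that(3,1,2)] by (rule pt [OF that])
  have card_P: "1 \<le> card ?P" using plane_self [OF J(1)] finite_plane by (simp add: Suc_le_eq card_gt_0_iff) blast
  have "\<exists>\<Psi>\<in>vecs 2 3. \<exists>\<Xi>\<in>vecs 2 3. \<exists>e. e \<noteq> 0 \<and>
    (\<forall>Y\<in>?P. r.G Y dvd dot 2 \<Psi> (\<beta>' Y) \<and> r.G Y dvd dot 2 \<Xi> (\<beta>' Y) \<and> trunc 2 (dot 2 \<Xi> (\<beta>' Y)) = r.B * lin 2 (\<beta>' Y)) \<and>
    mvar 0 * trunc 2 (\<Psi> 1) - mvar 1 * trunc 2 (\<Psi> 0) = mconst e * (\<Prod>Y\<in>?P. lin 2 (\<beta>' Y))"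
    by (rule r.rank3_lifting [where pt = pt and b = b, OF card_P _ b(1) _ b(3)],
        rule pt', assumption+, rule b(2), assumption+)
  then obtain \<psi> \<xi> e where \<psi>: "\<psi> \<in> vecs 2 3" "\<xi> \<in> vecs 2 3" "e \<noteq> 0"
    and G': "\<forall>Y\<in>?P. r.G Y dvd dot 2 \<psi> (\<beta>' Y) \<and> r.G Y dvd dot 2 \<xi> (\<beta>' Y) \<and> trunc 2 (dot 2 \<xi> (\<beta>' Y)) = r.B * lin 2 (\<beta>' Y)"
    and det: "mvar 0 * trunc 2 (\<psi> 1) - mvar 1 * trunc 2 (\<psi> 0) = mconst e * (\<Prod>Y\<in>?P. lin 2 (\<beta>' Y))"
    by (elim bexE exE conjE)
  define \<sigma> where "\<sigma> i = (if i = 0 then lb Y1 else if i = 1 then lb Y2 else if i = (2::nat) then t else 0)" for i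
  let ?s = "psubst \<sigma>"
  have s_lin: "?s (lin 2 (\<beta>' Y)) = lb Y" if "Y \<in> ?P" for Y
    by (simp add: lin2 \<sigma>_def dotP [OF that])
  have s_form: "?s (r.form L) = form L" if "L \<in> over ?P" for L
    using s_lin [of "z L"] that by (simp add: r.form_def form_def over_def) (simp add: \<sigma>_def)
  have fibre: "r.fibre Y = fibre Y" if "Y \<in> ?P" for Y
    unfolding r.fibre_def fibre_def using that by (auto simp: over_def)
  have m: "r.m Y = m Y" if "Y \<in> ?P" for Y
    by (simp add: r.m_def m_def fibre [OF that])
  have s_G: "?s (r.G Y) = G Y" if "Y \<in> ?P" for Y
    unfolding r.G_def G_def fibre [OF that] psubst_prod
    by (rule prod.cong) (use that in \<open>auto intro!: s_form simp: fibre_def over_def\<close>)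
  have s_B: "?s r.B = (\<Prod>X\<in>?P. lb X ^ (m X - 1))"
    unfolding r.B_def psubst_prod by (rule prod.cong) (simp_all add: m s_lin)
  have s_trunc: "trunc n (?s p) = ?s (trunc 2 p)" if "p \<in> poly_ring 3" for p
    using that
  proof (induction rule: poly_ring_induct)
    case (var i)
    then have "i = 0 \<or> i = 1 \<or> i = 2" by auto
    then show ?case by (auto simp: \<sigma>_def trunc_mvar trunc_eq)
  qed simp_all
  have s_in: "?s p \<in> poly_ring (Suc n)" if "p \<in> poly_ring 3" for p
    using that by (rule psubst_in_poly_ring) (auto simp: \<sigma>_def intro: lin_in_poly_ring)
  \<comment> \<open>The combination of u1 and u2 whose values on the forms of Y1 and Y2 are the
    images of f 0 and f 1.\<close>
  define lift where "lift f i = mconst (u1 i) * ?s (f 0) + mconst (u2 i) * ?s (f 1)" for f :: "nat \<Rightarrow> 'k mpol" and i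
  have lift_dot: "dot n (lift f) b = mconst (\<Sum>i<n. b i * u1 i) * ?s (f 0) + mconst (\<Sum>i<n. b i * u2 i) * ?s (f 1)" for f b
    by (simp add: dot_def lift_def mconst_sum mconst_mult algebra_simps sum.distrib sum_distrib_left)
  have lift12: "dot n (lift f) (\<beta> Y1) = ?s (f 0)" "dot n (lift f) (\<beta> Y2) = ?s (f 1)" for f
    unfolding lift_dot u by simp_all
  have lift_P: "dot n (lift f) (\<beta> Y) = ?s (dot 2 f (\<beta>' Y))" if "Y \<in> ?P" for f Y
    unfolding dotP [OF that] lift12 by (simp add: dot_def numeral_eq_Suc)
  have lift_in: "lift f \<in> vecs n (Suc n)" if "f \<in> vecs 2 3" for f
    using that s_in by (simp add: lift_def)
  have "trunc n (dot n (lift \<xi>) (\<beta> Y)) = (\<Prod>X\<in>?P. lb X ^ (m X - 1)) * lb Y" if Y: "Y \<in> ?P" for Y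
  proof -
    have "dot 2 \<xi> (\<beta>' Y) \<in> poly_ring 3" by (rule vecs_dot [OF \<psi>(2)])
    from s_trunc [OF this] show ?thesis using G' Y by (simp add: lift_P s_B s_lin)
  qed
  moreover have "G Y dvd dot n (lift f) (\<beta> Y)" if Y: "Y \<in> ?P" and "r.G Y dvd dot 2 f (\<beta>' Y)" for Y f
    using psubst_dvd [OF that(2), of \<sigma>] by (simp add: lift_P [OF Y] s_G [OF Y])
  moreover have "lb Y1 * trunc n (dot n (lift \<psi>) (\<beta> Y2)) - lb Y2 * trunc n (dot n (lift \<psi>) (\<beta> Y1))
      = mconst e * (\<Prod>X\<in>?P. lb X)"
  proof -
    have "\<psi> 0 \<in> poly_ring 3" "\<psi> 1 \<in> poly_ring 3" using \<psi>(1) by auto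
    then have "lb Y1 * trunc n (dot n (lift \<psi>) (\<beta> Y2)) - lb Y2 * trunc n (dot n (lift \<psi>) (\<beta> Y1))
        = ?s (mvar 0 * trunc 2 (\<psi> 1) - mvar 1 * trunc 2 (\<psi> 0))"
      by (simp add: lift12 s_trunc \<sigma>_def)
    also have "\<dots> = mconst e * (\<Prod>X\<in>?P. lb X)"
      unfolding det by (simp add: s_lin)
    finally show ?thesis .
  qed
  ultimately show "\<exists>\<Psi>\<in>vecs n (Suc n). \<exists>\<Xi>\<in>vecs n (Suc n). \<exists>e. e \<noteq> 0 \<and>
        (\<forall>Y\<in>?P. G Y dvd dot n \<Psi> (\<beta> Y) \<and> G Y dvd dot n \<Xi> (\<beta> Y) \<and>
           trunc n (dot n \<Xi> (\<beta> Y)) = (\<Prod>X\<in>?P. lb X ^ (m X - 1)) * lb Y) \<and>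
        lb Y1 * trunc n (dot n \<Psi> (\<beta> Y2)) - lb Y2 * trunc n (dot n \<Psi> (\<beta> Y1))
          = mconst e * (\<Prod>X\<in>?P. lb X)"
    using G' \<psi>(3) lift_in [OF \<psi>(1)] lift_in [OF \<psi>(2)]
    by (intro bexI [of _ "lift \<psi>"] bexI [of _ "lift \<xi>"] exI [of _ e]) (simp_all only:, simp_all)
qed

end

section \<open>Derivations as vectors of polynomials\<close>

lemma DerD:
  assumes "\<theta> \<in> Der n"
  shows "f \<in> poly_ring n \<Longrightarrow> \<theta> f \<in> poly_ring n"
    and "f \<in> poly_ring n \<Longrightarrow> g \<in> poly_ring n \<Longrightarrow> \<theta> (f + g) = \<theta> f + \<theta> g"
    and "f \<in> poly_ring n \<Longrightarrow> \<theta> (mconst a * f) = mconst a * \<theta> f"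
    and "f \<in> poly_ring n \<Longrightarrow> g \<in> poly_ring n \<Longrightarrow> \<theta> (f * g) = f * \<theta> g + g * \<theta> f"
    and "f \<notin> poly_ring n \<Longrightarrow> \<theta> f = undefined"
  using assms unfolding Der_def by (auto simp: PiE_iff extensional_def)

lemma Der_mconst: "\<theta> \<in> Der n \<Longrightarrow> \<theta> (mconst a) = 0"
proof -
  assume \<theta>: "\<theta> \<in> Der n"
  have "\<theta> (1 * 1) = 1 * \<theta> 1 + 1 * \<theta> 1" by (rule DerD(4) [OF \<theta>]) auto
  then have "\<theta> 1 = \<theta> 1 + \<theta> 1" by (simp only: mult_1)
  then have "\<theta> 1 = 0" by (simp only: add_cancel_right_right)
  then show ?thesis using DerD(3) [OF \<theta> poly_ring_1, of a] by simp
qed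

lemma Der_sum: "\<theta> \<in> Der n \<Longrightarrow> (\<And>x. x \<in> A \<Longrightarrow> f x \<in> poly_ring n) \<Longrightarrow> \<theta> (sum f A) = (\<Sum>x\<in>A. \<theta> (f x))"
proof (induction A rule: infinite_finite_induct)
  case (insert x A)
  then show ?case using DerD(2) [of \<theta> n "f x" "sum f A"] by simp
qed (use Der_mconst [of \<theta> n 0] in simp_all)

lemma Der_lin:
  assumes \<theta>: "\<theta> \<in> Der n" shows "\<theta> (lin n b) = dot n (\<lambda>i. \<theta> (mvar i)) b"
proof -
  have "\<theta> (lin n b) = (\<Sum>i<n. \<theta> (mconst (b i) * mvar i))"
    unfolding dot_def by (rule Der_sum [OF \<theta>]) simp
  also have "\<dots> = (\<Sum>i<n. mconst (b i) * \<theta> (mvar i))"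
    by (rule sum.cong) (simp_all add: DerD(3) [OF \<theta>])
  finally show ?thesis by (simp add: dot_def)
qed

text \<open>A derivation is determined by its values on the variables, and both sides obey the
  Leibniz rule.\<close>

lemma Der_combination:
  assumes \<theta>: "\<theta> \<in> Der n" and \<Theta>: "\<Theta> \<subseteq> Der n"
    and eq: "\<And>i. i < n \<Longrightarrow> \<theta> (mvar i) = (\<Sum>\<eta>\<in>\<Theta>. a \<eta> * \<eta> (mvar i))" and f: "f \<in> poly_ring n"
  shows "\<theta> f = (\<Sum>\<eta>\<in>\<Theta>. a \<eta> * \<eta> f)"
  using f
proof (induction rule: poly_ring_induct)
  case (const e)
  have "(\<Sum>\<eta>\<in>\<Theta>. a \<eta> * \<eta> (mconst e)) = 0" using \<Theta> Der_mconst by (intro sum.neutral) auto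
  then show ?case using Der_mconst [OF \<theta>] by simp
next
  case (add p q)
  have "(\<Sum>\<eta>\<in>\<Theta>. a \<eta> * \<eta> (p + q)) = (\<Sum>\<eta>\<in>\<Theta>. a \<eta> * \<eta> p + a \<eta> * \<eta> q)"
  proof (rule sum.cong)
    fix \<eta> assume "\<eta> \<in> \<Theta>"
    then have "\<eta> (p + q) = \<eta> p + \<eta> q" using \<Theta> add DerD(2) by blast
    then show "a \<eta> * \<eta> (p + q) = a \<eta> * \<eta> p + a \<eta> * \<eta> q" by (simp add: distrib_left)
  qed simp
  then show ?case using DerD(2) [OF \<theta>] add by (simp add: sum.distrib)
next
  case (mult p q)
  have "(\<Sum>\<eta>\<in>\<Theta>. a \<eta> * \<eta> (p * q)) = (\<Sum>\<eta>\<in>\<Theta>. p * (a \<eta> * \<eta> q) + q * (a \<eta> * \<eta> p))"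
  proof (rule sum.cong)
    fix \<eta> assume "\<eta> \<in> \<Theta>"
    then have "\<eta> (p * q) = p * \<eta> q + q * \<eta> p" using \<Theta> mult DerD(4) by blast
    then show "a \<eta> * \<eta> (p * q) = p * (a \<eta> * \<eta> q) + q * (a \<eta> * \<eta> p)" by (simp add: algebra_simps)
  qed simp
  then show ?case using DerD(4) [OF \<theta>] mult by (simp add: sum.distrib sum_distrib_left)
qed (use eq in auto)

text \<open>
  The derivation with values \<open>f\<^sub>i\<close> on the variables is read off from the substitution
  \<open>x\<^sub>i \<mapsto> x\<^sub>i + \<epsilon> f\<^sub>i\<close>, where the fresh variable \<open>x\<^sub>n\<close> plays the role of \<open>\<epsilon>\<close>.
\<close>

definition eps_coeff :: "nat \<Rightarrow> ('k::field) mpol \<Rightarrow> 'k mpol" where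
  "eps_coeff n q = trunc n (THE k. q = trunc n q + mvar n * k)"

lemma eps_coeff_eq:
  assumes "a \<in> poly_ring n" shows "eps_coeff n (a + mvar n * k) = trunc n k"
proof -
  have "(THE k'. a + mvar n * k = trunc n (a + mvar n * k) + mvar n * k') = k"
    by (rule the_equality) (use assms in \<open>auto simp: trunc_eq trunc_mvar\<close>)
  then show ?thesis by (simp add: eps_coeff_def)
qed

definition der_of :: "nat \<Rightarrow> (nat \<Rightarrow> ('k::field) mpol) \<Rightarrow> 'k mpol \<Rightarrow> 'k mpol" where
  "der_of n f p = (if p \<in> poly_ring n then eps_coeff n (psubst (\<lambda>i. mvar i + mvar n * f i) p) else undefined)"

lemma eps_subst: "p \<in> poly_ring n \<Longrightarrow> \<exists>k. psubst (\<lambda>i. mvar i + mvar n * f i) p = p + mvar n * k"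
proof (induction rule: poly_ring_induct)
  case (const c)
  show ?case by (intro exI [of _ 0]) simp
next
  case (var i)
  show ?case by (intro exI [of _ "f i"]) simp
next
  case (add p q)
  then obtain k k' where "psubst (\<lambda>i. mvar i + mvar n * f i) p = p + mvar n * k"
    "psubst (\<lambda>i. mvar i + mvar n * f i) q = q + mvar n * k'" by blast
  then show ?case by (intro exI [of _ "k + k'"]) (simp add: algebra_simps)
next
  case (mult p q)
  then obtain k k' where "psubst (\<lambda>i. mvar i + mvar n * f i) p = p + mvar n * k"
    "psubst (\<lambda>i. mvar i + mvar n * f i) q = q + mvar n * k'" by blast
  then show ?case by (intro exI [of _ "p * k' + q * k + mvar n * k * k'"]) (simp add: algebra_simps)
qed

lemma der_of_Der:
  fixes f :: "nat \<Rightarrow> ('k::field) mpol" shows "der_of n f \<in> Der n"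
proof -
  let ?s = "psubst (\<lambda>i. mvar i + mvar n * f i)"
  have ex: "\<exists>k. ?s p = p + mvar n * k \<and> der_of n f p = trunc n k" if "p \<in> poly_ring n" for p
    using eps_subst [OF that, of f] eps_coeff_eq [OF that] that by (auto simp: der_of_def)
  have val: "der_of n f p = trunc n k" if "p \<in> poly_ring n" "?s p = p + mvar n * k" for p k
    using that eps_coeff_eq [OF that(1)] by (simp add: der_of_def)
  show ?thesis
    unfolding Der_def
  proof (intro CollectI conjI ballI allI PiE_I)
    fix p :: "'k mpol" assume p: "p \<in> poly_ring n"
    then obtain k where k: "?s p = p + mvar n * k" "der_of n f p = trunc n k" using ex by blast
    show "der_of n f p \<in> poly_ring n" unfolding k(2) by simp
    show "der_of n f (mconst c * p) = mconst c * der_of n f p" for c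
      using val [of "mconst c * p" "mconst c * k"] p k by (simp add: algebra_simps)
    fix q :: "'k mpol" assume q: "q \<in> poly_ring n"
    then obtain l where l: "?s q = q + mvar n * l" "der_of n f q = trunc n l" using ex by blast
    show "der_of n f (p + q) = der_of n f p + der_of n f q"
      using val [of "p + q" "k + l"] p q k l by (simp add: algebra_simps)
    show "der_of n f (p * q) = p * der_of n f q + q * der_of n f p"
      using val [of "p * q" "p * l + q * k + mvar n * k * l"] p q k l
      by (simp add: algebra_simps trunc_eq trunc_mvar)
  next
    fix p :: "'k mpol" assume "p \<notin> poly_ring n"
    then show "der_of n f p = undefined" by (simp add: der_of_def)
  qed
qed

lemma der_of_mvar: "i < n \<Longrightarrow> f i \<in> poly_ring n \<Longrightarrow> der_of n f (mvar i) = f i"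
  using eps_coeff_eq [of "mvar i" n "f i"] by (simp add: der_of_def trunc_eq)

text \<open>The dictionary between a module M of derivations and the set D of their value vectors on
  the variables. Entries from n on carry no meaning, whence the last clause.\<close>

definition coeff_vecs :: "nat \<Rightarrow> (('k::field) mpol \<Rightarrow> 'k mpol) set \<Rightarrow> (nat \<Rightarrow> 'k mpol) set \<Rightarrow> bool" where
  "coeff_vecs n M D \<longleftrightarrow> D \<subseteq> vecs n n \<and>
    (\<forall>\<theta>\<in>Der n. \<theta> \<in> M \<longleftrightarrow> (\<lambda>i. \<theta> (mvar i)) \<in> D) \<and> M \<subseteq> Der n \<and>
    (\<forall>f g. f \<in> D \<longrightarrow> (\<forall>i<n. g i = f i) \<longrightarrow> g \<in> D)"

lemma coeff_vecsD:
  assumes "coeff_vecs n M D"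
  shows "f \<in> D \<Longrightarrow> f \<in> vecs n n" "\<theta> \<in> Der n \<Longrightarrow> \<theta> \<in> M \<longleftrightarrow> (\<lambda>i. \<theta> (mvar i)) \<in> D" "M \<subseteq> Der n"
    and "f \<in> D \<Longrightarrow> (\<And>i. i < n \<Longrightarrow> g i = f i) \<Longrightarrow> g \<in> D"
  using assms unfolding coeff_vecs_def by (blast, blast, blast, simp)

lemma der_of_in:
  assumes D: "coeff_vecs n M D" and f: "f \<in> D"
  shows "der_of n f \<in> M" "i < n \<Longrightarrow> der_of n f (mvar i) = f i"
proof -
  show mv: "der_of n f (mvar i) = f i" if "i < n" for i
    using that coeff_vecsD(1) [OF D f] by (intro der_of_mvar) auto
  have "(\<lambda>i. der_of n f (mvar i)) \<in> D" by (rule coeff_vecsD(4) [OF D f]) (rule mv)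
  then show "der_of n f \<in> M" using coeff_vecsD(2) [OF D der_of_Der] by (simp only:)
qed

lemma der_basis_to_vecs:
  fixes \<Theta> :: "(('k::field) mpol \<Rightarrow> 'k mpol) set"
  assumes D: "coeff_vecs n M D" and b: "der_basis n M \<Theta>"
  shows "finite \<Theta>" "\<theta> \<in> \<Theta> \<Longrightarrow> (\<lambda>i. \<theta> (mvar i)) \<in> D"
    and "\<eta> \<in> D \<Longrightarrow> \<exists>a. (\<forall>\<theta>\<in>\<Theta>. a \<theta> \<in> poly_ring n) \<and> (\<forall>i<n. \<eta> i = (\<Sum>\<theta>\<in>\<Theta>. a \<theta> * \<theta> (mvar i)))"
    and "(\<forall>\<theta>\<in>\<Theta>. a \<theta> \<in> poly_ring n) \<Longrightarrow> (\<forall>i<n. (\<Sum>\<theta>\<in>\<Theta>. a \<theta> * \<theta> (mvar i)) = 0) \<Longrightarrow> \<forall>\<theta>\<in>\<Theta>. a \<theta> = 0"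
proof -
  have \<Theta>M: "\<Theta> \<subseteq> M" and MD: "M \<subseteq> Der n" using D b by (auto simp: coeff_vecs_def der_basis_def)
  have \<Theta>D: "\<Theta> \<subseteq> Der n" using \<Theta>M MD by blast
  show "finite \<Theta>" using b by (simp add: der_basis_def)
  show "(\<lambda>i. \<theta> (mvar i)) \<in> D" if "\<theta> \<in> \<Theta>" using D \<Theta>M \<Theta>D that by (auto simp: coeff_vecs_def)
  show "\<exists>a. (\<forall>\<theta>\<in>\<Theta>. a \<theta> \<in> poly_ring n) \<and> (\<forall>i<n. \<eta> i = (\<Sum>\<theta>\<in>\<Theta>. a \<theta> * \<theta> (mvar i)))" if \<eta>: "\<eta> \<in> D"
  proof -
    note mv = der_of_in(2) [OF D \<eta>]
    have "der_of n \<eta> \<in> M" by (rule der_of_in(1) [OF D \<eta>])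
    then obtain a where "a \<in> \<Theta> \<rightarrow> poly_ring n" "\<forall>f\<in>poly_ring n. der_of n \<eta> f = (\<Sum>\<theta>\<in>\<Theta>. a \<theta> * \<theta> f)"
      using b unfolding der_basis_def by blast
    then show ?thesis using mv by (intro exI [of _ a]) auto
  qed
  show "\<forall>\<theta>\<in>\<Theta>. a \<theta> = 0"
    if a: "\<forall>\<theta>\<in>\<Theta>. a \<theta> \<in> poly_ring n" "\<forall>i<n. (\<Sum>\<theta>\<in>\<Theta>. a \<theta> * \<theta> (mvar i)) = 0"
  proof -
    \<comment> \<open>The relation is given on the variables only. Writing the zero derivation as
      the combination with coefficients a extends it to all of \<open>poly_ring n\<close>.\<close>
    define \<zeta> :: "'k mpol \<Rightarrow> 'k mpol" where "\<zeta> = der_of n (\<lambda>i. 0)"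
    have \<zeta>: "\<zeta> \<in> Der n" "\<And>i. i < n \<Longrightarrow> \<zeta> (mvar i) = 0" by (simp_all add: \<zeta>_def der_of_Der der_of_mvar)
    have z0: "\<zeta> f = 0" if "f \<in> poly_ring n" for f
      using Der_combination [OF \<zeta>(1), of "{}" "\<lambda>_. 0" f] \<zeta>(2) that by simp
    have z1: "\<zeta> f = (\<Sum>\<theta>\<in>\<Theta>. a \<theta> * \<theta> f)" if "f \<in> poly_ring n" for f
      by (rule Der_combination [OF \<zeta>(1) \<Theta>D _ that]) (use a(2) \<zeta>(2) in auto)
    have rel: "\<forall>f\<in>poly_ring n. (\<Sum>\<theta>\<in>\<Theta>. a \<theta> * \<theta> f) = 0"
    proof
      fix f :: "'k mpol" assume f: "f \<in> poly_ring n"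
      show "(\<Sum>\<theta>\<in>\<Theta>. a \<theta> * \<theta> f) = 0" unfolding z1 [OF f, symmetric] by (rule z0 [OF f])
    qed
    have "a \<in> \<Theta> \<rightarrow> poly_ring n" using a(1) by auto
    moreover have "\<forall>c\<in>\<Theta> \<rightarrow> poly_ring n. (\<forall>f\<in>poly_ring n. (\<Sum>\<eta>\<in>\<Theta>. c \<eta> * \<eta> f) = 0) \<longrightarrow> (\<forall>\<eta>\<in>\<Theta>. c \<eta> = 0)"
      using b unfolding der_basis_def by (elim conjE)
    ultimately show ?thesis using rel by (elim ballE [of _ _ a]) simp_all
  qed
qed

lemma vecs_to_der_basis:
  fixes \<Phi> :: "'x \<Rightarrow> nat \<Rightarrow> ('k::field) mpol"
  assumes D: "coeff_vecs n M D" and K: "finite K" "\<And>k. k \<in> K \<Longrightarrow> \<Phi> k \<in> D"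
    and gen: "\<And>\<eta>. \<eta> \<in> D \<Longrightarrow> \<exists>a. (\<forall>k\<in>K. a k \<in> poly_ring n) \<and> (\<forall>i<n. \<eta> i = (\<Sum>k\<in>K. a k * \<Phi> k i))"
    and indep: "\<And>a. (\<forall>k\<in>K. a k \<in> poly_ring n) \<Longrightarrow> (\<forall>i<n. (\<Sum>k\<in>K. a k * \<Phi> k i) = 0) \<Longrightarrow> \<forall>k\<in>K. a k = 0"
    and hom: "\<And>k. k \<in> K \<Longrightarrow> \<exists>d. \<forall>i<n. homogeneous_poly d (\<Phi> k i)"
  shows "\<exists>\<Theta>. der_basis n M \<Theta> \<and> (\<forall>\<theta>\<in>\<Theta>. homogeneous_derivation n \<theta>)"
proof -
  let ?d = "\<lambda>k. der_of n (\<Phi> k)"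
  have mv: "?d k (mvar i) = \<Phi> k i" if "k \<in> K" "i < n" for k i
    by (rule der_of_in(2) [OF D K(2) [OF that(1)] that(2)])
  have dM: "?d k \<in> M" if "k \<in> K" for k by (rule der_of_in(1) [OF D K(2) [OF that]])
  \<comment> \<open>Equal members at different indices would satisfy a relation with coefficients 1
    and -1. Injectivity allows the family to be replaced by the set of its members.\<close>
  have inj: "inj_on ?d K"
  proof (rule inj_onI, rule ccontr)
    fix k l assume kl: "k \<in> K" "l \<in> K" "?d k = ?d l" "k \<noteq> l"
    let ?a = "\<lambda>x. if x = k then 1 else if x = l then - 1 else (0 :: 'k mpol)"
    have "(\<Sum>x\<in>K. ?a x * \<Phi> x i) = 0" if i: "i < n" for i
    proof -
      have "(\<Sum>x\<in>K. ?a x * \<Phi> x i) = (\<Sum>x\<in>K. (if x = k then \<Phi> k i else 0) - (if x = l then \<Phi> l i else 0))"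
        by (rule sum.cong) (use kl in auto)
      also have "\<dots> = \<Phi> k i - \<Phi> l i" using K(1) kl by (simp add: sum_subtractf)
      also have "\<dots> = 0" using mv [OF kl(1) i] mv [OF kl(2) i] kl(3) by simp
      finally show ?thesis .
    qed
    moreover have "\<forall>x\<in>K. ?a x \<in> poly_ring n" using poly_ring_uminus [OF poly_ring_1] by auto
    ultimately have "\<forall>x\<in>K. ?a x = 0" by (intro indep) auto
    then show False using kl(1) by auto
  qed
  have sum_img: "(\<Sum>\<theta>\<in>?d ` K. a \<theta> * \<theta> f) = (\<Sum>k\<in>K. a (?d k) * ?d k f)" for a f
    by (simp add: sum.reindex [OF inj])
  have sub: "?d ` K \<subseteq> Der n" by (auto simp: der_of_Der)
  have "der_basis n M (?d ` K)"
    unfolding der_basis_def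
  proof (intro conjI ballI impI)
    show "finite (?d ` K)" using K by simp
    show "?d ` K \<subseteq> M" using dM by auto
    fix \<theta> assume \<theta>: "\<theta> \<in> M"
    then have \<theta>D: "\<theta> \<in> Der n" "(\<lambda>i. \<theta> (mvar i)) \<in> D" using D by (auto simp: coeff_vecs_def)
    obtain a where a: "\<forall>k\<in>K. a k \<in> poly_ring n" "\<forall>i<n. \<theta> (mvar i) = (\<Sum>k\<in>K. a k * \<Phi> k i)"
      using gen [OF \<theta>D(2)] by blast
    let ?a = "\<lambda>\<theta>. a (the_inv_into K ?d \<theta>)"
    have a': "?a (?d k) = a k" if "k \<in> K" for k by (simp add: the_inv_into_f_f [OF inj that])
    have eq: "\<theta> f = (\<Sum>\<eta>\<in>?d ` K. ?a \<eta> * \<eta> f)" if "f \<in> poly_ring n" for f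
    proof (rule Der_combination [OF \<theta>D(1) sub _ that])
      fix i assume i: "i < n"
      show "\<theta> (mvar i) = (\<Sum>\<eta>\<in>?d ` K. ?a \<eta> * \<eta> (mvar i))"
        unfolding sum_img using a(2) i by (simp add: a' mv)
    qed
    have "?a \<in> ?d ` K \<rightarrow> poly_ring n" using a(1) a' by auto
    then show "\<exists>c\<in>?d ` K \<rightarrow> poly_ring n. \<forall>f\<in>poly_ring n. \<theta> f = (\<Sum>\<eta>\<in>?d ` K. c \<eta> * \<eta> f)"
      by (intro bexI [of _ ?a] ballI eq)
  next
    fix a \<theta> assume a: "a \<in> ?d ` K \<rightarrow> poly_ring n" "\<forall>f\<in>poly_ring n. (\<Sum>\<eta>\<in>?d ` K. a \<eta> * \<eta> f) = 0"
      and \<theta>: "\<theta> \<in> ?d ` K"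
    have "\<forall>k\<in>K. a (?d k) = 0"
    proof (rule indep)
      show "\<forall>i<n. (\<Sum>k\<in>K. a (?d k) * \<Phi> k i) = 0"
      proof (intro allI impI)
        fix i assume i: "i < n"
        have "(\<Sum>k\<in>K. a (?d k) * ?d k (mvar i)) = 0"
          using a(2) i unfolding sum_img by simp
        then show "(\<Sum>k\<in>K. a (?d k) * \<Phi> k i) = 0" using mv i by simp
      qed
    qed (use a in auto)
    then show "a \<theta> = 0" using \<theta> by auto
  qed
  moreover have "\<forall>\<theta>\<in>?d ` K. homogeneous_derivation n \<theta>"
  proof
    fix \<theta> assume "\<theta> \<in> ?d ` K"
    then obtain k where k: "k \<in> K" "\<theta> = ?d k" by blast
    obtain e where "\<forall>i<n. homogeneous_poly e (\<Phi> k i)" using hom [OF k(1)] by blast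
    then show "homogeneous_derivation n \<theta>"
      unfolding homogeneous_derivation_def by (intro exI [of _ e]) (simp add: k mv)
  qed
  ultimately show ?thesis by blast
qed

section \<open>Linear functionals and hyperplanes\<close>

context finite_dimensional_vector_space
begin

lemma vector_space_self: "vector_space ((*) :: 'a \<Rightarrow> 'a \<Rightarrow> 'a)"
  by unfold_locales (simp_all add: algebra_simps)

abbreviation functional :: "('b \<Rightarrow> 'a) \<Rightarrow> bool" where
  "functional \<alpha> \<equiv> Vector_Spaces.linear scale (*) \<alpha>"

lemma functional_simps:
  assumes "functional \<alpha>"
  shows "\<alpha> (x + y) = \<alpha> x + \<alpha> y" "\<alpha> (x - y) = \<alpha> x - \<alpha> y" "\<alpha> (scale k x) = k * \<alpha> x" "\<alpha> 0 = 0"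
proof -
  interpret vector_space_pair scale "(*) :: 'a \<Rightarrow> 'a \<Rightarrow> 'a"
    by (intro vector_space_pair.intro vector_space_self) unfold_locales
  show "\<alpha> (x + y) = \<alpha> x + \<alpha> y" "\<alpha> (x - y) = \<alpha> x - \<alpha> y" "\<alpha> (scale k x) = k * \<alpha> x" "\<alpha> 0 = 0"
    using linear_add [OF assms] linear_diff [OF assms] linear_scale [OF assms] linear_0 [OF assms] by auto
qed

lemma functional_scale: "functional \<alpha> \<Longrightarrow> functional (\<lambda>x. k * \<alpha> x)"
  unfolding Vector_Spaces.linear_iff by (auto simp: algebra_simps)

lemma functional_eq_on_span:
  assumes "functional \<alpha>" "functional \<gamma>" "\<And>x. x \<in> S \<Longrightarrow> \<alpha> x = \<gamma> x" "x \<in> span S"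
  shows "\<alpha> x = \<gamma> x"
proof -
  interpret vector_space_pair scale "(*) :: 'a \<Rightarrow> 'a \<Rightarrow> 'a"
    by (intro vector_space_pair.intro vector_space_self) unfold_locales
  show ?thesis using linear_eq_on [OF assms(1,2,4)] assms(3) by blast
qed

lemma functional_exists:
  assumes H: "subspace H" "subspace W" "H \<subseteq> W" "dim H + 1 = dim W" and v: "v \<in> W" "v \<notin> H"
  shows "\<exists>\<alpha>. functional \<alpha> \<and> (\<forall>x\<in>H. \<alpha> x = 0) \<and> \<alpha> v = 1 \<and> {x \<in> W. \<alpha> x = 0} = H"
proof -
  interpret vp: vector_space_pair scale "(*) :: 'a \<Rightarrow> 'a \<Rightarrow> 'a"
    by (intro vector_space_pair.intro vector_space_self) unfold_locales
  obtain B where B: "B \<subseteq> H" "independent B" "H \<subseteq> span B" "card B = dim H" by (rule basis_exists [of H])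
  have spB: "span B = H" using span_minimal [OF B(1) H(1)] B(3) by auto
  have finB: "finite B" by (rule finiteI_independent [OF B(2)])
  have ind: "independent (insert v B)" by (rule independent_insertI) (use v spB B in auto)
  have vB: "v \<notin> B" using v B(1) by auto
  have sub: "insert v B \<subseteq> W" using v B(1) H(3) by auto
  have W: "W \<subseteq> span (insert v B)"
    by (rule card_ge_dim_independent [OF sub ind]) (use finB vB B(4) H(4) in simp)
  obtain \<alpha> where \<alpha>: "functional \<alpha>" "\<And>x. x \<in> insert v B \<Longrightarrow> \<alpha> x = (if x = v then 1 else 0)"
    using vp.linear_independent_extend [OF ind, of "\<lambda>x. if x = v then 1 else 0"] by blast
  have zero: "functional (\<lambda>x. 0)" unfolding Vector_Spaces.linear_iff using vector_space_self vector_space_axioms by auto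
  have \<alpha>H: "\<alpha> x = 0" if "x \<in> H" for x
    by (rule functional_eq_on_span [OF \<alpha>(1) zero, of B]) (use \<alpha>(2) vB that spB in auto)
  have ker: "x \<in> H" if x: "x \<in> W" "\<alpha> x = 0" for x
  proof -
    obtain k where k: "x - scale k v \<in> span B"
      using W x(1) span_breakdown_eq [of x v B] by blast
    then have "\<alpha> (x - scale k v) = 0" using \<alpha>H spB by auto
    then have "k = 0" using x(2) \<alpha>(2) [of v] by (simp add: functional_simps [OF \<alpha>(1)])
    then show ?thesis using k spB by simp
  qed
  have "{x \<in> W. \<alpha> x = 0} = H" using ker \<alpha>H H(3) by auto
  then show ?thesis using \<alpha> \<alpha>H by (intro exI [of _ \<alpha>]) simp
qed

lemma functional_proportional:
  assumes W: "subspace W" and \<alpha>: "functional \<alpha>" and \<gamma>: "functional \<gamma>"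
    and ker: "\<forall>x\<in>W. \<gamma> x = 0 \<longrightarrow> \<alpha> x = 0"
  shows "\<exists>s. \<forall>x\<in>W. \<alpha> x = s * \<gamma> x"
proof (cases "\<exists>w\<in>W. \<gamma> w \<noteq> 0")
  case True
  then obtain w where w: "w \<in> W" "\<gamma> w \<noteq> 0" by blast
  show ?thesis
  proof (rule exI [of _ "\<alpha> w / \<gamma> w"], rule ballI)
    fix x assume x: "x \<in> W"
    let ?y = "x - scale (\<gamma> x / \<gamma> w) w"
    have y: "?y \<in> W" by (intro subspace_diff W x subspace_scale w)
    have "\<gamma> ?y = 0" using w(2) by (simp add: functional_simps [OF \<gamma>])
    then have "\<alpha> ?y = 0" using ker y by simp
    then show "\<alpha> x = (\<alpha> w / \<gamma> w) * \<gamma> x" by (simp add: functional_simps [OF \<alpha>])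
  qed
next
  case False
  then show ?thesis using ker by (intro exI [of _ 0]) simp
qed

text \<open>u and w2 are dual to the first two functionals up to scaling. Subtracting the components
  of x along them leaves a vector in the common kernel, where the third functional vanishes.\<close>

lemma functional_span2:
  assumes W: "subspace W" and \<phi>: "functional \<phi>1" "functional \<phi>2" "functional \<phi>3"
    and nz: "\<exists>w\<in>W. \<phi>1 w = 0 \<and> \<phi>2 w \<noteq> 0" "\<exists>w\<in>W. \<phi>1 w \<noteq> 0"
    and ker: "\<forall>x\<in>W. \<phi>1 x = 0 \<longrightarrow> \<phi>2 x = 0 \<longrightarrow> \<phi>3 x = 0"
  shows "\<exists>s r. \<forall>x\<in>W. \<phi>3 x = s * \<phi>1 x + r * \<phi>2 x"
proof -
  obtain w2 where w2: "w2 \<in> W" "\<phi>1 w2 = 0" "\<phi>2 w2 \<noteq> 0" using nz(1) by blast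
  obtain w1 where w1: "w1 \<in> W" "\<phi>1 w1 \<noteq> 0" using nz(2) by blast
  define u where "u = w1 - scale (\<phi>2 w1 / \<phi>2 w2) w2"
  have u: "u \<in> W" "\<phi>1 u = \<phi>1 w1" "\<phi>2 u = 0"
    using w1 w2 by (auto simp: u_def functional_simps [OF \<phi>(1)] functional_simps [OF \<phi>(2)] intro!: subspace_diff subspace_scale W)
  show ?thesis
  proof (rule exI [of _ "\<phi>3 u / \<phi>1 u"], rule exI [of _ "\<phi>3 w2 / \<phi>2 w2"], rule ballI)
    fix x assume x: "x \<in> W"
    let ?y = "x - scale (\<phi>1 x / \<phi>1 u) u - scale (\<phi>2 x / \<phi>2 w2) w2"
    have y: "?y \<in> W" by (intro subspace_diff subspace_scale W x u w2)
    have y0: "\<phi>1 ?y = 0" "\<phi>2 ?y = 0"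
      using u w1 w2 by (simp_all add: functional_simps [OF \<phi>(1)] functional_simps [OF \<phi>(2)])
    have "\<phi>3 ?y = 0" using bspec [OF ker y] y0 by blast
    then show "\<phi>3 x = (\<phi>3 u / \<phi>1 u) * \<phi>1 x + (\<phi>3 w2 / \<phi>2 w2) * \<phi>2 x"
      by (simp add: functional_simps [OF \<phi>(3)] algebra_simps)
  qed
qed

lemma dim_inter_hyperplane:
  assumes H: "subspace H" "subspace W" "H \<subseteq> W" "dim H + 1 = dim W" and P: "subspace P" "P \<subseteq> W" "\<not> P \<subseteq> H"
  shows "dim (P \<inter> H) + 1 = dim P"
proof -
  obtain v where v: "v \<in> P" "v \<notin> H" using P(3) by blast
  have vW: "v \<in> W" using v P by blast
  obtain \<alpha> where \<alpha>: "functional \<alpha>" "\<forall>x\<in>H. \<alpha> x = 0" "\<alpha> v = 1" "{x \<in> W. \<alpha> x = 0} = H"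
    using functional_exists [OF H vW v(2)] by (elim exE conjE)
  obtain B where B: "B \<subseteq> P \<inter> H" "independent B" "P \<inter> H \<subseteq> span B" "card B = dim (P \<inter> H)" by (rule basis_exists [of "P \<inter> H"])
  have PH: "subspace (P \<inter> H)" by (rule subspace_inter [OF P(1) H(1)])
  have spB: "span B = P \<inter> H" using span_minimal [OF B(1) PH] B(3) by auto
  have finB: "finite B" by (rule finiteI_independent [OF B(2)])
  have ind: "independent (insert v B)" by (rule independent_insertI) (use v spB B in auto)
  have "P \<subseteq> span (insert v B)"
  proof
    fix x assume x: "x \<in> P"
    let ?y = "x - scale (\<alpha> x) v"
    have "?y \<in> P" by (intro subspace_diff subspace_scale P(1) x v)
    moreover have "\<alpha> ?y = 0" by (simp add: functional_simps [OF \<alpha>(1)] \<alpha>(3))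
    ultimately have "?y \<in> span B" using \<alpha>(4) P(2) spB by blast
    then show "x \<in> span (insert v B)" using span_breakdown_eq [of x v B] by blast
  qed
  then have "card (insert v B) = dim P"
    using v B(1) by (intro basis_card_eq_dim [OF _ _ ind]) auto
  then show ?thesis using finB v B(1,4) by (subst (asm) card_insert_disjoint) auto
qed

end

section \<open>The characteristic polynomial in rank three\<close>

definition points :: "'v set set \<Rightarrow> 'v set set" where
  "points A = {L \<inter> L' | L L'. L \<in> A \<and> L' \<in> A \<and> L \<noteq> L'}"

definition multi :: "'v set set \<Rightarrow> 'v set \<Rightarrow> nat" where
  "multi A X = card {L \<in> A. X \<subseteq> L}"

text \<open>The sum of the Moebius values of the codimension-two flats, hence the second Betti
  number. These flats are points of the projective plane when the rank is three.\<close>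

definition betti2 :: "'v set set \<Rightarrow> nat" where
  "betti2 A = (\<Sum>X\<in>points A. multi A X - 1)"

text \<open>The one property of hyperplanes on which the incidence count rests: any two members
  through a codimension-two flat already cut it out. In this form it passes to subsets.\<close>

definition rank2_flats :: "'v set set \<Rightarrow> bool" where
  "rank2_flats A \<longleftrightarrow> (\<forall>L1\<in>A. \<forall>L2\<in>A. \<forall>L3\<in>A. L1 \<noteq> L2 \<longrightarrow> L3 \<noteq> L1 \<longrightarrow> L1 \<inter> L2 \<subseteq> L3 \<longrightarrow> L1 \<inter> L3 = L1 \<inter> L2)"

lemma rank2_flatsD:
  "rank2_flats A \<Longrightarrow> L1 \<in> A \<Longrightarrow> L2 \<in> A \<Longrightarrow> L3 \<in> A \<Longrightarrow> L1 \<noteq> L2 \<Longrightarrow> L3 \<noteq> L1 \<Longrightarrow> L1 \<inter> L2 \<subseteq> L3 \<Longrightarrow> L1 \<inter> L3 = L1 \<inter> L2"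
  unfolding rank2_flats_def by blast

lemma finite_points: "finite A \<Longrightarrow> finite (points A)"
proof -
  assume "finite A"
  moreover have "points A \<subseteq> (\<lambda>(L, L'). L \<inter> L') ` (A \<times> A)" by (auto simp: points_def)
  ultimately show ?thesis by (meson finite_SigmaI finite_imageI finite_subset)
qed

text \<open>Every flat on L contributes exactly one: if it is a flat of A already, its multiplicity
  grows by one; otherwise a single member of A contains it, and it enters with multiplicity two.
  Flats not on L are unchanged. This is deletion and restriction for the second Betti
  number.\<close>

lemma betti2_insert:
  assumes fin: "finite A" and L: "L \<notin> A" and flats: "rank2_flats (insert L A)"
  shows "betti2 (insert L A) = betti2 A + card ((\<inter>) L ` A)"
proof -
  let ?Q = "(\<inter>) L ` A"
  have pts: "points (insert L A) = points A \<union> ?Q"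
    using L by (auto simp: points_def)
  have fQ: "finite ?Q" and fp: "finite (points A)" using fin by (auto simp: finite_points)
  have multi_in: "multi (insert L A) X = multi A X + (if X \<subseteq> L then 1 else 0)" for X
  proof -
    have "{M \<in> insert L A. X \<subseteq> M} = (if X \<subseteq> L then insert L {M \<in> A. X \<subseteq> M} else {M \<in> A. X \<subseteq> M})" by auto
    then show ?thesis using fin L by (simp add: multi_def)
  qed
  have pos: "1 \<le> multi A X" if X: "X \<in> ?Q" for X
  proof -
    obtain M where M: "M \<in> A" "X = L \<inter> M" using X by blast
    then have "{M \<in> A. X \<subseteq> M} \<noteq> {}" by blast
    then show ?thesis using fin by (simp add: multi_def Suc_le_eq card_gt_0_iff)
  qed
  have one: "multi A X - 1 = 0" if X: "X \<in> ?Q" "X \<notin> points A" for X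
  proof -
    obtain M where M: "M \<in> A" "X = L \<inter> M" using X by blast
    have "M' = M" if M': "M' \<in> A" "X \<subseteq> M'" for M'
    proof (rule ccontr)
      assume ne: "M' \<noteq> M"
      have "M \<inter> M' = M \<inter> L" using rank2_flatsD [OF flats, of M L M'] M M' ne L by auto
      then have "X = M \<inter> M'" using M(2) by blast
      then have "X \<in> points A" using M(1) M'(1) ne unfolding points_def by blast
      then show False using X by blast
    qed
    then have "{M' \<in> A. X \<subseteq> M'} = {M}" using M by blast
    then show ?thesis by (simp add: multi_def)
  qed
  have notQ: "\<not> X \<subseteq> L" if X: "X \<in> points A" "X \<notin> ?Q" for X
  proof
    assume XL: "X \<subseteq> L"
    obtain M M' where M: "M \<in> A" "M' \<in> A" "M \<noteq> M'" "X = M \<inter> M'" using X by (auto simp: points_def)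
    have "M \<inter> L = M \<inter> M'" using rank2_flatsD [OF flats, of M M' L] M XL L by auto
    then have "X = L \<inter> M" using M(4) by blast
    then show False using X M(1) by blast
  qed
  have step: "multi (insert L A) X - 1 = (multi A X - 1) + (if X \<in> ?Q then 1 else 0)" if "X \<in> points A \<union> ?Q" for X
  proof (cases "X \<in> ?Q")
    case True
    then have "X \<subseteq> L" by auto
    then show ?thesis using pos [OF True] True by (simp add: multi_in)
  next
    case False
    then show ?thesis using notQ [of X] that by (simp add: multi_in)
  qed
  have "betti2 (insert L A) = (\<Sum>X\<in>points A \<union> ?Q. (multi A X - 1) + (if X \<in> ?Q then 1 else 0))"
    unfolding betti2_def pts by (rule sum.cong) (simp_all only: step)
  also have "\<dots> = (\<Sum>X\<in>points A \<union> ?Q. multi A X - 1) + (\<Sum>X\<in>points A \<union> ?Q. if X \<in> ?Q then 1 else 0)"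
    by (rule sum.distrib)
  also have "(\<Sum>X\<in>points A \<union> ?Q. multi A X - 1) = betti2 A"
    unfolding betti2_def by (rule sum.mono_neutral_right) (use fQ fp one in auto)
  also have "(\<Sum>X\<in>points A \<union> ?Q. if X \<in> ?Q then 1 else 0) = (\<Sum>X\<in>?Q. 1::nat)"
    by (rule sum.mono_neutral_cong_right) (use fQ fp in auto)
  finally show ?thesis by simp
qed

text \<open>The last case gathers everything of codimension at least three: in rank two it cannot
  occur, and in rank three it leaves only the common intersection.\<close>

lemma lattice_cases [consumes 2, case_names top atom point deep]:
  assumes sub: "\<forall>L\<in>A. L \<subseteq> W" and Y: "Y \<in> inter_lattice W A"
  obtains "Y = W" | "Y \<in> A" | L1 L2 where "L1 \<in> A" "L2 \<in> A" "L1 \<noteq> L2" "Y = L1 \<inter> L2"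
    | L1 L2 L3 where "L1 \<in> A" "L2 \<in> A" "L1 \<noteq> L2" "L3 \<in> A" "\<not> L1 \<inter> L2 \<subseteq> L3" "Y \<subseteq> L1 \<inter> L2 \<inter> L3"
proof -
  obtain B where B: "B \<subseteq> A" "Y = W \<inter> \<Inter>B" using Y by (auto simp: inter_lattice_def)
  consider "B = {}" | L where "B = {L}" | L1 L2 where "L1 \<in> B" "L2 \<in> B" "L1 \<noteq> L2" by blast
  then show thesis
  proof cases
    case 1 then show ?thesis using that(1) B by simp
  next
    case (2 L)
    then have "Y = L" using B sub by auto
    then show ?thesis using that(2) 2 B by blast
  next
    case (3 L1 L2)
    show ?thesis
    proof (cases "\<forall>L\<in>B. L1 \<inter> L2 \<subseteq> L")
      case True
      then have "Y = L1 \<inter> L2" using B sub 3 by blast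
      then show ?thesis using that(3) 3 B by blast
    next
      case False
      then obtain L3 where "L3 \<in> B" "\<not> L1 \<inter> L2 \<subseteq> L3" by blast
      moreover from this have "Y \<subseteq> L1 \<inter> L2 \<inter> L3" using B 3 by blast
      ultimately show ?thesis using that(4) [of L1 L2 L3] 3 B by blast
    qed
  qed
qed

lemma lattice_top: "W \<in> inter_lattice W A"
  unfolding inter_lattice_def by (rule CollectI, rule exI [of _ "{}"]) simp

lemma lattice_atom: "L \<in> A \<Longrightarrow> L \<subseteq> W \<Longrightarrow> L \<in> inter_lattice W A"
  unfolding inter_lattice_def by (rule CollectI, rule exI [of _ "{L}"]) auto

lemma lattice_point: "L \<in> A \<Longrightarrow> L' \<in> A \<Longrightarrow> L \<subseteq> W \<Longrightarrow> L \<inter> L' \<in> inter_lattice W A"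
  unfolding inter_lattice_def by (rule CollectI, rule exI [of _ "{L, L'}"]) auto

lemma mobius_top: "mobius W A W = 1"
  by (subst mobius.simps) simp

lemma mobius_below: "finite A \<Longrightarrow> Y \<noteq> W \<Longrightarrow> mobius W A Y = - (\<Sum>Z\<in>{Z \<in> inter_lattice W A. Y \<subset> Z}. mobius W A Z)"
  by (subst mobius.simps) simp

lemma sum_monom: "(\<Sum>x\<in>S. monom (f x) k) = monom (\<Sum>x\<in>S. f x) k"
  by (induction S rule: infinite_finite_induct) (simp_all add: add_monom)

lemma monom_mult_quadratic:
  "monom 1 d * [:a, b, c:] = monom a d + monom b (d + 1) + monom (c::int) (d + 2)"
proof -
  have "[:a, b, c:] = monom a 0 + monom b 1 + monom c 2"
    by (simp add: monom_0 monom_Suc numeral_2_eq_2)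
  then show ?thesis by (simp add: distrib_left mult_monom)
qed

text \<open>Both polynomials contain the factors t^d and t - 1. What remains of the divisor is t -
  (h - 1), and the condition that h - 1 is a root of the remaining quadratic is a linear equation
  for b.\<close>

lemma cubic_dvd_imp:
  fixes h n b :: int
  assumes dvd: "monom 1 (d + 2) - monom h (d + 1) + monom (h - 1) d
      dvd monom 1 (d + 3) - monom n (d + 2) + monom b (d + 1) - monom (1 - n + b) d"
    and h: "h \<noteq> 1"
  shows "b = (n - 1) + (h - 1) * (n - h)"
proof -
  let ?p = "monom 1 d * [:-1, 1:] :: int poly"
  have l: "monom 1 (d + 2) - monom h (d + 1) + monom (h - 1) d = ?p * [:- (h - 1), 1:]"
  proof -
    have "[:-1, 1:] * [:- (h - 1), 1:] = [:h - 1, - h, 1:]" by simp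
    then have "?p * [:- (h - 1), 1:] = monom 1 d * [:h - 1, - h, 1:]" by (simp only: mult.assoc)
    then show ?thesis unfolding monom_mult_quadratic by (simp add: minus_monom)
  qed
  have r: "monom 1 (d + 3) - monom n (d + 2) + monom b (d + 1) - monom (1 - n + b) d
      = ?p * [:b - (n - 1), - (n - 1), 1:]"
  proof -
    have "[:-1, 1:] * [:b - (n - 1), - (n - 1), 1:] = [:n - 1 - b, b, - n:] + monom 1 3"
      by (simp add: numeral_3_eq_3 monom_Suc monom_0)
    then have "?p * [:b - (n - 1), - (n - 1), 1:] = monom 1 d * ([:n - 1 - b, b, - n:] + monom 1 3)"
      by (simp only: mult.assoc)
    also have "\<dots> = monom (n - 1 - b) d + monom b (d + 1) + monom (- n) (d + 2) + monom 1 (d + 3)"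
      unfolding distrib_left monom_mult_quadratic by (simp add: mult_monom)
    also have "\<dots> = monom 1 (d + 3) - monom n (d + 2) + monom b (d + 1) - monom (1 - n + b) d"
      by (simp add: minus_monom [symmetric] diff_monom [symmetric] add_monom [symmetric])
    finally show ?thesis by simp
  qed
  have "?p * [:- (h - 1), 1:] dvd ?p * [:b - (n - 1), - (n - 1), 1:]" using dvd unfolding l r .
  moreover have "?p \<noteq> 0" unfolding mult_eq_0_iff by simp
  ultimately have "[:- (h - 1), 1:] dvd [:b - (n - 1), - (n - 1), 1:]" using dvd_mult_cancel_left by blast
  then have "poly [:b - (n - 1), - (n - 1), 1:] (h - 1) = 0" unfolding poly_eq_0_iff_dvd .
  then show ?thesis by (simp add: algebra_simps)
qed

section \<open>Characteristic polynomials of arrangements of rank two and three\<close>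

context finite_dimensional_vector_space
begin

lemma arrangementD:
  assumes "arrangement scale W A"
  shows "subspace W" "finite A" "L \<in> A \<Longrightarrow> subspace L" "L \<in> A \<Longrightarrow> L \<subseteq> W" "L \<in> A \<Longrightarrow> dim L + 1 = dim W"
  using assms by (auto simp: arrangement_def)

lemma dim_less: "subspace S \<Longrightarrow> subspace T \<Longrightarrow> S \<subset> T \<Longrightarrow> dim S < dim T"
  using subspace_dim_equal [of S T] dim_subset [of S T] by (metis less_imp_le not_less psubsetE psubset_imp_subset)

lemma hyperplane_eq:
  assumes A: "arrangement scale W A" and L: "L \<in> A" "L' \<in> A" "L \<subseteq> L'" shows "L = L'"
  using subspace_dim_equal [of L L'] arrangementD [OF A] L by (metis add_right_cancel order_refl)

lemma dim_point:
  assumes A: "arrangement scale W A" and L: "L \<in> A" "L' \<in> A" "L \<noteq> L'"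
  shows "dim (L \<inter> L') + 2 = dim W" "subspace (L \<inter> L')"
proof -
  note AD = arrangementD [OF A]
  have "dim (L \<inter> L') + 1 = dim L"
    by (rule dim_inter_hyperplane [OF AD(3)[OF L(2)] AD(1) AD(4)[OF L(2)] AD(5)[OF L(2)] AD(3)[OF L(1)] AD(4)[OF L(1)]])
      (use hyperplane_eq [OF A L(1,2)] L(3) in blast)
  then show "dim (L \<inter> L') + 2 = dim W" using AD(5) [OF L(1)] by simp
  show "subspace (L \<inter> L')" by (rule subspace_inter [OF AD(3)[OF L(1)] AD(3)[OF L(2)]])
qed

lemma arrangement_rank2_flats: "arrangement scale W A \<Longrightarrow> rank2_flats A"
  unfolding rank2_flats_def
proof (intro ballI impI)
  fix L1 L2 L3
  assume A: "arrangement scale W A" and L: "L1 \<in> A" "L2 \<in> A" "L3 \<in> A" "L1 \<noteq> L2" "L3 \<noteq> L1" "L1 \<inter> L2 \<subseteq> L3"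
  have "L1 \<inter> L2 = L1 \<inter> L3"
    using dim_point [OF A L(1,2,4)] dim_point [OF A L(1,3)] L(5,6)
    by (intro subspace_dim_equal) auto
  then show "L1 \<inter> L3 = L1 \<inter> L2" ..
qed

lemma arrangement_localization: "arrangement scale W A \<Longrightarrow> arrangement scale W (localization A X)"
  by (auto simp: arrangement_def localization_def)

lemma localization_hyperplane: "arrangement scale W A \<Longrightarrow> H \<in> A \<Longrightarrow> localization A H = {H}"
  using hyperplane_eq [of W A H] by (auto simp: localization_def)

lemma restriction_hyperplane:
  assumes "arrangement scale W A" "H \<in> A" shows "restriction A H = (\<lambda>L. L \<inter> H) ` (A - {H})"
  unfolding restriction_def localization_hyperplane [OF assms] by auto

lemma arrangement_restriction:
  assumes A: "arrangement scale W A" and H: "H \<in> A"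
  shows "arrangement scale H (restriction A H)"
proof -
  note AD = arrangementD [OF A]
  have "subspace Z \<and> Z \<subseteq> H \<and> dim Z + 1 = dim H" if Z: "Z \<in> restriction A H" for Z
  proof -
    obtain L where L: "L \<in> A" "L \<noteq> H" "Z = L \<inter> H"
      using Z unfolding restriction_hyperplane [OF A H] by blast
    then show ?thesis using dim_point [OF A L(1) H L(2)] AD(5) [OF H] by auto
  qed
  moreover have "finite (restriction A H)" unfolding restriction_hyperplane [OF A H] using AD(2) by simp
  ultimately show ?thesis using AD(3) [OF H] by (auto simp: arrangement_def)
qed

text \<open>Since every member contains X, the lattice is W, the hyperplanes and X. The polynomial
  factors as t^(dim X) (t - 1)(t - (|A| - 1)).\<close>

lemma char_poly_rank2:
  assumes A: "arrangement scale W A" and X: "X \<in> inter_lattice W A" "\<And>L. L \<in> A \<Longrightarrow> X \<subseteq> L" "dim X + 2 = dim W" "subspace X"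
  shows "char_poly scale W A = monom 1 (dim X + 2) - monom (int (card A)) (dim X + 1) + monom (int (card A) - 1) (dim X)"
    and "2 \<le> card A"
proof -
  note AD = arrangementD [OF A]
  have sub: "\<forall>L\<in>A. L \<subseteq> W" using AD(4) by blast
  have dW: "dim W = dim X + 2" and dL: "\<And>L. L \<in> A \<Longrightarrow> dim L = dim X + 1" using X(3) AD(5) by fastforce+
  have lat: "inter_lattice W A = {W} \<union> A \<union> {X}"
  proof
    show "inter_lattice W A \<subseteq> {W} \<union> A \<union> {X}"
    proof
      fix Y assume Y: "Y \<in> inter_lattice W A"
      have XY: "X \<subseteq> Y" using Y X(2) X(1) by (auto simp: inter_lattice_def)
      from sub Y show "Y \<in> {W} \<union> A \<union> {X}"
      proof (cases rule: lattice_cases)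
        case (point L1 L2)
        have "X = Y" using dim_point [OF A point(1-3)] XY X(3,4) point(4) by (intro subspace_dim_equal) auto
        then show ?thesis by simp
      next
        case (deep L1 L2 L3)
        have "X = L1 \<inter> L2" using dim_point [OF A deep(1-3)] X(2) [OF deep(1)] X(2) [OF deep(2)] X(3,4) by (intro subspace_dim_equal) auto
        then show ?thesis using deep(5) X(2) [OF deep(4)] by blast
      qed auto
    qed
    show "{W} \<union> A \<union> {X} \<subseteq> inter_lattice W A" using lattice_top lattice_atom AD(4) X(1) by blast
  qed
  have "W \<notin> A" by (rule notI, drule dL) (use dW in linarith)
  moreover have "X \<notin> A" by (rule notI, drule dL) linarith
  moreover have "X \<noteq> W" using dW by auto
  ultimately have ne: "W \<notin> A" "X \<noteq> W" "X \<notin> A" by auto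
  have \<mu>L: "mobius W A L = -1" if L: "L \<in> A" for L
  proof -
    have "{Z \<in> inter_lattice W A. L \<subset> Z} = {W}"
      unfolding lat using AD(4) [OF L] hyperplane_eq [OF A L] X(2) [OF L] ne L by blast
    then show ?thesis using mobius_below [OF AD(2), of L W] ne L by (auto simp: mobius_top)
  qed
  have "{Z \<in> inter_lattice W A. X \<subset> Z} = insert W A"
    unfolding lat using AD(4) X(2) ne by (auto dest: AD(4)) (use X(1) in \<open>auto simp: inter_lattice_def\<close>)
  then have \<mu>X: "mobius W A X = int (card A) - 1"
    using mobius_below [OF AD(2) ne(2)] ne(1) AD(2) by (simp add: mobius_top \<mu>L)
  have "char_poly scale W A = (\<Sum>Z\<in>insert W (insert X A). monom (mobius W A Z) (dim Z))"
    unfolding char_poly_def lat by (rule sum.cong) auto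
  also have "\<dots> = monom 1 (dim W) + (monom (int (card A) - 1) (dim X) + (\<Sum>L\<in>A. monom (- 1) (dim X + 1)))"
    using ne AD(2) by (simp add: mobius_top \<mu>X \<mu>L dL)
  also have "\<dots> = monom 1 (dim X + 2) - monom (int (card A)) (dim X + 1) + monom (int (card A) - 1) (dim X)"
    unfolding sum_monom dW by (simp add: minus_monom [symmetric])
  finally show "char_poly scale W A = monom 1 (dim X + 2) - monom (int (card A)) (dim X + 1) + monom (int (card A) - 1) (dim X)" .
  have "\<exists>L1 L2. L1 \<in> A \<and> L2 \<in> A \<and> L1 \<noteq> L2"
    using sub X(1) by (cases rule: lattice_cases) (use ne in blast)+
  then obtain L1 L2 where L: "L1 \<in> A" "L2 \<in> A" "L1 \<noteq> L2" by blast
  then have "card {L1, L2} \<le> card A" using AD(2) by (intro card_mono) auto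
  then show "2 \<le> card A" using L by simp
qed

text \<open>The lattice has the four levels W, A, \<open>points A\<close> and X. The Moebius value
  of a point is its multiplicity minus one, and the value at X makes the total sum vanish.\<close>

lemma char_poly_rank3:
  assumes A: "arrangement scale W A" and X: "X \<in> inter_lattice W A" "\<And>L. L \<in> A \<Longrightarrow> X \<subseteq> L" "dim X + 3 = dim W" "subspace X"
  shows "char_poly scale W A = monom 1 (dim X + 3) - monom (int (card A)) (dim X + 2)
    + monom (int (betti2 A)) (dim X + 1) - monom (1 - int (card A) + int (betti2 A)) (dim X)"
proof -
  note AD = arrangementD [OF A]
  have sub: "\<forall>L\<in>A. L \<subseteq> W" using AD(4) by blast
  have dW: "dim W = dim X + 3" and dL: "\<And>L. L \<in> A \<Longrightarrow> dim L = dim X + 2" using X(3) AD(5) by fastforce+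
  have dP: "dim P = dim X + 1" "subspace P" "X \<subseteq> P" "P \<subseteq> W" if P: "P \<in> points A" for P
  proof -
    obtain L L' where L: "L \<in> A" "L' \<in> A" "L \<noteq> L'" "P = L \<inter> L'" using P by (auto simp: points_def)
    then show "dim P = dim X + 1" "subspace P" "X \<subseteq> P" "P \<subseteq> W"
      using dim_point [OF A L(1-3)] dW X(2) AD(4) by auto
  qed
  have XW: "X \<subseteq> W" using X(1) by (auto simp: inter_lattice_def)
  have lat: "inter_lattice W A = insert W (A \<union> points A \<union> {X})"
  proof
    show "inter_lattice W A \<subseteq> insert W (A \<union> points A \<union> {X})"
    proof
      fix Y assume Y: "Y \<in> inter_lattice W A"
      have XY: "X \<subseteq> Y" using Y X(2) X(1) by (auto simp: inter_lattice_def)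
      from sub Y show "Y \<in> insert W (A \<union> points A \<union> {X})"
      proof (cases rule: lattice_cases)
        case (point L1 L2)
        then have "Y \<in> points A" unfolding points_def by blast
        then show ?thesis by simp
      next
        case (deep L1 L2 L3)
        note P = dim_point [OF A deep(1-3)]
        have "dim ((L1 \<inter> L2) \<inter> L3) + 1 = dim (L1 \<inter> L2)"
          by (rule dim_inter_hyperplane [OF AD(3)[OF deep(4)] AD(1) AD(4)[OF deep(4)] AD(5)[OF deep(4)] P(2)])
            (use AD(4) deep in blast)+
        then have "X = L1 \<inter> L2 \<inter> L3"
          using P dW X(2) [OF deep(1)] X(2) [OF deep(2)] X(2) [OF deep(4)] X(4) AD(3) [OF deep(1)] AD(3) [OF deep(2)] AD(3) [OF deep(4)]
          by (intro subspace_dim_equal subspace_inter) simp_all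
        then show ?thesis using deep(6) XY by blast
      qed auto
    qed
    have "points A \<subseteq> inter_lattice W A"
    proof
      fix P assume "P \<in> points A"
      then obtain L L' where L: "L \<in> A" "L' \<in> A" "P = L \<inter> L'" by (auto simp: points_def)
      show "P \<in> inter_lattice W A" unfolding L(3) by (rule lattice_point [OF L(1,2) AD(4) [OF L(1)]])
    qed
    moreover have "A \<subseteq> inter_lattice W A" using lattice_atom AD(4) by blast
    ultimately show "insert W (A \<union> points A \<union> {X}) \<subseteq> inter_lattice W A"
      using lattice_top X(1) by blast
  qed
  have "W \<notin> A" by (rule notI, drule dL) (use dW in linarith)
  moreover have "W \<notin> points A" by (rule notI, drule dP(1)) (use dW in linarith)
  moreover have "X \<notin> A" by (rule notI, drule dL) linarith
  moreover have "X \<notin> points A" by (rule notI, drule dP(1)) linarith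
  moreover have "X \<noteq> W" using dW by auto
  moreover have "L \<notin> points A" if "L \<in> A" for L
    by (rule notI, drule dP(1)) (use dL [OF that] in linarith)
  ultimately have ne: "W \<notin> A" "W \<notin> points A" "X \<noteq> W" "X \<notin> A" "X \<notin> points A" "A \<inter> points A = {}" by auto
  have fin: "finite A" "finite (points A)" using AD(2) finite_points by auto
  have larger: "dim Y < dim Z" if "subspace Y" "subspace Z" "Y \<subset> Z" for Y Z using dim_less that .
  have \<mu>L: "mobius W A L = -1" if L: "L \<in> A" for L
  proof -
    have WL: "L \<subset> W" using AD(4) [OF L] ne(1) L by auto
    have only: "Z = W" if Z: "Z \<in> inter_lattice W A" "L \<subset> Z" for Z
    proof -
      have "Z \<notin> A" using hyperplane_eq [OF A L] Z(2) by blast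
      moreover have "Z \<notin> points A" using larger [OF AD(3)[OF L] dP(2), of Z] dP(1) [of Z] dL [OF L] Z(2) by auto
      moreover have "Z \<noteq> X" using X(2) [OF L] Z(2) by blast
      ultimately show ?thesis using Z(1) unfolding lat by blast
    qed
    have "Z \<in> {Z \<in> inter_lattice W A. L \<subset> Z} \<longleftrightarrow> Z = W" for Z
      using only [of Z] WL lattice_top [of W A] by auto
    then have "{Z \<in> inter_lattice W A. L \<subset> Z} = {W}" by blast
    then show ?thesis using mobius_below [OF AD(2), of L W] ne L by (auto simp: mobius_top)
  qed
  have \<mu>P: "mobius W A P = int (multi A P - 1)" if P: "P \<in> points A" for P
  proof -
    have "{Z \<in> inter_lattice W A. P \<subset> Z} = insert W {L \<in> A. P \<subseteq> L}"
    proof (rule set_eqI)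
      fix Z
      have "Z \<notin> points A" if "P \<subset> Z" using larger [OF dP(2)[OF P] dP(2), of Z] dP(1) [of Z] dP(1) [OF P] that by auto
      moreover have "Z \<noteq> X" if "P \<subset> Z" using dP(3) [OF P] that by blast
      ultimately show "Z \<in> {Z \<in> inter_lattice W A. P \<subset> Z} \<longleftrightarrow> Z \<in> insert W {L \<in> A. P \<subseteq> L}"
        unfolding lat using ne P dP(4) [OF P] by blast
    qed
    moreover have "W \<notin> {L \<in> A. P \<subseteq> L}" using ne by blast
    moreover have "1 \<le> multi A P"
    proof -
      obtain L where "L \<in> A" "P \<subseteq> L" using P by (auto simp: points_def)
      then have "{L \<in> A. P \<subseteq> L} \<noteq> {}" by blast
      then show ?thesis using fin by (simp add: multi_def Suc_le_eq card_gt_0_iff)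
    qed
    moreover have "(\<Sum>L\<in>{L \<in> A. P \<subseteq> L}. mobius W A L) = - int (multi A P)"
      by (simp add: \<mu>L multi_def)
    ultimately show ?thesis using mobius_below [OF AD(2), of P W] ne P fin by (auto simp: mobius_top)
  qed
  have sumP: "(\<Sum>P\<in>points A. mobius W A P) = int (betti2 A)"
    unfolding betti2_def by (simp add: \<mu>P)
  have "{Z \<in> inter_lattice W A. X \<subset> Z} = insert W (A \<union> points A)"
  proof -
    have "\<forall>L\<in>A. X \<subset> L" using X(2) ne(4) by blast
    moreover have "\<forall>P\<in>points A. X \<subset> P" using dP(3) ne(5) by blast
    moreover have "X \<subset> W" using XW ne(3) by blast
    ultimately show ?thesis unfolding lat by auto
  qed
  then have \<mu>X: "mobius W A X = - (1 - int (card A) + int (betti2 A))"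
    using mobius_below [OF AD(2) ne(3)] ne fin by (simp add: mobius_top \<mu>L sumP sum.union_disjoint)
  have "char_poly scale W A = (\<Sum>Z\<in>insert W (insert X (A \<union> points A)). monom (mobius W A Z) (dim Z))"
    unfolding char_poly_def lat by (rule sum.cong) auto
  also have "\<dots> = monom 1 (dim W) + (monom (mobius W A X) (dim X) + ((\<Sum>L\<in>A. monom (mobius W A L) (dim L))
      + (\<Sum>P\<in>points A. monom (mobius W A P) (dim P))))"
    using ne fin by (simp add: mobius_top sum.union_disjoint)
  also have "(\<Sum>L\<in>A. monom (mobius W A L) (dim L)) = (\<Sum>L\<in>A. monom (- 1) (dim X + 2))"
    by (rule sum.cong) (simp_all add: \<mu>L dL)
  also have "(\<Sum>P\<in>points A. monom (mobius W A P) (dim P)) = (\<Sum>P\<in>points A. monom (mobius W A P) (dim X + 1))"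
    by (rule sum.cong) (simp_all add: dP(1))
  also have "monom (mobius W A X) (dim X) = - monom (1 - int (card A) + int (betti2 A)) (dim X)"
    unfolding \<mu>X by (simp only: minus_monom)
  finally show ?thesis
    unfolding sum_monom sumP dW by (simp add: minus_monom [symmetric])
qed

text \<open>A flat of codimension two in H has codimension three in W, so the localization has rank
  three and its restriction to H has rank two; \<open>cubic_dvd_imp\<close> then fixes the second
  Betti number. The bound is phrased with the hyperplanes other than H, as in
  \<open>rank3_lifting\<close>.\<close>

lemma betti2_of_dvd:
  assumes A: "arrangement scale W A" and H: "H \<in> A"
    and X: "X \<in> inter_lattice_codim scale 2 H (restriction A H)" "subspace X"
    and dvd: "char_poly scale H (restriction (localization A X) H) dvd char_poly scale W (localization A X)"
  defines "A' \<equiv> localization A X"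
  shows "betti2 A' \<le> card (A' - {H}) + (card (restriction A' H) - 1) * (card (A' - {H}) + 1 - card (restriction A' H))"
proof -
  have A': "arrangement scale W A'" unfolding A'_def by (rule arrangement_localization [OF A])
  note AD = arrangementD [OF A']
  have dX: "dim X + 2 = dim H" using X(1) by (simp add: inter_lattice_codim_def)
  obtain B where B: "B \<subseteq> restriction A H" "X = H \<inter> \<Inter>B" using X(1) by (auto simp: inter_lattice_codim_def inter_lattice_def)
  have XH: "X \<subseteq> H" using B by blast
  have H': "H \<in> A'" using H XH by (simp add: A'_def localization_def)
  have dW: "dim X + 3 = dim W" using dX AD(5) [OF H'] by simp
  have B': "B \<subseteq> restriction A' H"
  proof
    fix Z assume Z: "Z \<in> B"
    then obtain L where L: "L \<in> A" "L \<noteq> H" "Z = L \<inter> H" using B(1) unfolding restriction_hyperplane [OF A H] by blast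
    have "X \<subseteq> L" using B(2) Z L(3) by blast
    then have "L \<in> A' - {H}" using L by (simp add: A'_def localization_def)
    then show "Z \<in> restriction A' H" unfolding restriction_hyperplane [OF A' H'] using L(3) by blast
  qed
  have XlatH: "X \<in> inter_lattice H (restriction A' H)" using B(2) B' by (auto simp: inter_lattice_def)
  have below: "X \<subseteq> L" if "L \<in> A'" for L using that by (simp add: A'_def localization_def)
  have belowH: "X \<subseteq> Z" if "Z \<in> restriction A' H" for Z
    using that below XH unfolding restriction_hyperplane [OF A' H'] by blast
  have "X \<in> inter_lattice W A'"
  proof -
    \<comment> \<open>The members of B are traces on H. The hyperplanes over them, together with H,
      exhibit X as an intersection of members of A'.\<close>
    define C where "C = {L \<in> A'. L \<inter> H \<in> B} \<union> {H}"
    have "X = W \<inter> \<Inter>C"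
    proof
      show "X \<subseteq> W \<inter> \<Inter>C" using below H' AD(4) [OF H'] XH by (auto simp: C_def)
      show "W \<inter> \<Inter>C \<subseteq> X"
      proof
        fix x assume x: "x \<in> W \<inter> \<Inter>C"
        have "x \<in> Z" if Z: "Z \<in> B" for Z
        proof -
          obtain L where "L \<in> A'" "Z = L \<inter> H" using B' Z unfolding restriction_hyperplane [OF A' H'] by blast
          then show ?thesis using x Z by (auto simp: C_def)
        qed
        then show "x \<in> X" unfolding B(2) using x by (auto simp: C_def)
      qed
    qed
    moreover have "C \<subseteq> A'" using H' by (auto simp: C_def)
    ultimately show ?thesis by (auto simp: inter_lattice_def)
  qed
  note c3 = char_poly_rank3 [OF A' this below dW X(2)]
  note c2 = char_poly_rank2 [OF arrangement_restriction [OF A' H'] XlatH belowH dX X(2)]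
  let ?n = "card A'" and ?h = "card (restriction A' H)"
  have eq: "int (betti2 A') = (int ?n - 1) + (int ?h - 1) * (int ?n - int ?h)"
    by (rule cubic_dvd_imp [of "dim X"]) (use dvd c2 c3 in \<open>simp_all add: A'_def\<close>)
  have n: "card (A' - {H}) + 1 = ?n" using H' AD(2) by (metis Suc_eq_plus1 card_Suc_Diff1)
  have h: "?h \<le> card (A' - {H})"
    unfolding restriction_hyperplane [OF A' H'] using AD(2) by (intro card_image_le) simp
  \<comment> \<open>The subtractions of natural numbers are exact: there are at least two traces,
    and at most as many as hyperplanes other than H.\<close>
  have 1: "int ?n - 1 = int (card (A' - {H}))" using n by linarith
  have 2: "int ?h - 1 = int (?h - 1)" using c2(2) by linarith
  have 3: "int ?n - int ?h = int (card (A' - {H}) + 1 - ?h)" using n h by linarith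
  have "int (betti2 A') = int (card (A' - {H}) + (?h - 1) * (card (A' - {H}) + 1 - ?h))"
    using eq unfolding 1 2 3 by (simp only: of_nat_add of_nat_mult)
  then show ?thesis unfolding of_nat_eq_iff by (rule eq_imp_le)
qed

end

section \<open>Lifting freeness from a restriction\<close>

lemma rank2_flats_mono: "rank2_flats A \<Longrightarrow> B \<subseteq> A \<Longrightarrow> rank2_flats B"
  unfolding rank2_flats_def by blast

text \<open>Intersecting with X first does not change the trace on a subspace Y of X. Along a flag,
  all arrangements are therefore restrictions of A itself.\<close>

lemma restriction_restriction: "Y \<subseteq> X \<Longrightarrow> restriction (restriction A X) Y = restriction A Y"
proof
  assume YX: "Y \<subseteq> X"
  show "restriction (restriction A X) Y \<subseteq> restriction A Y"
  proof
    fix Z assume "Z \<in> restriction (restriction A X) Y"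
    then obtain L where "L \<in> A" "\<not> Y \<subseteq> L \<inter> X" "Z = L \<inter> X \<inter> Y"
      unfolding restriction_def localization_def by blast
    moreover from this have "Z = L \<inter> Y" "\<not> Y \<subseteq> L" using YX by blast+
    ultimately show "Z \<in> restriction A Y" unfolding restriction_def localization_def by blast
  qed
  show "restriction A Y \<subseteq> restriction (restriction A X) Y"
  proof
    fix Z assume "Z \<in> restriction A Y"
    then obtain L where L: "L \<in> A" "\<not> Y \<subseteq> L" "Z = L \<inter> Y" unfolding restriction_def localization_def by blast
    have "\<not> X \<subseteq> L" using L(2) YX by blast
    then have "L \<inter> X \<in> restriction A X" using L(1) unfolding restriction_def localization_def by blast
    moreover have "\<not> Y \<subseteq> L \<inter> X" "Z = (L \<inter> X) \<inter> Y" using L YX by blast+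
    ultimately show "Z \<in> restriction (restriction A X) Y" unfolding restriction_def [of "restriction A X"] localization_def by blast
  qed
qed

text \<open>This turns the divisibility hypothesis along a flag, stated for localizations of a
  restriction, into the one for a single hyperplane, stated for restrictions of a
  localization.\<close>

lemma restriction_localization:
  assumes "Y \<subseteq> X" shows "restriction (localization A Y) X = localization (restriction A X) Y"
proof -
  have "Y \<subseteq> L \<inter> X \<longleftrightarrow> Y \<subseteq> L" for L using assms by blast
  then show ?thesis unfolding restriction_def localization_def by blast
qed

section \<open>Coordinates for an abstract arrangement\<close>

context finite_dimensional_vector_space
begin

lemma ordered_basisD:
  assumes "ordered_basis scale W bs"
  shows "distinct bs" "independent (set bs)" "span (set bs) = W" "dim W = length bs" "subspace W"
    "i < length bs \<Longrightarrow> bs ! i \<in> W"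
proof -
  show 1: "distinct bs" "independent (set bs)" "span (set bs) = W" using assms by (auto simp: ordered_basis_def)
  show "dim W = length bs" unfolding 1(3) [symmetric] dim_span_eq_card_independent [OF 1(2)] by (rule distinct_card [OF 1(1)])
  show "subspace W" unfolding 1(3) [symmetric] by (rule subspace_span)
  show "bs ! i \<in> W" if "i < length bs" unfolding 1(3) [symmetric] by (rule span_base) (use that in simp)
qed

lemma functional_eq_on_basis:
  assumes bs: "ordered_basis scale W bs" and f: "functional f" "functional g"
    and eq: "\<And>i. i < length bs \<Longrightarrow> f (bs ! i) = g (bs ! i)" and x: "x \<in> W"
  shows "f x = g x"
  using f
proof (rule functional_eq_on_span [of f g "set bs"])
  show "f y = g y" if "y \<in> set bs" for y using that eq by (metis in_set_conv_nth)
  show "x \<in> span (set bs)" using ordered_basisD(3) [OF bs] x by simp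
qed

lemma functional_combination: "functional f \<Longrightarrow> functional g \<Longrightarrow> functional (\<lambda>x. s * f x + r * g x)"
  unfolding Vector_Spaces.linear_iff by (auto simp: algebra_simps)

text \<open>Functionals on W are determined by their values on the basis, so relations of
  coefficient vectors are relations of functionals; \<open>functional_span2\<close> produces such a
  relation from an inclusion of kernels.\<close>

lemma span2_functionals:
  assumes bs: "ordered_basis scale W bs" and f: "functional f1" "functional f2" "functional f3"
    and ker: "{x \<in> W. f1 x = 0} = L1" "{x \<in> W. f2 x = 0} = L2" "{x \<in> W. f3 x = 0} = L3"
    and ne: "\<not> L1 \<subseteq> L2" "L1 \<noteq> W"
    and a: "\<And>i. i < length bs \<Longrightarrow> a1 i = f1 (bs ! i)" "\<And>i. i < length bs \<Longrightarrow> a2 i = f2 (bs ! i)"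
      "\<And>i. i < length bs \<Longrightarrow> a3 i = f3 (bs ! i)"
      "\<And>i. length bs \<le> i \<Longrightarrow> a1 i = 0" "\<And>i. length bs \<le> i \<Longrightarrow> a2 i = 0" "\<And>i. length bs \<le> i \<Longrightarrow> a3 i = 0"
  shows "span2 a1 a2 a3 \<longleftrightarrow> L1 \<inter> L2 \<subseteq> L3"
proof
  assume "span2 a1 a2 a3"
  then obtain s r where sr: "a3 = (\<lambda>i. s * a1 i + r * a2 i)" by (auto simp: span2_def)
  have eq: "f3 x = s * f1 x + r * f2 x" if "x \<in> W" for x
  proof (rule functional_eq_on_basis [OF bs f(3) functional_combination [OF f(1,2)] _ that])
    fix i assume i: "i < length bs"
    show "f3 (bs ! i) = s * f1 (bs ! i) + r * f2 (bs ! i)"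
      using fun_cong [OF sr, of i] a(1-3) [OF i] by simp
  qed
  show "L1 \<inter> L2 \<subseteq> L3"
  proof
    fix x assume "x \<in> L1 \<inter> L2"
    then have "x \<in> W" "f1 x = 0" "f2 x = 0" using ker by auto
    then have "x \<in> {x \<in> W. f3 x = 0}" using eq by simp
    then show "x \<in> L3" unfolding ker(3) .
  qed
next
  assume sub: "L1 \<inter> L2 \<subseteq> L3"
  have nz1: "\<exists>w\<in>W. f1 w = 0 \<and> f2 w \<noteq> 0" using ne(1) ker by blast
  have nz2: "\<exists>w\<in>W. f1 w \<noteq> 0" using ne(2) ker(1) by blast
  have k: "\<forall>x\<in>W. f1 x = 0 \<longrightarrow> f2 x = 0 \<longrightarrow> f3 x = 0" using sub ker by blast
  obtain s r where sr: "\<forall>x\<in>W. f3 x = s * f1 x + r * f2 x"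
    using functional_span2 [OF ordered_basisD(5) [OF bs] f nz1 nz2 k] by (elim exE)
  have "a3 i = s * a1 i + r * a2 i" for i
    using a bspec [OF sr ordered_basisD(6) [OF bs]] by (cases "i < length bs") simp_all
  then show "span2 a1 a2 a3" unfolding span2_def by blast
qed

text \<open>All defining forms of a hyperplane are proportional on W, so testing one chosen form g L
  suffices. By \<open>Der_lin\<close> the value on a linear form is a \<open>dot\<close>
  product.\<close>

lemma log_coeff_vecs:
  assumes bs: "ordered_basis scale W bs" and g: "\<And>L. L \<in> A \<Longrightarrow> functional (g L)" "\<And>L. L \<in> A \<Longrightarrow> {x \<in> W. g L x = 0} = L"
  defines "n \<equiv> length bs" and "w \<equiv> \<lambda>L i. g L (bs ! i)"
  shows "coeff_vecs n (log_derivations scale bs A) {f \<in> vecs n n. \<forall>L\<in>A. lin n (w L) dvd dot n f (w L)}"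
proof -
  have lf: "linear_form bs \<alpha> = lin n (\<lambda>i. \<alpha> (bs ! i))" for \<alpha>
    by (simp add: linear_form_def dot_def n_def)
  have W: "span (set bs) = W" by (rule ordered_basisD(3) [OF bs])
  have iff: "\<theta> \<in> log_derivations scale bs A \<longleftrightarrow> (\<forall>L\<in>A. lin n (w L) dvd dot n (\<lambda>i. \<theta> (mvar i)) (w L))"
    if \<theta>: "\<theta> \<in> Der n" for \<theta>
  proof
    assume l: "\<theta> \<in> log_derivations scale bs A"
    show "\<forall>L\<in>A. lin n (w L) dvd dot n (\<lambda>i. \<theta> (mvar i)) (w L)"
    proof
      fix L assume L: "L \<in> A"
      have "defining_form scale (span (set bs)) L (g L)" using g [OF L] W by (simp add: defining_form_def)
      then obtain q where "\<theta> (linear_form bs (g L)) = q * linear_form bs (g L)"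
        using l L unfolding log_derivations_def by blast
      then show "lin n (w L) dvd dot n (\<lambda>i. \<theta> (mvar i)) (w L)"
        unfolding lf Der_lin [OF \<theta>] w_def by simp
    qed
  next
    assume d: "\<forall>L\<in>A. lin n (w L) dvd dot n (\<lambda>i. \<theta> (mvar i)) (w L)"
    have "\<exists>q\<in>poly_ring n. \<theta> (linear_form bs \<alpha>) = q * linear_form bs \<alpha>"
      if L: "L \<in> A" and \<alpha>: "defining_form scale (span (set bs)) L \<alpha>" for L \<alpha>
    proof -
      have \<alpha>': "functional \<alpha>" "{x \<in> W. \<alpha> x = 0} = L" using \<alpha> W by (simp_all add: defining_form_def)
      have ker: "\<forall>x\<in>W. g L x = 0 \<longrightarrow> \<alpha> x = 0" using \<alpha>'(2) g(2) [OF L] by blast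
      obtain s where s: "\<forall>x\<in>W. \<alpha> x = s * g L x"
        using functional_proportional [OF ordered_basisD(5) [OF bs] \<alpha>'(1) g(1) [OF L] ker] by (elim exE)
      have c: "dot n f (\<lambda>i. \<alpha> (bs ! i)) = mconst s * dot n f (w L)" for f
      proof -
        have "dot n f (\<lambda>i. \<alpha> (bs ! i)) = dot n f (\<lambda>i. s * w L i)"
          by (rule dot_cong) (simp_all add: w_def bspec [OF s] ordered_basisD(6) [OF bs] n_def)
        then show ?thesis by (simp only: dot_scale_right)
      qed
      have in_n: "dot n (\<lambda>i. \<theta> (mvar i)) (w L) \<in> poly_ring n" using DerD(1) [OF \<theta>] by (intro dot_in_poly_ring) simp
      obtain q where q: "q \<in> poly_ring n" "dot n (\<lambda>i. \<theta> (mvar i)) (w L) = lin n (w L) * q"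
        by (rule poly_ring_dvdE [OF _ _ in_n]) (use d L in \<open>auto intro: lin_in_poly_ring\<close>)
      have "\<theta> (linear_form bs \<alpha>) = q * linear_form bs \<alpha>"
        unfolding lf Der_lin [OF \<theta>] unfolding c q(2) by (simp add: mult_ac)
      then show ?thesis using q(1) by blast
    qed
    then show "\<theta> \<in> log_derivations scale bs A"
      unfolding log_derivations_def using \<theta> by (simp add: n_def)
  qed
  show ?thesis
    unfolding coeff_vecs_def
  proof (intro conjI allI impI ballI)
    fix \<theta> :: "'a mpol \<Rightarrow> 'a mpol" assume \<theta>: "\<theta> \<in> Der n"
    have "(\<lambda>i. \<theta> (mvar i)) \<in> vecs n n" using DerD(1) [OF \<theta>] by simp
    then show "\<theta> \<in> log_derivations scale bs A \<longleftrightarrow> (\<lambda>i. \<theta> (mvar i)) \<in> {f \<in> vecs n n. \<forall>L\<in>A. lin n (w L) dvd dot n f (w L)}"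
      using iff [OF \<theta>] by simp
  next
    show "log_derivations scale bs A \<subseteq> Der n" by (auto simp: log_derivations_def n_def)
  next
    fix f f' :: "nat \<Rightarrow> 'a mpol"
    assume f: "f \<in> {f \<in> vecs n n. \<forall>L\<in>A. lin n (w L) dvd dot n f (w L)}" and eq: "\<forall>i<n. f' i = f i"
    have "dot n f' b = dot n f b" for b by (rule dot_cong) (use eq in auto)
    then show "f' \<in> {f \<in> vecs n n. \<forall>L\<in>A. lin n (w L) dvd dot n f (w L)}" using f eq by simp
  qed auto
qed

lemma free_arrangement_empty:
  assumes "subspace W" shows "free_arrangement scale W {}"
proof -
  obtain B where B: "B \<subseteq> W" "finite B" "independent B" "W \<subseteq> span B" "card B = dim W"
    by (rule basis_subspace_exists [OF assms]) blast
  obtain bs where bs: "set bs = B" "distinct bs" using finite_distinct_list [OF B(2)] by blast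
  have ob: "ordered_basis scale W bs"
    unfolding ordered_basis_def using bs B span_minimal [OF B(1) assms] by auto
  let ?n = "length bs"
  have D: "coeff_vecs ?n (log_derivations scale bs {}) (vecs ?n ?n)"
    using log_coeff_vecs [OF ob, of "{}" "\<lambda>_ _. 0"] by simp
  let ?\<Phi> = "\<lambda>k i. if i = k then 1 else (0 :: 'a mpol)"
  have s: "(\<Sum>k<?n. a k * ?\<Phi> k i) = a i" if "i < ?n" for a :: "nat \<Rightarrow> 'a mpol" and i
  proof -
    have "(\<Sum>k<?n. a k * ?\<Phi> k i) = (\<Sum>k<?n. if k = i then a i else 0)" by (rule sum.cong) auto
    then show ?thesis using that by simp
  qed
  have "\<exists>\<Theta>. der_basis ?n (log_derivations scale bs {}) \<Theta> \<and> (\<forall>\<theta>\<in>\<Theta>. homogeneous_derivation ?n \<theta>)"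
  proof (rule vecs_to_der_basis [OF D, of "{..<?n}" ?\<Phi>])
    show "\<exists>a. (\<forall>k\<in>{..<?n}. a k \<in> poly_ring ?n) \<and> (\<forall>i<?n. \<eta> i = (\<Sum>k\<in>{..<?n}. a k * ?\<Phi> k i))"
      if "\<eta> \<in> vecs ?n ?n" for \<eta>
      using that s by (intro exI [of _ \<eta>]) simp
    show "\<forall>k\<in>{..<?n}. a k = 0" if "\<forall>i<?n. (\<Sum>k\<in>{..<?n}. a k * ?\<Phi> k i) = 0" for a
      using that s by simp
    show "\<exists>d. \<forall>i<?n. homogeneous_poly d (?\<Phi> k i)" for k
      by (rule exI [of _ 0]) simp
  qed simp_all
  then show ?thesis unfolding free_arrangement_def using ob by blast
qed

lemma defining_functional:
  assumes A: "arrangement scale W A" and L: "L \<in> A"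
  shows "\<exists>\<alpha>. functional \<alpha> \<and> {x \<in> W. \<alpha> x = 0} = L"
proof -
  note AD = arrangementD [OF A]
  have "L \<noteq> W" using AD(5) [OF L] by auto
  then obtain v where v: "v \<in> W" "v \<notin> L" using AD(4) [OF L] by blast
  show ?thesis using functional_exists [OF AD(3)[OF L] AD(1) AD(4)[OF L] AD(5)[OF L] v] by blast
qed

text \<open>In suitable coordinates the arrangement becomes an instance of \<open>pencils\<close>:
  freeness of the restriction supplies a \<open>restricted_basis\<close>, divisibility supplies
  \<open>rank3_condition\<close> at each codimension-two flat, and the basis from
  \<open>vec_basis_exists\<close> is translated back into derivations.\<close>

theorem free_of_free_restriction:
  assumes A: "arrangement scale W A" and H: "H \<in> A"
    and dvd: "\<And>X. X \<in> inter_lattice_codim scale 2 H (restriction A H) \<Longrightarrow>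
      char_poly scale H (restriction (localization A X) H) dvd char_poly scale W (localization A X)"
    and free: "free_arrangement scale H (restriction A H)"
  shows "free_arrangement scale W A"
proof -
  note AD = arrangementD [OF A]
  define J where "J = restriction A H"
  have AJ: "arrangement scale H J" unfolding J_def by (rule arrangement_restriction [OF A H])
  note JD = arrangementD [OF AJ]
  obtain bs \<Theta> where bs: "ordered_basis scale H bs" and \<Theta>: "der_basis (length bs) (log_derivations scale bs J) \<Theta>"
    and \<Theta>hom: "\<forall>\<theta>\<in>\<Theta>. homogeneous_derivation (length bs) \<theta>"
    using free unfolding free_arrangement_def J_def by blast
  define n where "n = length bs"
  note bsD = ordered_basisD [OF bs, folded n_def]
  have "H \<noteq> W" using AD(5) [OF H] by auto
  then obtain v where v: "v \<in> W" "v \<notin> H" using AD(4) [OF H] by blast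
  \<comment> \<open>The vector v completes a basis of H to one of W. Its dual coordinate is t = x_n,
    which vanishes on H.\<close>
  define bs' where "bs' = bs @ [v]"
  have len: "length bs' = Suc n" by (simp add: bs'_def n_def)
  have nth': "bs' ! i = (if i < n then bs ! i else v)" if "i < Suc n" for i
    using that by (auto simp: bs'_def n_def nth_append less_Suc_eq)
  have bs': "ordered_basis scale W bs'"
  proof -
    have set': "set bs' = insert v (set bs)" by (simp add: bs'_def)
    have vb: "v \<notin> set bs" using v(2) bsD(3) span_superset [of "set bs"] by blast
    have ind: "independent (insert v (set bs))" by (rule independent_insertI) (use v(2) bsD in auto)
    have sub: "insert v (set bs) \<subseteq> W" using v(1) bsD(3) AD(4) [OF H] span_superset [of "set bs"] by blast
    have "W \<subseteq> span (insert v (set bs))"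
      by (rule card_ge_dim_independent [OF sub ind])
        (use vb bsD(4) distinct_card [OF bsD(1)] AD(5) [OF H] n_def in simp)
    then show ?thesis
      unfolding ordered_basis_def set' using ind bsD(1) vb span_minimal [OF sub AD(1)] by (auto simp: bs'_def)
  qed
  obtain \<tau> where \<tau>: "functional \<tau>" "\<forall>x\<in>H. \<tau> x = 0" "\<tau> v = 1" "{x \<in> W. \<tau> x = 0} = H"
    using functional_exists [OF AD(3)[OF H] AD(1) AD(4)[OF H] AD(5)[OF H] v] by (elim exE conjE)
  have "\<exists>\<gamma>. \<forall>Z\<in>J. functional (\<gamma> Z) \<and> {x \<in> H. \<gamma> Z x = 0} = Z"
    by (rule bchoice) (use defining_functional [OF AJ] in blast)
  then obtain \<gamma> where \<gamma>: "\<And>Z. Z \<in> J \<Longrightarrow> functional (\<gamma> Z)" "\<And>Z. Z \<in> J \<Longrightarrow> {x \<in> H. \<gamma> Z x = 0} = Z" by blast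
  define I where "I = A - {H}"
  define z where "z L = L \<inter> H" for L
  have zI: "z ` I = J" unfolding J_def restriction_hyperplane [OF A H] I_def z_def ..
  \<comment> \<open>The functionals are rescaled so that hyperplanes with the same trace restrict to
    the same form on H; only then do they have the shape lb (z L) + c L t.\<close>
  have "\<exists>\<alpha>. \<forall>L\<in>I. functional (\<alpha> L) \<and> {x \<in> W. \<alpha> L x = 0} = L \<and> (\<forall>x\<in>H. \<alpha> L x = \<gamma> (z L) x)"
  proof (rule bchoice, rule ballI)
    fix L assume L: "L \<in> I"
    then have LA: "L \<in> A" and Z: "z L \<in> J" using zI by (auto simp: I_def)
    obtain \<alpha>0 where \<alpha>0: "functional \<alpha>0" "{x \<in> W. \<alpha>0 x = 0} = L" using defining_functional [OF A LA] by blast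
    have ker: "\<forall>x\<in>H. \<alpha>0 x = 0 \<longrightarrow> \<gamma> (z L) x = 0"
      using \<alpha>0(2) \<gamma>(2) [OF Z] AD(4) [OF H] unfolding z_def by blast
    obtain s where s: "\<forall>x\<in>H. \<gamma> (z L) x = s * \<alpha>0 x"
      using functional_proportional [OF AD(3)[OF H] \<gamma>(1)[OF Z] \<alpha>0(1) ker] by (elim exE)
    have "s \<noteq> 0"
    proof
      assume "s = 0"
      then have "z L = H" using s \<gamma>(2) [OF Z] by auto
      then show False using JD(5) [OF Z] by simp
    qed
    then have k: "{x \<in> W. s * \<alpha>0 x = 0} = L" using \<alpha>0(2) by simp
    show "\<exists>\<alpha>. functional \<alpha> \<and> {x \<in> W. \<alpha> x = 0} = L \<and> (\<forall>x\<in>H. \<alpha> x = \<gamma> (z L) x)"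
    proof (intro exI [of _ "\<lambda>x. s * \<alpha>0 x"] conjI)
      show "functional (\<lambda>x. s * \<alpha>0 x)" by (rule functional_scale [OF \<alpha>0(1)])
      show "{x \<in> W. s * \<alpha>0 x = 0} = L" by (rule k)
      show "\<forall>x\<in>H. s * \<alpha>0 x = \<gamma> (z L) x" by (rule ballI) (rule bspec [OF s, symmetric])
    qed
  qed
  then obtain \<alpha> where \<alpha>0: "\<forall>L\<in>I. functional (\<alpha> L) \<and> {x \<in> W. \<alpha> L x = 0} = L \<and> (\<forall>x\<in>H. \<alpha> L x = \<gamma> (z L) x)"
    by (elim exE)
  have \<alpha>: "functional (\<alpha> L)" "{x \<in> W. \<alpha> L x = 0} = L" "x \<in> H \<Longrightarrow> \<alpha> L x = \<gamma> (z L) x" if "L \<in> I" for L x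
    using bspec [OF \<alpha>0 that] by auto
  define \<beta> where "\<beta> Z i = (if i < n then \<gamma> Z (bs ! i) else 0)" for Z i
  define c where "c L = \<alpha> L v" for L
  interpret pencils n J \<beta> I z c
  proof
    show "finite J" by (rule JD(2))
    show "finite I" using AD(2) by (simp add: I_def)
    show "z ` I = J" by (rule zI)
    show "\<beta> Y i = 0" if "n \<le> i" for Y i using that by (simp add: \<beta>_def)
    show "lin n (\<beta> Y) \<noteq> 0" if Y: "Y \<in> J" for Y
    proof
      assume "lin n (\<beta> Y) = 0"
      then have "\<gamma> Y (bs ! i) = 0" if "i < n" for i using that unfolding lin_eq_0_iff by (simp add: \<beta>_def)
      then have "\<gamma> Y x = 0 * \<gamma> Y x" if "x \<in> H" for x
        by (intro functional_eq_on_basis [OF bs \<gamma>(1)[OF Y] functional_scale [OF \<gamma>(1)[OF Y]] _ that]) (simp add: n_def)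
      then have "Y = H" using \<gamma>(2) [OF Y] by auto
      then show False using JD(5) [OF Y] by simp
    qed
    show "\<beta> Y \<noteq> (\<lambda>i. s * \<beta> Z i)" if YZ: "Y \<in> J" "Z \<in> J" "Y \<noteq> Z" for Y Z s
    proof
      assume eq: "\<beta> Y = (\<lambda>i. s * \<beta> Z i)"
      have g: "\<gamma> Y x = s * \<gamma> Z x" if "x \<in> H" for x
      proof (rule functional_eq_on_basis [OF bs \<gamma>(1)[OF YZ(1)] functional_scale [OF \<gamma>(1)[OF YZ(2)]] _ that])
        fix i assume "i < length bs"
        then show "\<gamma> Y (bs ! i) = s * \<gamma> Z (bs ! i)" using fun_cong [OF eq, of i] by (simp add: \<beta>_def n_def)
      qed
      have "Z \<subseteq> Y"
      proof
        fix x assume x: "x \<in> Z"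
        then have "x \<in> H" "\<gamma> Z x = 0" using \<gamma>(2) [OF YZ(2)] by auto
        then have "x \<in> {x \<in> H. \<gamma> Y x = 0}" using g by simp
        then show "x \<in> Y" unfolding \<gamma>(2) [OF YZ(1)] .
      qed
      then show False using hyperplane_eq [OF AJ YZ(2,1)] YZ(3) by blast
    qed
    show "L = L'" if L: "L \<in> I" "L' \<in> I" "z L = z L'" "c L = c L'" for L L'
    proof -
      have e: "\<alpha> L x = \<alpha> L' x" if "x \<in> W" for x
      proof (rule functional_eq_on_basis [OF bs' \<alpha>(1)[OF L(1)] \<alpha>(1)[OF L(2)] _ that])
        fix i assume "i < length bs'"
        then have i: "i < Suc n" by (simp add: len)
        show "\<alpha> L (bs' ! i) = \<alpha> L' (bs' ! i)"
          unfolding nth' [OF i] using L(3,4) bsD(6) [of i] \<alpha>(3) [OF L(1)] \<alpha>(3) [OF L(2)] by (simp add: c_def)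
      qed
      have "{x \<in> W. \<alpha> L x = 0} = {x \<in> W. \<alpha> L' x = 0}" by (rule Collect_cong) (simp add: e cong: conj_cong)
      then show ?thesis unfolding \<alpha>(2) [OF L(1)] \<alpha>(2) [OF L(2)] .
    qed
  qed
  have lb_eq: "dot n f (\<beta> Z) = dot n f (\<lambda>i. \<gamma> Z (bs ! i))" for f Z by (rule dot_cong) (simp_all add: \<beta>_def)
  have CJ: "coeff_vecs n (log_derivations scale bs J) {f \<in> vecs n n. \<forall>Z\<in>J. lb Z dvd dot n f (\<beta> Z)}"
    unfolding lb_eq unfolding n_def by (rule log_coeff_vecs [OF bs \<gamma>])
  have rb: "restricted_basis \<Theta> (\<lambda>\<theta> i. \<theta> (mvar i))"
    unfolding restricted_basis_def
  proof (intro conjI ballI allI impI)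
    note b = der_basis_to_vecs [OF CJ \<Theta> [folded n_def]]
    show "finite \<Theta>" by (rule b(1))
    show "(\<lambda>i. \<theta> (mvar i)) \<in> vecs n n" if "\<theta> \<in> \<Theta>" for \<theta> using b(2) [OF that] by simp
    show "lb Y dvd dot n (\<lambda>i. \<theta> (mvar i)) (\<beta> Y)" if "\<theta> \<in> \<Theta>" "Y \<in> J" for \<theta> Y using b(2) [OF that(1)] that(2) by simp
    show "\<exists>a. (\<forall>\<theta>\<in>\<Theta>. a \<theta> \<in> poly_ring n) \<and> (\<forall>i<n. \<eta> i = (\<Sum>\<theta>\<in>\<Theta>. a \<theta> * \<theta> (mvar i)))"
      if "\<eta> \<in> vecs n n" "\<forall>Y\<in>J. lb Y dvd dot n \<eta> (\<beta> Y)" for \<eta> by (rule b(3)) (use that in simp)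
    show "a \<theta> = 0" if "(\<forall>\<theta>\<in>\<Theta>. a \<theta> \<in> poly_ring n) \<and> (\<forall>i<n. (\<Sum>\<theta>\<in>\<Theta>. a \<theta> * \<theta> (mvar i)) = 0)" "\<theta> \<in> \<Theta>" for a \<theta>
      using b(4) [of a] that by blast
  qed
  define hyp where "hyp e = (case e of None \<Rightarrow> H | Some L \<Rightarrow> L)" for e :: "'b set option"
  define \<phi> where "\<phi> e = (case e of None \<Rightarrow> \<tau> | Some L \<Rightarrow> \<alpha> L)" for e :: "'b set option"
  have hyp_simps [simp]: "hyp None = H" "hyp (Some L) = L" and \<phi>_simps [simp]: "\<phi> None = \<tau>" "\<phi> (Some L) = \<alpha> L" for L
    by (simp_all add: hyp_def \<phi>_def)
  have \<phi>: "functional (\<phi> e)" "{x \<in> W. \<phi> e x = 0} = hyp e" "hyp e \<in> A"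
    "\<And>i. i < length bs' \<Longrightarrow> covec e i = \<phi> e (bs' ! i)" "\<And>i. length bs' \<le> i \<Longrightarrow> covec e i = 0" if e: "e \<in> lines I" for e
  proof -
    have k: "functional (\<phi> e) \<and> {x \<in> W. \<phi> e x = 0} = hyp e \<and> hyp e \<in> A"
    proof (cases e)
      case None
      then show "functional (\<phi> e) \<and> {x \<in> W. \<phi> e x = 0} = hyp e \<and> hyp e \<in> A" using \<tau>(1,4) H by simp
    next
      case (Some L)
      then have "L \<in> I" using e by (auto simp: lines_def)
      then show "functional (\<phi> e) \<and> {x \<in> W. \<phi> e x = 0} = hyp e \<and> hyp e \<in> A"
        using \<alpha>(1,2) [of L] Some by (simp add: I_def)
    qed
    show "functional (\<phi> e)" by (rule k [THEN conjunct1])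
    show "{x \<in> W. \<phi> e x = 0} = hyp e" by (rule k [THEN conjunct2, THEN conjunct1])
    show "hyp e \<in> A" by (rule k [THEN conjunct2, THEN conjunct2])
    show "covec e i = 0" if "length bs' \<le> i" for i
      using linear_forms.supp [OF linear_forms_lines e, of i] that by (simp add: len)
    show "covec e i = \<phi> e (bs' ! i)" if "i < length bs'" for i
    proof -
      have i: "i < Suc n" using that by (simp add: len)
      show ?thesis
      proof (cases e)
        case None
        then show ?thesis unfolding nth' [OF i] using \<tau>(2,3) bsD(6) [of i] i by (auto simp: less_Suc_eq)
      next
        case (Some L)
        then have "L \<in> I" using e by (auto simp: lines_def)
        then show ?thesis unfolding nth' [OF i] Some
          using \<alpha>(3) [of L "bs ! i"] bsD(6) [of i] i by (auto simp: vec_def \<beta>_def c_def less_Suc_eq)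
      qed
    qed
  qed
  have hyp_inj: "hyp e \<noteq> hyp e'" if "e \<in> lines I" "e' \<in> lines I" "e \<noteq> e'" for e e'
    using that by (cases e; cases e') (auto simp: lines_def I_def)
  have flats: "rank2_flats A" by (rule arrangement_rank2_flats [OF A])
  \<comment> \<open>By \<open>rank2_flats\<close>, containment of the flat of L and e in e' is
    already equality of the two flats, which turns the span condition into equality of
    points.\<close>
  have pt: "hyp L \<inter> hyp e = hyp L \<inter> hyp e' \<longleftrightarrow> span2 (covec L) (covec e) (covec e')"
    if l: "e \<in> lines I" "e' \<in> lines I" "L \<in> lines I" and ne: "e \<noteq> L" "e' \<noteq> L" for e e' L
  proof -
    have "hyp L \<noteq> W" using AD(5) [OF \<phi>(3)[OF l(3)]] by auto
    moreover have "\<not> hyp L \<subseteq> hyp e"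
      using hyperplane_eq [OF A \<phi>(3)[OF l(3)] \<phi>(3)[OF l(1)]] hyp_inj [OF l(3,1)] ne by blast
    ultimately have "span2 (covec L) (covec e) (covec e') \<longleftrightarrow> hyp L \<inter> hyp e \<subseteq> hyp e'"
      by (intro span2_functionals [OF bs' \<phi>(1)[OF l(3)] \<phi>(1)[OF l(1)] \<phi>(1)[OF l(2)]
          \<phi>(2)[OF l(3)] \<phi>(2)[OF l(1)] \<phi>(2)[OF l(2)]] \<phi>(4,5) l)
    moreover have "hyp L \<inter> hyp e = hyp L \<inter> hyp e'" if "hyp L \<inter> hyp e \<subseteq> hyp e'"
      using rank2_flatsD [OF flats \<phi>(3)[OF l(3)] \<phi>(3)[OF l(1)] \<phi>(3)[OF l(2)] _ _ that] hyp_inj l ne by blast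
    ultimately show ?thesis by blast
  qed
  have lfl: locally_free_lifting
  proof (rule locally_free_liftingI)
    fix Y1 Y2 assume Y: "Y1 \<in> J" "Y2 \<in> J" "Y1 \<noteq> Y2"
    define X where "X = Y1 \<inter> Y2"
    define A' where "A' = localization A X"
    note dX = dim_point [OF AJ Y, folded X_def]
    have XH: "X \<subseteq> H" using JD(4) [OF Y(1)] by (auto simp: X_def)
    have HA': "H \<in> A'" using H XH by (simp add: A'_def localization_def)
    have "Y1 \<noteq> H" using JD(5) [OF Y(1)] by auto
    moreover have "\<not> Y1 \<subseteq> Y2" using hyperplane_eq [OF AJ Y(1,2)] Y(3) by blast
    ultimately have span: "span2 (\<beta> Y1) (\<beta> Y2) (\<beta> Z) \<longleftrightarrow> X \<subseteq> Z" if "Z \<in> J" for Z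
      unfolding X_def
      by (intro span2_functionals [OF bs \<gamma>(1)[OF Y(1)] \<gamma>(1)[OF Y(2)] \<gamma>(1)[OF that]
          \<gamma>(2)[OF Y(1)] \<gamma>(2)[OF Y(2)] \<gamma>(2)[OF that]]) (simp_all add: \<beta>_def n_def)
    have over: "over (plane Y1 Y2) = A' - {H}"
    proof (rule set_eqI)
      fix L
      have "L \<in> over (plane Y1 Y2) \<longleftrightarrow> L \<in> I \<and> X \<subseteq> z L"
        using span zI by (auto simp: over_def plane_def)
      also have "\<dots> \<longleftrightarrow> L \<in> A' - {H}" using XH by (auto simp: I_def z_def A'_def localization_def)
      finally show "L \<in> over (plane Y1 Y2) \<longleftrightarrow> L \<in> A' - {H}" .
    qed
    have arrA': "arrangement scale W A'" unfolding A'_def by (rule arrangement_localization [OF A])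
    have plane: "plane Y1 Y2 = restriction A' H"
    proof -
      have "plane Y1 Y2 = z ` over (plane Y1 Y2)" using zI by (auto simp: over_def plane_def)
      then show ?thesis unfolding over restriction_hyperplane [OF arrA' HA'] by (simp add: z_def)
    qed
    have subI: "lines (over (plane Y1 Y2)) \<subseteq> lines I" by (auto simp: lines_def over_def)
    have "X \<in> inter_lattice H J" unfolding X_def by (rule lattice_point [OF Y(1,2) JD(4)[OF Y(1)]])
    then have Xc: "X \<in> inter_lattice_codim scale 2 H (restriction A H)"
      using dX(1) by (simp add: inter_lattice_codim_def J_def)
    have hypA': "hyp ` lines (over (plane Y1 Y2)) = A'"
    proof -
      have "hyp ` lines (over (plane Y1 Y2)) = insert H (over (plane Y1 Y2))"
        by (simp only: lines_def image_insert image_image hyp_simps image_ident)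
      also have "\<dots> = A'" unfolding over by (rule insert_Diff [OF HA'])
      finally show ?thesis .
    qed
    let ?E = "lines (over (plane Y1 Y2))"
    have p1: "\<forall>e\<in>?E. \<forall>e'\<in>?E. \<forall>L\<in>?E. e \<noteq> L \<longrightarrow> e' \<noteq> L \<longrightarrow>
        (hyp L \<inter> hyp e = hyp L \<inter> hyp e' \<longleftrightarrow> span2 (covec L) (covec e) (covec e'))"
      by (intro ballI impI pt subsetD [OF subI])
    have p2: "betti2 (hyp ` {None}) = 0" by (simp add: betti2_def points_def)
    have p3: "\<forall>E L. E \<subseteq> ?E \<longrightarrow> None \<in> E \<longrightarrow> L \<in> ?E \<longrightarrow> L \<notin> E \<longrightarrow>
        betti2 (hyp ` insert L E) = betti2 (hyp ` E) + card ((\<lambda>e. hyp L \<inter> hyp e) ` E)"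
    proof (intro allI impI)
      fix E L assume E: "E \<subseteq> ?E" "None \<in> E" "L \<in> ?E" "L \<notin> E"
      have EI: "E \<subseteq> lines I" "L \<in> lines I" using E(1,3) subI by auto
      have fin: "finite (hyp ` E)"
        by (rule finite_imageI, rule finite_subset [OF EI(1)]) (simp add: lines_def finite_I)
      have new: "hyp L \<notin> hyp ` E"
      proof
        assume "hyp L \<in> hyp ` E"
        then obtain e where e: "e \<in> E" "hyp L = hyp e" by (rule imageE)
        then have "L \<noteq> e" using E(4) by auto
        then show False using hyp_inj [OF EI(2) subsetD [OF EI(1) e(1)]] e(2) by simp
      qed
      have "insert (hyp L) (hyp ` E) \<subseteq> A" using EI by (auto intro: \<phi>(3))
      then have "rank2_flats (insert (hyp L) (hyp ` E))" by (rule rank2_flats_mono [OF flats])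
      from betti2_insert [OF fin new this]
      show "betti2 (hyp ` insert L E) = betti2 (hyp ` E) + card ((\<lambda>e. hyp L \<inter> hyp e) ` E)"
        by (simp only: image_insert image_image)
    qed
    have p4: "betti2 (hyp ` ?E) \<le> card (over (plane Y1 Y2)) +
        (card (plane Y1 Y2) - 1) * (card (over (plane Y1 Y2)) + 1 - card (plane Y1 Y2))"
      unfolding hypA' unfolding over unfolding plane unfolding A'_def
      by (rule betti2_of_dvd [OF A H Xc dX(2) dvd [OF Xc]])
    \<comment> \<open>The point of two hyperplanes is their intersection as a set, and b is the
      second Betti number of the hyperplanes chosen so far.\<close>
    show "rank3_condition TYPE('b set) Y1 Y2"
      unfolding rank3_condition_def
      by (rule exI [of _ "\<lambda>e e'. hyp e \<inter> hyp e'"], rule exI [of _ "\<lambda>E. betti2 (hyp ` E)"])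
        (rule conjI [OF p1 conjI [OF p2 conjI [OF p3 p4]]])
  qed
  have hom: "\<exists>d. \<forall>i<n. homogeneous_poly d (\<theta> (mvar i))" if "\<theta> \<in> \<Theta>" for \<theta>
    using \<Theta>hom that by (simp add: homogeneous_derivation_def n_def)
  have "\<exists>(K' :: ('a mpol \<Rightarrow> 'a mpol) option set) \<Phi>. vec_basis K' \<Phi>"
    by (rule vec_basis_exists [OF rb _ lfl]) (rule hom)
  then obtain K' :: "('a mpol \<Rightarrow> 'a mpol) option set" and \<Phi> where vb: "vec_basis K' \<Phi>" by (elim exE)
  define g where "g L = (if L = H then \<tau> else \<alpha> L)" for L
  have gA: "functional (g L)" "{x \<in> W. g L x = 0} = L" if L: "L \<in> A" for L
    using \<tau>(1,4) \<alpha>(1,2) [of L] L by (cases "L = H"; simp add: g_def I_def)+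
  have cov: "dot (Suc n) f (\<lambda>i. g (hyp e) (bs' ! i)) = dot (Suc n) f (covec e)" if e: "e \<in> lines I" for e f
  proof (rule dot_cong)
    fix i assume "i < Suc n"
    moreover have "g (hyp e) = \<phi> e" using e by (cases e) (auto simp: lines_def I_def g_def)
    ultimately show "g (hyp e) (bs' ! i) = covec e i" using \<phi>(4) [OF e, of i] by (simp add: len)
  qed simp
  have dH: "dot (Suc n) f (\<lambda>i. g H (bs' ! i)) = f n" for f
    using cov [of None f] by (simp add: lines_def dot_def)
  have dL: "dot (Suc n) f (\<lambda>i. g L (bs' ! i)) = dot (Suc n) f (vec L)" if "L \<in> I" for f L
    using cov [of "Some L" f] that by (simp add: lines_def)
  have "coeff_vecs (Suc n) (log_derivations scale bs' A)
      {f \<in> vecs (Suc n) (Suc n). \<forall>L\<in>A. lin (Suc n) (\<lambda>i. g L (bs' ! i)) dvd dot (Suc n) f (\<lambda>i. g L (bs' ! i))}"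
    using log_coeff_vecs [OF bs' gA] unfolding len by simp
  moreover have "{f \<in> vecs (Suc n) (Suc n). \<forall>L\<in>A. lin (Suc n) (\<lambda>i. g L (bs' ! i)) dvd dot (Suc n) f (\<lambda>i. g L (bs' ! i))} = log_vecs"
  proof -
    have AI: "A = insert H I" using H by (auto simp: I_def)
    show ?thesis unfolding log_vecs_def AI by (auto simp: dH dL form_lin)
  qed
  ultimately have CA: "coeff_vecs (Suc n) (log_derivations scale bs' A) log_vecs" by (simp only:)
  note v = vb [unfolded vec_basis_def]
  note v1 = v [THEN conjunct1] and v2 = v [THEN conjunct2, THEN conjunct1]
    and v3 = v [THEN conjunct2, THEN conjunct2, THEN conjunct1]
    and v4 = v [THEN conjunct2, THEN conjunct2, THEN conjunct2]
  have "\<exists>\<Theta>'. der_basis (Suc n) (log_derivations scale bs' A) \<Theta>' \<and> (\<forall>\<theta>\<in>\<Theta>'. homogeneous_derivation (Suc n) \<theta>)"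
  proof (rule vecs_to_der_basis [OF CA v1])
    show "\<Phi> k \<in> log_vecs" if k: "k \<in> K'" for k by (rule bspec [OF v2 k, THEN conjunct1])
    show "\<exists>d. \<forall>i<Suc n. homogeneous_poly d (\<Phi> k i)" if k: "k \<in> K'" for k by (rule bspec [OF v2 k, THEN conjunct2])
    show "\<exists>a. (\<forall>k\<in>K'. a k \<in> poly_ring (Suc n)) \<and> (\<forall>i<Suc n. \<eta> i = (\<Sum>k\<in>K'. a k * \<Phi> k i))" if "\<eta> \<in> log_vecs" for \<eta>
      by (rule bspec [OF v3 that])
    show "\<forall>k\<in>K'. a k = 0" if a: "\<forall>k\<in>K'. a k \<in> poly_ring (Suc n)" "\<forall>i<Suc n. (\<Sum>k\<in>K'. a k * \<Phi> k i) = 0" for a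
      by (rule v4 [THEN spec, THEN mp, OF conjI [OF a]])
  qed
  then have "\<exists>\<Theta>'. der_basis (length bs') (log_derivations scale bs' A) \<Theta>' \<and>
      (\<forall>\<theta>\<in>\<Theta>'. homogeneous_derivation (length bs') \<theta>)" by (simp only: len)
  then show ?thesis unfolding free_arrangement_def using bs' by blast
qed

section \<open>Flags\<close>

text \<open>Restricting to hyperplanes leads to an empty arrangement. The divisibility hypothesis is
  vacuous on the way, because a hyperplane of dimension at most one contains no flat of codimension
  two.\<close>

lemma free_arrangement_dim_le_2:
  "arrangement scale W A \<Longrightarrow> dim W \<le> 2 \<Longrightarrow> free_arrangement scale W A"
proof (induction "dim W" arbitrary: W A rule: less_induct)
  case less
  note A = less.prems(1)
  show ?case
  proof (cases "A = {}")
    case True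
    then show ?thesis using free_arrangement_empty arrangementD(1) [OF A] by simp
  next
    case False
    then obtain H where H: "H \<in> A" by blast
    have dH: "dim H + 1 = dim W" by (rule arrangementD(5) [OF A H])
    show ?thesis
    proof (rule free_of_free_restriction [OF A H])
      show "free_arrangement scale H (restriction A H)"
        by (rule less.hyps [OF _ arrangement_restriction [OF A H]]) (use dH less.prems(2) in auto)
    qed (use dH less.prems(2) in \<open>auto simp: inter_lattice_codim_def\<close>)
  qed
qed

lemma arrangement_restriction_flat:
  assumes A: "arrangement scale W A" and X: "subspace X" "X \<subseteq> W"
  shows "arrangement scale X (restriction A X)"
proof -
  note AD = arrangementD [OF A]
  have "subspace Z \<and> Z \<subseteq> X \<and> dim Z + 1 = dim X" if Z: "Z \<in> restriction A X" for Z
  proof -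
    obtain L where L: "L \<in> A" "\<not> X \<subseteq> L" "Z = L \<inter> X" using Z unfolding restriction_def localization_def by blast
    have "dim (X \<inter> L) + 1 = dim X"
      by (rule dim_inter_hyperplane [OF AD(3)[OF L(1)] AD(1) AD(4)[OF L(1)] AD(5)[OF L(1)] X L(2)])
    then show ?thesis using subspace_inter [OF AD(3)[OF L(1)] X(1)] L(3) by (simp add: Int_commute)
  qed
  moreover have "finite (restriction A X)"
  proof -
    have "restriction A X \<subseteq> (\<lambda>L. L \<inter> X) ` A" by (auto simp: restriction_def)
    then show ?thesis using AD(2) finite_subset by blast
  qed
  ultimately show ?thesis using X(1) by (auto simp: arrangement_def)
qed

text \<open>The flag ends in dimension two, where every arrangement is free, and freeness is carried
  from X (k + 1) up to X k. The bound \<open>i + 3 \<le> l\<close> expresses i \<le> l - 3 without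
  truncated subtraction.\<close>

lemma free_of_flag:
  assumes l: "dim UNIV = l" "2 \<le> l" and A: "arrangement scale UNIV A"
    and X: "X 0 = UNIV" "\<And>i. i + 1 \<le> l - 2 \<Longrightarrow> X (i + 1) \<subseteq> X i"
      "\<And>i. i \<le> l - 2 \<Longrightarrow> X i \<in> inter_lattice_codim scale i UNIV A"
    and dvd: "\<And>i Y. i + 3 \<le> l \<Longrightarrow> Y \<in> inter_lattice_codim scale 2 (X (i + 1)) (restriction A (X (i + 1))) \<Longrightarrow>
      char_poly scale (X (i + 1)) (localization (restriction A (X (i + 1))) Y)
        dvd char_poly scale (X i) (localization (restriction A (X i)) Y)"
  shows "free_arrangement scale UNIV A"
proof -
  note AD = arrangementD [OF A]
  have dimX: "dim (X i) + i = l" if "i \<le> l - 2" for i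
    using X(3) [OF that] l(1) by (simp add: inter_lattice_codim_def)
  have flat: "\<exists>B\<subseteq>A. X i = \<Inter>B" if "i \<le> l - 2" for i
    using X(3) [OF that] by (auto simp: inter_lattice_codim_def inter_lattice_def)
  have sub: "subspace (X i)" if i: "i \<le> l - 2" for i
  proof -
    obtain B where B: "B \<subseteq> A" "X i = \<Inter>B" using flat [OF i] by (elim exE conjE)
    show ?thesis unfolding B(2) by (rule subspace_Inter) (use B(1) AD(3) in blast)
  qed
  have arr: "arrangement scale (X i) (restriction A (X i))" if "i \<le> l - 2" for i
    by (rule arrangement_restriction_flat [OF A sub [OF that]]) simp
  have "free_arrangement scale (X 0) (restriction A (X 0))"
  proof (rule inc_induct [of 0 "l - 2"])
    show "free_arrangement scale (X (l - 2)) (restriction A (X (l - 2)))"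
      by (rule free_arrangement_dim_le_2 [OF arr]) (use dimX [of "l - 2"] l in auto)
  next
    fix k assume k: "k < l - 2" and IH: "free_arrangement scale (X (Suc k)) (restriction A (X (Suc k)))"
    have k1: "k \<le> l - 2" "Suc k \<le> l - 2" using k by auto
    have le: "X (Suc k) \<subseteq> X k" using X(2) [of k] k by simp
    obtain B where B: "B \<subseteq> A" "X (Suc k) = \<Inter>B" using flat [OF k1(2)] by blast
    have "\<not> X k \<subseteq> X (Suc k)" using dimX [OF k1(1)] dimX [OF k1(2)] le by auto
    \<comment> \<open>Some hyperplane L through X (k + 1) does not contain X k. Its trace on X k
      contains X (k + 1) and has the same dimension, so X (k + 1) is a member of the restriction to
      X k.\<close>
    then obtain L where L: "L \<in> B" "\<not> X k \<subseteq> L" using B(2) by blast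
    have LA: "L \<in> A" using L B by blast
    have LX: "L \<inter> X k \<in> restriction A (X k)" using LA L(2) unfolding restriction_def localization_def by blast
    have "X (Suc k) = L \<inter> X k"
      using arrangementD(3,5) [OF arr [OF k1(1)] LX] sub [OF k1(2)] dimX [OF k1(1)] dimX [OF k1(2)] le B(2) L(1)
      by (intro subspace_dim_equal) auto
    then have H: "X (Suc k) \<in> restriction A (X k)" using LX by simp
    note rr = restriction_restriction [OF le, of A]
    show "free_arrangement scale (X k) (restriction A (X k))"
    proof (rule free_of_free_restriction [OF arr [OF k1(1)] H])
      fix Y assume Y: "Y \<in> inter_lattice_codim scale 2 (X (Suc k)) (restriction (restriction A (X k)) (X (Suc k)))"
      then have Ys: "Y \<subseteq> X (Suc k)" by (auto simp: inter_lattice_codim_def inter_lattice_def)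
      have "restriction (localization (restriction A (X k)) Y) (X (Suc k)) = localization (restriction A (X (Suc k))) Y"
        unfolding restriction_localization [OF Ys] rr by (rule refl)
      then show "char_poly scale (X (Suc k)) (restriction (localization (restriction A (X k)) Y) (X (Suc k)))
          dvd char_poly scale (X k) (localization (restriction A (X k)) Y)"
        using dvd [of k Y] Y k unfolding rr by simp
    qed (use IH rr in simp)
  qed simp
  moreover have "restriction A UNIV = A"
  proof -
    have "\<not> UNIV \<subseteq> L" if "L \<in> A" for L
    proof
      assume "UNIV \<subseteq> L"
      then have "L = UNIV" by (rule top.extremum_uniqueI)
      then show False using AD(5) [OF that] by simp
    qed
    then have "localization A UNIV = {}" unfolding localization_def by blast
    then show ?thesis by (auto simp: restriction_def)
  qed
  ultimately show ?thesis by (simp add: X(1))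
qed

end

theorem corollary3p13:
  fixes scale :: "'k::field \<Rightarrow> 'v::ab_group_add \<Rightarrow> 'v"
    and Basis :: "'v set"
    and A :: "'v set set"
    and l :: nat
  assumes V: "finite_dimensional_vector_space scale Basis"
    and dim_V: "vector_space.dim scale (UNIV :: 'v set) = l"
    and l: "l \<ge> 2"
    and A: "arrangement scale UNIV A"
  shows
    "((\<exists>H\<in>A.
         (\<forall>X \<in> inter_lattice_codim scale 2 H (restriction A H).
            char_poly scale H (restriction (localization A X) H)
              dvd char_poly scale UNIV (localization A X)) \<and>
         free_arrangement scale H (restriction A H))
      \<longrightarrow> free_arrangement scale UNIV A)
     \<and>
     ((\<exists>X :: nat \<Rightarrow> 'v set.
         X 0 = UNIV \<and>
         (\<forall>i. i + 1 \<le> l - 2 \<longrightarrow> X (i + 1) \<subseteq> X i) \<and>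
         (\<forall>i \<le> l - 2. X i \<in> inter_lattice_codim scale i UNIV A) \<and>
         (\<forall>i. i + 3 \<le> l \<longrightarrow>
            (\<forall>Y \<in> inter_lattice_codim scale 2 (X (i + 1)) (restriction A (X (i + 1))).
               char_poly scale (X (i + 1))
                   (localization (restriction A (X (i + 1))) Y)
                 dvd char_poly scale (X i) (localization (restriction A (X i)) Y))))
      \<longrightarrow> free_arrangement scale UNIV A)"
proof -
  interpret finite_dimensional_vector_space scale Basis by (rule V)
  show ?thesis
  proof (intro conjI impI, goal_cases)
    case 1
    then obtain H where H: "H \<in> A"
      "\<forall>X \<in> inter_lattice_codim scale 2 H (restriction A H).
          char_poly scale H (restriction (localization A X) H) dvd char_poly scale UNIV (localization A X)"
      "free_arrangement scale H (restriction A H)" by (elim bexE conjE)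
    show ?case by (rule free_of_free_restriction [OF A H(1) _ H(3)]) (rule H(2) [rule_format])
  next
    case 2
    then show ?case
    proof (elim exE conjE)
      fix X :: "nat \<Rightarrow> 'v set"
      assume X: "X 0 = UNIV" "\<forall>i. i + 1 \<le> l - 2 \<longrightarrow> X (i + 1) \<subseteq> X i"
        "\<forall>i \<le> l - 2. X i \<in> inter_lattice_codim scale i UNIV A"
        "\<forall>i. i + 3 \<le> l \<longrightarrow>
            (\<forall>Y \<in> inter_lattice_codim scale 2 (X (i + 1)) (restriction A (X (i + 1))).
               char_poly scale (X (i + 1)) (localization (restriction A (X (i + 1))) Y)
                 dvd char_poly scale (X i) (localization (restriction A (X i)) Y))"
      show ?thesis
      proof (rule free_of_flag [where X = X, OF dim_V l A X(1)])
        show "X (i + 1) \<subseteq> X i" if "i + 1 \<le> l - 2" for i by (rule X(2) [rule_format, OF that])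
        show "X i \<in> inter_lattice_codim scale i UNIV A" if "i \<le> l - 2" for i by (rule X(3) [rule_format, OF that])
        show "char_poly scale (X (i + 1)) (localization (restriction A (X (i + 1))) Y)
            dvd char_poly scale (X i) (localization (restriction A (X i)) Y)"
          if "i + 3 \<le> l" "Y \<in> inter_lattice_codim scale 2 (X (i + 1)) (restriction A (X (i + 1)))" for i Y
          by (rule X(4) [rule_format, OF that])
      qed
    qed
  qed
qed

end
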